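(* Let $\mathfrak U$ be a Grothendieck universe containing the set of integers, let $\mathfrak V$ be a Grothendieck universe strictly containing $\mathfrak U$, and let $I$ be a set in $\mathfrak V\smallsetminus\mathfrak U$. Let $\mathbb F$ be a field in $\mathfrak U$, let $\Lambda=\mathbb F\langle I\rangle$, and let $\mathcal A$ be the abelian category of $\Lambda$-modules $M$ that admit a submodule $M'\subseteq M$ such that $M'$ and $M/M'$ are finite direct sums of copies of the trivial $\Lambda$-module $\mathbb F$. Let $\mathbf K^{\mathrm b}(\mathcal A)$ be the bounded homotopy category of complexes over $\mathcal A$, and $\operatorname{Ab}(\mathbf K^{\mathrm b}(\mathcal A))$ its abelianisation. Then the abelian category $\operatorname{Ab}(\mathbf K^{\mathrm b}(\mathcal A))$ is a $\mathfrak U$-category, and there exists a Serre subcategory $\mathcal C\subseteq\operatorname{Ab}(\mathbf K^{\mathrm b}(\mathcal A))$ such that the corresponding quotient $\operatorname{Ab}(\mathbf K^{\mathrm b}(\mathcal A))/\mathcal C$ is not a $\mathfrak U$-category.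
   Context: $\mathfrak U$-category: a category such that for every pair of objects $X,Y$ the set $\operatorname{Hom}(X,Y)$ belongs to $\mathfrak U$. The algebra $\Lambda=\mathbb F\langle I\rangle$ is the polynomial algebra over $\mathbb F$ in (non-commuting) variables indexed by $I$: a $\Lambda$-module is an $\mathbb F$-vector space together with a family of $\mathbb F$-linear endomorphisms indexed by the elements of $I$, and module morphisms are the linear maps commuting with these endomorphisms. The trivial $\Lambda$-module $\mathbb F$ is the one-dimensional vector space $\mathbb F$ on which all the endomorphisms indexed by $I$ are zero. Abelianisation: for a triangulated category $\mathcal T$, the abelianisation is a fully faithful cohomological functor $\mathcal T\to\operatorname{Ab}(\mathcal T)$ into an abelian category such that for every abelian category $\mathcal B$ composition with it induces an equivalence from the category of exact functors $\operatorname{Ab}(\mathcal T)\to\mathcal B$ to the category of cohomological functors $\mathcal T\to\mathcal B$ (both with natural transformations as morphisms). Abelian quotient: for an abelian category $\mathcal D$ and a Serre subcategory $\mathcal C$ (full, closed under subobjects, quotients and extensions), $\mathcal D/\mathcal C$ is the localisation $\mathcal D[\Sigma^{-1}]$ with respect to the class $\Sigma$ of morphisms whose kernel and cokernel both lie in $\mathcal C$.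
   Formalization: Membership of Hom sets in 𝔘 is read up to bijection, and "I in 𝔙∖𝔘" is read as: I lies in 𝔙 and is not in bijection with any element of 𝔘 (for a singleton I={x} with x in 𝔙∖𝔘 the claim would be false). *)

theory Defs
  imports "HOL-Algebra.Module" "HOL-Algebra.AbelCoset" "HOL-Library.Equipollence"
begin

section \<open>Sets and Grothendieck universes\<close>

text \<open>The type of \<open>mem\<close> plays the role of the class of all sets; HOL sets over this type are
  classes. Separation follows from replacement, and the axiom of choice is inherited from HOL.\<close>

definition elts :: "('v \<Rightarrow> 'v \<Rightarrow> bool) \<Rightarrow> 'v \<Rightarrow> 'v set" where
  "elts mem x = {y. mem y x}"

locale zfc_sets =
  fixes mem :: "'v \<Rightarrow> 'v \<Rightarrow> bool"
  assumes extensionality: "elts mem x = elts mem y \<Longrightarrow> x = y"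
    and foundation: "wfP mem"
    and pairing: "\<exists>p. elts mem p = {x, y}"
    and union: "\<exists>u. elts mem u = (\<Union>y \<in> elts mem x. elts mem y)"
    and powerset: "\<exists>p. elts mem p = {y. elts mem y \<subseteq> elts mem x}"
    and replacement: "\<exists>y. elts mem y = f ` elts mem x"
    and infinity: "\<exists>w. (\<exists>e \<in> elts mem w. elts mem e = {}) \<and>
      (\<forall>x \<in> elts mem w. \<exists>y \<in> elts mem w. elts mem y = insert x (elts mem x))"

definition grothendieck_universe :: "('v \<Rightarrow> 'v \<Rightarrow> bool) \<Rightarrow> 'v \<Rightarrow> bool" where
  "grothendieck_universe mem U \<longleftrightarrow>
     (\<forall>x y. mem x y \<longrightarrow> mem y U \<longrightarrow> mem x U) \<and>
     (\<forall>x y. mem x U \<longrightarrow> mem y U \<longrightarrow> (\<exists>p. mem p U \<and> elts mem p = {x, y})) \<and>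
     (\<forall>x. mem x U \<longrightarrow> (\<exists>p. mem p U \<and> elts mem p = {y. elts mem y \<subseteq> elts mem x})) \<and>
     (\<forall>j f. mem j U \<longrightarrow> (\<forall>i \<in> elts mem j. mem (f i) U) \<longrightarrow>
        (\<exists>u. mem u U \<and> elts mem u = (\<Union>i \<in> elts mem j. elts mem (f i))))"

text \<open>A collection (over any type) is small with respect to \<open>U\<close> if it belongs to \<open>U\<close> up to
  bijection. A universal property determines the sets of morphisms of a category only up to
  bijection, so that membership in \<open>U\<close> is meaningful for them only in this sense. Being
  small is a condition on cardinality: a singleton \<open>{U}\<close> is small without belonging to \<open>U\<close>.\<close>

definition U_small :: "('v \<Rightarrow> 'v \<Rightarrow> bool) \<Rightarrow> 'v \<Rightarrow> 'b set \<Rightarrow> bool" where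
  "U_small mem U S \<longleftrightarrow> (\<exists>u. mem u U \<and> S \<approx> elts mem u)"


section \<open>Categories\<close>

text \<open>Composition is in applicative order: \<open>cmp C X Y Z g f\<close> is the composite of
  \<open>f : X \<rightarrow> Y\<close> followed by \<open>g : Y \<rightarrow> Z\<close>. The sets \<open>Mor C X Y\<close> need not be disjoint, which is why
  the operations on morphisms take the objects as arguments.\<close>

record ('o, 'a) cat =
  Ob :: "'o set"
  Mor :: "'o \<Rightarrow> 'o \<Rightarrow> 'a set"
  idm :: "'o \<Rightarrow> 'a"
  cmp :: "'o \<Rightarrow> 'o \<Rightarrow> 'o \<Rightarrow> 'a \<Rightarrow> 'a \<Rightarrow> 'a"

locale category =
  fixes C :: "('o, 'a, 'x) cat_scheme"
  assumes idm_in: "X \<in> Ob C \<Longrightarrow> idm C X \<in> Mor C X X"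
    and cmp_in: "\<lbrakk>X \<in> Ob C; Y \<in> Ob C; Z \<in> Ob C; f \<in> Mor C X Y; g \<in> Mor C Y Z\<rbrakk>
      \<Longrightarrow> cmp C X Y Z g f \<in> Mor C X Z"
    and idm_right: "\<lbrakk>X \<in> Ob C; Y \<in> Ob C; f \<in> Mor C X Y\<rbrakk> \<Longrightarrow> cmp C X X Y f (idm C X) = f"
    and idm_left: "\<lbrakk>X \<in> Ob C; Y \<in> Ob C; f \<in> Mor C X Y\<rbrakk> \<Longrightarrow> cmp C X Y Y (idm C Y) f = f"
    and cmp_assoc: "\<lbrakk>W \<in> Ob C; X \<in> Ob C; Y \<in> Ob C; Z \<in> Ob C;
        f \<in> Mor C W X; g \<in> Mor C X Y; h \<in> Mor C Y Z\<rbrakk>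
      \<Longrightarrow> cmp C W Y Z h (cmp C W X Y g f) = cmp C W X Z (cmp C X Y Z h g) f"

definition U_category :: "('v \<Rightarrow> 'v \<Rightarrow> bool) \<Rightarrow> 'v \<Rightarrow> ('o, 'a, 'x) cat_scheme \<Rightarrow> bool" where
  "U_category mem U C \<longleftrightarrow> (\<forall>X \<in> Ob C. \<forall>Y \<in> Ob C. U_small mem U (Mor C X Y))"

definition is_iso :: "('o, 'a, 'x) cat_scheme \<Rightarrow> 'o \<Rightarrow> 'o \<Rightarrow> 'a \<Rightarrow> bool" where
  "is_iso C X Y f \<longleftrightarrow> f \<in> Mor C X Y \<and>
     (\<exists>g \<in> Mor C Y X. cmp C X Y X g f = idm C X \<and> cmp C Y X Y f g = idm C Y)"

definition is_mono :: "('o, 'a, 'x) cat_scheme \<Rightarrow> 'o \<Rightarrow> 'o \<Rightarrow> 'a \<Rightarrow> bool" where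
  "is_mono C X Y f \<longleftrightarrow> f \<in> Mor C X Y \<and>
     (\<forall>W \<in> Ob C. \<forall>u \<in> Mor C W X. \<forall>v \<in> Mor C W X. cmp C W X Y f u = cmp C W X Y f v \<longrightarrow> u = v)"

definition is_epi :: "('o, 'a, 'x) cat_scheme \<Rightarrow> 'o \<Rightarrow> 'o \<Rightarrow> 'a \<Rightarrow> bool" where
  "is_epi C X Y f \<longleftrightarrow> f \<in> Mor C X Y \<and>
     (\<forall>W \<in> Ob C. \<forall>u \<in> Mor C Y W. \<forall>v \<in> Mor C Y W. cmp C X Y W u f = cmp C X Y W v f \<longrightarrow> u = v)"

definition zero_object :: "('o, 'a, 'x) cat_scheme \<Rightarrow> 'o \<Rightarrow> bool" where
  "zero_object C Z \<longleftrightarrow> Z \<in> Ob C \<and>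
     (\<forall>X \<in> Ob C. (\<exists>!f. f \<in> Mor C X Z) \<and> (\<exists>!f. f \<in> Mor C Z X))"

subsection \<open>Functors and natural transformations\<close>

record ('o, 'a, 'p, 'b) func =
  FOb :: "'o \<Rightarrow> 'p"
  FMor :: "'o \<Rightarrow> 'o \<Rightarrow> 'a \<Rightarrow> 'b"

definition is_functor ::
  "('o, 'a, 'x) cat_scheme \<Rightarrow> ('p, 'b, 'y) cat_scheme \<Rightarrow> ('o, 'a, 'p, 'b) func \<Rightarrow> bool" where
  "is_functor C D F \<longleftrightarrow> category C \<and> category D \<and>
     (\<forall>X \<in> Ob C. FOb F X \<in> Ob D) \<and>
     (\<forall>X \<in> Ob C. \<forall>Y \<in> Ob C. \<forall>f \<in> Mor C X Y. FMor F X Y f \<in> Mor D (FOb F X) (FOb F Y)) \<and>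
     (\<forall>X \<in> Ob C. FMor F X X (idm C X) = idm D (FOb F X)) \<and>
     (\<forall>X \<in> Ob C. \<forall>Y \<in> Ob C. \<forall>Z \<in> Ob C. \<forall>f \<in> Mor C X Y. \<forall>g \<in> Mor C Y Z.
        FMor F X Z (cmp C X Y Z g f) =
        cmp D (FOb F X) (FOb F Y) (FOb F Z) (FMor F Y Z g) (FMor F X Y f))"

definition fully_faithful ::
  "('o, 'a, 'x) cat_scheme \<Rightarrow> ('p, 'b, 'y) cat_scheme \<Rightarrow> ('o, 'a, 'p, 'b) func \<Rightarrow> bool" where
  "fully_faithful C D F \<longleftrightarrow>
     (\<forall>X \<in> Ob C. \<forall>Y \<in> Ob C. bij_betw (FMor F X Y) (Mor C X Y) (Mor D (FOb F X) (FOb F Y)))"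

definition id_func :: "('o, 'a, 'o, 'a) func" where
  "id_func = \<lparr>FOb = (\<lambda>X. X), FMor = (\<lambda>X Y f. f)\<rparr>"

definition comp_func ::
  "('p, 'b, 'q, 'c) func \<Rightarrow> ('o, 'a, 'p, 'b) func \<Rightarrow> ('o, 'a, 'q, 'c) func" where
  "comp_func G F = \<lparr>FOb = (\<lambda>X. FOb G (FOb F X)),
     FMor = (\<lambda>X Y f. FMor G (FOb F X) (FOb F Y) (FMor F X Y f))\<rparr>"

definition nat_trans ::
  "('o, 'a, 'x) cat_scheme \<Rightarrow> ('p, 'b, 'y) cat_scheme \<Rightarrow> ('o, 'a, 'p, 'b) func
   \<Rightarrow> ('o, 'a, 'p, 'b) func \<Rightarrow> ('o \<Rightarrow> 'b) \<Rightarrow> bool" where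
  "nat_trans C D F G \<alpha> \<longleftrightarrow> \<alpha> \<in> extensional (Ob C) \<and>
     (\<forall>X \<in> Ob C. \<alpha> X \<in> Mor D (FOb F X) (FOb G X)) \<and>
     (\<forall>X \<in> Ob C. \<forall>Y \<in> Ob C. \<forall>f \<in> Mor C X Y.
        cmp D (FOb F X) (FOb F Y) (FOb G Y) (\<alpha> Y) (FMor F X Y f) =
        cmp D (FOb F X) (FOb G X) (FOb G Y) (FMor G X Y f) (\<alpha> X))"

definition nat_isomorphic ::
  "('o, 'a, 'x) cat_scheme \<Rightarrow> ('p, 'b, 'y) cat_scheme \<Rightarrow> ('o, 'a, 'p, 'b) func
   \<Rightarrow> ('o, 'a, 'p, 'b) func \<Rightarrow> bool" where
  "nat_isomorphic C D F G \<longleftrightarrow>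
     (\<exists>\<alpha>. nat_trans C D F G \<alpha> \<and> (\<forall>X \<in> Ob C. is_iso D (FOb F X) (FOb G X) (\<alpha> X)))"

definition is_equivalence ::
  "('o, 'a, 'x) cat_scheme \<Rightarrow> ('p, 'b, 'y) cat_scheme \<Rightarrow> ('o, 'a, 'p, 'b) func \<Rightarrow> bool" where
  "is_equivalence C D F \<longleftrightarrow> is_functor C D F \<and>
     (\<exists>G. is_functor D C G \<and> nat_isomorphic C C (comp_func G F) id_func \<and>
          nat_isomorphic D D (comp_func F G) id_func)"

text \<open>The category of those functors from \<open>C\<close> to \<open>D\<close> that satisfy \<open>P\<close>, with all natural
  transformations as morphisms. Functors that differ only outside \<open>C\<close> are distinct
  (but isomorphic) objects.\<close>

definition functor_cat ::
  "('o, 'a, 'x) cat_scheme \<Rightarrow> ('p, 'b, 'y) cat_scheme \<Rightarrow> (('o, 'a, 'p, 'b) func \<Rightarrow> bool)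
   \<Rightarrow> (('o, 'a, 'p, 'b) func, 'o \<Rightarrow> 'b) cat" where
  "functor_cat C D P = \<lparr>Ob = {F. is_functor C D F \<and> P F},
     Mor = (\<lambda>F G. {\<alpha>. nat_trans C D F G \<alpha>}),
     idm = (\<lambda>F. \<lambda>X \<in> Ob C. idm D (FOb F X)),
     cmp = (\<lambda>F G H \<beta> \<alpha>. \<lambda>X \<in> Ob C. cmp D (FOb F X) (FOb G X) (FOb H X) (\<beta> X) (\<alpha> X))\<rparr>"

definition precomp ::
  "('o, 'a, 'x) cat_scheme \<Rightarrow> ('o, 'a, 'p, 'b) func
   \<Rightarrow> (('p, 'b, 'q, 'c) func, 'p \<Rightarrow> 'c, ('o, 'a, 'q, 'c) func, 'o \<Rightarrow> 'c) func" where
  "precomp C H = \<lparr>FOb = (\<lambda>F. comp_func F H), FMor = (\<lambda>F G \<alpha>. \<lambda>X \<in> Ob C. \<alpha> (FOb H X))\<rparr>"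

subsection \<open>Localisation\<close>

definition inverts ::
  "('o \<times> 'o \<times> 'a) set \<Rightarrow> ('p, 'b, 'y) cat_scheme \<Rightarrow> ('o, 'a, 'p, 'b) func \<Rightarrow> bool" where
  "inverts \<Sigma> D F \<longleftrightarrow> (\<forall>(X, Y, f) \<in> \<Sigma>. is_iso D (FOb F X) (FOb F Y) (FMor F X Y f))"

text \<open>\<open>E\<close> together with \<open>Q : D \<rightarrow> E\<close> is the localisation of \<open>D\<close> with respect to \<open>\<Sigma>\<close>. The test
  categories \<open>B\<close> have their objects and morphisms in the same types as \<open>E\<close>; for the type of
  all sets these are all categories.\<close>

definition is_localisation ::
  "('o, 'a, 'x) cat_scheme \<Rightarrow> ('o \<times> 'o \<times> 'a) set \<Rightarrow> ('p, 'b) cat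
   \<Rightarrow> ('o, 'a, 'p, 'b) func \<Rightarrow> bool" where
  "is_localisation D \<Sigma> E Q \<longleftrightarrow> is_functor D E Q \<and> inverts \<Sigma> E Q \<and>
     (\<forall>B :: ('p, 'b) cat. category B \<longrightarrow>
        is_equivalence (functor_cat E B (\<lambda>F. True)) (functor_cat D B (inverts \<Sigma> B))
          (precomp D Q))"


section \<open>Preadditive and abelian categories\<close>

record ('o, 'a) pcat = "('o, 'a) cat" +
  madd :: "'o \<Rightarrow> 'o \<Rightarrow> 'a \<Rightarrow> 'a \<Rightarrow> 'a"
  mzero :: "'o \<Rightarrow> 'o \<Rightarrow> 'a"

definition mor_group :: "('o, 'a, 'x) pcat_scheme \<Rightarrow> 'o \<Rightarrow> 'o \<Rightarrow> 'a monoid" where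
  "mor_group C X Y = \<lparr>carrier = Mor C X Y, mult = madd C X Y, one = mzero C X Y\<rparr>"

definition mneg :: "('o, 'a, 'x) pcat_scheme \<Rightarrow> 'o \<Rightarrow> 'o \<Rightarrow> 'a \<Rightarrow> 'a" where
  "mneg C X Y f = m_inv (mor_group C X Y) f"

locale preadditive = category C for C :: "('o, 'a, 'x) pcat_scheme" +
  assumes mor_group: "\<lbrakk>X \<in> Ob C; Y \<in> Ob C\<rbrakk> \<Longrightarrow> comm_group (mor_group C X Y)"
    and cmp_madd_left: "\<lbrakk>X \<in> Ob C; Y \<in> Ob C; Z \<in> Ob C; f \<in> Mor C X Y; g \<in> Mor C Y Z; h \<in> Mor C Y Z\<rbrakk>
      \<Longrightarrow> cmp C X Y Z (madd C Y Z g h) f = madd C X Z (cmp C X Y Z g f) (cmp C X Y Z h f)"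
    and cmp_madd_right: "\<lbrakk>X \<in> Ob C; Y \<in> Ob C; Z \<in> Ob C; f \<in> Mor C X Y; g \<in> Mor C X Y; h \<in> Mor C Y Z\<rbrakk>
      \<Longrightarrow> cmp C X Y Z h (madd C X Y f g) = madd C X Z (cmp C X Y Z h f) (cmp C X Y Z h g)"

definition is_kernel ::
  "('o, 'a, 'x) pcat_scheme \<Rightarrow> 'o \<Rightarrow> 'o \<Rightarrow> 'a \<Rightarrow> 'o \<Rightarrow> 'a \<Rightarrow> bool" where
  "is_kernel C X Y f K k \<longleftrightarrow> K \<in> Ob C \<and> k \<in> Mor C K X \<and> cmp C K X Y f k = mzero C K Y \<and>
     (\<forall>W \<in> Ob C. \<forall>w \<in> Mor C W X. cmp C W X Y f w = mzero C W Y \<longrightarrow>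
        (\<exists>!u. u \<in> Mor C W K \<and> cmp C W K X k u = w))"

definition is_cokernel ::
  "('o, 'a, 'x) pcat_scheme \<Rightarrow> 'o \<Rightarrow> 'o \<Rightarrow> 'a \<Rightarrow> 'o \<Rightarrow> 'a \<Rightarrow> bool" where
  "is_cokernel C X Y f K k \<longleftrightarrow> K \<in> Ob C \<and> k \<in> Mor C Y K \<and> cmp C X Y K k f = mzero C X K \<and>
     (\<forall>W \<in> Ob C. \<forall>w \<in> Mor C Y W. cmp C X Y W w f = mzero C X W \<longrightarrow>
        (\<exists>!u. u \<in> Mor C K W \<and> cmp C Y K W u k = w))"

definition is_biproduct ::
  "('o, 'a, 'x) pcat_scheme \<Rightarrow> 'o \<Rightarrow> 'o \<Rightarrow> 'o \<Rightarrow> 'a \<Rightarrow> 'a \<Rightarrow> 'a \<Rightarrow> 'a \<Rightarrow> bool" where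
  "is_biproduct C X Y S i1 i2 p1 p2 \<longleftrightarrow> S \<in> Ob C \<and>
     i1 \<in> Mor C X S \<and> i2 \<in> Mor C Y S \<and> p1 \<in> Mor C S X \<and> p2 \<in> Mor C S Y \<and>
     cmp C X S X p1 i1 = idm C X \<and> cmp C Y S Y p2 i2 = idm C Y \<and>
     cmp C Y S X p1 i2 = mzero C Y X \<and> cmp C X S Y p2 i1 = mzero C X Y \<and>
     madd C S S (cmp C S X S i1 p1) (cmp C S Y S i2 p2) = idm C S"

locale abelian_category = preadditive C for C :: "('o, 'a, 'x) pcat_scheme" +
  assumes has_zero: "\<exists>Z. zero_object C Z"
    and has_biproduct: "\<lbrakk>X \<in> Ob C; Y \<in> Ob C\<rbrakk> \<Longrightarrow> \<exists>S i1 i2 p1 p2. is_biproduct C X Y S i1 i2 p1 p2"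
    and has_kernel: "\<lbrakk>X \<in> Ob C; Y \<in> Ob C; f \<in> Mor C X Y\<rbrakk> \<Longrightarrow> \<exists>K k. is_kernel C X Y f K k"
    and has_cokernel: "\<lbrakk>X \<in> Ob C; Y \<in> Ob C; f \<in> Mor C X Y\<rbrakk> \<Longrightarrow> \<exists>K k. is_cokernel C X Y f K k"
    and mono_normal: "\<lbrakk>X \<in> Ob C; Y \<in> Ob C; is_mono C X Y f\<rbrakk>
      \<Longrightarrow> \<exists>Z \<in> Ob C. \<exists>g \<in> Mor C Y Z. is_kernel C Y Z g X f"
    and epi_normal: "\<lbrakk>X \<in> Ob C; Y \<in> Ob C; is_epi C X Y f\<rbrakk>
      \<Longrightarrow> \<exists>W \<in> Ob C. \<exists>g \<in> Mor C W X. is_cokernel C W X g Y f"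

definition is_image ::
  "('o, 'a, 'x) pcat_scheme \<Rightarrow> 'o \<Rightarrow> 'o \<Rightarrow> 'a \<Rightarrow> 'o \<Rightarrow> 'a \<Rightarrow> bool" where
  "is_image C X Y f M m \<longleftrightarrow> (\<exists>Q q. is_cokernel C X Y f Q q \<and> is_kernel C Y Q q M m)"

definition exact_at ::
  "('o, 'a, 'x) pcat_scheme \<Rightarrow> 'o \<Rightarrow> 'o \<Rightarrow> 'o \<Rightarrow> 'a \<Rightarrow> 'a \<Rightarrow> bool" where
  "exact_at C X Y Z f g \<longleftrightarrow> f \<in> Mor C X Y \<and> g \<in> Mor C Y Z \<and>
     (\<exists>M m. is_image C X Y f M m \<and> is_kernel C Y Z g M m)"

definition short_exact ::
  "('o, 'a, 'x) pcat_scheme \<Rightarrow> 'o \<Rightarrow> 'o \<Rightarrow> 'o \<Rightarrow> 'a \<Rightarrow> 'a \<Rightarrow> bool" where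
  "short_exact C X Y Z f g \<longleftrightarrow> is_mono C X Y f \<and> exact_at C X Y Z f g \<and> is_epi C Y Z g"

definition additive_functor ::
  "('o, 'a, 'x) pcat_scheme \<Rightarrow> ('p, 'b, 'y) pcat_scheme \<Rightarrow> ('o, 'a, 'p, 'b) func \<Rightarrow> bool" where
  "additive_functor C D F \<longleftrightarrow> is_functor C D F \<and>
     (\<forall>X \<in> Ob C. \<forall>Y \<in> Ob C. \<forall>f \<in> Mor C X Y. \<forall>g \<in> Mor C X Y.
        FMor F X Y (madd C X Y f g) = madd D (FOb F X) (FOb F Y) (FMor F X Y f) (FMor F X Y g))"

definition exact_functor ::
  "('o, 'a, 'x) pcat_scheme \<Rightarrow> ('p, 'b, 'y) pcat_scheme \<Rightarrow> ('o, 'a, 'p, 'b) func \<Rightarrow> bool" where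
  "exact_functor C D F \<longleftrightarrow> additive_functor C D F \<and>
     (\<forall>X \<in> Ob C. \<forall>Y \<in> Ob C. \<forall>Z \<in> Ob C. \<forall>f g. short_exact C X Y Z f g \<longrightarrow>
        short_exact D (FOb F X) (FOb F Y) (FOb F Z) (FMor F X Y f) (FMor F Y Z g))"

subsection \<open>Serre subcategories and abelian quotients\<close>

text \<open>A full subcategory is given by its class of objects.\<close>

definition serre_subcategory :: "('o, 'a, 'x) pcat_scheme \<Rightarrow> 'o set \<Rightarrow> bool" where
  "serre_subcategory D C \<longleftrightarrow> C \<subseteq> Ob D \<and> C \<noteq> {} \<and>
     (\<forall>X \<in> Ob D. \<forall>Y \<in> C. \<forall>f. is_mono D X Y f \<longrightarrow> X \<in> C) \<and>
     (\<forall>X \<in> C. \<forall>Y \<in> Ob D. \<forall>f. is_epi D X Y f \<longrightarrow> Y \<in> C) \<and>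
     (\<forall>X \<in> C. \<forall>Y \<in> Ob D. \<forall>Z \<in> C. \<forall>f g. short_exact D X Y Z f g \<longrightarrow> Y \<in> C)"

definition serre_morphisms :: "('o, 'a, 'x) pcat_scheme \<Rightarrow> 'o set \<Rightarrow> ('o \<times> 'o \<times> 'a) set" where
  "serre_morphisms D C = {(X, Y, f). X \<in> Ob D \<and> Y \<in> Ob D \<and> f \<in> Mor D X Y \<and>
     (\<exists>K \<in> C. \<exists>k. is_kernel D X Y f K k) \<and> (\<exists>K \<in> C. \<exists>k. is_cokernel D X Y f K k)}"

definition is_abelian_quotient ::
  "('o, 'a, 'x) pcat_scheme \<Rightarrow> 'o set \<Rightarrow> ('p, 'b) cat \<Rightarrow> ('o, 'a, 'p, 'b) func \<Rightarrow> bool" where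
  "is_abelian_quotient D C E Q \<longleftrightarrow> is_localisation D (serre_morphisms D C) E Q"


section \<open>Triangulated structure and abelianisation\<close>

text \<open>The data of a triangulated category: the shift and the distinguished triangles
  \<open>(X, Y, Z, u : X \<rightarrow> Y, v : Y \<rightarrow> Z, w : Z \<rightarrow> X[1])\<close>.\<close>

record ('o, 'a) tcat = "('o, 'a) pcat" +
  shift :: "('o, 'a, 'o, 'a) func"
  dist :: "('o \<times> 'o \<times> 'o \<times> 'a \<times> 'a \<times> 'a) set"

definition cohomological ::
  "('o, 'a, 'x) tcat_scheme \<Rightarrow> ('p, 'b, 'y) pcat_scheme \<Rightarrow> ('o, 'a, 'p, 'b) func \<Rightarrow> bool" where
  "cohomological T B H \<longleftrightarrow> additive_functor T B H \<and>
     (\<forall>(X, Y, Z, u, v, w) \<in> dist T.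
        exact_at B (FOb H X) (FOb H Y) (FOb H Z) (FMor H X Y u) (FMor H Y Z v))"

text \<open>As for localisations, the test categories have the same types as the abelianisation.\<close>

definition is_abelianisation ::
  "('o, 'a, 'x) tcat_scheme \<Rightarrow> ('p, 'b) pcat \<Rightarrow> ('o, 'a, 'p, 'b) func \<Rightarrow> bool" where
  "is_abelianisation T D H \<longleftrightarrow> abelian_category D \<and> cohomological T D H \<and> fully_faithful T D H \<and>
     (\<forall>B :: ('p, 'b) pcat. abelian_category B \<longrightarrow>
        is_equivalence (functor_cat D B (exact_functor D B)) (functor_cat T B (cohomological T B))
          (precomp T H))"


section \<open>The bounded homotopy category\<close>

record ('o, 'a) complex =
  cob :: "int \<Rightarrow> 'o"
  cd :: "int \<Rightarrow> 'a"

definition bounded_complexes :: "('o, 'a, 'x) pcat_scheme \<Rightarrow> ('o, 'a) complex set" where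
  "bounded_complexes A = {X. (\<forall>n. cob X n \<in> Ob A) \<and>
     (\<forall>n. cd X n \<in> Mor A (cob X n) (cob X (n + 1))) \<and>
     (\<forall>n. cmp A (cob X n) (cob X (n + 1)) (cob X (n + 2)) (cd X (n + 1)) (cd X n) =
        mzero A (cob X n) (cob X (n + 2))) \<and>
     (\<exists>N. \<forall>n. N < \<bar>n\<bar> \<longrightarrow> zero_object A (cob X n))}"

definition chain_maps ::
  "('o, 'a, 'x) pcat_scheme \<Rightarrow> ('o, 'a) complex \<Rightarrow> ('o, 'a) complex \<Rightarrow> (int \<Rightarrow> 'a) set" where
  "chain_maps A X Y = {f. (\<forall>n. f n \<in> Mor A (cob X n) (cob Y n)) \<and>
     (\<forall>n. cmp A (cob X n) (cob X (n + 1)) (cob Y (n + 1)) (f (n + 1)) (cd X n) =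
          cmp A (cob X n) (cob Y n) (cob Y (n + 1)) (cd Y n) (f n))}"

definition homotopic ::
  "('o, 'a, 'x) pcat_scheme \<Rightarrow> ('o, 'a) complex \<Rightarrow> ('o, 'a) complex
   \<Rightarrow> (int \<Rightarrow> 'a) \<Rightarrow> (int \<Rightarrow> 'a) \<Rightarrow> bool" where
  "homotopic A X Y f g \<longleftrightarrow>
     (\<exists>s. (\<forall>n. s n \<in> Mor A (cob X n) (cob Y (n - 1))) \<and>
       (\<forall>n. f n = madd A (cob X n) (cob Y n) (g n)
         (madd A (cob X n) (cob Y n)
           (cmp A (cob X n) (cob Y (n - 1)) (cob Y n) (cd Y (n - 1)) (s n))
           (cmp A (cob X n) (cob X (n + 1)) (cob Y n) (s (n + 1)) (cd X n)))))"

definition homotopy_class ::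
  "('o, 'a, 'x) pcat_scheme \<Rightarrow> ('o, 'a) complex \<Rightarrow> ('o, 'a) complex
   \<Rightarrow> (int \<Rightarrow> 'a) \<Rightarrow> (int \<Rightarrow> 'a) set" where
  "homotopy_class A X Y f = {g \<in> chain_maps A X Y. homotopic A X Y g f}"

text \<open>Operations on homotopy classes are the union of the classes obtained from all
  representatives; all these classes coincide.\<close>

definition Kb_pcat ::
  "('o, 'a, 'x) pcat_scheme \<Rightarrow> (('o, 'a) complex, (int \<Rightarrow> 'a) set) pcat" where
  "Kb_pcat A = \<lparr>Ob = bounded_complexes A,
     Mor = (\<lambda>X Y. homotopy_class A X Y ` chain_maps A X Y),
     idm = (\<lambda>X. homotopy_class A X X (\<lambda>n. idm A (cob X n))),
     cmp = (\<lambda>X Y Z G F. \<Union>g \<in> G. \<Union>f \<in> F.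
       homotopy_class A X Z (\<lambda>n. cmp A (cob X n) (cob Y n) (cob Z n) (g n) (f n))),
     madd = (\<lambda>X Y F G. \<Union>f \<in> F. \<Union>g \<in> G.
       homotopy_class A X Y (\<lambda>n. madd A (cob X n) (cob Y n) (f n) (g n))),
     mzero = (\<lambda>X Y. homotopy_class A X Y (\<lambda>n. mzero A (cob X n) (cob Y n)))\<rparr>"

text \<open>The shift \<open>X[1]\<close> has components \<open>X[1]\<^sup>n = X\<^sup>n\<^sup>+\<^sup>1\<close> and the differential of \<open>X\<close> with
  opposite sign.\<close>

definition shift_complex :: "('o, 'a, 'x) pcat_scheme \<Rightarrow> ('o, 'a) complex \<Rightarrow> ('o, 'a) complex" where
  "shift_complex A X = \<lparr>cob = (\<lambda>n. cob X (n + 1)),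
     cd = (\<lambda>n. mneg A (cob X (n + 1)) (cob X (n + 2)) (cd X (n + 1)))\<rparr>"

definition Kb_shift ::
  "('o, 'a, 'x) pcat_scheme
   \<Rightarrow> (('o, 'a) complex, (int \<Rightarrow> 'a) set, ('o, 'a) complex, (int \<Rightarrow> 'a) set) func" where
  "Kb_shift A = \<lparr>FOb = shift_complex A,
     FMor = (\<lambda>X Y F. \<Union>f \<in> F.
       homotopy_class A (shift_complex A X) (shift_complex A Y) (\<lambda>n. f (n + 1)))\<rparr>"

text \<open>\<open>Z\<close> is a mapping cone of \<open>f\<close>: its components are biproducts of \<open>X\<^sup>n\<^sup>+\<^sup>1\<close> and \<open>Y\<^sup>n\<close>, and its
  differential is given by the matrix with rows \<open>(- d\<^sub>X, 0)\<close> and \<open>(f, d\<^sub>Y)\<close>.\<close>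

definition is_cone ::
  "('o, 'a, 'x) pcat_scheme \<Rightarrow> ('o, 'a) complex \<Rightarrow> ('o, 'a) complex \<Rightarrow> (int \<Rightarrow> 'a)
   \<Rightarrow> ('o, 'a) complex \<Rightarrow> (int \<Rightarrow> 'a) \<Rightarrow> (int \<Rightarrow> 'a) \<Rightarrow> bool" where
  "is_cone A X Y f Z i2 p1 \<longleftrightarrow>
     (\<exists>i1 p2. \<forall>n.
       is_biproduct A (cob X (n + 1)) (cob Y n) (cob Z n) (i1 n) (i2 n) (p1 n) (p2 n) \<and>
       cd Z n =
         madd A (cob Z n) (cob Z (n + 1))
           (cmp A (cob Z n) (cob X (n + 2)) (cob Z (n + 1)) (i1 (n + 1))
             (cmp A (cob Z n) (cob X (n + 1)) (cob X (n + 2))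
               (mneg A (cob X (n + 1)) (cob X (n + 2)) (cd X (n + 1))) (p1 n)))
           (cmp A (cob Z n) (cob Y (n + 1)) (cob Z (n + 1)) (i2 (n + 1))
             (madd A (cob Z n) (cob Y (n + 1))
               (cmp A (cob Z n) (cob X (n + 1)) (cob Y (n + 1)) (f (n + 1)) (p1 n))
               (cmp A (cob Z n) (cob Y n) (cob Y (n + 1)) (cd Y n) (p2 n)))))"

definition standard_triangles ::
  "('o, 'a, 'x) pcat_scheme \<Rightarrow> (('o, 'a) complex \<times> ('o, 'a) complex \<times> ('o, 'a) complex \<times>
     (int \<Rightarrow> 'a) set \<times> (int \<Rightarrow> 'a) set \<times> (int \<Rightarrow> 'a) set) set" where
  "standard_triangles A = {(X, Y, Z, homotopy_class A X Y f, homotopy_class A Y Z i2,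
       homotopy_class A Z (shift_complex A X) p1) | X Y Z f i2 p1.
     X \<in> bounded_complexes A \<and> Y \<in> bounded_complexes A \<and> Z \<in> bounded_complexes A \<and>
     f \<in> chain_maps A X Y \<and> is_cone A X Y f Z i2 p1}"

definition distinguished_triangles ::
  "('o, 'a, 'x) pcat_scheme \<Rightarrow> (('o, 'a) complex \<times> ('o, 'a) complex \<times> ('o, 'a) complex \<times>
     (int \<Rightarrow> 'a) set \<times> (int \<Rightarrow> 'a) set \<times> (int \<Rightarrow> 'a) set) set" where
  "distinguished_triangles A = (let K = Kb_pcat A; S = Kb_shift A in
     {(X, Y, Z, u, v, w). X \<in> Ob K \<and> Y \<in> Ob K \<and> Z \<in> Ob K \<and>
        u \<in> Mor K X Y \<and> v \<in> Mor K Y Z \<and> w \<in> Mor K Z (FOb S X) \<and>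
        (\<exists>X' Y' Z' u' v' w' a b c. (X', Y', Z', u', v', w') \<in> standard_triangles A \<and>
           is_iso K X X' a \<and> is_iso K Y Y' b \<and> is_iso K Z Z' c \<and>
           cmp K X Y Y' b u = cmp K X X' Y' u' a \<and>
           cmp K Y Z Z' c v = cmp K Y Y' Z' v' b \<and>
           cmp K Z (FOb S X) (FOb S X') (FMor S X X' a) w = cmp K Z Z' (FOb S X') w' c)})"

definition Kb ::
  "('o, 'a, 'x) pcat_scheme \<Rightarrow> (('o, 'a) complex, (int \<Rightarrow> 'a) set) tcat" where
  "Kb A = pcat.extend (Kb_pcat A) (tcat.fields (Kb_shift A) (distinguished_triangles A))"


section \<open>Modules over the free algebra\<close>

text \<open>A module over the free algebra on \<open>J\<close> over \<open>R\<close> is an \<open>R\<close>-module together with a family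
  \<open>act\<close> of \<open>R\<close>-linear endomorphisms indexed by \<open>J\<close>. The fields \<open>mult\<close> and \<open>one\<close> of the
  underlying module record carry no meaning; modules that differ only there, or in values
  outside the carrier, are distinct but isomorphic objects.\<close>

record ('r, 'b, 'i) fmodule = "('r, 'b) module" +
  act :: "'i \<Rightarrow> 'b \<Rightarrow> 'b"

definition linear_maps ::
  "('r, 'y) ring_scheme \<Rightarrow> ('r, 'b, 'm) module_scheme \<Rightarrow> ('r, 'c, 'n) module_scheme
   \<Rightarrow> ('b \<Rightarrow> 'c) set" where
  "linear_maps R M N = {f \<in> carrier M \<rightarrow> carrier N.
     (\<forall>x \<in> carrier M. \<forall>y \<in> carrier M. f (x \<oplus>\<^bsub>M\<^esub> y) = f x \<oplus>\<^bsub>N\<^esub> f y) \<and>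
     (\<forall>a \<in> carrier R. \<forall>x \<in> carrier M. f (a \<odot>\<^bsub>M\<^esub> x) = a \<odot>\<^bsub>N\<^esub> f x)}"

definition free_alg_module ::
  "('r, 'y) ring_scheme \<Rightarrow> 'i set \<Rightarrow> ('r, 'b, 'i) fmodule \<Rightarrow> bool" where
  "free_alg_module R J M \<longleftrightarrow> module R M \<and> (\<forall>j \<in> J. act M j \<in> linear_maps R M M)"

definition fmod_homs ::
  "('r, 'y) ring_scheme \<Rightarrow> 'i set \<Rightarrow> ('r, 'b, 'i) fmodule \<Rightarrow> ('r, 'c, 'i) fmodule
   \<Rightarrow> ('b \<Rightarrow> 'c) set" where
  "fmod_homs R J M N = {f \<in> linear_maps R M N \<inter> extensional (carrier M).
     \<forall>j \<in> J. \<forall>x \<in> carrier M. f (act M j x) = act N j (f x)}"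

definition fmod_isomorphic ::
  "('r, 'y) ring_scheme \<Rightarrow> 'i set \<Rightarrow> ('r, 'b, 'i) fmodule \<Rightarrow> ('r, 'c, 'i) fmodule \<Rightarrow> bool" where
  "fmod_isomorphic R J M N \<longleftrightarrow> (\<exists>f \<in> fmod_homs R J M N. bij_betw f (carrier M) (carrier N))"

definition trivial_fmod :: "('r, 'y) ring_scheme \<Rightarrow> ('r, 'r, 'i) fmodule" where
  "trivial_fmod R = \<lparr>carrier = carrier R, mult = mult R, one = one R, zero = zero R,
     add = add R, smult = mult R, act = (\<lambda>j x. \<zero>\<^bsub>R\<^esub>)\<rparr>"

definition fmod_power :: "('r, 'b, 'i) fmodule \<Rightarrow> nat \<Rightarrow> ('r, nat \<Rightarrow> 'b, 'i) fmodule" where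
  "fmod_power M n = \<lparr>carrier = {..<n} \<rightarrow>\<^sub>E carrier M,
     mult = (\<lambda>x y. \<lambda>k \<in> {..<n}. x k \<otimes>\<^bsub>M\<^esub> y k), one = (\<lambda>k \<in> {..<n}. \<one>\<^bsub>M\<^esub>),
     zero = (\<lambda>k \<in> {..<n}. \<zero>\<^bsub>M\<^esub>), add = (\<lambda>x y. \<lambda>k \<in> {..<n}. x k \<oplus>\<^bsub>M\<^esub> y k),
     smult = (\<lambda>a x. \<lambda>k \<in> {..<n}. a \<odot>\<^bsub>M\<^esub> x k), act = (\<lambda>j x. \<lambda>k \<in> {..<n}. act M j (x k))\<rparr>"

definition free_alg_submodule ::
  "('r, 'y) ring_scheme \<Rightarrow> 'i set \<Rightarrow> 'b set \<Rightarrow> ('r, 'b, 'i) fmodule \<Rightarrow> bool" where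
  "free_alg_submodule R J H M \<longleftrightarrow> submodule H R M \<and> (\<forall>j \<in> J. \<forall>x \<in> H. act M j x \<in> H)"

definition quotient_fmod ::
  "('r, 'b, 'i) fmodule \<Rightarrow> 'b set \<Rightarrow> ('r, 'b set, 'i) fmodule" where
  "quotient_fmod M H = \<lparr>carrier = a_rcosets\<^bsub>M\<^esub> H, mult = (\<lambda>X Y. undefined), one = undefined,
     zero = H, add = set_add M,
     smult = (\<lambda>a X. \<Union>x \<in> X. H +>\<^bsub>M\<^esub> (a \<odot>\<^bsub>M\<^esub> x)),
     act = (\<lambda>j X. \<Union>x \<in> X. H +>\<^bsub>M\<^esub> act M j x)\<rparr>"

definition finite_trivial_sum ::
  "('r, 'y) ring_scheme \<Rightarrow> 'i set \<Rightarrow> ('r, 'b, 'i) fmodule \<Rightarrow> bool" where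
  "finite_trivial_sum R J M \<longleftrightarrow> (\<exists>n. fmod_isomorphic R J M (fmod_power (trivial_fmod R) n))"

text \<open>The modules are those whose underlying sets belong to the universe \<open>V\<close>.\<close>

definition two_step_modules ::
  "('v \<Rightarrow> 'v \<Rightarrow> bool) \<Rightarrow> 'v \<Rightarrow> ('r, 'y) ring_scheme \<Rightarrow> 'i set \<Rightarrow> ('r, 'v, 'i) fmodule set" where
  "two_step_modules mem V R J = {M. free_alg_module R J M \<and>
     (\<exists>m. mem m V \<and> carrier M = elts mem m) \<and>
     (\<exists>H. free_alg_submodule R J H M \<and> finite_trivial_sum R J (M\<lparr>carrier := H\<rparr>) \<and>
          finite_trivial_sum R J (quotient_fmod M H))}"

definition two_step_cat ::
  "('v \<Rightarrow> 'v \<Rightarrow> bool) \<Rightarrow> 'v \<Rightarrow> ('r, 'y) ring_scheme \<Rightarrow> 'i set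
   \<Rightarrow> (('r, 'v, 'i) fmodule, 'v \<Rightarrow> 'v) pcat" where
  "two_step_cat mem V R J = \<lparr>Ob = two_step_modules mem V R J,
     Mor = fmod_homs R J,
     idm = (\<lambda>M. \<lambda>x \<in> carrier M. x),
     cmp = (\<lambda>M N P g f. compose (carrier M) g f),
     madd = (\<lambda>M N f g. \<lambda>x \<in> carrier M. f x \<oplus>\<^bsub>N\<^esub> g x),
     mzero = (\<lambda>M N. \<lambda>x \<in> carrier M. \<zero>\<^bsub>N\<^esub>)\<rparr>"

end

theory Submission
  imports Defs
begin

text \<open>Every object of \<open>Ab(T)\<close> is the image of a morphism between objects of \<open>T = K\<^sup>b(A)\<close>, so that its
  sets of morphisms embed into those of \<open>T\<close>. These are small because a module in \<open>A\<close> is an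
  extension of \<open>F\<^sup>m\<close> by \<open>F\<^sup>n\<close>.

  The trivial module \<open>1\<close> has a self-extension \<open>E\<^sub>j\<close> for every \<open>j \<in> I\<close>, and its class is represented by
  a roof \<open>Y \<leftarrow> X\<^sub>j \<rightarrow> Z\<close> in \<open>T\<close> whose left leg is a quasi-isomorphism. If the kernels and cokernels of the
  left legs lie in \<open>C\<close>, the roofs become morphisms \<open>e\<^sub>j : Y \<rightarrow> Z\<close> in the quotient. To keep
  them distinct, \<open>C\<close> is chosen as a common kernel of exact functors that separate them: letting all
  variables but \<open>i\<close> act as zero is an exact endofunctor of \<open>A\<close>, and the induced functor on \<open>T\<close> extends
  to an exact endofunctor \<open>G\<^sub>i\<close> of \<open>Ab(T)\<close>. As \<open>P\<^sub>i = (E\<^sub>i \<rightarrow> E\<^sub>i)\<close> is projective in \<open>Ab(T)\<close>, the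
  functor \<open>Hom(P\<^sub>i, G\<^sub>i -)\<close> is exact. It sends \<open>e\<^sub>i\<close> to a nonzero map and \<open>e\<^sub>j\<close> to zero for \<open>j \<noteq> i\<close>.\<close>

section \<open>Preadditive and abelian categories\<close>

text \<open>The quotient is given only by its universal property, so its morphisms can be told apart
  only by functors on the abelianisation that invert the morphisms with kernel and cokernel in
  \<open>C\<close>. Hence \<open>Hom(P_i, G_i -)\<close> is used as a functor to sets, a target of
  the type that the universal property admits.

  Origin of \<open>P_i\<close>: both layers of a module in \<open>A\<close> have zero action, so
  once all variables but i act as zero the module lives over F[x]/(x^2), with x acting as i. There
  \<open>E_i\<close> is free of rank one, so that complexes built from it see quasi-isomorphisms as
  isomorphisms and the left legs of the roofs become bijections. The map \<open>E_i -> E_i\<close>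
  is multiplication by x: \<open>P_i\<close> is the beginning of the free resolution of the trivial
  module, cut at the length that still detects Ext^1(1, 1). For j other than i, switching off j
  splits \<open>E_j\<close>, and its class vanishes.

  That images exhaust Ab(T) comes from the universal property: they form an abelian subcategory
  through which the functor from T factors, and uniqueness makes the resulting retraction isomorphic
  to the identity.\<close>

context category
begin

lemma is_isoI:
  "\<lbrakk>f \<in> Mor C X Y; g \<in> Mor C Y X; cmp C X Y X g f = idm C X; cmp C Y X Y f g = idm C Y\<rbrakk>
   \<Longrightarrow> is_iso C X Y f"
  unfolding is_iso_def by blast

end

context preadditive
begin

lemma madd_in: "\<lbrakk>X \<in> Ob C; Y \<in> Ob C; f \<in> Mor C X Y; g \<in> Mor C X Y\<rbrakk> \<Longrightarrow> madd C X Y f g \<in> Mor C X Y"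
  using comm_group.axioms(2)[OF mor_group, of X Y] group.is_monoid monoid.m_closed
  unfolding mor_group_def by fastforce

lemma mzero_in: "\<lbrakk>X \<in> Ob C; Y \<in> Ob C\<rbrakk> \<Longrightarrow> mzero C X Y \<in> Mor C X Y"
  using comm_group.axioms(2)[OF mor_group, of X Y] group.is_monoid monoid.one_closed
  unfolding mor_group_def by fastforce

lemma mneg_in: "\<lbrakk>X \<in> Ob C; Y \<in> Ob C; f \<in> Mor C X Y\<rbrakk> \<Longrightarrow> mneg C X Y f \<in> Mor C X Y"
  using comm_group.axioms(2)[OF mor_group, of X Y] group.inv_closed
  unfolding mor_group_def mneg_def by fastforce

lemma madd_assoc:
  "\<lbrakk>X \<in> Ob C; Y \<in> Ob C; f \<in> Mor C X Y; g \<in> Mor C X Y; h \<in> Mor C X Y\<rbrakk>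
   \<Longrightarrow> madd C X Y (madd C X Y f g) h = madd C X Y f (madd C X Y g h)"
  using comm_group.axioms(2)[OF mor_group, of X Y, THEN group.is_monoid, THEN monoid.m_assoc, of f g h]
  unfolding mor_group_def by simp

lemma madd_comm:
  "\<lbrakk>X \<in> Ob C; Y \<in> Ob C; f \<in> Mor C X Y; g \<in> Mor C X Y\<rbrakk>
   \<Longrightarrow> madd C X Y f g = madd C X Y g f"
  using comm_group.axioms(1)[OF mor_group, of X Y, THEN comm_monoid.m_comm, of f g]
  unfolding mor_group_def by simp

lemma madd_lcomm:
  "\<lbrakk>X \<in> Ob C; Y \<in> Ob C; f \<in> Mor C X Y; g \<in> Mor C X Y; h \<in> Mor C X Y\<rbrakk>
   \<Longrightarrow> madd C X Y f (madd C X Y g h) = madd C X Y g (madd C X Y f h)"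
  using madd_assoc madd_comm by metis

lemma madd_0_left: "\<lbrakk>X \<in> Ob C; Y \<in> Ob C; f \<in> Mor C X Y\<rbrakk> \<Longrightarrow> madd C X Y (mzero C X Y) f = f"
  using comm_group.axioms(2)[OF mor_group, of X Y, THEN group.is_monoid, THEN monoid.l_one, of f]
  unfolding mor_group_def by simp

lemma madd_0_right: "\<lbrakk>X \<in> Ob C; Y \<in> Ob C; f \<in> Mor C X Y\<rbrakk> \<Longrightarrow> madd C X Y f (mzero C X Y) = f"
  using comm_group.axioms(2)[OF mor_group, of X Y, THEN group.is_monoid, THEN monoid.r_one, of f]
  unfolding mor_group_def by simp

lemma madd_neg_right: "\<lbrakk>X \<in> Ob C; Y \<in> Ob C; f \<in> Mor C X Y\<rbrakk> \<Longrightarrow> madd C X Y f (mneg C X Y f) = mzero C X Y"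
  using comm_group.axioms(2)[OF mor_group, of X Y, THEN group.r_inv, of f]
  unfolding mor_group_def mneg_def by simp

lemma madd_neg_left: "\<lbrakk>X \<in> Ob C; Y \<in> Ob C; f \<in> Mor C X Y\<rbrakk> \<Longrightarrow> madd C X Y (mneg C X Y f) f = mzero C X Y"
  using comm_group.axioms(2)[OF mor_group, of X Y, THEN group.l_inv, of f]
  unfolding mor_group_def mneg_def by simp

lemma madd_neg_cancel1:
  "\<lbrakk>X \<in> Ob C; Y \<in> Ob C; f \<in> Mor C X Y; g \<in> Mor C X Y\<rbrakk>
   \<Longrightarrow> madd C X Y f (madd C X Y (mneg C X Y f) g) = g"
  by (metis madd_assoc madd_neg_right madd_0_left mneg_in)

lemma madd_neg_cancel2:
  "\<lbrakk>X \<in> Ob C; Y \<in> Ob C; f \<in> Mor C X Y; g \<in> Mor C X Y\<rbrakk>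
   \<Longrightarrow> madd C X Y (mneg C X Y f) (madd C X Y f g) = g"
  by (metis madd_assoc madd_neg_left madd_0_left mneg_in)

lemma madd_cancel:
  "\<lbrakk>X \<in> Ob C; Y \<in> Ob C; f \<in> Mor C X Y; g \<in> Mor C X Y; h \<in> Mor C X Y\<rbrakk>
   \<Longrightarrow> madd C X Y f g = madd C X Y f h \<longleftrightarrow> g = h"
  by (metis madd_neg_cancel2)

lemma neg_unique:
  "\<lbrakk>X \<in> Ob C; Y \<in> Ob C; f \<in> Mor C X Y; g \<in> Mor C X Y; madd C X Y f g = mzero C X Y\<rbrakk>
   \<Longrightarrow> mneg C X Y f = g"
  by (metis madd_neg_cancel2 madd_0_right mneg_in)

lemma mneg_mneg: "\<lbrakk>X \<in> Ob C; Y \<in> Ob C; f \<in> Mor C X Y\<rbrakk> \<Longrightarrow> mneg C X Y (mneg C X Y f) = f"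
  by (meson neg_unique madd_neg_left mneg_in)

lemma mneg_zero: "\<lbrakk>X \<in> Ob C; Y \<in> Ob C\<rbrakk> \<Longrightarrow> mneg C X Y (mzero C X Y) = mzero C X Y"
  by (simp add: neg_unique madd_0_left mzero_in)

lemma mneg_madd:
  "\<lbrakk>X \<in> Ob C; Y \<in> Ob C; f \<in> Mor C X Y; g \<in> Mor C X Y\<rbrakk>
   \<Longrightarrow> mneg C X Y (madd C X Y f g) = madd C X Y (mneg C X Y f) (mneg C X Y g)"
  by (rule neg_unique)
    (simp_all add: madd_in mneg_in madd_assoc madd_lcomm[of X Y g] madd_neg_right madd_0_right)

text \<open>The usual reason why additive maps preserve zero; it serves composition here and
  additive functors later on.\<close>

lemma idem_zero:
  "\<lbrakk>X \<in> Ob C; Y \<in> Ob C; f \<in> Mor C X Y; madd C X Y f f = f\<rbrakk> \<Longrightarrow> f = mzero C X Y"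
  by (metis madd_0_right madd_cancel mzero_in)

lemma cmp_0_left:
  assumes "X \<in> Ob C" "Y \<in> Ob C" "Z \<in> Ob C" "f \<in> Mor C X Y"
  shows "cmp C X Y Z (mzero C Y Z) f = mzero C X Z"
  using idem_zero[of X Z "cmp C X Y Z (mzero C Y Z) f"] assms
    cmp_madd_left[of X Y Z f "mzero C Y Z" "mzero C Y Z"] by (simp add: cmp_in mzero_in madd_0_left)

lemma cmp_0_right:
  assumes "X \<in> Ob C" "Y \<in> Ob C" "Z \<in> Ob C" "g \<in> Mor C Y Z"
  shows "cmp C X Y Z g (mzero C X Y) = mzero C X Z"
  using idem_zero[of X Z "cmp C X Y Z g (mzero C X Y)"] assms
    cmp_madd_right[of X Y Z "mzero C X Y" "mzero C X Y" g] by (simp add: cmp_in mzero_in madd_0_left)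

lemma cmp_neg_left:
  assumes "X \<in> Ob C" "Y \<in> Ob C" "Z \<in> Ob C" "f \<in> Mor C X Y" "g \<in> Mor C Y Z"
  shows "cmp C X Y Z (mneg C Y Z g) f = mneg C X Z (cmp C X Y Z g f)"
  using assms by (intro neg_unique[symmetric])
    (simp_all add: cmp_in mneg_in cmp_madd_left[symmetric] madd_neg_right cmp_0_left)

lemma cmp_neg_right:
  assumes "X \<in> Ob C" "Y \<in> Ob C" "Z \<in> Ob C" "f \<in> Mor C X Y" "g \<in> Mor C Y Z"
  shows "cmp C X Y Z g (mneg C X Y f) = mneg C X Z (cmp C X Y Z g f)"
  using assms by (intro neg_unique[symmetric])
    (simp_all add: cmp_in mneg_in cmp_madd_right[symmetric] madd_neg_right cmp_0_right)

lemmas mor_in = idm_in cmp_in madd_in mzero_in mneg_in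

text \<open>A normal form for simp: composites are bracketed to the right and distributed over sums
  and signs. Equations between matrices of morphisms then become equations between sums, which
  \<open>madd_ac\<close> settles.\<close>

lemmas mor_simps = idm_left idm_right cmp_assoc[symmetric] cmp_madd_left cmp_madd_right
  madd_0_left madd_0_right madd_neg_left madd_neg_right madd_neg_cancel1 madd_neg_cancel2
  mneg_mneg mneg_zero mneg_madd cmp_0_left cmp_0_right cmp_neg_left cmp_neg_right

lemmas madd_ac = madd_assoc madd_comm madd_lcomm

lemma madd_neg_eq_zero:
  assumes "X \<in> Ob C" "Y \<in> Ob C" "f \<in> Mor C X Y" "g \<in> Mor C X Y"
    and "madd C X Y f (mneg C X Y g) = mzero C X Y"
  shows "f = g"
  using assms by (metis madd_assoc madd_neg_left madd_0_left madd_0_right mneg_in)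

lemma zero_object_iff:
  "zero_object C Z \<longleftrightarrow> Z \<in> Ob C \<and> idm C Z = mzero C Z Z"
proof safe
  assume *: "zero_object C Z"
  show "Z \<in> Ob C" using * by (simp add: zero_object_def)
  then show "idm C Z = mzero C Z Z" using * unfolding zero_object_def by (metis idm_in mzero_in)
next
  assume Z: "Z \<in> Ob C" "idm C Z = mzero C Z Z"
  have "f = mzero C X Z" if "X \<in> Ob C" "f \<in> Mor C X Z" for X f
    using that Z cmp_0_left idm_left by metis
  moreover have "f = mzero C Z X" if "X \<in> Ob C" "f \<in> Mor C Z X" for X f
    using that Z cmp_0_right idm_right by metis
  ultimately show "zero_object C Z" unfolding zero_object_def using Z mzero_in by blast
qed

lemma zero_object_to: "\<lbrakk>zero_object C Z; X \<in> Ob C; f \<in> Mor C X Z\<rbrakk> \<Longrightarrow> f = mzero C X Z"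
  unfolding zero_object_def using mzero_in by blast

lemma zero_object_from: "\<lbrakk>zero_object C Z; X \<in> Ob C; f \<in> Mor C Z X\<rbrakk> \<Longrightarrow> f = mzero C Z X"
  unfolding zero_object_def using mzero_in by blast

end


text \<open>Zero object and biproducts are what complexes, cones and homotopies use; the module
  category enters the homotopy theory through this interface.\<close>

locale additive_category = preadditive C for C :: "('o, 'a, 'x) pcat_scheme" +
  assumes has_zero: "\<exists>Z. zero_object C Z"
    and has_biproduct: "\<lbrakk>X \<in> Ob C; Y \<in> Ob C\<rbrakk> \<Longrightarrow> \<exists>S i1 i2 p1 p2. is_biproduct C X Y S i1 i2 p1 p2"

context preadditive
begin

lemma biproductD:
  assumes "X \<in> Ob C" "Y \<in> Ob C" "is_biproduct C X Y S i1 i2 p1 p2"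
  shows "S \<in> Ob C" "i1 \<in> Mor C X S" "i2 \<in> Mor C Y S" "p1 \<in> Mor C S X" "p2 \<in> Mor C S Y"
    "cmp C X S X p1 i1 = idm C X" "cmp C Y S Y p2 i2 = idm C Y"
    "cmp C Y S X p1 i2 = mzero C Y X" "cmp C X S Y p2 i1 = mzero C X Y"
    "madd C S S (cmp C S X S i1 p1) (cmp C S Y S i2 p2) = idm C S"
  using assms(3) unfolding is_biproduct_def by blast+

text \<open>Composing with the decomposition of the identity as \<open>i1 p1 + i2 p2\<close>
  recovers a morphism from its two restrictions.\<close>

lemma biproduct_eq_from:
  assumes "X \<in> Ob C" "Y \<in> Ob C" "is_biproduct C X Y S i1 i2 p1 p2"
    and "W \<in> Ob C" "f \<in> Mor C S W" "g \<in> Mor C S W"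
    and "cmp C X S W f i1 = cmp C X S W g i1" "cmp C Y S W f i2 = cmp C Y S W g i2"
  shows "f = g"
proof -
  note b = biproductD[OF assms(1-3)]
  have "h = madd C S W (cmp C S X W (cmp C X S W h i1) p1) (cmp C S Y W (cmp C Y S W h i2) p2)"
    if "h \<in> Mor C S W" for h
    using arg_cong[OF b(10), of "\<lambda>k. cmp C S S W h k"] that assms(1,2,4) b(1-5)
    by (simp add: mor_in mor_simps)
  then show ?thesis using assms by metis
qed

end

text \<open>Exactness at \<open>Y\<close> without a choice of image: whatever is killed by
  \<open>f\<close> on the right must kill whatever \<open>g\<close> kills on the left. The condition
  is self-dual, and it is the form in which exactness is passed between a category and a full
  subcategory.\<close>

definition exact_pair ::
  "('o, 'a, 'x) pcat_scheme \<Rightarrow> 'o \<Rightarrow> 'o \<Rightarrow> 'o \<Rightarrow> 'a \<Rightarrow> 'a \<Rightarrow> bool" where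
  "exact_pair C X Y Z f g \<longleftrightarrow> f \<in> Mor C X Y \<and> g \<in> Mor C Y Z \<and> cmp C X Y Z g f = mzero C X Z \<and>
     (\<forall>A \<in> Ob C. \<forall>B \<in> Ob C. \<forall>a \<in> Mor C Y A. \<forall>b \<in> Mor C B Y.
        cmp C X Y A a f = mzero C X A \<and> cmp C B Y Z g b = mzero C B Z \<longrightarrow> cmp C B Y A a b = mzero C B A)"

text \<open>Statements about epimorphisms and cokernels are obtained from those about monomorphisms
  and kernels by instantiating them at the dual category; the simp rules below carry out the
  translation.\<close>

definition op_cat :: "('o, 'a, 'x) pcat_scheme \<Rightarrow> ('o, 'a) pcat" where
  "op_cat C = \<lparr>Ob = Ob C, Mor = (\<lambda>X Y. Mor C Y X), idm = idm C,
     cmp = (\<lambda>X Y Z g f. cmp C Z Y X f g), madd = (\<lambda>X Y. madd C Y X), mzero = (\<lambda>X Y. mzero C Y X)\<rparr>"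

lemma op_sel [simp]:
  "Ob (op_cat C) = Ob C" "Mor (op_cat C) X Y = Mor C Y X" "idm (op_cat C) = idm C"
  "cmp (op_cat C) X Y Z g f = cmp C Z Y X f g" "madd (op_cat C) X Y = madd C Y X"
  "mzero (op_cat C) X Y = mzero C Y X"
  by (simp_all add: op_cat_def)

lemma op_mono [simp]: "is_mono (op_cat C) X Y f = is_epi C Y X f"
  by (simp add: is_mono_def is_epi_def)

lemma op_epi [simp]: "is_epi (op_cat C) X Y f = is_mono C Y X f"
  by (simp add: is_mono_def is_epi_def)

lemma op_kernel [simp]: "is_kernel (op_cat C) X Y f K k = is_cokernel C Y X f K k"
  by (simp add: is_kernel_def is_cokernel_def)

lemma op_cokernel [simp]: "is_cokernel (op_cat C) X Y f K k = is_kernel C Y X f K k"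
  by (simp add: is_kernel_def is_cokernel_def)

lemma op_biproduct [simp]: "is_biproduct (op_cat C) X Y S i1 i2 p1 p2 = is_biproduct C X Y S p1 p2 i1 i2"
  unfolding is_biproduct_def by auto

lemma op_exact_pair [simp]: "exact_pair (op_cat C) X Y Z f g = exact_pair C Z Y X g f"
  unfolding exact_pair_def by auto

lemma op_zero [simp]: "zero_object (op_cat C) Z = zero_object C Z"
  unfolding zero_object_def by (simp add: conj_commute)

section \<open>Monomorphisms, kernels and factorisations, with their duals\<close>

context preadditive
begin

lemma mono_iff: "\<lbrakk>X \<in> Ob C; Y \<in> Ob C\<rbrakk> \<Longrightarrow> is_mono C X Y f \<longleftrightarrow> f \<in> Mor C X Y \<and>
    (\<forall>W \<in> Ob C. \<forall>u \<in> Mor C W X. cmp C W X Y f u = mzero C W Y \<longrightarrow> u = mzero C W X)"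
    (is "_ \<Longrightarrow> _ \<Longrightarrow> _ \<longleftrightarrow> ?r")
proof (rule iffI)
  assume o: "X \<in> Ob C" "Y \<in> Ob C" and m: "is_mono C X Y f"
  then have f: "f \<in> Mor C X Y" by (simp add: is_mono_def)
  have "u = mzero C W X" if "W \<in> Ob C" "u \<in> Mor C W X" "cmp C W X Y f u = mzero C W Y" for W u
    using m that mzero_in[OF that(1) o(1)] cmp_0_right[OF that(1) o f] unfolding is_mono_def by simp
  with f show ?r by blast
next
  assume o: "X \<in> Ob C" "Y \<in> Ob C" and r: ?r
  then have f: "f \<in> Mor C X Y" by blast
  have "u = v" if uv: "W \<in> Ob C" "u \<in> Mor C W X" "v \<in> Mor C W X" "cmp C W X Y f u = cmp C W X Y f v"
    for W u v
  proof -
    have "cmp C W X Y f (madd C W X u (mneg C W X v)) = mzero C W Y"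
      using o f uv by (simp add: mor_in mor_simps)
    then have "madd C W X u (mneg C W X v) = mzero C W X"
      using r o uv(1-3) by (simp add: mor_in)
    then show "u = v" using madd_neg_eq_zero o uv by blast
  qed
  then show "is_mono C X Y f" using f unfolding is_mono_def by blast
qed

lemma monoD: "\<lbrakk>is_mono C X Y f; X \<in> Ob C; Y \<in> Ob C; W \<in> Ob C; u \<in> Mor C W X; cmp C W X Y f u = mzero C W Y\<rbrakk>
    \<Longrightarrow> u = mzero C W X"
  using mono_iff by blast

lemma mono_in: "is_mono C X Y f \<Longrightarrow> f \<in> Mor C X Y" by (simp add: is_mono_def)
lemma epi_in: "is_epi C X Y f \<Longrightarrow> f \<in> Mor C X Y" by (simp add: is_epi_def)

lemma mono_eq: "\<lbrakk>is_mono C X Y f; W \<in> Ob C; u \<in> Mor C W X; v \<in> Mor C W X; cmp C W X Y f u = cmp C W X Y f v\<rbrakk>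
    \<Longrightarrow> u = v"
  unfolding is_mono_def by blast

lemma epi_eq: "\<lbrakk>is_epi C X Y f; W \<in> Ob C; u \<in> Mor C Y W; v \<in> Mor C Y W; cmp C X Y W u f = cmp C X Y W v f\<rbrakk>
    \<Longrightarrow> u = v"
  unfolding is_epi_def by blast

lemma op_preadditive: "preadditive (op_cat C)"
proof (intro preadditive.intro category.intro preadditive_axioms.intro)
  fix X Y assume "X \<in> Ob (op_cat C)" "Y \<in> Ob (op_cat C)"
  then show "comm_group (mor_group (op_cat C) X Y)" using mor_group[of Y X] by (simp add: mor_group_def)
qed (simp_all add: mor_in mor_simps)

lemma epi_iff: "\<lbrakk>X \<in> Ob C; Y \<in> Ob C\<rbrakk> \<Longrightarrow> is_epi C X Y f \<longleftrightarrow> f \<in> Mor C X Y \<and>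
    (\<forall>W \<in> Ob C. \<forall>u \<in> Mor C Y W. cmp C X Y W u f = mzero C X W \<longrightarrow> u = mzero C Y W)"
  using preadditive.mono_iff[OF op_preadditive, of Y X f] by simp

lemma epiD: "\<lbrakk>is_epi C X Y f; X \<in> Ob C; Y \<in> Ob C; W \<in> Ob C; u \<in> Mor C Y W; cmp C X Y W u f = mzero C X W\<rbrakk>
    \<Longrightarrow> u = mzero C Y W"
  using epi_iff by blast

lemma mono_cmp:
  assumes "X \<in> Ob C" "Y \<in> Ob C" "Z \<in> Ob C" "is_mono C X Y f" "is_mono C Y Z g"
  shows "is_mono C X Z (cmp C X Y Z g f)"
proof -
  have fg: "f \<in> Mor C X Y" "g \<in> Mor C Y Z" using assms mono_in by blast+
  show ?thesis
    unfolding mono_iff[OF assms(1,3)]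
  proof (intro conjI ballI impI)
    fix W u assume W: "W \<in> Ob C" "u \<in> Mor C W X" "cmp C W X Z (cmp C X Y Z g f) u = mzero C W Z"
    then have "cmp C W Y Z g (cmp C W X Y f u) = mzero C W Z"
      using assms fg by (simp add: cmp_assoc)
    then have "cmp C W X Y f u = mzero C W Y"
      using monoD[OF assms(5,2,3) W(1)] cmp_in assms W fg by blast
    then show "u = mzero C W X" using monoD[OF assms(4,1,2)] W by blast
  qed (use assms fg in \<open>simp add: mor_in\<close>)
qed

lemma epi_cmp:
  assumes "X \<in> Ob C" "Y \<in> Ob C" "Z \<in> Ob C" "is_epi C X Y f" "is_epi C Y Z g"
  shows "is_epi C X Z (cmp C X Y Z g f)"
  using preadditive.mono_cmp[OF op_preadditive, of Z Y X g f] assms by simp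

lemma kernelD:
  assumes "is_kernel C X Y f K k"
  shows "K \<in> Ob C" "k \<in> Mor C K X" "cmp C K X Y f k = mzero C K Y"
    "\<And>W w. \<lbrakk>W \<in> Ob C; w \<in> Mor C W X; cmp C W X Y f w = mzero C W Y\<rbrakk>
       \<Longrightarrow> \<exists>!u. u \<in> Mor C W K \<and> cmp C W K X k u = w"
  using assms unfolding is_kernel_def by blast+

lemma kernel_factor:
  assumes "is_kernel C X Y f K k" "W \<in> Ob C" "w \<in> Mor C W X" "cmp C W X Y f w = mzero C W Y"
  obtains u where "u \<in> Mor C W K" "cmp C W K X k u = w"
  using kernelD(4)[OF assms] by blast

lemma kernel_mono:
  assumes "X \<in> Ob C" "Y \<in> Ob C" "f \<in> Mor C X Y" "is_kernel C X Y f K k"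
  shows "is_mono C K X k"
  unfolding is_mono_def
proof (intro conjI ballI impI)
  note k = kernelD(1-3)[OF assms(4)]
  show "k \<in> Mor C K X" by (rule k)
  fix W u v assume W: "W \<in> Ob C" "u \<in> Mor C W K" "v \<in> Mor C W K" "cmp C W K X k u = cmp C W K X k v"
  have "cmp C W X Y f (cmp C W K X k u) = mzero C W Y"
    using W assms k by (simp add: cmp_assoc cmp_0_left)
  moreover have "cmp C W K X k u \<in> Mor C W X" using W assms k cmp_in by blast
  ultimately have "\<exists>!t. t \<in> Mor C W K \<and> cmp C W K X k t = cmp C W K X k u"
    using kernelD(4)[OF assms(4) W(1)] by blast
  then show "u = v" using W(2,3) W(4)[symmetric] by blast
qed

lemma cokernelD:
  assumes "is_cokernel C X Y f K k"
  shows "K \<in> Ob C" "k \<in> Mor C Y K" "cmp C X Y K k f = mzero C X K"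
  using assms unfolding is_cokernel_def by blast+

lemma cokernel_factor:
  assumes "is_cokernel C X Y f K k" "W \<in> Ob C" "w \<in> Mor C Y W" "cmp C X Y W w f = mzero C X W"
  obtains u where "u \<in> Mor C K W" "cmp C Y K W u k = w"
  using assms unfolding is_cokernel_def by blast

lemma cokernel_epi:
  assumes "X \<in> Ob C" "Y \<in> Ob C" "f \<in> Mor C X Y" "is_cokernel C X Y f K k"
  shows "is_epi C Y K k"
  using preadditive.kernel_mono[OF op_preadditive, of Y X f K k] assms by simp

lemma kernelI:
  assumes "X \<in> Ob C" "Y \<in> Ob C" "K \<in> Ob C" "f \<in> Mor C X Y" "is_mono C K X k"
    "cmp C K X Y f k = mzero C K Y"
    "\<And>W w. \<lbrakk>W \<in> Ob C; w \<in> Mor C W X; cmp C W X Y f w = mzero C W Y\<rbrakk> \<Longrightarrow> \<exists>u \<in> Mor C W K. cmp C W K X k u = w"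
  shows "is_kernel C X Y f K k"
  unfolding is_kernel_def
  using assms mono_eq[OF assms(5)] mono_in by blast

end

context abelian_category
begin

lemma op_abelian: "abelian_category (op_cat C)"
proof -
  interpret op: preadditive "op_cat C" by (rule op_preadditive)
  show ?thesis
  proof
    show "\<exists>Z. zero_object (op_cat C) Z" using has_zero by simp
    fix X Y f
    assume o: "X \<in> Ob (op_cat C)" "Y \<in> Ob (op_cat C)"
    have o': "X \<in> Ob C" "Y \<in> Ob C" using o by simp_all
    obtain S i1 i2 p1 p2 where "is_biproduct C X Y S i1 i2 p1 p2" using has_biproduct[OF o'] by blast
    then have "is_biproduct (op_cat C) X Y S p1 p2 i1 i2" by simp
    then show "\<exists>S i1 i2 p1 p2. is_biproduct (op_cat C) X Y S i1 i2 p1 p2" by blast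
    show "\<exists>K k. is_kernel (op_cat C) X Y f K k" if "f \<in> Mor (op_cat C) X Y"
      using has_cokernel[OF o'(2,1)] that by simp
    show "\<exists>K k. is_cokernel (op_cat C) X Y f K k" if "f \<in> Mor (op_cat C) X Y"
      using has_kernel[OF o'(2,1)] that by simp
    show "\<exists>Z \<in> Ob (op_cat C). \<exists>g \<in> Mor (op_cat C) Y Z. is_kernel (op_cat C) Y Z g X f" if "is_mono (op_cat C) X Y f"
      using epi_normal[OF o'(2,1)] that by simp
    show "\<exists>W \<in> Ob (op_cat C). \<exists>g \<in> Mor (op_cat C) W X. is_cokernel (op_cat C) W X g Y f" if "is_epi (op_cat C) X Y f"
      using mono_normal[OF o'(2,1)] that by simp
  qed
qed

text \<open>A monomorphism is the kernel of some \<open>g\<close>, and \<open>g\<close> factors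
  through the cokernel \<open>q\<close> of \<open>f\<close>. So everything that \<open>q\<close>
  kills is killed by \<open>g\<close> and factors through \<open>f\<close>.\<close>

lemma mono_kernel_cokernel:
  assumes "X \<in> Ob C" "Y \<in> Ob C" "is_mono C X Y f" "is_cokernel C X Y f Q q"
  shows "is_kernel C Y Q q X f"
proof -
  obtain Z g where g: "Z \<in> Ob C" "g \<in> Mor C Y Z" "is_kernel C Y Z g X f"
    using mono_normal[OF assms(1-3)] by blast
  note q = cokernelD[OF assms(4)] and f = mono_in[OF assms(3)]
  obtain g' where g': "g' \<in> Mor C Q Z" "cmp C Y Q Z g' q = g"
    using cokernel_factor[OF assms(4) g(1,2)] kernelD(3)[OF g(3)] by blast
  show ?thesis
  proof (rule kernelI[OF assms(2) q(1) assms(1) q(2) assms(3) q(3)])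
    fix W w assume w: "W \<in> Ob C" "w \<in> Mor C W Y" "cmp C W Y Q q w = mzero C W Q"
    have "cmp C W Y Z g w = cmp C W Q Z g' (cmp C W Y Q q w)"
      unfolding g'(2)[symmetric] using w(1,2) assms q(1,2) g'(1) g(1) by (simp add: cmp_assoc)
    then have "cmp C W Y Z g w = mzero C W Z" using w q g g' by (simp add: cmp_0_right)
    then show "\<exists>u \<in> Mor C W X. cmp C W X Y f u = w" using kernel_factor[OF g(3) w(1,2)] by blast
  qed
qed

lemma epi_cokernel_kernel:
  assumes "X \<in> Ob C" "Y \<in> Ob C" "is_epi C X Y f" "is_kernel C X Y f K k"
  shows "is_cokernel C K X k Y f"
  using abelian_category.mono_kernel_cokernel[OF op_abelian, of Y X f K k] assms by simp

text \<open>Here \<open>m\<close> is the kernel of the cokernel of \<open>f\<close>. If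
  \<open>u e = 0\<close>, then \<open>f\<close> factors through \<open>m k\<close> with
  \<open>k\<close> the kernel of \<open>u\<close>. The monomorphism \<open>m k\<close> is the kernel
  of some \<open>g\<close>; as \<open>g\<close> kills \<open>f\<close>, it kills \<open>m\<close>.
  Hence \<open>m\<close> factors through \<open>m k\<close>, which gives \<open>k\<close> a section
  and forces \<open>u = 0\<close>.\<close>

lemma epi_mono_factor:
  assumes "X \<in> Ob C" "Y \<in> Ob C" "f \<in> Mor C X Y"
  obtains J e m where "J \<in> Ob C" "is_epi C X J e" "is_mono C J Y m" "cmp C X J Y m e = f"
proof -
  obtain Q q where Q: "is_cokernel C X Y f Q q" using has_cokernel assms by blast
  note q = cokernelD[OF Q]
  obtain J m where J: "is_kernel C Y Q q J m" using has_kernel assms q by blast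
  note m = kernelD(1-3)[OF J] and mm = kernel_mono[OF assms(2) q(1,2) J]
  obtain e where e: "e \<in> Mor C X J" "cmp C X J Y m e = f" using kernel_factor[OF J assms(1,3) q(3)] by blast
  have "is_epi C X J e"
    unfolding epi_iff[OF assms(1) m(1)]
  proof (intro conjI ballI impI)
    fix W u assume u: "W \<in> Ob C" "u \<in> Mor C J W" "cmp C X J W u e = mzero C X W"
    obtain K k where K: "is_kernel C J W u K k" using has_kernel u m by blast
    note k = kernelD(1-3)[OF K] and km = kernel_mono[OF m(1) u(1,2) K]
    obtain e' where e': "e' \<in> Mor C X K" "cmp C X K J k e' = e" using kernel_factor[OF K assms(1) e(1) u(3)] by blast
    have mk: "is_mono C K Y (cmp C K J Y m k)" using mono_cmp[OF k(1) m(1) assms(2) km mm] .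
    obtain Z g where g: "Z \<in> Ob C" "g \<in> Mor C Y Z" "is_kernel C Y Z g K (cmp C K J Y m k)"
      using mono_normal[OF k(1) assms(2) mk] by blast
    have f: "f = cmp C X K Y (cmp C K J Y m k) e'"
      using e(2) e'(2) assms m k e' by (simp add: cmp_assoc[symmetric])
    have "cmp C X Y Z g f = cmp C X K Z (cmp C K Y Z g (cmp C K J Y m k)) e'"
      unfolding f using assms m k e' g by (simp add: mor_in cmp_assoc)
    then have "cmp C X Y Z g f = mzero C X Z"
      using kernelD(3)[OF g(3)] assms k e' g by (simp add: cmp_0_left)
    then obtain g' where g': "g' \<in> Mor C Q Z" "cmp C Y Q Z g' q = g" using cokernel_factor[OF Q g(1,2)] by blast
    have "cmp C J Y Z g m = cmp C J Q Z g' (cmp C J Y Q q m)"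
      unfolding g'(2)[symmetric] using assms m(1,2) q(1,2) g'(1) g(1) by (simp add: cmp_assoc)
    then have "cmp C J Y Z g m = mzero C J Z" using m q g g' by (simp add: cmp_0_right)
    then obtain t where t: "t \<in> Mor C J K" "cmp C J K Y (cmp C K J Y m k) t = m"
      using kernel_factor[OF g(3) m(1,2)] by blast
    have kt_in: "cmp C J K J k t \<in> Mor C J J" by (rule cmp_in[OF m(1) k(1) m(1) t(1) k(2)])
    have "cmp C J J Y m (cmp C J K J k t) = cmp C J J Y m (idm C J)"
      unfolding cmp_assoc[OF m(1) k(1) m(1) assms(2) t(1) k(2) m(2)] t(2)
      using m assms(2) by (simp add: idm_right)
    then have kt: "cmp C J K J k t = idm C J"
      by (rule mono_eq[OF mm m(1) kt_in idm_in[OF m(1)]])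
    have "u = cmp C J J W u (cmp C J K J k t)" unfolding kt using u m by (simp add: idm_right)
    also have "\<dots> = mzero C J W"
      unfolding cmp_assoc[OF m(1) k(1) m(1) u(1) t(1) k(2) u(2)] k(3) using k t u m by (simp add: cmp_0_left)
    finally show "u = mzero C J W" .
  qed (rule e)
  then show thesis using that[OF m(1)] mm e by blast
qed

text \<open>The cokernel \<open>q\<close> of \<open>f\<close> and the kernel of \<open>g\<close>
  form a universal test pair, since all other test morphisms factor through them. Next to
  \<open>g f = 0\<close>, both forms of exactness say that \<open>q\<close> kills the kernel of
  \<open>g\<close>.\<close>

lemma exact_at_iff:
  assumes "X \<in> Ob C" "Y \<in> Ob C" "Z \<in> Ob C"
  shows "exact_at C X Y Z f g \<longleftrightarrow> exact_pair C X Y Z f g"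
proof
  assume "exact_at C X Y Z f g"
  then obtain M m Q q where f: "f \<in> Mor C X Y" and g: "g \<in> Mor C Y Z"
    and Q: "is_cokernel C X Y f Q q" and M: "is_kernel C Y Q q M m" "is_kernel C Y Z g M m"
    unfolding exact_at_def is_image_def by blast
  note q = cokernelD[OF Q] and m = kernelD(1-3)[OF M(1)]
  show "exact_pair C X Y Z f g"
    unfolding exact_pair_def
  proof (intro conjI ballI impI f g)
    obtain u where u: "u \<in> Mor C X M" "cmp C X M Y m u = f" using kernel_factor[OF M(1) assms(1) f q(3)] by blast
    show "cmp C X Y Z g f = mzero C X Z"
      unfolding u(2)[symmetric] using u(1) assms m g kernelD(3)[OF M(2)] by (simp add: cmp_assoc cmp_0_left)
    fix A B a b assume A: "A \<in> Ob C" "B \<in> Ob C" "a \<in> Mor C Y A" "b \<in> Mor C B Y"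
      and *: "cmp C X Y A a f = mzero C X A \<and> cmp C B Y Z g b = mzero C B Z"
    obtain v where v: "v \<in> Mor C B M" "cmp C B M Y m v = b" using kernel_factor[OF M(2) A(2,4)] * by blast
    obtain a' where a': "a' \<in> Mor C Q A" "cmp C Y Q A a' q = a" using cokernel_factor[OF Q A(1,3)] * by blast
    have "cmp C B Y A a b = cmp C B M A (cmp C M Q A a' (cmp C M Y Q q m)) v"
      unfolding v(2)[symmetric] a'(2)[symmetric] using v(1) a'(1) A(1,2) m(1,2) q(1,2) assms
      by (simp add: mor_in cmp_assoc[symmetric])
    then show "cmp C B Y A a b = mzero C B A"
      using v a' A m q assms by (simp add: cmp_0_left cmp_0_right)
  qed
next
  assume e: "exact_pair C X Y Z f g"
  then have f: "f \<in> Mor C X Y" and g: "g \<in> Mor C Y Z" and gf: "cmp C X Y Z g f = mzero C X Z"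
    unfolding exact_pair_def by blast+
  obtain Q q where Q: "is_cokernel C X Y f Q q" using has_cokernel assms f by blast
  note q = cokernelD[OF Q]
  obtain M m where M: "is_kernel C Y Q q M m" using has_kernel assms q by blast
  note m = kernelD(1-3)[OF M]
  obtain g' where g': "g' \<in> Mor C Q Z" "cmp C Y Q Z g' q = g" using cokernel_factor[OF Q assms(3) g gf] by blast
  have "is_kernel C Y Z g M m"
  proof (rule kernelI[OF assms(2,3) m(1) g kernel_mono[OF assms(2) q(1,2) M]])
    show "cmp C M Y Z g m = mzero C M Z"
      unfolding g'(2)[symmetric] using g'(1) m q assms by (simp add: cmp_assoc[symmetric] cmp_0_right)
    fix W w assume w: "W \<in> Ob C" "w \<in> Mor C W Y" "cmp C W Y Z g w = mzero C W Z"
    then have "cmp C W Y Q q w = mzero C W Q" using e q unfolding exact_pair_def by blast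
    then show "\<exists>u \<in> Mor C W M. cmp C W M Y m u = w" using kernel_factor[OF M w(1,2)] by blast
  qed
  then show "exact_at C X Y Z f g" unfolding exact_at_def is_image_def using Q M f g by blast
qed

end

section \<open>Images of morphisms between given objects\<close>

text \<open>Such an object is the image of the composite of the epimorphism and the monomorphism.
  Keeping the two halves apart makes the notion self-dual and leaves each half to be treated
  separately.\<close>

definition img_objects :: "('o, 'a, 'x) pcat_scheme \<Rightarrow> 'o set \<Rightarrow> 'o set" where
  "img_objects C S = {Z \<in> Ob C. (\<exists>X \<in> S. \<exists>\<pi>. is_epi C X Z \<pi>) \<and> (\<exists>Y \<in> S. \<exists>\<iota>. is_mono C Z Y \<iota>)}"

lemma op_img_objects [simp]: "img_objects (op_cat C) S = img_objects C S"
proof -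
  have "is_mono (op_cat C) X Y = is_epi C Y X" "is_epi (op_cat C) X Y = is_mono C Y X" for X Y
    by (rule ext, simp)+
  then show ?thesis unfolding img_objects_def by auto
qed

context abelian_category
begin

text \<open>The kernel embeds into an object of \<open>S\<close> because \<open>Z\<close> does. To
  cover it, take a weak kernel \<open>K0\<close> of the composite \<open>h\<close> of
  \<open>X -> Z -> Z' -> Y'\<close>, which is a morphism between objects of \<open>S\<close>. Its
  map to \<open>Z\<close> lands in the kernel of \<open>\<phi>\<close>; the point is that the
  resulting map \<open>q\<close> is an epimorphism.\<close>

lemma img_kernel:
  assumes S: "S \<subseteq> Ob C"
    and wk: "\<And>X Y h. \<lbrakk>X \<in> S; Y \<in> S; h \<in> Mor C X Y\<rbrakk> \<Longrightarrow> \<exists>K \<in> S. \<exists>k. exact_pair C K X Y k h"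
    and Z: "Z \<in> img_objects C S" "Z' \<in> img_objects C S" and phi: "\<phi> \<in> Mor C Z Z'"
    and ker: "is_kernel C Z Z' \<phi> K \<kappa>"
  shows "K \<in> img_objects C S"
proof -
  obtain X \<pi> Y \<iota> Y' \<iota>' where XY: "X \<in> S" "is_epi C X Z \<pi>" "Y \<in> S" "is_mono C Z Y \<iota>"
    "Y' \<in> S" "is_mono C Z' Y' \<iota>'"
    using Z unfolding img_objects_def by blast
  have o: "X \<in> Ob C" "Y \<in> Ob C" "Y' \<in> Ob C" "Z \<in> Ob C" "Z' \<in> Ob C"
    using XY S Z unfolding img_objects_def by blast+
  note pi = epi_in[OF XY(2)] and io = mono_in[OF XY(4)] and io' = mono_in[OF XY(6)]
  note kap = kernelD(1-3)[OF ker] and kmono = kernel_mono[OF o(4,5) phi ker]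
  define g where "g = cmp C X Z Z' \<phi> \<pi>"
  have g: "g \<in> Mor C X Z'" unfolding g_def by (rule cmp_in[OF o(1,4,5) pi phi])
  define h where "h = cmp C X Z' Y' \<iota>' g"
  have h: "h \<in> Mor C X Y'" unfolding h_def by (rule cmp_in[OF o(1,5,3) g io'])
  obtain K0 k0 where K0: "K0 \<in> S" and ex: "exact_pair C K0 X Y' k0 h" using wk[OF XY(1,5) h] by blast
  have oK0: "K0 \<in> Ob C" using K0 S by blast
  have k0: "k0 \<in> Mor C K0 X" "cmp C K0 X Y' h k0 = mzero C K0 Y'" using ex unfolding exact_pair_def by blast+
  define a where "a = cmp C K0 X Z \<pi> k0"
  have a: "a \<in> Mor C K0 Z" unfolding a_def by (rule cmp_in[OF oK0 o(1,4) k0(1) pi])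
  have "cmp C K0 Z' Y' \<iota>' (cmp C K0 X Z' g k0) = mzero C K0 Y'"
    using k0(2) unfolding h_def cmp_assoc[OF oK0 o(1,5,3) k0(1) g io'] .
  then have gk0: "cmp C K0 X Z' g k0 = mzero C K0 Z'"
    by (rule monoD[OF XY(6) o(5,3) oK0 cmp_in[OF oK0 o(1,5) k0(1) g]])
  have pa: "cmp C K0 Z Z' \<phi> a = mzero C K0 Z'"
    using gk0 unfolding a_def g_def cmp_assoc[OF oK0 o(1,4,5) k0(1) pi phi] .
  obtain q where q: "q \<in> Mor C K0 K" "cmp C K0 K Z \<kappa> q = a" using kernel_factor[OF ker oK0 a pa] .
  \<comment> \<open>Whatever kills \<open>a\<close> kills \<open>\<kappa>\<close>. Factor
    \<open>\<phi> \<pi>\<close> as \<open>m e\<close>; then \<open>e\<close> descends along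
    \<open>\<pi>\<close> to \<open>e'\<close> with \<open>m e' = \<phi>\<close>. Exactness at
    \<open>X\<close> makes \<open>c \<pi>\<close> vanish on the kernel of \<open>e\<close>, so
    \<open>c\<close> factors through \<open>e'\<close>, and \<open>e'\<close> kills
    \<open>\<kappa>\<close>.\<close>
  have L1: "cmp C K Z Q c \<kappa> = mzero C K Q"
    if Q: "Q \<in> Ob C" "c \<in> Mor C Z Q" "cmp C K0 Z Q c a = mzero C K0 Q" for Q c
  proof -
    obtain J e m where J: "J \<in> Ob C" "is_epi C X J e" "is_mono C J Z' m" "cmp C X J Z' m e = g"
      using epi_mono_factor[OF o(1,5) g] .
    note e = epi_in[OF J(2)] and m = mono_in[OF J(3)]
    obtain N n where N: "is_kernel C X Z \<pi> N n" using has_kernel[OF o(1,4) pi] by blast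
    note n = kernelD(1-3)[OF N]
    have "cmp C N J Z' m (cmp C N X J e n) = cmp C N X Z' g n"
      unfolding J(4)[symmetric] by (rule cmp_assoc[OF n(1) o(1) J(1) o(5) n(2) e m])
    also have "\<dots> = cmp C N Z Z' \<phi> (cmp C N X Z \<pi> n)"
      unfolding g_def by (rule cmp_assoc[symmetric, OF n(1) o(1,4,5) n(2) pi phi])
    also have "\<dots> = mzero C N Z'" unfolding n(3) by (rule cmp_0_right[OF n(1) o(4,5) phi])
    finally have "cmp C N X J e n = mzero C N J"
      by (rule monoD[OF J(3,1) o(5) n(1) cmp_in[OF n(1) o(1) J(1) n(2) e]])
    then obtain e' where e': "e' \<in> Mor C Z J" "cmp C X Z J e' \<pi> = e"
      using cokernel_factor[OF epi_cokernel_kernel[OF o(1,4) XY(2) N] J(1) e] by blast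
    have "cmp C X Z Z' (cmp C Z J Z' m e') \<pi> = cmp C X Z Z' \<phi> \<pi>"
      unfolding cmp_assoc[symmetric, OF o(1,4) J(1) o(5) pi e'(1) m] e'(2) J(4) g_def ..
    then have me': "cmp C Z J Z' m e' = \<phi>"
      by (rule epi_eq[OF XY(2) o(5) cmp_in[OF o(4) J(1) o(5) e'(1) m] phi])
    obtain N2 n2 where N2: "is_kernel C X J e N2 n2" using has_kernel[OF o(1) J(1) e] by blast
    note n2 = kernelD(1-3)[OF N2]
    have cpi: "cmp C X Z Q c \<pi> \<in> Mor C X Q" by (rule cmp_in[OF o(1,4) Q(1) pi Q(2)])
    have "cmp C N2 X Y' h n2 = cmp C N2 Z' Y' \<iota>' (cmp C N2 J Z' m (cmp C N2 X J e n2))"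
      unfolding h_def J(4)[symmetric] using n2(1,2) o J(1) e m io' by (simp add: mor_in cmp_assoc)
    also have "\<dots> = mzero C N2 Y'" unfolding n2(3) using n2(1) o J(1) m io' by (simp add: cmp_0_right)
    finally have hn2: "cmp C N2 X Y' h n2 = mzero C N2 Y'" .
    have "cmp C K0 X Q (cmp C X Z Q c \<pi>) k0 = mzero C K0 Q"
      using Q(3) unfolding a_def cmp_assoc[OF oK0 o(1,4) Q(1) k0(1) pi Q(2)] .
    then have "cmp C N2 X Q (cmp C X Z Q c \<pi>) n2 = mzero C N2 Q"
      using ex hn2 Q(1) n2(1,2) cpi unfolding exact_pair_def by blast
    then obtain v where v: "v \<in> Mor C J Q" "cmp C X J Q v e = cmp C X Z Q c \<pi>"
      using cokernel_factor[OF epi_cokernel_kernel[OF o(1) J(1,2) N2] Q(1) cpi] by blast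
    have "cmp C X Z Q (cmp C Z J Q v e') \<pi> = cmp C X Z Q c \<pi>"
      unfolding cmp_assoc[symmetric, OF o(1,4) J(1) Q(1) pi e'(1) v(1)] e'(2) v(2) ..
    then have c: "cmp C Z J Q v e' = c"
      by (rule epi_eq[OF XY(2) Q(1) cmp_in[OF o(4) J(1) Q(1) e'(1) v(1)] Q(2)])
    have "cmp C K J Z' m (cmp C K Z J e' \<kappa>) = mzero C K Z'"
      unfolding cmp_assoc[OF kap(1) o(4) J(1) o(5) kap(2) e'(1) m] me' by (rule kap(3))
    then have e'k: "cmp C K Z J e' \<kappa> = mzero C K J"
      by (rule monoD[OF J(3,1) o(5) kap(1) cmp_in[OF kap(1) o(4) J(1) kap(2) e'(1)]])
    show ?thesis
      unfolding c[symmetric] cmp_assoc[symmetric, OF kap(1) o(4) J(1) Q(1) kap(2) e'(1) v(1)] e'k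
      by (rule cmp_0_right[OF kap(1) J(1) Q(1) v(1)])
  qed
  \<comment> \<open>Let \<open>J\<close> be the image of \<open>a\<close> in \<open>Z\<close>.
    Applying \<open>L1\<close> to the cokernel of \<open>J\<close> in \<open>Z\<close> shows that
    \<open>\<kappa>\<close> factors through \<open>J\<close>. Hence the map \<open>j\<close> from
    \<open>J\<close> to the kernel has a section \<open>t\<close>, and \<open>u j = 0\<close> gives
    \<open>u = 0\<close>.\<close>
  have "is_epi C K0 K q"
    unfolding epi_iff[OF oK0 kap(1)]
  proof (intro conjI ballI impI q(1))
    fix W u assume u: "W \<in> Ob C" "u \<in> Mor C K W" "cmp C K0 K W u q = mzero C K0 W"
    obtain J e m where J: "J \<in> Ob C" "is_epi C K0 J e" "is_mono C J Z m" "cmp C K0 J Z m e = a"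
      using epi_mono_factor[OF oK0 o(4) a] .
    note e = epi_in[OF J(2)] and m = mono_in[OF J(3)]
    have "cmp C K0 J Z' (cmp C J Z Z' \<phi> m) e = mzero C K0 Z'"
      unfolding cmp_assoc[symmetric, OF oK0 J(1) o(4,5) e m phi] J(4) by (rule pa)
    then have "cmp C J Z Z' \<phi> m = mzero C J Z'"
      by (rule epiD[OF J(2) oK0 J(1) o(5) cmp_in[OF J(1) o(4,5) m phi]])
    then obtain j where j: "j \<in> Mor C J K" "cmp C J K Z \<kappa> j = m" using kernel_factor[OF ker J(1) m] by blast
    have "cmp C K0 K Z \<kappa> (cmp C K0 J K j e) = cmp C K0 K Z \<kappa> q"
      unfolding cmp_assoc[OF oK0 J(1) kap(1) o(4) e j(1) kap(2)] j(2) J(4) q(2) ..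
    then have je: "cmp C K0 J K j e = q"
      by (rule mono_eq[OF kmono oK0 cmp_in[OF oK0 J(1) kap(1) e j(1)] q(1)])
    obtain Q c where Q: "is_cokernel C J Z m Q c" using has_cokernel[OF J(1) o(4) m] by blast
    note c = cokernelD[OF Q]
    have "cmp C K0 Z Q c a = cmp C K0 J Q (cmp C J Z Q c m) e"
      unfolding J(4)[symmetric] by (rule cmp_assoc[OF oK0 J(1) o(4) c(1) e m c(2)])
    also have "\<dots> = mzero C K0 Q" unfolding c(3) by (rule cmp_0_left[OF oK0 J(1) c(1) e])
    finally have "cmp C K Z Q c \<kappa> = mzero C K Q" by (rule L1[OF c(1,2)])
    then obtain t where t: "t \<in> Mor C K J" "cmp C K J Z m t = \<kappa>"
      using kernel_factor[OF mono_kernel_cokernel[OF J(1) o(4) J(3) Q] kap(1,2)] by blast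
    have jt_in: "cmp C K J K j t \<in> Mor C K K" by (rule cmp_in[OF kap(1) J(1) kap(1) t(1) j(1)])
    have "cmp C K K Z \<kappa> (cmp C K J K j t) = cmp C K K Z \<kappa> (idm C K)"
      unfolding cmp_assoc[OF kap(1) J(1) kap(1) o(4) t(1) j(1) kap(2)] j(2) t(2)
      using idm_right[OF kap(1) o(4) kap(2)] by simp
    then have jt: "cmp C K J K j t = idm C K"
      by (rule mono_eq[OF kmono kap(1) jt_in idm_in[OF kap(1)]])
    have "cmp C K0 J W (cmp C J K W u j) e = mzero C K0 W"
      unfolding cmp_assoc[symmetric, OF oK0 J(1) kap(1) u(1) e j(1) u(2)] je by (rule u(3))
    then have uj: "cmp C J K W u j = mzero C J W"
      by (rule epiD[OF J(2) oK0 J(1) u(1) cmp_in[OF J(1) kap(1) u(1) j(1) u(2)]])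
    have "u = cmp C K K W u (cmp C K J K j t)" unfolding jt by (rule idm_right[symmetric, OF kap(1) u(1,2)])
    also have "\<dots> = mzero C K W"
      unfolding cmp_assoc[OF kap(1) J(1) kap(1) u(1) t(1) j(1) u(2)] uj by (rule cmp_0_left[OF kap(1) J(1) u(1) t(1)])
    finally show "u = mzero C K W" .
  qed
  moreover have "is_mono C K Y (cmp C K Z Y \<iota> \<kappa>)" by (rule mono_cmp[OF kap(1) o(4,2) kmono XY(4)])
  ultimately show ?thesis unfolding img_objects_def using kap(1) K0 XY(3) by blast
qed

lemma img_cokernel:
  assumes S: "S \<subseteq> Ob C"
    and wk: "\<And>X Y h. \<lbrakk>X \<in> S; Y \<in> S; h \<in> Mor C X Y\<rbrakk> \<Longrightarrow> \<exists>K \<in> S. \<exists>k. exact_pair C X Y K h k"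
    and Z: "Z \<in> img_objects C S" "Z' \<in> img_objects C S" and phi: "\<phi> \<in> Mor C Z Z'"
    and coker: "is_cokernel C Z Z' \<phi> K \<kappa>"
  shows "K \<in> img_objects C S"
  using abelian_category.img_kernel[OF op_abelian, of S Z' Z \<phi> K \<kappa>] assms by simp

text \<open>Composing with \<open>i1\<close> and \<open>i2\<close> shows that \<open>u j1 e\<close>
  and \<open>u j2 e'\<close> vanish. The epimorphisms cancel, and \<open>u\<close> is determined by
  \<open>u j1\<close> and \<open>u j2\<close>.\<close>

lemma biproduct_epi:
  assumes o: "X \<in> Ob C" "X' \<in> Ob C" "Z \<in> Ob C" "Z' \<in> Ob C"
    and e: "is_epi C X Z e" "is_epi C X' Z' e'"
    and P: "is_biproduct C X X' P i1 i2 p1 p2" and B: "is_biproduct C Z Z' B j1 j2 q1 q2"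
  shows "is_epi C P B (madd C P B (cmp C P Z B j1 (cmp C P X Z e p1)) (cmp C P Z' B j2 (cmp C P X' Z' e' p2)))"
    (is "is_epi C P B ?f")
proof -
  note p = biproductD[OF o(1,2) P] and b = biproductD[OF o(3,4) B]
  note ee = epi_in[OF e(1)] epi_in[OF e(2)]
  have f: "?f \<in> Mor C P B" using o p(1-5) b(1-5) ee by (simp add: mor_in)
  show ?thesis
    unfolding epi_iff[OF p(1) b(1)]
  proof (intro conjI ballI impI f)
    fix W u assume u: "W \<in> Ob C" "u \<in> Mor C B W" and 0: "cmp C P B W u ?f = mzero C P W"
    have "cmp C X Z W (cmp C Z B W u j1) e = cmp C X P W (cmp C P B W u ?f) i1"
      using o p b(1-5) ee u by (simp add: mor_in mor_simps)
    also have "\<dots> = mzero C X W" unfolding 0 using o p u by (simp add: cmp_0_left)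
    finally have 1: "cmp C Z B W u j1 = mzero C Z W"
      using epiD[OF e(1) o(1,3) u(1)] cmp_in o b u by blast
    have "cmp C X' Z' W (cmp C Z' B W u j2) e' = cmp C X' P W (cmp C P B W u ?f) i2"
      using o p b(1-5) ee u by (simp add: mor_in mor_simps)
    also have "\<dots> = mzero C X' W" unfolding 0 using o p u by (simp add: cmp_0_left)
    finally have 2: "cmp C Z' B W u j2 = mzero C Z' W"
      using epiD[OF e(2) o(2,4) u(1)] cmp_in o b u by blast
    show "u = mzero C B W"
      by (rule biproduct_eq_from[OF o(3,4) B u(1,2)]) (use o b(1-5) u 1 2 in \<open>simp_all add: mor_in mor_simps\<close>)
  qed
qed

lemma img_biproduct:
  assumes S: "S \<subseteq> Ob C"
    and bp: "\<And>X Y. \<lbrakk>X \<in> S; Y \<in> S\<rbrakk> \<Longrightarrow> \<exists>P \<in> S. \<exists>i1 i2 p1 p2. is_biproduct C X Y P i1 i2 p1 p2"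
    and Z: "Z \<in> img_objects C S" "Z' \<in> img_objects C S" and B: "is_biproduct C Z Z' B j1 j2 q1 q2"
  shows "B \<in> img_objects C S"
proof -
  obtain X \<pi> Y \<iota> X' \<pi>' Y' \<iota>' where XY: "X \<in> S" "is_epi C X Z \<pi>" "Y \<in> S" "is_mono C Z Y \<iota>"
    "X' \<in> S" "is_epi C X' Z' \<pi>'" "Y' \<in> S" "is_mono C Z' Y' \<iota>'"
    using Z unfolding img_objects_def by blast
  have o: "X \<in> Ob C" "Y \<in> Ob C" "X' \<in> Ob C" "Y' \<in> Ob C" "Z \<in> Ob C" "Z' \<in> Ob C"
    using XY S Z unfolding img_objects_def by blast+
  have oB: "B \<in> Ob C" using B unfolding is_biproduct_def by blast
  obtain P i1 i2 p1 p2 where P: "P \<in> S" "is_biproduct C X X' P i1 i2 p1 p2" using bp[OF XY(1,5)] by blast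
  obtain R k1 k2 r1 r2 where R: "R \<in> S" "is_biproduct C Y Y' R k1 k2 r1 r2" using bp[OF XY(3,7)] by blast
  have "\<exists>f. is_epi C P B f" using biproduct_epi[OF o(1,3,5,6) XY(2,6) P(2) B] by blast
  moreover have "\<exists>f. is_mono C B R f"
    using abelian_category.biproduct_epi[OF op_abelian, of Y Y' Z Z' \<iota> \<iota>' R r1 r2 k1 k2 B q1 q2 j1 j2]
      o XY(4,8) R(2) B by auto
  ultimately show ?thesis unfolding img_objects_def using oB P(1) R(1) by blast
qed

text \<open>Supplies a zero object inside a nonempty subcategory that is closed under
  kernels.\<close>

lemma kernel_idm_zero:
  assumes "X \<in> Ob C" "is_kernel C X X (idm C X) K k"
  shows "zero_object C K"
proof -
  note k = kernelD(1-3)[OF assms(2)] and m = kernel_mono[OF assms(1,1) idm_in[OF assms(1)] assms(2)]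
  have "k = mzero C K X" using k assms(1) by (simp add: idm_left)
  then have "cmp C K K X k (idm C K) = mzero C K X" using k(1,2) assms(1) by (simp add: idm_right)
  then have "idm C K = mzero C K K"
    by (rule monoD[OF m k(1) assms(1) k(1) idm_in[OF k(1)]])
  then show ?thesis using k(1) by (simp add: zero_object_iff)
qed

end

section \<open>Full subcategories closed under kernels, cokernels and biproducts\<close>

lemma sub_sel [simp]:
  "Ob (C\<lparr>Ob := S\<rparr>) = S" "Mor (C\<lparr>Ob := S\<rparr>) = Mor C" "idm (C\<lparr>Ob := S\<rparr>) = idm C"
  "cmp (C\<lparr>Ob := S\<rparr>) = cmp C" "madd (C\<lparr>Ob := S\<rparr>) = madd C" "mzero (C\<lparr>Ob := S\<rparr>) = mzero C"
  for C :: "('o, 'a, 'x) pcat_scheme"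
  by simp_all

lemma op_sub: "op_cat (C\<lparr>Ob := S\<rparr>) = (op_cat C)\<lparr>Ob := S\<rparr>"
  by (simp add: op_cat_def)

locale closed_subcategory = abelian_category C for C :: "('o, 'a, 'x) pcat_scheme" +
  fixes S :: "'o set"
  assumes sub: "S \<subseteq> Ob C" and ne: "S \<noteq> {}"
    and ker_closed: "\<lbrakk>X \<in> S; Y \<in> S; f \<in> Mor C X Y; is_kernel C X Y f K k\<rbrakk> \<Longrightarrow> K \<in> S"
    and coker_closed: "\<lbrakk>X \<in> S; Y \<in> S; f \<in> Mor C X Y; is_cokernel C X Y f K k\<rbrakk> \<Longrightarrow> K \<in> S"
    and biprod_closed: "\<lbrakk>X \<in> S; Y \<in> S; is_biproduct C X Y P i1 i2 p1 p2\<rbrakk> \<Longrightarrow> P \<in> S"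
begin

abbreviation "CS \<equiv> C\<lparr>Ob := S\<rparr>"

lemma inOb: "X \<in> S \<Longrightarrow> X \<in> Ob C" using sub by blast

lemma sub_preadditive: "preadditive CS"
proof (intro preadditive.intro category.intro preadditive_axioms.intro)
  fix X Y assume "X \<in> Ob CS" "Y \<in> Ob CS"
  then show "comm_group (mor_group CS X Y)" using mor_group[of X Y] inOb by (simp add: mor_group_def)
qed (simp_all add: inOb mor_in mor_simps)

lemma sub_kernel: "\<lbrakk>X \<in> S; Y \<in> S; f \<in> Mor C X Y; is_kernel C X Y f K k\<rbrakk> \<Longrightarrow> is_kernel CS X Y f K k"
  using ker_closed[of X Y f K k] inOb unfolding is_kernel_def by simp

lemma sub_cokernel: "\<lbrakk>X \<in> S; Y \<in> S; f \<in> Mor C X Y; is_cokernel C X Y f K k\<rbrakk> \<Longrightarrow> is_cokernel CS X Y f K k"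
  using coker_closed[of X Y f K k] inOb unfolding is_cokernel_def by simp

text \<open>The subcategory offers fewer test morphisms, but the kernel computed in \<open>C\<close>
  belongs to \<open>S\<close> and is itself one of them; it is zero in either category.\<close>

lemma sub_mono: 
  assumes "X \<in> S" "Y \<in> S" shows "is_mono CS X Y f \<longleftrightarrow> is_mono C X Y f"
proof
  assume m: "is_mono CS X Y f"
  have o: "X \<in> Ob C" "Y \<in> Ob C" using assms inOb by blast+
  have f: "f \<in> Mor C X Y" using m by (simp add: is_mono_def)
  obtain K k where K: "is_kernel C X Y f K k" using has_kernel[OF o f] by blast
  note k = kernelD(1-3)[OF K]
  have "K \<in> S" using ker_closed assms f K by blast
  then have k0: "k = mzero C K X"
    using preadditive.monoD[OF sub_preadditive m, of K k] k assms by simp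
  show "is_mono C X Y f"
    unfolding mono_iff[OF o]
  proof (intro conjI ballI impI f)
    fix W u assume u: "W \<in> Ob C" "u \<in> Mor C W X" "cmp C W X Y f u = mzero C W Y"
    then obtain t where t: "t \<in> Mor C W K" "cmp C W K X k t = u" using kernel_factor[OF K] by blast
    then show "u = mzero C W X" using cmp_0_left[OF u(1) k(1) o(1) t(1)] k0 by simp
  qed
next
  assume "is_mono C X Y f"
  then show "is_mono CS X Y f" using inOb unfolding is_mono_def by auto
qed

lemma op_closed: "closed_subcategory (op_cat C) S"
  using op_abelian
proof (rule closed_subcategory.intro, unfold_locales)
  fix X Y P i1 i2 p1 p2 assume "X \<in> S" "Y \<in> S" "is_biproduct (op_cat C) X Y P i1 i2 p1 p2"
  then show "P \<in> S" using biprod_closed[of X Y P p1 p2 i1 i2] by simp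
next
  fix X Y f K k assume "X \<in> S" "Y \<in> S" "f \<in> Mor (op_cat C) X Y" "is_kernel (op_cat C) X Y f K k"
  then show "K \<in> S" using coker_closed[of Y X f K k] by simp
next
  fix X Y f K k assume "X \<in> S" "Y \<in> S" "f \<in> Mor (op_cat C) X Y" "is_cokernel (op_cat C) X Y f K k"
  then show "K \<in> S" using ker_closed[of Y X f K k] by simp
qed (use sub ne in simp_all)

lemma sub_epi: "\<lbrakk>X \<in> S; Y \<in> S\<rbrakk> \<Longrightarrow> is_epi CS X Y f \<longleftrightarrow> is_epi C X Y f"
  using closed_subcategory.sub_mono[OF op_closed, of Y X f] op_mono[of CS Y X f] by (simp add: op_sub)

lemma sub_abelian: "abelian_category CS"
proof -
  interpret CS: preadditive CS by (rule sub_preadditive)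
  show ?thesis
  proof (intro abelian_category.intro abelian_category_axioms.intro sub_preadditive)
    obtain X where X: "X \<in> S" using ne by blast
    obtain K k where K: "is_kernel C X X (idm C X) K k" using has_kernel idm_in inOb[OF X] by blast
    have "K \<in> S" using ker_closed[OF X X idm_in[OF inOb[OF X]] K] .
    moreover have "zero_object C K" using kernel_idm_zero[OF inOb[OF X] K] .
    ultimately have "zero_object CS K" using inOb unfolding zero_object_def by simp
    then show "\<exists>Z. zero_object CS Z" by blast
  next
    fix X Y assume "X \<in> Ob CS" "Y \<in> Ob CS"
    then have XY: "X \<in> S" "Y \<in> S" by simp_all
    obtain P i1 i2 p1 p2 where P: "is_biproduct C X Y P i1 i2 p1 p2" using has_biproduct XY inOb by blast
    then have "is_biproduct CS X Y P i1 i2 p1 p2"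
      using biprod_closed[OF XY P] unfolding is_biproduct_def by simp
    then show "\<exists>P i1 i2 p1 p2. is_biproduct CS X Y P i1 i2 p1 p2" by blast
  next
    fix X Y f assume *: "X \<in> Ob CS" "Y \<in> Ob CS" "f \<in> Mor CS X Y"
    then have XY: "X \<in> S" "Y \<in> S" "f \<in> Mor C X Y" by simp_all
    show "\<exists>K k. is_kernel CS X Y f K k" using sub_kernel[OF XY] has_kernel[of X Y f] XY inOb by blast
    show "\<exists>K k. is_cokernel CS X Y f K k" using sub_cokernel[OF XY] has_cokernel[of X Y f] XY inOb by blast
  next
    fix X Y f assume *: "X \<in> Ob CS" "Y \<in> Ob CS" "is_mono CS X Y f"
    then have XY: "X \<in> S" "Y \<in> S" by simp_all
    have m: "is_mono C X Y f" using * sub_mono[OF XY] by simp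
    note f = mono_in[OF m]
    obtain Q q where Q: "is_cokernel C X Y f Q q" using has_cokernel[of X Y f] f XY inOb by blast
    have QS: "Q \<in> S" using coker_closed[OF XY f Q] .
    note q = cokernelD[OF Q]
    have "is_kernel CS Y Q q X f"
      by (rule sub_kernel[OF XY(2) QS q(2) mono_kernel_cokernel[OF XY[THEN inOb] m Q]])
    then show "\<exists>Z \<in> Ob CS. \<exists>g \<in> Mor CS Y Z. is_kernel CS Y Z g X f" using QS q(2) by auto
  next
    fix X Y f assume *: "X \<in> Ob CS" "Y \<in> Ob CS" "is_epi CS X Y f"
    then have XY: "X \<in> S" "Y \<in> S" by simp_all
    have m: "is_epi C X Y f" using * sub_epi[OF XY] by simp
    note f = epi_in[OF m]
    obtain Q q where Q: "is_kernel C X Y f Q q" using has_kernel[of X Y f] f XY inOb by blast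
    have QS: "Q \<in> S" using ker_closed[OF XY f Q] .
    note q = kernelD(1-3)[OF Q]
    have "is_cokernel CS Q X q Y f"
      by (rule sub_cokernel[OF QS XY(1) q(2) epi_cokernel_kernel[OF XY[THEN inOb] m Q]])
    then show "\<exists>W \<in> Ob CS. \<exists>g \<in> Mor CS W X. is_cokernel CS W X g Y f" using QS q(2) by auto
  qed
qed

text \<open>The kernel of \<open>g\<close> and the cokernel of \<open>f\<close> computed in
  \<open>C\<close> lie in \<open>S\<close>, and every test pair over \<open>C\<close> factors
  through them.\<close>

lemma sub_exact_pair:
  assumes "X \<in> S" "Y \<in> S" "Z \<in> S"
  shows "exact_pair CS X Y Z f g \<longleftrightarrow> exact_pair C X Y Z f g"
proof
  assume "exact_pair C X Y Z f g"
  then show "exact_pair CS X Y Z f g" using inOb unfolding exact_pair_def by simp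
next
  assume e: "exact_pair CS X Y Z f g"
  then have f: "f \<in> Mor C X Y" and g: "g \<in> Mor C Y Z" and gf: "cmp C X Y Z g f = mzero C X Z"
    unfolding exact_pair_def by simp_all
  note o = assms[THEN inOb]
  obtain Q q where Q: "is_cokernel C X Y f Q q" using has_cokernel[OF o(1,2) f] by blast
  obtain K k where K: "is_kernel C Y Z g K k" using has_kernel[OF o(2,3) g] by blast
  note q = cokernelD[OF Q] and k = kernelD(1-3)[OF K]
  have "Q \<in> S" "K \<in> S" using ker_closed coker_closed assms f g K Q by blast+
  then have qk: "cmp C K Y Q q k = mzero C K Q" using e q k unfolding exact_pair_def by simp
  show "exact_pair C X Y Z f g"
    unfolding exact_pair_def
  proof (intro conjI ballI impI f g gf)
    fix A B a b assume A: "A \<in> Ob C" "B \<in> Ob C" "a \<in> Mor C Y A" "b \<in> Mor C B Y"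
      and *: "cmp C X Y A a f = mzero C X A \<and> cmp C B Y Z g b = mzero C B Z"
    obtain v where v: "v \<in> Mor C B K" "cmp C B K Y k v = b" using kernel_factor[OF K A(2,4)] * by blast
    obtain a' where a': "a' \<in> Mor C Q A" "cmp C Y Q A a' q = a" using cokernel_factor[OF Q A(1,3)] * by blast
    have "cmp C B Y A a b = cmp C B K A (cmp C K Q A a' (cmp C K Y Q q k)) v"
      unfolding v(2)[symmetric] a'(2)[symmetric] using v(1) a'(1) A(1,2) k(1,2) q(1,2) o
      by (simp add: mor_in cmp_assoc[symmetric])
    then show "cmp C B Y A a b = mzero C B A"
      unfolding qk using v(1) a'(1) A k(1,2) q(1,2) by (simp add: cmp_0_left cmp_0_right)
  qed
qed

lemma sub_short_exact:
  assumes "X \<in> S" "Y \<in> S" "Z \<in> S"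
  shows "short_exact CS X Y Z f g \<longleftrightarrow> short_exact C X Y Z f g"
  unfolding short_exact_def exact_at_iff[OF assms[THEN inOb]]
  using abelian_category.exact_at_iff[OF sub_abelian, of X Y Z f g] assms
  by (simp add: sub_mono sub_epi sub_exact_pair)

end

section \<open>Functors and universal properties\<close>

lemma iso_in: "is_iso C X Y f \<Longrightarrow> f \<in> Mor C X Y"
  by (simp add: is_iso_def)

lemma iso_inverse:
  assumes "is_iso C X Y f"
  obtains g where "is_iso C Y X g" "cmp C X Y X g f = idm C X" "cmp C Y X Y f g = idm C Y"
  using assms unfolding is_iso_def by blast

context category
begin

lemma iso_idm: "X \<in> Ob C \<Longrightarrow> is_iso C X X (idm C X)"
  by (rule is_isoI[where g = "idm C X"]) (simp_all add: idm_in idm_left)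

lemma iso_cmp:
  assumes o: "X \<in> Ob C" "Y \<in> Ob C" "Z \<in> Ob C" and f: "is_iso C X Y f" and g: "is_iso C Y Z g"
  shows "is_iso C X Z (cmp C X Y Z g f)"
proof -
  obtain f' where f': "is_iso C Y X f'" "cmp C X Y X f' f = idm C X" "cmp C Y X Y f f' = idm C Y"
    using iso_inverse[OF f] .
  obtain g' where g': "is_iso C Z Y g'" "cmp C Y Z Y g' g = idm C Y" "cmp C Z Y Z g g' = idm C Z"
    using iso_inverse[OF g] .
  note m = f[THEN iso_in] g[THEN iso_in] f'(1)[THEN iso_in] g'(1)[THEN iso_in]
  have "cmp C Y Z X (cmp C Z Y X f' g') g = f'"
    unfolding cmp_assoc[symmetric, OF o(2,3,2,1) m(2,4,3)] g'(2) by (rule idm_right[OF o(2,1) m(3)])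
  then have 1: "cmp C X Z X (cmp C Z Y X f' g') (cmp C X Y Z g f) = idm C X"
    using cmp_assoc[OF o(1,2,3,1) m(1,2) cmp_in[OF o(3,2,1) m(4,3)]] f'(2) by simp
  have "cmp C Y X Z (cmp C X Y Z g f) f' = g"
    unfolding cmp_assoc[symmetric, OF o(2,1,2,3) m(3,1,2)] f'(3) by (rule idm_right[OF o(2,3) m(2)])
  then have 2: "cmp C Z X Z (cmp C X Y Z g f) (cmp C Z Y X f' g') = idm C Z"
    using cmp_assoc[OF o(3,2,1,3) m(4,3) cmp_in[OF o(1,2,3) m(1,2)]] g'(3) by simp
  show ?thesis
    by (rule is_isoI[OF cmp_in[OF o m(1,2)] cmp_in[OF o(3,2,1) m(4,3)] 1 2])
qed

end

lemma functorD:
  assumes "is_functor C D F"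
  shows "category C" "category D" "X \<in> Ob C \<Longrightarrow> FOb F X \<in> Ob D"
    "\<lbrakk>X \<in> Ob C; Y \<in> Ob C; f \<in> Mor C X Y\<rbrakk> \<Longrightarrow> FMor F X Y f \<in> Mor D (FOb F X) (FOb F Y)"
    "X \<in> Ob C \<Longrightarrow> FMor F X X (idm C X) = idm D (FOb F X)"
    "\<lbrakk>X \<in> Ob C; Y \<in> Ob C; Z \<in> Ob C; f \<in> Mor C X Y; g \<in> Mor C Y Z\<rbrakk> \<Longrightarrow>
        FMor F X Z (cmp C X Y Z g f) =
        cmp D (FOb F X) (FOb F Y) (FOb F Z) (FMor F Y Z g) (FMor F X Y f)"
  using assms unfolding is_functor_def by simp_all

lemma functor_iso:
  assumes F: "is_functor C D F" and o: "X \<in> Ob C" "Y \<in> Ob C" and f: "is_iso C X Y f"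
  shows "is_iso D (FOb F X) (FOb F Y) (FMor F X Y f)"
proof -
  obtain g where g: "is_iso C Y X g" "cmp C X Y X g f = idm C X" "cmp C Y X Y f g = idm C Y"
    using iso_inverse[OF f] .
  note m = iso_in[OF f] iso_in[OF g(1)]
  show ?thesis
    by (rule category.is_isoI[OF functorD(2)[OF F] functorD(4)[OF F o m(1)] functorD(4)[OF F o(2,1) m(2)]])
      (simp_all add: functorD(6)[OF F, symmetric] o m g functorD(5)[OF F])
qed

lemma comp_func_sel [simp]:
  "FOb (comp_func G F) X = FOb G (FOb F X)"
  "FMor (comp_func G F) X Y f = FMor G (FOb F X) (FOb F Y) (FMor F X Y f)"
  by (simp_all add: comp_func_def)

lemma id_func_sel [simp]: "FOb id_func X = X" "FMor id_func X Y f = f"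
  by (simp_all add: id_func_def)

lemma functor_comp:
  assumes F: "is_functor C D F" and G: "is_functor D E G"
  shows "is_functor C E (comp_func G F)"
  unfolding is_functor_def using functorD(1)[OF F] functorD(2)[OF G]
  by (simp add: functorD(3-6)[OF F] functorD(3-6)[OF G])

lemma functor_id: "category C \<Longrightarrow> is_functor C C id_func"
  by (simp add: is_functor_def)

lemma nat_transD:
  assumes "nat_trans C D F G \<alpha>"
  shows "\<alpha> \<in> extensional (Ob C)" "X \<in> Ob C \<Longrightarrow> \<alpha> X \<in> Mor D (FOb F X) (FOb G X)"
    "\<lbrakk>X \<in> Ob C; Y \<in> Ob C; f \<in> Mor C X Y\<rbrakk> \<Longrightarrow>
        cmp D (FOb F X) (FOb F Y) (FOb G Y) (\<alpha> Y) (FMor F X Y f) =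
        cmp D (FOb F X) (FOb G X) (FOb G Y) (FMor G X Y f) (\<alpha> X)"
  using assms unfolding nat_trans_def by simp_all

lemma nat_trans_id:
  assumes F: "is_functor C D F"
  shows "nat_trans C D F F (\<lambda>X \<in> Ob C. idm D (FOb F X))"
proof -
  interpret D: category D by (rule functorD(2)[OF F])
  show ?thesis unfolding nat_trans_def by (simp add: D.idm_in D.idm_left D.idm_right functorD(3-6)[OF F])
qed

lemma nat_trans_cmp:
  assumes F: "is_functor C D F" "is_functor C D G" "is_functor C D H"
    and a: "nat_trans C D F G \<alpha>" and b: "nat_trans C D G H \<beta>"
  shows "nat_trans C D F H (\<lambda>X \<in> Ob C. cmp D (FOb F X) (FOb G X) (FOb H X) (\<beta> X) (\<alpha> X))"
  unfolding nat_trans_def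
proof (intro conjI ballI)
  interpret D: category D by (rule functorD(2)[OF F(1)])
  fix X assume X: "X \<in> Ob C"
  note o = F(1)[THEN functorD(3)] F(2)[THEN functorD(3)] F(3)[THEN functorD(3)]
  show "(\<lambda>X \<in> Ob C. cmp D (FOb F X) (FOb G X) (FOb H X) (\<beta> X) (\<alpha> X)) X \<in> Mor D (FOb F X) (FOb H X)"
    using X by (simp add: D.cmp_in o nat_transD(2)[OF a] nat_transD(2)[OF b])
  fix Y f assume Y: "Y \<in> Ob C" and f: "f \<in> Mor C X Y"
  note m = functorD(4)[OF F(1) X Y f] functorD(4)[OF F(2) X Y f] functorD(4)[OF F(3) X Y f]
  note al = nat_transD(2)[OF a X] nat_transD(2)[OF a Y] and be = nat_transD(2)[OF b X] nat_transD(2)[OF b Y]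
  have "cmp D (FOb F X) (FOb F Y) (FOb H Y) (cmp D (FOb F Y) (FOb G Y) (FOb H Y) (\<beta> Y) (\<alpha> Y)) (FMor F X Y f) =
    cmp D (FOb F X) (FOb G Y) (FOb H Y) (\<beta> Y) (cmp D (FOb F X) (FOb F Y) (FOb G Y) (\<alpha> Y) (FMor F X Y f))"
    by (rule D.cmp_assoc[symmetric]) (use o X Y m al be in auto)
  also have "\<dots> = cmp D (FOb F X) (FOb G Y) (FOb H Y) (\<beta> Y) (cmp D (FOb F X) (FOb G X) (FOb G Y) (FMor G X Y f) (\<alpha> X))"
    unfolding nat_transD(3)[OF a X Y f] ..
  also have "\<dots> = cmp D (FOb F X) (FOb G X) (FOb H Y) (cmp D (FOb G X) (FOb G Y) (FOb H Y) (\<beta> Y) (FMor G X Y f)) (\<alpha> X)"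
    by (rule D.cmp_assoc) (use o X Y m al be in auto)
  also have "\<dots> = cmp D (FOb F X) (FOb G X) (FOb H Y) (cmp D (FOb G X) (FOb H X) (FOb H Y) (FMor H X Y f) (\<beta> X)) (\<alpha> X)"
    unfolding nat_transD(3)[OF b X Y f] ..
  also have "\<dots> = cmp D (FOb F X) (FOb H X) (FOb H Y) (FMor H X Y f) (cmp D (FOb F X) (FOb G X) (FOb H X) (\<beta> X) (\<alpha> X))"
    by (rule D.cmp_assoc[symmetric]) (use o X Y m al be in auto)
  finally show "cmp D (FOb F X) (FOb F Y) (FOb H Y)
      ((\<lambda>X \<in> Ob C. cmp D (FOb F X) (FOb G X) (FOb H X) (\<beta> X) (\<alpha> X)) Y) (FMor F X Y f) =
    cmp D (FOb F X) (FOb H X) (FOb H Y) (FMor H X Y f)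
      ((\<lambda>X \<in> Ob C. cmp D (FOb F X) (FOb G X) (FOb H X) (\<beta> X) (\<alpha> X)) X)"
    using X Y by simp
qed simp

lemma functor_cat_sel [simp]:
  "Ob (functor_cat C D P) = {F. is_functor C D F \<and> P F}"
  "Mor (functor_cat C D P) F G = {\<alpha>. nat_trans C D F G \<alpha>}"
  "idm (functor_cat C D P) F = (\<lambda>X \<in> Ob C. idm D (FOb F X))"
  "cmp (functor_cat C D P) F G H \<beta> \<alpha> = (\<lambda>X \<in> Ob C. cmp D (FOb F X) (FOb G X) (FOb H X) (\<beta> X) (\<alpha> X))"
  by (simp_all add: functor_cat_def)

lemma functor_cat_category: "category (functor_cat C D P)"
proof
  fix F assume "F \<in> Ob (functor_cat C D P)"
  then show "idm (functor_cat C D P) F \<in> Mor (functor_cat C D P) F F" by (simp add: nat_trans_id)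
next
  fix F G H \<alpha> \<beta>
  assume "F \<in> Ob (functor_cat C D P)" "G \<in> Ob (functor_cat C D P)" "H \<in> Ob (functor_cat C D P)"
    "\<alpha> \<in> Mor (functor_cat C D P) F G" "\<beta> \<in> Mor (functor_cat C D P) G H"
  then show "cmp (functor_cat C D P) F G H \<beta> \<alpha> \<in> Mor (functor_cat C D P) F H" by (simp add: nat_trans_cmp)
next
  fix F G \<alpha>
  assume "F \<in> Ob (functor_cat C D P)" "G \<in> Ob (functor_cat C D P)" "\<alpha> \<in> Mor (functor_cat C D P) F G"
  then have *: "is_functor C D F" "is_functor C D G" "nat_trans C D F G \<alpha>" by simp_all
  interpret D: category D by (rule functorD(2)[OF *(1)])
  show "cmp (functor_cat C D P) F F G \<alpha> (idm (functor_cat C D P) F) = \<alpha>"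
    using nat_transD(1)[OF *(3)]
    by (intro extensionalityI[where A = "Ob C"])
      (simp_all add: D.idm_right functorD(3)[OF *(1)] functorD(3)[OF *(2)] nat_transD(2)[OF *(3)])
  show "cmp (functor_cat C D P) F G G (idm (functor_cat C D P) G) \<alpha> = \<alpha>"
    using nat_transD(1)[OF *(3)]
    by (intro extensionalityI[where A = "Ob C"])
      (simp_all add: D.idm_left functorD(3)[OF *(1)] functorD(3)[OF *(2)] nat_transD(2)[OF *(3)])
next
  fix F G H L \<alpha> \<beta> \<gamma>
  assume "F \<in> Ob (functor_cat C D P)" "G \<in> Ob (functor_cat C D P)" "H \<in> Ob (functor_cat C D P)"
    "L \<in> Ob (functor_cat C D P)" "\<alpha> \<in> Mor (functor_cat C D P) F G" "\<beta> \<in> Mor (functor_cat C D P) G H"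
    "\<gamma> \<in> Mor (functor_cat C D P) H L"
  then have *: "is_functor C D F" "is_functor C D G" "is_functor C D H" "is_functor C D L"
     "nat_trans C D F G \<alpha>" "nat_trans C D G H \<beta>" "nat_trans C D H L \<gamma>" by simp_all
  interpret D: category D by (rule functorD(2)[OF *(1)])
  show "cmp (functor_cat C D P) F H L \<gamma> (cmp (functor_cat C D P) F G H \<beta> \<alpha>) =
    cmp (functor_cat C D P) F G L (cmp (functor_cat C D P) G H L \<gamma> \<beta>) \<alpha>"
    by (simp add: fun_eq_iff restrict_def D.cmp_assoc *(1-4)[THEN functorD(3)] *(5-7)[THEN nat_transD(2)])
qed

lemma functor_cat_iso:
  "is_iso (functor_cat C D P) F G \<alpha> \<Longrightarrow> nat_isomorphic C D F G"
proof -
  assume "is_iso (functor_cat C D P) F G \<alpha>"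
  then obtain \<beta> where a: "nat_trans C D F G \<alpha>" and b: "nat_trans C D G F \<beta>"
    and 1: "(\<lambda>X \<in> Ob C. cmp D (FOb F X) (FOb G X) (FOb F X) (\<beta> X) (\<alpha> X)) = (\<lambda>X \<in> Ob C. idm D (FOb F X))"
    and 2: "(\<lambda>X \<in> Ob C. cmp D (FOb G X) (FOb F X) (FOb G X) (\<alpha> X) (\<beta> X)) = (\<lambda>X \<in> Ob C. idm D (FOb G X))"
    unfolding is_iso_def by auto
  have "is_iso D (FOb F X) (FOb G X) (\<alpha> X)" if X: "X \<in> Ob C" for X
    using nat_transD(2)[OF a X] nat_transD(2)[OF b X] fun_cong[OF 1, of X] fun_cong[OF 2, of X] X
    unfolding is_iso_def by auto
  then show ?thesis using a unfolding nat_isomorphic_def by blast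
qed

text \<open>Pointwise inverses are natural: insert \<open>\<alpha>\<close> after its inverse and
  move it across the square. Isomorphic functors thereby become isomorphic objects of the functor
  category, whatever property \<open>P\<close> selects.\<close>

lemma nat_isomorphic_iso:
  assumes F: "is_functor C D F" "is_functor C D G" and i: "nat_isomorphic C D F G"
  shows "\<exists>\<alpha>. is_iso (functor_cat C D P) F G \<alpha>"
proof -
  interpret D: category D by (rule functorD(2)[OF F(1)])
  obtain \<alpha> where a: "nat_trans C D F G \<alpha>" and ai: "\<And>X. X \<in> Ob C \<Longrightarrow> is_iso D (FOb F X) (FOb G X) (\<alpha> X)"
    using i unfolding nat_isomorphic_def by blast
  have "\<forall>X \<in> Ob C. \<exists>b. b \<in> Mor D (FOb G X) (FOb F X) \<and>
     cmp D (FOb F X) (FOb G X) (FOb F X) b (\<alpha> X) = idm D (FOb F X) \<and>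
     cmp D (FOb G X) (FOb F X) (FOb G X) (\<alpha> X) b = idm D (FOb G X)"
    using ai unfolding is_iso_def by blast
  then obtain b where b: "\<And>X. X \<in> Ob C \<Longrightarrow> b X \<in> Mor D (FOb G X) (FOb F X)"
     "\<And>X. X \<in> Ob C \<Longrightarrow> cmp D (FOb F X) (FOb G X) (FOb F X) (b X) (\<alpha> X) = idm D (FOb F X)"
     "\<And>X. X \<in> Ob C \<Longrightarrow> cmp D (FOb G X) (FOb F X) (FOb G X) (\<alpha> X) (b X) = idm D (FOb G X)"
    by metis
  have "nat_trans C D G F (restrict b (Ob C))"
    unfolding nat_trans_def
  proof (intro conjI ballI)
    fix X Y f assume X: "X \<in> Ob C" and Y: "Y \<in> Ob C" and f: "f \<in> Mor C X Y"
    note o = functorD(3)[OF F(1) X] functorD(3)[OF F(1) Y] functorD(3)[OF F(2) X] functorD(3)[OF F(2) Y]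
    note m = functorD(4)[OF F(1) X Y f] functorD(4)[OF F(2) X Y f]
    note al = nat_transD(2)[OF a X] nat_transD(2)[OF a Y]
    let ?l = "cmp D (FOb G X) (FOb G Y) (FOb F Y) (b Y) (FMor G X Y f)"
    have l: "?l \<in> Mor D (FOb G X) (FOb F Y)" using o m b(1) Y by (simp add: D.cmp_in)
    have "?l = cmp D (FOb G X) (FOb G X) (FOb F Y) ?l (cmp D (FOb G X) (FOb F X) (FOb G X) (\<alpha> X) (b X))"
      unfolding b(3)[OF X] by (rule D.idm_right[symmetric, OF o(3,2) l])
    also have "\<dots> = cmp D (FOb G X) (FOb F X) (FOb F Y) (cmp D (FOb F X) (FOb G Y) (FOb F Y) (b Y)
        (cmp D (FOb F X) (FOb G X) (FOb G Y) (FMor G X Y f) (\<alpha> X))) (b X)"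
      using o m al b(1)[OF X] b(1)[OF Y] by (simp add: D.cmp_in D.cmp_assoc)
    also have "\<dots> = cmp D (FOb G X) (FOb F X) (FOb F Y) (cmp D (FOb F X) (FOb F Y) (FOb F Y)
        (cmp D (FOb F Y) (FOb G Y) (FOb F Y) (b Y) (\<alpha> Y)) (FMor F X Y f)) (b X)"
      unfolding nat_transD(3)[OF a X Y f, symmetric]
      using o m al b(1)[OF X] b(1)[OF Y] by (simp add: D.cmp_in D.cmp_assoc)
    also have "\<dots> = cmp D (FOb G X) (FOb F X) (FOb F Y) (FMor F X Y f) (b X)"
      unfolding b(2)[OF Y] using o m by (simp add: D.idm_left)
    finally show "cmp D (FOb G X) (FOb G Y) (FOb F Y) (restrict b (Ob C) Y) (FMor G X Y f) =
       cmp D (FOb G X) (FOb F X) (FOb F Y) (FMor F X Y f) (restrict b (Ob C) X)" using X Y by simp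
  qed (simp_all add: b)
  then have "is_iso (functor_cat C D P) F G \<alpha>"
    using a unfolding is_iso_def by (intro conjI bexI[of _ "restrict b (Ob C)"]) (simp_all add: b cong: restrict_cong)
  then show ?thesis by blast
qed

section \<open>Equivalences and the two halves of a universal property\<close>

lemma equivalence_ess_surj:
  assumes e: "is_equivalence C D F" and Y: "Y \<in> Ob D"
  shows "\<exists>X \<in> Ob C. \<exists>f. is_iso D (FOb F X) Y f"
proof -
  obtain G where "is_functor D C G" and "nat_isomorphic D D (comp_func F G) id_func"
    using e unfolding is_equivalence_def by blast
  then show ?thesis using Y functorD(3)[of D C G Y] unfolding nat_isomorphic_def by auto
qed

text \<open>A quasi-inverse \<open>G\<close> turns \<open>f\<close> into an isomorphism from
  \<open>G (F X)\<close> to \<open>G (F Y)\<close>, and these objects are isomorphic to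
  \<open>X\<close> and \<open>Y\<close>. The resulting isomorphism is not claimed to be a preimage
  of \<open>f\<close>.\<close>

lemma equivalence_reflects_iso:
  assumes e: "is_equivalence C D F" and o: "X \<in> Ob C" "Y \<in> Ob C" and f: "is_iso D (FOb F X) (FOb F Y) f"
  shows "\<exists>g. is_iso C X Y g"
proof -
  have F: "is_functor C D F" using e unfolding is_equivalence_def by blast
  interpret C: category C by (rule functorD(1)[OF F])
  obtain G where G: "is_functor D C G" and n: "nat_isomorphic C C (comp_func G F) id_func"
    using e unfolding is_equivalence_def by blast
  obtain \<alpha> where al: "\<And>X. X \<in> Ob C \<Longrightarrow> is_iso C (FOb G (FOb F X)) X (\<alpha> X)"
    using n unfolding nat_isomorphic_def by auto
  obtain \<beta> where be: "is_iso C X (FOb G (FOb F X)) \<beta>" using iso_inverse[OF al[OF o(1)]] .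
  note F' = functorD(3)[OF F] and G' = functorD(3)[OF G]
  note g = functor_iso[OF G F'[OF o(1)] F'[OF o(2)] f]
  show ?thesis
    using C.iso_cmp[OF o(1) G'[OF F'[OF o(2)]] o(2) C.iso_cmp[OF o(1) G'[OF F'[OF o(1)]] G'[OF F'[OF o(2)]] be g] al[OF o(2)]]
    by blast
qed

lemma precomp_FOb [simp]: "FOb (precomp C H) F = comp_func F H"
  by (simp add: precomp_def)

text \<open>Essential surjectivity of precomposition: the existence half of the universal properties
  of both localisation and abelianisation.\<close>

lemma precomp_equivalence_lift:
  assumes e: "is_equivalence (functor_cat E B P) (functor_cat D B P') (precomp D Q)"
    and F: "is_functor D B F" "P' F"
  obtains G where "is_functor E B G" "P G" "nat_isomorphic D B (comp_func G Q) F"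
proof -
  obtain G \<alpha> where "G \<in> Ob (functor_cat E B P)" "is_iso (functor_cat D B P') (comp_func G Q) F \<alpha>"
    using equivalence_ess_surj[OF e, of F] F by auto
  from that[OF _ _ functor_cat_iso[OF this(2)]] this(1) show thesis by simp
qed

text \<open>The uniqueness half, which compares two extensions by comparing them on the original
  category.\<close>

lemma precomp_equivalence_reflect:
  assumes e: "is_equivalence (functor_cat E B P) (functor_cat D B P') (precomp D Q)"
    and G: "is_functor E B G" "P G" "is_functor E B G'" "P G'"
    and Q: "is_functor D E Q" and i: "nat_isomorphic D B (comp_func G Q) (comp_func G' Q)"
  shows "nat_isomorphic E B G G'"
proof -
  obtain \<alpha> where "is_iso (functor_cat D B P') (comp_func G Q) (comp_func G' Q) \<alpha>"
    using nat_isomorphic_iso[OF functor_comp[OF Q G(1)] functor_comp[OF Q G(3)] i] by blast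
  then have "\<exists>\<gamma>. is_iso (functor_cat E B P) G G' \<gamma>"
    using equivalence_reflects_iso[OF e, of G G' \<alpha>] G by simp
  then show ?thesis using functor_cat_iso by blast
qed

lemma additive_functorD:
  assumes "additive_functor C D F"
  shows "is_functor C D F"
    "\<lbrakk>X \<in> Ob C; Y \<in> Ob C; f \<in> Mor C X Y; g \<in> Mor C X Y\<rbrakk> \<Longrightarrow>
        FMor F X Y (madd C X Y f g) = madd D (FOb F X) (FOb F Y) (FMor F X Y f) (FMor F X Y g)"
  using assms unfolding additive_functor_def by simp_all

lemma exact_functorD:
  assumes "exact_functor C D F"
  shows "additive_functor C D F"
    "\<lbrakk>X \<in> Ob C; Y \<in> Ob C; Z \<in> Ob C; short_exact C X Y Z f g\<rbrakk> \<Longrightarrow>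
        short_exact D (FOb F X) (FOb F Y) (FOb F Z) (FMor F X Y f) (FMor F Y Z g)"
  using assms unfolding exact_functor_def by simp_all

text \<open>The functor \<open>H\<close> takes values in the abelian subcategory on \<open>S\<close>
  and is cohomological there, so it extends to an exact functor \<open>G\<close> from
  \<open>D\<close> to that subcategory. Seen as an endofunctor of \<open>D\<close>, \<open>G\<close>
  restricts along \<open>H\<close> to something isomorphic to \<open>H\<close>, as the identity
  does; so \<open>G\<close> is isomorphic to the identity.\<close>

lemma abelianisation_retract:
  fixes D :: "('p, 'b) pcat"
  assumes ab: "is_abelianisation T D H" and S: "closed_subcategory D S"
    and H: "\<And>X. X \<in> Ob T \<Longrightarrow> FOb H X \<in> S" and Z: "Z \<in> Ob D"
    and dist: "\<And>X Y Z u v w. (X, Y, Z, u, v, w) \<in> dist T \<Longrightarrow> X \<in> Ob T \<and> Y \<in> Ob T \<and> Z \<in> Ob T"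
  shows "\<exists>Z' \<in> S. \<exists>f. is_iso D Z' Z f"
proof -
  interpret closed_subcategory D S by (rule S)
  have coh: "cohomological T D H" using ab unfolding is_abelianisation_def by blast
  then have add: "additive_functor T D H" unfolding cohomological_def by blast
  note Hf = additive_functorD(1)[OF add]
  interpret CS: abelian_category CS by (rule sub_abelian)
  have "is_functor T CS H"
    unfolding is_functor_def using functorD(1)[OF Hf] CS.category_axioms
    by (simp add: H functorD(4-6)[OF Hf])
  then have addS: "additive_functor T CS H"
    unfolding additive_functor_def by (simp add: additive_functorD(2)[OF add])
  have cohS: "cohomological T CS H"
    unfolding cohomological_def
  proof (intro conjI addS ballI, clarify)
    fix X Y Z u v w assume t: "(X, Y, Z, u, v, w) \<in> dist T"
    then have "exact_at D (FOb H X) (FOb H Y) (FOb H Z) (FMor H X Y u) (FMor H Y Z v)"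
      using coh unfolding cohomological_def by blast
    then show "exact_at CS (FOb H X) (FOb H Y) (FOb H Z) (FMor H X Y u) (FMor H Y Z v)"
      using dist[OF t] H inOb by (simp add: exact_at_iff CS.exact_at_iff sub_exact_pair)
  qed
  have eq: "is_equivalence (functor_cat D B (exact_functor D B)) (functor_cat T B (cohomological T B)) (precomp T H)"
    if "abelian_category B" for B :: "('p, 'b) pcat"
    using ab that unfolding is_abelianisation_def by blast
  obtain G where G: "is_functor D CS G" "exact_functor D CS G" "nat_isomorphic T CS (comp_func G H) H"
    using precomp_equivalence_lift[OF eq[OF sub_abelian] additive_functorD(1)[OF addS] cohS] .
  have GS: "FOb G X \<in> S" if "X \<in> Ob D" for X using functorD(3)[OF G(1) that] by simp
  \<comment> \<open>The same record \<open>G\<close> is now read as an endofunctor of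
    \<open>D\<close>. It remains exact because a sequence of objects of \<open>S\<close> is short
    exact in the subcategory exactly if it is so in \<open>D\<close>.\<close>
  have Gf: "is_functor D D G"
    unfolding is_functor_def using category_axioms GS functorD(4-6)[OF G(1)] inOb by simp
  then have Ga: "additive_functor D D G"
    unfolding additive_functor_def using additive_functorD(2)[OF exact_functorD(1)[OF G(2)]] by simp
  have Ge: "exact_functor D D G"
    unfolding exact_functor_def using Ga exact_functorD(2)[OF G(2)] sub_short_exact GS by simp
  have idf: "is_functor D D id_func" using functor_id category_axioms by blast
  have ide: "exact_functor D D id_func"
    unfolding exact_functor_def additive_functor_def using idf by simp
  have "comp_func id_func H = H" by (simp add: comp_func_def)
  moreover have "nat_isomorphic T D (comp_func G H) H"
    using G(3) unfolding nat_isomorphic_def nat_trans_def is_iso_def by simp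
  ultimately have "nat_isomorphic T D (comp_func G H) (comp_func id_func H)" by simp
  \<comment> \<open>The component at \<open>Z\<close> of the isomorphism between \<open>G\<close>
    and the identity connects \<open>G Z\<close>, which lies in \<open>S\<close>, with
    \<open>Z\<close>.\<close>
  from precomp_equivalence_reflect[OF eq[OF abelian_category_axioms] Gf Ge idf ide Hf this]
  show ?thesis unfolding nat_isomorphic_def using Z GS by auto
qed

section \<open>Localisation by paths\<close>

definition inv_mor :: "('p, 'b, 'y) cat_scheme \<Rightarrow> 'p \<Rightarrow> 'p \<Rightarrow> 'b \<Rightarrow> 'b" where
  "inv_mor B X Y f = (SOME g. g \<in> Mor B Y X \<and> cmp B X Y X g f = idm B X \<and> cmp B Y X Y f g = idm B Y)"

lemma inv_mor:
  assumes "is_iso B X Y f"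
  shows "inv_mor B X Y f \<in> Mor B Y X" "cmp B X Y X (inv_mor B X Y f) f = idm B X"
    "cmp B Y X Y f (inv_mor B X Y f) = idm B Y"
proof -
  have "\<exists>g. g \<in> Mor B Y X \<and> cmp B X Y X g f = idm B X \<and> cmp B Y X Y f g = idm B Y"
    using assms unfolding is_iso_def by blast
  from someI_ex[OF this] show "inv_mor B X Y f \<in> Mor B Y X" "cmp B X Y X (inv_mor B X Y f) f = idm B X"
    "cmp B Y X Y f (inv_mor B X Y f) = idm B Y"
    unfolding inv_mor_def by blast+
qed

lemma (in category) inv_mor_unique:
  assumes o: "X \<in> Ob C" "Y \<in> Ob C" and f: "is_iso C X Y f"
    and g: "g \<in> Mor C Y X" "cmp C Y X Y f g = idm C Y"
  shows "g = inv_mor C X Y f"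
proof -
  note i = inv_mor[OF f] and m = iso_in[OF f]
  have "g = cmp C Y X X (cmp C X Y X (inv_mor C X Y f) f) g"
    unfolding i(2) by (rule idm_left[symmetric, OF o(2,1) g(1)])
  also have "\<dots> = inv_mor C X Y f"
    unfolding cmp_assoc[symmetric, OF o(2,1,2,1) g(1) m i(1)] g(2) by (rule idm_right[OF o(2,1) i(1)])
  finally show ?thesis .
qed

text \<open>A step \<open>(True, Y, f)\<close> of a path from \<open>X\<close> runs along \<open>f : X \<rightarrow> Y\<close>, a step \<open>(False, Y, f)\<close>
  runs backwards along \<open>f : Y \<rightarrow> X\<close>.\<close>

fun path :: "('o, 'a, 'x) cat_scheme \<Rightarrow> ('o \<times> 'o \<times> 'a) set \<Rightarrow> 'o \<Rightarrow> (bool \<times> 'o \<times> 'a) list \<Rightarrow> 'o \<Rightarrow> bool" where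
  "path D \<Sigma> X [] Z \<longleftrightarrow> X = Z \<and> X \<in> Ob D"
| "path D \<Sigma> X ((b, Y, f) # p) Z \<longleftrightarrow> X \<in> Ob D \<and> Y \<in> Ob D \<and>
     (if b then f \<in> Mor D X Y else (Y, X, f) \<in> \<Sigma> \<and> f \<in> Mor D Y X) \<and> path D \<Sigma> Y p Z"

text \<open>The value of a path under a functor that inverts \<Sigma>. The endpoint is passed along
  because composition takes its objects as arguments.\<close>

fun ev :: "('p, 'b, 'y) cat_scheme \<Rightarrow> ('o, 'a, 'p, 'b) func \<Rightarrow> 'o \<Rightarrow> (bool \<times> 'o \<times> 'a) list \<Rightarrow> 'o \<Rightarrow> 'b" where
  "ev B F X [] Z = idm B (FOb F X)"
| "ev B F X ((b, Y, f) # p) Z = cmp B (FOb F X) (FOb F Y) (FOb F Z) (ev B F Y p Z)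
     (if b then FMor F X Y f else inv_mor B (FOb F Y) (FOb F X) (FMor F Y X f))"

lemma path_ends: "path D \<Sigma> X p Z \<Longrightarrow> X \<in> Ob D \<and> Z \<in> Ob D"
  by (induction p arbitrary: X) (auto split: prod.splits)

lemma path_append: "\<lbrakk>path D \<Sigma> X p Y; path D \<Sigma> Y q Z\<rbrakk> \<Longrightarrow> path D \<Sigma> X (p @ q) Z"
  by (induction p arbitrary: X) auto

locale inverting_functor =
  fixes D :: "('o, 'a, 'x) cat_scheme" and \<Sigma> and B :: "('p, 'b, 'y) cat_scheme" and F
  assumes F: "is_functor D B F" and inv: "inverts \<Sigma> B F"
begin

lemma step_in:
  assumes "X \<in> Ob D" "Y \<in> Ob D" "if b then f \<in> Mor D X Y else (Y, X, f) \<in> \<Sigma> \<and> f \<in> Mor D Y X"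
  shows "(if b then FMor F X Y f else inv_mor B (FOb F Y) (FOb F X) (FMor F Y X f)) \<in> Mor B (FOb F X) (FOb F Y)"
proof (cases b)
  case True
  then show ?thesis using assms functorD(4)[OF F] by simp
next
  case False
  then have "is_iso B (FOb F Y) (FOb F X) (FMor F Y X f)" using assms inv unfolding inverts_def by auto
  then show ?thesis using False inv_mor(1) by simp
qed

lemma ev_in: "path D \<Sigma> X p Z \<Longrightarrow> ev B F X p Z \<in> Mor B (FOb F X) (FOb F Z)"
proof (induction p arbitrary: X)
  case Nil
  then show ?case using category.idm_in[OF functorD(2)[OF F]] functorD(3)[OF F] by auto
next
  case (Cons s p)
  obtain b Y f where s: "s = (b, Y, f)" by (cases s)
  have o: "X \<in> Ob D" "Y \<in> Ob D" "Z \<in> Ob D" and p: "path D \<Sigma> Y p Z"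
    using Cons.prems path_ends[of D \<Sigma> Y p Z] unfolding s by auto
  show ?case unfolding s ev.simps
    by (rule category.cmp_in[OF functorD(2)[OF F] functorD(3)[OF F o(1)] functorD(3)[OF F o(2)]
          functorD(3)[OF F o(3)] step_in[OF o(1,2)] Cons.IH[OF p]])
      (use Cons.prems s in simp)
qed

lemma ev_append:
  "\<lbrakk>path D \<Sigma> X p Y; path D \<Sigma> Y q Z\<rbrakk>
   \<Longrightarrow> ev B F X (p @ q) Z = cmp B (FOb F X) (FOb F Y) (FOb F Z) (ev B F Y q Z) (ev B F X p Y)"
proof (induction p arbitrary: X)
  case Nil
  then show ?case
    using category.idm_right[OF functorD(2)[OF F] _ _ ev_in[OF Nil.prems(2)]] functorD(3)[OF F]
      path_ends[OF Nil.prems(2)] by simp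
next
  case (Cons s p)
  obtain b W f where s: "s = (b, W, f)" by (cases s)
  have o: "X \<in> Ob D" "W \<in> Ob D" "Y \<in> Ob D" "Z \<in> Ob D" and p: "path D \<Sigma> W p Y"
    using Cons.prems path_ends[of D \<Sigma> Y q Z] unfolding s by auto
  have st: "(if b then FMor F X W f else inv_mor B (FOb F W) (FOb F X) (FMor F W X f)) \<in> Mor B (FOb F X) (FOb F W)"
    using Cons.prems s by (intro step_in[OF o(1,2)]) simp
  show ?case
    unfolding s append_Cons ev.simps Cons.IH[OF p Cons.prems(2)]
    by (rule category.cmp_assoc[symmetric, OF functorD(2)[OF F]])
      (use o functorD(3)[OF F] st ev_in[OF p] ev_in[OF Cons.prems(2)] in auto)
qed

end

text \<open>The universal property tests against categories with the same types as the localisation.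
  So the path category must have its morphisms in the type \<open>'a\<close> itself, and
  \<open>code\<close> places paths there.\<close>

locale localisation_construction = category D
  for D :: "('o, 'a, 'x) cat_scheme" +
  fixes \<Sigma> :: "('o \<times> 'o \<times> 'a) set" and code :: "(bool \<times> 'o \<times> 'a) list \<Rightarrow> 'a"
  assumes Sigma: "(X, Y, f) \<in> \<Sigma> \<Longrightarrow> X \<in> Ob D \<and> Y \<in> Ob D \<and> f \<in> Mor D X Y"
    and code: "inj code"
begin

text \<open>In place of generating relations, two paths count as equal when every functor that
  inverts \<Sigma> evaluates them equally. The category laws and the factorisation of such functors
  then reduce to properties of evaluation.\<close>

definition same :: "'o \<Rightarrow> 'o \<Rightarrow> (bool \<times> 'o \<times> 'a) list \<Rightarrow> (bool \<times> 'o \<times> 'a) list \<Rightarrow> bool" where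
  "same X Z p q \<longleftrightarrow> (\<forall>(B :: ('o, 'a) cat) F. is_functor D B F \<and> inverts \<Sigma> B F \<longrightarrow> ev B F X p Z = ev B F X q Z)"

text \<open>A class of paths is a set of paths and does not fit into \<open>'a\<close>, so each
  class is replaced by one of its members. Equivalent paths have the same members in their classes
  and hence the same choice.\<close>

definition norm_path :: "'o \<Rightarrow> 'o \<Rightarrow> (bool \<times> 'o \<times> 'a) list \<Rightarrow> (bool \<times> 'o \<times> 'a) list" where
  "norm_path X Z p = (SOME q. path D \<Sigma> X q Z \<and> same X Z p q)"

definition cls :: "'o \<Rightarrow> 'o \<Rightarrow> (bool \<times> 'o \<times> 'a) list \<Rightarrow> 'a" where
  "cls X Z p = code (norm_path X Z p)"

definition dec :: "'a \<Rightarrow> (bool \<times> 'o \<times> 'a) list" where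
  "dec = inv_into UNIV code"

definition loc :: "('o, 'a) cat" where
  "loc = \<lparr>Ob = Ob D, Mor = (\<lambda>X Z. cls X Z ` {p. path D \<Sigma> X p Z}), idm = (\<lambda>X. cls X X []),
     cmp = (\<lambda>X Y Z g f. cls X Z (dec f @ dec g))\<rparr>"

definition Q :: "('o, 'a, 'o, 'a) func" where
  "Q = \<lparr>FOb = (\<lambda>X. X), FMor = (\<lambda>X Y f. cls X Y [(True, Y, f)])\<rparr>"

lemma norm_path:
  assumes "path D \<Sigma> X p Z"
  shows "path D \<Sigma> X (norm_path X Z p) Z" "same X Z p (norm_path X Z p)"
proof -
  have "\<exists>q. path D \<Sigma> X q Z \<and> same X Z p q" using assms unfolding same_def by blast
  from someI_ex[OF this] show "path D \<Sigma> X (norm_path X Z p) Z" "same X Z p (norm_path X Z p)"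
    unfolding norm_path_def by blast+
qed

lemma cls_eq: "same X Z p q \<Longrightarrow> cls X Z p = cls X Z q"
  unfolding cls_def norm_path_def same_def by simp

lemma dec_cls: "dec (cls X Z p) = norm_path X Z p"
  unfolding dec_def cls_def using code by (simp add: inv_f_f)

lemma loc_sel [simp]:
  "Ob loc = Ob D" "idm loc X = cls X X []"
  by (simp_all add: loc_def)

lemma loc_MorE:
  assumes "m \<in> Mor loc X Z"
  obtains p where "path D \<Sigma> X p Z" "m = cls X Z p"
  using assms by (auto simp: loc_def)

lemma cls_in: "path D \<Sigma> X p Z \<Longrightarrow> cls X Z p \<in> Mor loc X Z"
  by (simp add: loc_def)

text \<open>Composition concatenates the stored representatives. Evaluation turns concatenation into
  composition, so that the class depends only on the classes of the two parts.\<close>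

lemma loc_cmp:
  assumes p: "path D \<Sigma> X p Y" and q: "path D \<Sigma> Y q Z"
  shows "cmp loc X Y Z (cls Y Z q) (cls X Y p) = cls X Z (p @ q)"
proof -
  have "same X Z (norm_path X Y p @ norm_path Y Z q) (p @ q)"
    unfolding same_def
  proof (intro allI impI, elim conjE)
    fix B :: "('o, 'a) cat" and F assume "is_functor D B F" "inverts \<Sigma> B F"
    then interpret inverting_functor D \<Sigma> B F by unfold_locales
    show "ev B F X (norm_path X Y p @ norm_path Y Z q) Z = ev B F X (p @ q) Z"
      using norm_path[OF p] norm_path[OF q] p q F inv unfolding same_def by (simp add: ev_append)
  qed
  then show ?thesis unfolding loc_def by (simp add: dec_cls cls_eq)
qed

lemma loc_category: "category loc"
proof
  fix X assume "X \<in> Ob loc"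
  then show "idm loc X \<in> Mor loc X X" by (simp add: cls_in)
next
  fix X Y f assume "f \<in> Mor loc X Y"
  then obtain p where p: "path D \<Sigma> X p Y" "f = cls X Y p" by (rule loc_MorE)
  then show "cmp loc X X Y f (idm loc X) = f" "cmp loc X Y Y (idm loc Y) f = f"
    using loc_cmp[of X "[]" X p Y] loc_cmp[of X p Y "[]" Y] path_ends[OF p(1)] by simp_all
next
  fix X Y Z f g assume "f \<in> Mor loc X Y" "g \<in> Mor loc Y Z"
  then obtain p q where p: "path D \<Sigma> X p Y" "f = cls X Y p" and q: "path D \<Sigma> Y q Z" "g = cls Y Z q"
    by (elim loc_MorE)
  then show "cmp loc X Y Z g f \<in> Mor loc X Z" by (simp add: loc_cmp cls_in path_append)
  fix W h assume "h \<in> Mor loc Z W"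
  then obtain r where r: "path D \<Sigma> Z r W" "h = cls Z W r" by (elim loc_MorE)
  show "cmp loc X Z W h (cmp loc X Y Z g f) = cmp loc X Y W (cmp loc Y Z W h g) f"
    unfolding p q r using p(1) q(1) r(1)
    by (simp add: loc_cmp path_append[OF p(1) q(1)] path_append[OF q(1) r(1)])
qed

lemma Q_sel [simp]: "FOb Q X = X" "FMor Q X Y f = cls X Y [(True, Y, f)]"
  by (simp_all add: Q_def)

lemma sameI:
  assumes "\<And>(B :: ('o, 'a) cat) F. inverting_functor D \<Sigma> B F \<Longrightarrow> ev B F X p Z = ev B F X q Z"
  shows "same X Z p q"
  using assms unfolding same_def inverting_functor_def by blast

lemma Q_functor: "is_functor D loc Q"
  unfolding is_functor_def
proof (intro conjI category_axioms loc_category ballI)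
  fix X assume X: "X \<in> Ob D"
  then show "FOb Q X \<in> Ob loc" by simp
  have "same X X [(True, X, idm D X)] []"
  proof (rule sameI)
    fix B :: "('o, 'a) cat" and F assume "inverting_functor D \<Sigma> B F"
    then interpret inverting_functor D \<Sigma> B F .
    show "ev B F X [(True, X, idm D X)] X = ev B F X [] X"
      using X functorD(2,3,5)[OF F] by (simp add: category.idm_left category.idm_in)
  qed
  then show "FMor Q X X (idm D X) = idm loc (FOb Q X)" by (simp add: cls_eq)
  fix Y f assume Y: "Y \<in> Ob D" "f \<in> Mor D X Y"
  then show "FMor Q X Y f \<in> Mor loc (FOb Q X) (FOb Q Y)" using X by (simp add: cls_in)
  fix Z g assume Z: "Z \<in> Ob D" "g \<in> Mor D Y Z"
  have "same X Z [(True, Z, cmp D X Y Z g f)] [(True, Y, f), (True, Z, g)]"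
  proof (rule sameI)
    fix B :: "('o, 'a) cat" and F assume "inverting_functor D \<Sigma> B F"
    then interpret inverting_functor D \<Sigma> B F .
    interpret B: category B by (rule functorD(2)[OF F])
    show "ev B F X [(True, Z, cmp D X Y Z g f)] Z = ev B F X [(True, Y, f), (True, Z, g)] Z"
      using X Y Z functorD(3,4,6)[OF F] by (simp add: B.idm_left B.cmp_in)
  qed
  then show "FMor Q X Z (cmp D X Y Z g f) =
      cmp loc (FOb Q X) (FOb Q Y) (FOb Q Z) (FMor Q Y Z g) (FMor Q X Y f)"
    using X Y Z by (simp add: loc_cmp cls_eq)
qed

lemma Q_inverse:
  assumes "(X, Y, f) \<in> \<Sigma>"
  shows "cmp loc X Y X (cls Y X [(False, X, f)]) (FMor Q X Y f) = idm loc X"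
    "cmp loc Y X Y (FMor Q X Y f) (cls Y X [(False, X, f)]) = idm loc Y"
proof -
  have *: "X \<in> Ob D" "Y \<in> Ob D" "f \<in> Mor D X Y" using Sigma[OF assms] by blast+
  have "same X X [(True, Y, f), (False, X, f)] [] \<and> same Y Y [(False, X, f), (True, Y, f)] []"
  proof (intro conjI sameI)
    fix B :: "('o, 'a) cat" and F assume "inverting_functor D \<Sigma> B F"
    then interpret inverting_functor D \<Sigma> B F .
    interpret B: category B by (rule functorD(2)[OF F])
    have "is_iso B (FOb F X) (FOb F Y) (FMor F X Y f)" using inv assms unfolding inverts_def by auto
    note i = inv_mor[OF this]
    show "ev B F X [(True, Y, f), (False, X, f)] X = ev B F X [] X"
      "ev B F Y [(False, X, f), (True, Y, f)] Y = ev B F Y [] Y"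
      using i * functorD(3,4)[OF F] by (simp_all add: B.idm_left)
  qed
  then show "cmp loc X Y X (cls Y X [(False, X, f)]) (FMor Q X Y f) = idm loc X"
    "cmp loc Y X Y (FMor Q X Y f) (cls Y X [(False, X, f)]) = idm loc Y"
    using * assms by (simp_all add: loc_cmp cls_eq)
qed

lemma Q_inverts: "inverts \<Sigma> loc Q"
  unfolding inverts_def
proof clarify
  fix X Y f assume s: "(X, Y, f) \<in> \<Sigma>"
  then have *: "X \<in> Ob D" "Y \<in> Ob D" "f \<in> Mor D X Y" using Sigma by blast+
  have "is_iso loc X Y (FMor Q X Y f)"
    by (rule category.is_isoI[OF loc_category _ _ Q_inverse[OF s]]) (use * s in \<open>simp_all add: cls_in\<close>)
  then show "is_iso loc (FOb Q X) (FOb Q Y) (FMor Q X Y f)" by simp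
qed

text \<open>Evaluation of the stored representative; it agrees with evaluation of any other path in
  the class, by the very definition of \<open>same\<close>.\<close>

definition ext_func :: "('o, 'a) cat \<Rightarrow> ('o, 'a, 'o, 'a) func \<Rightarrow> ('o, 'a, 'o, 'a) func" where
  "ext_func B F = \<lparr>FOb = FOb F, FMor = (\<lambda>X Z m. ev B F X (dec m) Z)\<rparr>"

lemma ext_FOb [simp]: "FOb (ext_func B F) = FOb F"
  by (simp add: ext_func_def)

context
  fixes B :: "('o, 'a) cat" and F
  assumes FB: "inverting_functor D \<Sigma> B F"
begin

interpretation inverting_functor D \<Sigma> B F by (rule FB)

lemma ext_FMor: "path D \<Sigma> X p Z \<Longrightarrow> FMor (ext_func B F) X Z (cls X Z p) = ev B F X p Z"
  using norm_path(2)[of X p Z] F inv unfolding same_def ext_func_def by (simp add: dec_cls)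

lemma ext_functor: "is_functor loc B (ext_func B F)"
  unfolding is_functor_def
proof (intro conjI loc_category functorD(2)[OF F] ballI)
  fix X assume X: "X \<in> Ob loc"
  then show "FOb (ext_func B F) X \<in> Ob B" using functorD(3)[OF F] by simp
  show "FMor (ext_func B F) X X (idm loc X) = idm B (FOb (ext_func B F) X)"
    using X ext_FMor[of X "[]" X] by simp
  fix Y f assume "f \<in> Mor loc X Y"
  then obtain p where p: "path D \<Sigma> X p Y" "f = cls X Y p" by (rule loc_MorE)
  then show "FMor (ext_func B F) X Y f \<in> Mor B (FOb (ext_func B F) X) (FOb (ext_func B F) Y)"
    by (simp add: ext_FMor ev_in)
  fix Z g assume "g \<in> Mor loc Y Z"
  then obtain q where q: "path D \<Sigma> Y q Z" "g = cls Y Z q" by (rule loc_MorE)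
  show "FMor (ext_func B F) X Z (cmp loc X Y Z g f) =
    cmp B (FOb (ext_func B F) X) (FOb (ext_func B F) Y) (FOb (ext_func B F) Z)
      (FMor (ext_func B F) Y Z g) (FMor (ext_func B F) X Y f)"
    using p q by (simp add: loc_cmp ext_FMor path_append[OF p(1) q(1)] ev_append)
qed

lemma ext_Q: "\<lbrakk>X \<in> Ob D; Y \<in> Ob D; f \<in> Mor D X Y\<rbrakk> \<Longrightarrow> FMor (ext_func B F) X Y (FMor Q X Y f) = FMor F X Y f"
  using functorD(2-4)[OF F] by (simp add: ext_FMor category.idm_left)

end

text \<open>A transformation natural on \<open>D\<close> is automatically natural for formal
  inverses, so it extends to the localisation with the same components.\<close>

lemma ev_natural:
  assumes "inverting_functor D \<Sigma> B F" "inverting_functor D \<Sigma> B G" and a: "nat_trans D B F G \<alpha>"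
  shows "path D \<Sigma> X p Z \<Longrightarrow> cmp B (FOb F X) (FOb F Z) (FOb G Z) (\<alpha> Z) (ev B F X p Z) =
    cmp B (FOb F X) (FOb G X) (FOb G Z) (ev B G X p Z) (\<alpha> X)"
proof (induction p arbitrary: X)
  interpret F: inverting_functor D \<Sigma> B F by fact
  interpret G: inverting_functor D \<Sigma> B G by fact
  interpret B: category B by (rule functorD(2)[OF F.F])
  note Fo = functorD(3)[OF F.F] and Go = functorD(3)[OF G.F]
  {
    case Nil
    then show ?case using nat_transD(2)[OF a] Fo Go by (auto simp: B.idm_left B.idm_right)
  next
    case (Cons s p)
    obtain b Y f where s: "s = (b, Y, f)" by (cases s)
    have o: "X \<in> Ob D" "Y \<in> Ob D" "Z \<in> Ob D" and p: "path D \<Sigma> Y p Z"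
      and st: "if b then f \<in> Mor D X Y else (Y, X, f) \<in> \<Sigma> \<and> f \<in> Mor D Y X"
      using Cons.prems path_ends[of D \<Sigma> Y p Z] unfolding s by auto
    let ?f = "if b then FMor F X Y f else inv_mor B (FOb F Y) (FOb F X) (FMor F Y X f)"
    let ?g = "if b then FMor G X Y f else inv_mor B (FOb G Y) (FOb G X) (FMor G Y X f)"
    note f = F.step_in[OF o(1,2) st] and g = G.step_in[OF o(1,2) st]
    note al = nat_transD(2)[OF a]
    have n: "cmp B (FOb F X) (FOb F Y) (FOb G Y) (\<alpha> Y) ?f = cmp B (FOb F X) (FOb G X) (FOb G Y) ?g (\<alpha> X)"
    proof (cases b)
      case True
      then show ?thesis using nat_transD(3)[OF a o(1,2)] st by simp
    next
      case False
      then have f': "f \<in> Mor D Y X" "(Y, X, f) \<in> \<Sigma>" using st by simp_all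
      have i: "is_iso B (FOb F Y) (FOb F X) (FMor F Y X f)" "is_iso B (FOb G Y) (FOb G X) (FMor G Y X f)"
        using f' F.inv G.inv unfolding inverts_def by auto
      note fi = inv_mor[OF i(1)] and gi = inv_mor[OF i(2)]
      note m = functorD(4)[OF F.F o(2,1) f'(1)] functorD(4)[OF G.F o(2,1) f'(1)]
      let ?a = "inv_mor B (FOb F Y) (FOb F X) (FMor F Y X f)" and ?b = "inv_mor B (FOb G Y) (FOb G X) (FMor G Y X f)"
      \<comment> \<open>For a backward step, put \<open>?b\<close> composed with \<open>G f\<close>
        in front, move \<open>\<alpha>\<close> across the square of \<open>f\<close>, and cancel
        \<open>F f\<close> against \<open>?a\<close>.\<close>
      have "cmp B (FOb F X) (FOb F Y) (FOb G Y) (\<alpha> Y) ?a =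
        cmp B (FOb F X) (FOb G Y) (FOb G Y) (cmp B (FOb G Y) (FOb G X) (FOb G Y) ?b (FMor G Y X f))
          (cmp B (FOb F X) (FOb F Y) (FOb G Y) (\<alpha> Y) ?a)"
        unfolding gi(2) using o Fo Go al fi(1) by (simp add: B.idm_left B.cmp_in)
      also have "\<dots> = cmp B (FOb F X) (FOb G X) (FOb G Y) ?b (cmp B (FOb F X) (FOb F Y) (FOb G X)
          (cmp B (FOb F Y) (FOb G Y) (FOb G X) (FMor G Y X f) (\<alpha> Y)) ?a)"
        using o Fo Go al fi(1) gi(1) m by (simp add: B.cmp_assoc[symmetric] B.cmp_in)
      also have "\<dots> = cmp B (FOb F X) (FOb G X) (FOb G Y) ?b (cmp B (FOb F X) (FOb F X) (FOb G X) (\<alpha> X)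
          (cmp B (FOb F X) (FOb F Y) (FOb F X) (FMor F Y X f) ?a))"
        unfolding nat_transD(3)[OF a o(2,1) f'(1), symmetric]
        using o Fo Go al fi(1) gi(1) m by (simp add: B.cmp_assoc[symmetric] B.cmp_in)
      also have "\<dots> = cmp B (FOb F X) (FOb G X) (FOb G Y) ?b (\<alpha> X)"
        unfolding fi(3) using o Fo Go al by (simp add: B.idm_right)
      finally show ?thesis using False by simp
    qed
    have "cmp B (FOb F X) (FOb F Z) (FOb G Z) (\<alpha> Z) (cmp B (FOb F X) (FOb F Y) (FOb F Z) (ev B F Y p Z) ?f) =
      cmp B (FOb F X) (FOb F Y) (FOb G Z) (cmp B (FOb F Y) (FOb F Z) (FOb G Z) (\<alpha> Z) (ev B F Y p Z)) ?f"
      by (rule B.cmp_assoc) (use o Fo Go al f F.ev_in[OF p] in auto)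
    also have "\<dots> = cmp B (FOb F X) (FOb G Y) (FOb G Z) (ev B G Y p Z) (cmp B (FOb F X) (FOb F Y) (FOb G Y) (\<alpha> Y) ?f)"
      unfolding Cons.IH[OF p] by (rule B.cmp_assoc[symmetric]) (use o Fo Go al f G.ev_in[OF p] in auto)
    also have "\<dots> = cmp B (FOb F X) (FOb G X) (FOb G Z) (cmp B (FOb G X) (FOb G Y) (FOb G Z) (ev B G Y p Z) ?g) (\<alpha> X)"
      unfolding n by (rule B.cmp_assoc) (use o Fo Go al g G.ev_in[OF p] in auto)
    finally show ?case unfolding s ev.simps .
  }
qed

text \<open>Functors that agree on a category but differ outside it are distinct records, so a round
  trip through an extension gives back a functor only up to isomorphism. The components of that
  isomorphism are identities.\<close>

lemma agree_nat_isomorphic: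
  fixes B :: "('o, 'a) cat" and C :: "('o, 'a, 'y) cat_scheme"
  assumes G: "is_functor (functor_cat C B P) (functor_cat C B P) \<G>"
    and ob: "\<And>F X. \<lbrakk>is_functor C B F; P F; X \<in> Ob C\<rbrakk> \<Longrightarrow> FOb (FOb \<G> F) X = FOb F X"
    and mor: "\<And>F X Y f. \<lbrakk>is_functor C B F; P F; X \<in> Ob C; Y \<in> Ob C; f \<in> Mor C X Y\<rbrakk> \<Longrightarrow>
       FMor (FOb \<G> F) X Y f = FMor F X Y f"
    and nt: "\<And>F F' \<alpha> X. \<lbrakk>is_functor C B F; P F; is_functor C B F'; P F'; nat_trans C B F F' \<alpha>; X \<in> Ob C\<rbrakk> \<Longrightarrow>
       FMor \<G> F F' \<alpha> X = \<alpha> X"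
  shows "nat_isomorphic (functor_cat C B P) (functor_cat C B P) \<G> id_func"
proof -
  let ?FC = "functor_cat C B P"
  let ?i = "\<lambda>F. \<lambda>X \<in> Ob C. idm B (FOb F X)"
  have nt1: "nat_trans C B (FOb \<G> F) F (?i F)" and nt2: "nat_trans C B F (FOb \<G> F) (?i F)"
    if F: "is_functor C B F" "P F" for F
  proof -
    interpret B: category B by (rule functorD(2)[OF F(1)])
    show "nat_trans C B (FOb \<G> F) F (?i F)" "nat_trans C B F (FOb \<G> F) (?i F)"
      unfolding nat_trans_def
      by (simp_all add: ob[OF F] mor[OF F] functorD(3,4)[OF F(1)] B.idm_in B.idm_left B.idm_right)
  qed
  show ?thesis
    unfolding nat_isomorphic_def
  proof (intro exI conjI ballI)
    show "nat_trans ?FC ?FC \<G> id_func (\<lambda>F \<in> Ob ?FC. ?i F)"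
      unfolding nat_trans_def
    proof (intro conjI ballI)
      fix F assume "F \<in> Ob ?FC"
      then have F: "is_functor C B F" "P F" by simp_all
      then show "(\<lambda>F \<in> Ob ?FC. ?i F) F \<in> Mor ?FC (FOb \<G> F) (FOb id_func F)" using nt1 by simp
      fix F' \<alpha> assume "F' \<in> Ob ?FC" and "\<alpha> \<in> Mor ?FC F F'"
      then have F': "is_functor C B F'" "P F'" and a: "nat_trans C B F F' \<alpha>" by simp_all
      interpret B: category B by (rule functorD(2)[OF F(1)])
      show "cmp ?FC (FOb \<G> F) (FOb \<G> F') (FOb id_func F') ((\<lambda>F \<in> Ob ?FC. ?i F) F') (FMor \<G> F F' \<alpha>) =
        cmp ?FC (FOb \<G> F) (FOb id_func F) (FOb id_func F') (FMor id_func F F' \<alpha>) ((\<lambda>F \<in> Ob ?FC. ?i F) F)"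
        by (rule ext)
         (simp add: F F' restrict_def ob[OF F] ob[OF F'] nt[OF F F' a] functorD(3)[OF F(1)] functorD(3)[OF F'(1)]
           nat_transD(2)[OF a] B.idm_left B.idm_right)
    qed simp
    fix F assume "F \<in> Ob ?FC"
    then have F: "is_functor C B F" "P F" by simp_all
    interpret B: category B by (rule functorD(2)[OF F(1)])
    have "is_iso ?FC (FOb \<G> F) F (?i F)"
      unfolding is_iso_def
      by (intro conjI bexI[of _ "?i F"])
        (simp_all add: nt1[OF F] nt2[OF F] ob[OF F] functorD(3)[OF F(1)] B.idm_in B.idm_left cong: restrict_cong)
    then show "is_iso ?FC (FOb \<G> F) (FOb id_func F) ((\<lambda>F \<in> Ob ?FC. ?i F) F)" using F by simp
  qed
qed

lemma precomp_functor:
  fixes B :: "('o, 'a) cat"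
  assumes B: "category B"
  shows "is_functor (functor_cat loc B (\<lambda>F. True)) (functor_cat D B (inverts \<Sigma> B)) (precomp D Q)"
  unfolding is_functor_def
proof (intro conjI functor_cat_category ballI)
  interpret B: category B by (rule B)
  fix F assume "F \<in> Ob (functor_cat loc B (\<lambda>F. True))"
  then have F: "is_functor loc B F" by simp
  have "is_iso B (FOb F X) (FOb F Y) (FMor F X Y (FMor Q X Y f))" if "(X, Y, f) \<in> \<Sigma>" for X Y f
    using functor_iso[OF F, of X Y "FMor Q X Y f"] Q_inverts that Sigma[OF that] unfolding inverts_def by auto
  then show "FOb (precomp D Q) F \<in> Ob (functor_cat D B (inverts \<Sigma> B))"
    using functor_comp[OF Q_functor F] by (auto simp: inverts_def)
  show "FMor (precomp D Q) F F (idm (functor_cat loc B (\<lambda>F. True)) F) =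
     idm (functor_cat D B (inverts \<Sigma> B)) (FOb (precomp D Q) F)"
    by (simp add: precomp_def cong: restrict_cong)
  fix G \<alpha> assume "G \<in> Ob (functor_cat loc B (\<lambda>F. True))" "\<alpha> \<in> Mor (functor_cat loc B (\<lambda>F. True)) F G"
  then have G: "is_functor loc B G" and a: "nat_trans loc B F G \<alpha>" by simp_all
  have "nat_trans D B (comp_func F Q) (comp_func G Q) (\<lambda>X \<in> Ob D. \<alpha> X)"
    unfolding nat_trans_def
    using nat_transD(2)[OF a] nat_transD(3)[OF a _ _ functorD(4)[OF Q_functor]] by simp
  then show "FMor (precomp D Q) F G \<alpha> \<in> Mor (functor_cat D B (inverts \<Sigma> B)) (FOb (precomp D Q) F) (FOb (precomp D Q) G)"
    by (simp add: precomp_def)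
  fix H \<beta>
  show "FMor (precomp D Q) F H (cmp (functor_cat loc B (\<lambda>F. True)) F G H \<beta> \<alpha>) =
    cmp (functor_cat D B (inverts \<Sigma> B)) (FOb (precomp D Q) F) (FOb (precomp D Q) G) (FOb (precomp D Q) H)
      (FMor (precomp D Q) G H \<beta>) (FMor (precomp D Q) F G \<alpha>)"
    by (simp add: precomp_def cong: restrict_cong)
qed

text \<open>By induction along the path. At a backward step, the value of \<open>F\<close> is
  inverse to the value at the forward step, and inverses are unique.\<close>

lemma ev_comp_Q:
  fixes B :: "('o, 'a) cat"
  assumes F: "is_functor loc B F"
  shows "path D \<Sigma> X p Z \<Longrightarrow> ev B (comp_func F Q) X p Z = FMor F X Z (cls X Z p)"
proof (induction p arbitrary: X)
  case Nil
  then show ?case using functorD(5)[OF F, of X] by auto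
next
  case (Cons s p)
  interpret B: category B by (rule functorD(2)[OF F])
  obtain b Y f where s: "s = (b, Y, f)" by (cases s)
  have o: "X \<in> Ob D" "Y \<in> Ob D" "Z \<in> Ob D" and p: "path D \<Sigma> Y p Z"
    and st: "if b then f \<in> Mor D X Y else (Y, X, f) \<in> \<Sigma> \<and> f \<in> Mor D Y X"
    using Cons.prems path_ends[of D \<Sigma> Y p Z] unfolding s by auto
  have p1: "path D \<Sigma> X [(b, Y, f)] Y" using o st by simp
  have "cls X Z (s # p) = cmp loc X Y Z (cls Y Z p) (cls X Y [(b, Y, f)])"
    unfolding s loc_cmp[OF p1 p] by simp
  then have 1: "FMor F X Z (cls X Z (s # p)) =
      cmp B (FOb F X) (FOb F Y) (FOb F Z) (FMor F Y Z (cls Y Z p)) (FMor F X Y (cls X Y [(b, Y, f)]))"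
    using functorD(6)[OF F _ _ _ cls_in[OF p1] cls_in[OF p]] o by simp
  have "(if b then FMor F X Y (FMor Q X Y f) else inv_mor B (FOb F Y) (FOb F X) (FMor F Y X (FMor Q Y X f))) =
     FMor F X Y (cls X Y [(b, Y, f)])"
  proof (cases b)
    case False
    then have f: "(Y, X, f) \<in> \<Sigma>" "f \<in> Mor D Y X" using st by simp_all
    have i: "is_iso loc Y X (FMor Q Y X f)" using Q_inverts f unfolding inverts_def by auto
    have "FMor F X Y (cls X Y [(False, Y, f)]) = inv_mor B (FOb F Y) (FOb F X) (FMor F Y X (FMor Q Y X f))"
    proof (rule B.inv_mor_unique)
      show "is_iso B (FOb F Y) (FOb F X) (FMor F Y X (FMor Q Y X f))"
        using functor_iso[OF F _ _ i] o by simp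
      have c: "cls X Y [(False, Y, f)] \<in> Mor loc X Y" using p1 False cls_in by simp
      then show "FMor F X Y (cls X Y [(False, Y, f)]) \<in> Mor B (FOb F X) (FOb F Y)"
        using functorD(4)[OF F] o by simp
      show "cmp B (FOb F X) (FOb F Y) (FOb F X) (FMor F Y X (FMor Q Y X f)) (FMor F X Y (cls X Y [(False, Y, f)])) = idm B (FOb F X)"
        using functorD(6)[OF F _ _ _ c iso_in[OF i]] Q_inverse(2)[OF f(1)] o functorD(5)[OF F, of X] by simp
    qed (use o functorD(3)[OF F] in simp_all)
    then show ?thesis using False by simp
  qed simp
  note 2 = this
  show ?case unfolding s ev.simps Cons.IH[OF p] comp_func_sel Q_sel(1) 2 1[unfolded s] ..
qed

lemma localisation: "is_localisation D \<Sigma> loc Q"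
  unfolding is_localisation_def
proof (intro conjI Q_functor Q_inverts allI impI)
  fix B :: "('o, 'a) cat" assume B: "category B"
  let ?E = "functor_cat loc B (\<lambda>F. True)" and ?D = "functor_cat D B (inverts \<Sigma> B)"
  \<comment> \<open>The quasi-inverse of precomposition. On transformations it is the identity,
    because the localisation has the same objects as \<open>D\<close>.\<close>
  define \<G> :: "(('o, 'a, 'o, 'a) func, 'o \<Rightarrow> 'a, ('o, 'a, 'o, 'a) func, 'o \<Rightarrow> 'a) func"
    where "\<G> = \<lparr>FOb = ext_func B, FMor = (\<lambda>F G \<alpha>. \<alpha>)\<rparr>"
  have sel [simp]: "FOb \<G> = ext_func B" "FMor \<G> F F' \<alpha> = \<alpha>" for F F' \<alpha> by (simp_all add: \<G>_def)
  have iF: "inverting_functor D \<Sigma> B F" if "F \<in> Ob ?D" for F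
    using that by (simp add: inverting_functor_def)
  have G: "is_functor ?D ?E \<G>"
    unfolding is_functor_def
  proof (intro conjI functor_cat_category ballI)
    fix F assume F: "F \<in> Ob ?D"
    then show "FOb \<G> F \<in> Ob ?E" using ext_functor[OF iF[OF F]] by simp
    show "FMor \<G> F F (idm ?D F) = idm ?E (FOb \<G> F)" by simp
    fix F' \<alpha> assume F': "F' \<in> Ob ?D" and "\<alpha> \<in> Mor ?D F F'"
    then have a: "nat_trans D B F F' \<alpha>" by simp
    have "nat_trans loc B (ext_func B F) (ext_func B F') \<alpha>"
      unfolding nat_trans_def
    proof (intro conjI ballI)
      fix X Y f assume "X \<in> Ob loc" "Y \<in> Ob loc" "f \<in> Mor loc X Y"
      then obtain p where p: "path D \<Sigma> X p Y" "f = cls X Y p" using loc_MorE by blast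
      show "cmp B (FOb (ext_func B F) X) (FOb (ext_func B F) Y) (FOb (ext_func B F') Y) (\<alpha> Y) (FMor (ext_func B F) X Y f) =
        cmp B (FOb (ext_func B F) X) (FOb (ext_func B F') X) (FOb (ext_func B F') Y) (FMor (ext_func B F') X Y f) (\<alpha> X)"
        unfolding p(2) ext_FMor[OF iF[OF F] p(1)] ext_FMor[OF iF[OF F'] p(1)]
        using ev_natural[OF iF[OF F] iF[OF F'] a p(1)] by simp
    qed (use nat_transD(1,2)[OF a] in simp_all)
    then show "FMor \<G> F F' \<alpha> \<in> Mor ?E (FOb \<G> F) (FOb \<G> F')" by simp
    fix F'' \<beta>
    show "FMor \<G> F F'' (cmp ?D F F' F'' \<beta> \<alpha>) = cmp ?E (FOb \<G> F) (FOb \<G> F') (FOb \<G> F'') (FMor \<G> F' F'' \<beta>) (FMor \<G> F F' \<alpha>)"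
      by simp
  qed
  note pf = precomp_functor[OF B]
  show "is_equivalence ?E ?D (precomp D Q)"
    unfolding is_equivalence_def
  proof (intro conjI exI[of _ \<G>] pf G)
    show "nat_isomorphic ?E ?E (comp_func \<G> (precomp D Q)) id_func"
    proof (rule agree_nat_isomorphic[OF functor_comp[OF pf G]])
      fix F X Y f assume F: "is_functor loc B F" and "X \<in> Ob loc" "Y \<in> Ob loc" "f \<in> Mor loc X Y"
      then obtain p where p: "path D \<Sigma> X p Y" "f = cls X Y p" using loc_MorE by blast
      have "comp_func F Q \<in> Ob ?D" using functorD(3)[OF pf, of F] F by simp
      then show "FMor (FOb (comp_func \<G> (precomp D Q)) F) X Y f = FMor F X Y f"
        unfolding p(2) using ext_FMor[OF iF p(1)] ev_comp_Q[OF F p(1)] by simp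
    qed (simp_all add: precomp_def)
    show "nat_isomorphic ?D ?D (comp_func (precomp D Q) \<G>) id_func"
    proof (rule agree_nat_isomorphic[OF functor_comp[OF G pf]])
      fix F X Y f assume F: "is_functor D B F" "inverts \<Sigma> B F" and "X \<in> Ob D" "Y \<in> Ob D" "f \<in> Mor D X Y"
      then show "FMor (FOb (comp_func (precomp D Q) \<G>) F) X Y f = FMor F X Y f"
        using ext_Q[of B F X Y f] by (simp add: inverting_functor_def)
    qed (simp_all add: precomp_def)
  qed
qed

end

section \<open>Sets and universes\<close>

context zfc_sets
begin

definition the_set :: "'v set \<Rightarrow> 'v" where
  "the_set A = (SOME x. elts mem x = A)"

lemma elts_the_set: "\<exists>x. elts mem x = A \<Longrightarrow> elts mem (the_set A) = A"
  unfolding the_set_def by (rule someI_ex)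

definition upair :: "'v \<Rightarrow> 'v \<Rightarrow> 'v" where
  "upair x y = the_set {x, y}"

lemma elts_upair [simp]: "elts mem (upair x y) = {x, y}"
  unfolding upair_def by (rule elts_the_set[OF pairing])

definition opair :: "'v \<Rightarrow> 'v \<Rightarrow> 'v" where
  "opair x y = upair (upair x x) (upair x y)"

lemma upair_eq: "upair a b = upair c d \<longleftrightarrow> {a, b} = {c, d}"
proof
  assume "upair a b = upair c d"
  then have "elts mem (upair a b) = elts mem (upair c d)" by (rule arg_cong)
  then show "{a, b} = {c, d}" by (simp only: elts_upair)
next
  assume "{a, b} = {c, d}"
  then have "elts mem (upair a b) = elts mem (upair c d)" by (simp only: elts_upair)
  then show "upair a b = upair c d" by (rule extensionality)
qed

lemma opair_eq [simp]: "opair a b = opair c d \<longleftrightarrow> a = c \<and> b = d"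
  unfolding opair_def upair_eq doubleton_eq_iff by auto

definition ofst :: "'v \<Rightarrow> 'v" where "ofst p = (THE x. \<exists>y. p = opair x y)"
definition osnd :: "'v \<Rightarrow> 'v" where "osnd p = (THE y. \<exists>x. p = opair x y)"

lemma ofst_opair [simp]: "ofst (opair x y) = x" and osnd_opair [simp]: "osnd (opair x y) = y"
  by (auto simp: ofst_def osnd_def)

lemma empty_set: "\<exists>e. elts mem e = {}"
  using infinity by blast

lemma subset_set:
  assumes "A \<subseteq> elts mem x" shows "\<exists>a. elts mem a = A"
proof (cases "A = {}")
  case True then show ?thesis using empty_set by simp
next
  case False
  then obtain a where "a \<in> A" by blast
  then have "(\<lambda>y. if y \<in> A then y else a) ` elts mem x = A" using assms by auto
  then show ?thesis using replacement by metis
qed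

definition zero_set :: 'v where "zero_set = the_set {}"

lemma elts_zero_set [simp]: "elts mem zero_set = {}"
  unfolding zero_set_def by (rule elts_the_set[OF empty_set])

lemma opair_nonzero: "opair x y \<noteq> zero_set"
proof
  assume "opair x y = zero_set"
  then have "elts mem (opair x y) = elts mem zero_set" by (rule arg_cong)
  then show False by (simp add: opair_def)
qed

text \<open>Pairs are never the empty set. This separates the empty path from the others and the two
  directions of a step from each other.\<close>

fun path_code :: "(bool \<times> 'v \<times> 'v) list \<Rightarrow> 'v" where
  "path_code [] = zero_set"
| "path_code ((b, Y, f) # p) = opair (if b then zero_set else opair zero_set zero_set) (opair Y (opair f (path_code p)))"

lemma inj_path_code: "inj path_code"
proof (rule injI)
  show "path_code p = path_code q \<Longrightarrow> p = q" for p q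
  proof (induction p arbitrary: q)
    case Nil
    then show ?case using opair_nonzero[THEN not_sym] by (cases q) auto
  next
    case (Cons s p)
    obtain b Y f where s: "s = (b, Y, f)" by (cases s)
    show ?case
    proof (cases q)
      case Nil then show ?thesis using Cons.prems s opair_nonzero by simp
    next
      case (Cons t q')
      obtain c Z g where t: "t = (c, Z, g)" by (cases t)
      show ?thesis using Cons.prems Cons.IH[of q'] opair_nonzero[THEN not_sym] opair_nonzero
        unfolding Cons s t by (auto split: if_splits)
    qed
  qed
qed

section \<open>The category of sets\<close>

definition cfun :: "'v \<Rightarrow> ('v \<Rightarrow> 'v) \<Rightarrow> 'v" where
  "cfun m f = the_set ((\<lambda>x. opair x (f x)) ` elts mem m)"

definition app :: "'v \<Rightarrow> 'v \<Rightarrow> 'v" where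
  "app g x = (THE y. opair x y \<in> elts mem g)"

lemma elts_cfun: "elts mem (cfun m f) = (\<lambda>x. opair x (f x)) ` elts mem m"
  unfolding cfun_def by (rule elts_the_set[OF replacement])

lemma app_cfun [simp]: "x \<in> elts mem m \<Longrightarrow> app (cfun m f) x = f x"
  unfolding app_def elts_cfun by (rule the_equality) auto

lemma cfun_cong: "(\<And>x. x \<in> elts mem m \<Longrightarrow> f x = g x) \<Longrightarrow> cfun m f = cfun m g"
  unfolding cfun_def by (rule arg_cong[of _ _ the_set]) auto

text \<open>Objects and morphisms are elements of the type of sets, so that this category is a
  legitimate test category for the quotient. It receives the functors that tell the morphisms of the
  quotient apart.\<close>

definition Set_cat :: "('v, 'v) cat" where
  "Set_cat = \<lparr>Ob = UNIV, Mor = (\<lambda>m n. {cfun m f |f. f \<in> elts mem m \<rightarrow> elts mem n}),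
     idm = (\<lambda>m. cfun m (\<lambda>x. x)), cmp = (\<lambda>m n k g f. cfun m (\<lambda>x. app g (app f x)))\<rparr>"

lemma Set_sel [simp]:
  "Ob Set_cat = UNIV" "Mor Set_cat m n = {cfun m f |f. f \<in> elts mem m \<rightarrow> elts mem n}"
  "idm Set_cat m = cfun m (\<lambda>x. x)" "cmp Set_cat m n k g f = cfun m (\<lambda>x. app g (app f x))"
  by (simp_all add: Set_cat_def)

lemma Set_category: "category Set_cat"
proof
  fix W X Y Z f g h
  assume "f \<in> Mor Set_cat W X" "g \<in> Mor Set_cat X Y"
  then obtain f' g' where f: "f = cfun W f'" "f' \<in> elts mem W \<rightarrow> elts mem X"
    and g: "g = cfun X g'" "g' \<in> elts mem X \<rightarrow> elts mem Y"
    by auto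
  have gf: "cmp Set_cat W X Y g f = cfun W (\<lambda>x. g' (f' x))"
    using f g by (auto intro!: cfun_cong simp: Pi_iff)
  then show "cmp Set_cat W X Y g f \<in> Mor Set_cat W Y" using f g by auto
  assume "h \<in> Mor Set_cat Y Z"
  then obtain h' where h: "h = cfun Y h'" "h' \<in> elts mem Y \<rightarrow> elts mem Z" by auto
  show "cmp Set_cat W Y Z h (cmp Set_cat W X Y g f) = cmp Set_cat W X Z (cmp Set_cat X Y Z h g) f"
    unfolding gf using f g h by (auto intro!: cfun_cong simp: Pi_iff)
qed (auto intro!: cfun_cong simp: Pi_iff)

end

section \<open>Closure properties of universes and of smallness\<close>

locale universe = zfc_sets +
  fixes U
  assumes universe: "grothendieck_universe mem U"
begin

lemmas U_axioms = universe[unfolded grothendieck_universe_def]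

lemma U_trans: "\<lbrakk>mem x y; mem y U\<rbrakk> \<Longrightarrow> mem x U"
  using U_axioms[THEN conjunct1] by blast

lemma U_upair: assumes "mem x U" "mem y U" shows "mem (upair x y) U"
proof -
  obtain p where "mem p U" "elts mem p = {x, y}"
    using U_axioms[THEN conjunct2, THEN conjunct1] assms by blast
  then show ?thesis using extensionality[of p "upair x y"] by simp
qed

lemma U_opair: "\<lbrakk>mem x U; mem y U\<rbrakk> \<Longrightarrow> mem (opair x y) U"
  unfolding opair_def by (intro U_upair)

lemma U_power: "mem x U \<Longrightarrow> \<exists>p. mem p U \<and> elts mem p = {y. elts mem y \<subseteq> elts mem x}"
  using U_axioms[THEN conjunct2, THEN conjunct2, THEN conjunct1] by blast

text \<open>A subset of \<open>x\<close> is an element of the power set of \<open>x\<close>, which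
  belongs to \<open>U\<close>, and \<open>U\<close> is transitive.\<close>

lemma U_subset:
  assumes "mem x U" "elts mem y \<subseteq> elts mem x" shows "mem y U"
proof -
  obtain p where "mem p U" "elts mem p = {y. elts mem y \<subseteq> elts mem x}"
    using U_power[OF assms(1)] by blast
  then show ?thesis using U_trans[of y p] assms(2) unfolding elts_def by blast
qed

lemma U_union:
  assumes "mem j U" "\<And>i. i \<in> elts mem j \<Longrightarrow> mem (f i) U"
  shows "\<exists>u. mem u U \<and> elts mem u = (\<Union>i \<in> elts mem j. elts mem (f i))"
  using U_axioms[THEN conjunct2, THEN conjunct2, THEN conjunct2, rule_format, OF assms(1), of f] assms(2)
  by simp

lemma U_image:
  assumes "mem j U" "\<And>i. i \<in> elts mem j \<Longrightarrow> mem (f i) U"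
  shows "\<exists>u. mem u U \<and> elts mem u = f ` elts mem j"
proof -
  \<comment> \<open>The image is written as a union of singletons, for which closure under indexed
    unions applies.\<close>
  obtain u where "mem u U" "elts mem u = (\<Union>i \<in> elts mem j. elts mem (upair (f i) (f i)))"
    using U_union[OF assms(1), of "\<lambda>i. upair (f i) (f i)"] U_upair assms(2) by blast
  then show ?thesis by (intro exI[of _ u]) auto
qed

lemma U_product:
  assumes "mem a U" "mem b U"
  shows "\<exists>p. mem p U \<and> elts mem p = (\<lambda>(x, y). opair x y) ` (elts mem a \<times> elts mem b)"
proof -
  have in_U: "x \<in> elts mem a \<Longrightarrow> mem x U" "y \<in> elts mem b \<Longrightarrow> mem y U" for x y
    using assms U_trans unfolding elts_def by blast+
  have "\<exists>u. mem u U \<and> elts mem u = opair x ` elts mem b" if "x \<in> elts mem a" for x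
    using U_image[OF assms(2), of "opair x"] U_opair in_U that by blast
  then obtain c where c: "\<And>x. x \<in> elts mem a \<Longrightarrow> mem (c x) U \<and> elts mem (c x) = opair x ` elts mem b"
    by metis
  obtain u where "mem u U" "elts mem u = (\<Union>x \<in> elts mem a. elts mem (c x))"
    using U_union[OF assms(1), of c] c by blast
  then show ?thesis using c by (intro exI[of _ u]) auto
qed

lemma U_smallI: "mem u U \<Longrightarrow> inj_on f S \<Longrightarrow> f ` S \<subseteq> elts mem u \<Longrightarrow> U_small mem U S"
proof -
  assume u: "mem u U" and f: "inj_on f S" "f ` S \<subseteq> elts mem u"
  obtain a where a: "elts mem a = f ` S" using subset_set[OF f(2)] by blast
  then have "mem a U" using U_subset[OF u] f(2) by simp
  moreover have "S \<approx> elts mem a" unfolding a using f(1) inj_on_image_eqpoll_self eqpoll_sym by blast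
  ultimately show ?thesis unfolding U_small_def by blast
qed

lemma U_smallE:
  assumes "U_small mem U S"
  obtains u f where "mem u U" "bij_betw f S (elts mem u)"
  using assms unfolding U_small_def eqpoll_def by blast

lemma U_small_inj:
  assumes "U_small mem U S" "inj_on f T" "f ` T \<subseteq> S"
  shows "U_small mem U T"
proof -
  obtain u g where u: "mem u U" "bij_betw g S (elts mem u)" using U_smallE[OF assms(1)] .
  show ?thesis
  proof (rule U_smallI[OF u(1)])
    show "inj_on (g \<circ> f) T"
      using assms(2,3) u(2) by (meson bij_betw_imp_inj_on comp_inj_on inj_on_subset)
    show "(g \<circ> f) ` T \<subseteq> elts mem u" using assms(3) u(2) unfolding bij_betw_def by auto
  qed
qed

lemma U_small_image:
  assumes "U_small mem U S" shows "U_small mem U (f ` S)"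
proof (rule U_small_inj[OF assms])
  show "inj_on (inv_into S f) (f ` S)" by (rule inj_on_inv_into) simp
  show "inv_into S f ` (f ` S) \<subseteq> S" by (auto intro: inv_into_into)
qed

lemma U_small_subset: "\<lbrakk>U_small mem U S; T \<subseteq> S\<rbrakk> \<Longrightarrow> U_small mem U T"
  using U_small_inj[of S id T] by simp

lemma U_small_elts: "mem u U \<Longrightarrow> U_small mem U (elts mem u)"
  unfolding U_small_def by auto

text \<open>A dependent function is coded by its graph, a subset of the product of the index set
  with the union of the fibres. The power set of that product lies in \<open>U\<close>.\<close>

lemma U_small_PiE:
  assumes I: "U_small mem U I" and S: "\<And>i. i \<in> I \<Longrightarrow> U_small mem U (S i)"
  shows "U_small mem U (PiE I S)"
proof -
  obtain a g where a: "mem a U" "bij_betw g I (elts mem a)" using U_smallE[OF I] .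
  have "\<exists>u h. mem u U \<and> bij_betw h (S i) (elts mem u)" if "i \<in> I" for i
    using U_smallE[OF S[OF that]] by metis
  then obtain u h where u: "\<And>i. i \<in> I \<Longrightarrow> mem (u i) U \<and> bij_betw (h i) (S i) (elts mem (u i))"
    by metis
  define k where "k = inv_into I g"
  have k: "k j \<in> I" "g (k j) = j" if "j \<in> elts mem a" for j
    using a(2) that unfolding k_def bij_betw_def by (auto simp: inv_into_into f_inv_into_f)
  have kg: "k (g i) = i" if "i \<in> I" for i
    using a(2) that unfolding k_def bij_betw_def by simp
  obtain w where w: "mem w U" "elts mem w = (\<Union>j \<in> elts mem a. elts mem (u (k j)))"
    using U_union[OF a(1), of "\<lambda>j. u (k j)"] u k by blast
  have uw: "elts mem (u i) \<subseteq> elts mem w" if "i \<in> I" for i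
    unfolding w using kg[OF that] a(2) that by (metis UN_upper bij_betwE)
  obtain p where p: "mem p U" "elts mem p = (\<lambda>(x, y). opair x y) ` (elts mem a \<times> elts mem w)"
    using U_product[OF a(1) w(1)] by blast
  obtain P where P: "mem P U" "elts mem P = {y. elts mem y \<subseteq> elts mem p}"
    using U_power[OF p(1)] by blast
  \<comment> \<open>The graph of \<open>f\<close> after moving indices and values into elements of
    \<open>U\<close> along the bijections \<open>g\<close> and \<open>h i\<close>.\<close>
  define gr where "gr f = (\<lambda>i. opair (g i) (h i (f i))) ` I" for f
  have gr: "gr f \<subseteq> elts mem p" if f: "f \<in> PiE I S" for f
  proof -
    have "h i (f i) \<in> elts mem w" "g i \<in> elts mem a" if i: "i \<in> I" for i
      using uw[OF i] u[OF i] a(2) f i by (blast dest: bij_betwE)+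
    then show ?thesis unfolding gr_def p by auto
  qed
  have el: "elts mem (the_set (gr f)) = gr f" if "f \<in> PiE I S" for f
    by (rule elts_the_set[OF subset_set[OF gr[OF that]]])
  show ?thesis
  proof (rule U_smallI[OF P(1)])
    show "(\<lambda>f. the_set (gr f)) ` PiE I S \<subseteq> elts mem P"
    proof (rule image_subsetI)
      fix f assume f: "f \<in> PiE I S"
      show "the_set (gr f) \<in> elts mem P" unfolding P(2) mem_Collect_eq el[OF f] by (rule gr[OF f])
    qed
    show "inj_on (\<lambda>f. the_set (gr f)) (PiE I S)"
    proof (rule inj_onI)
      fix f f' assume f: "f \<in> PiE I S" "f' \<in> PiE I S" and "the_set (gr f) = the_set (gr f')"
      then have "elts mem (the_set (gr f)) = elts mem (the_set (gr f'))" by (simp only:)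
      then have eq: "gr f = gr f'" unfolding el[OF f(1)] el[OF f(2)] .
      show "f = f'"
      proof (rule PiE_ext[OF f])
        fix i assume i: "i \<in> I"
        have "opair (g i) (h i (f i)) \<in> gr f" unfolding gr_def using i by blast
        then have "opair (g i) (h i (f i)) \<in> gr f'" unfolding eq .
        then obtain j where j: "j \<in> I" "g i = g j" "h i (f i) = h j (f' j)" unfolding gr_def by auto
        then have "i = j" using a(2) i unfolding bij_betw_def inj_on_def by blast
        then have "h i (f i) = h i (f' i)" using j(3) by (simp only:)
        then show "f i = f' i" using u[OF i] f i unfolding bij_betw_def inj_on_def by blast
      qed
    qed
  qed
qed

lemma U_small_Times:
  assumes "U_small mem U A" "U_small mem U B" shows "U_small mem U (A \<times> B)"
proof -
  obtain a f where a: "mem a U" "bij_betw f A (elts mem a)" using U_smallE[OF assms(1)] .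
  obtain b g where b: "mem b U" "bij_betw g B (elts mem b)" using U_smallE[OF assms(2)] .
  obtain p where p: "mem p U" "elts mem p = (\<lambda>(x, y). opair x y) ` (elts mem a \<times> elts mem b)"
    using U_product[OF a(1) b(1)] by blast
  show ?thesis
  proof (rule U_smallI[OF p(1)])
    show "inj_on (\<lambda>(x, y). opair (f x) (g y)) (A \<times> B)"
      using a(2) b(2) by (auto simp: inj_on_def bij_betw_def)
    have "opair (f x) (g y) \<in> elts mem p" if "x \<in> A" "y \<in> B" for x y
      unfolding p using bij_betwE[OF a(2)] bij_betwE[OF b(2)] that
      by (intro image_eqI[of _ _ "(f x, g y)"]) auto
    then show "(\<lambda>(x, y). opair (f x) (g y)) ` (A \<times> B) \<subseteq> elts mem p" by auto
  qed
qed

end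

section \<open>The bounded homotopy category\<close>

lemma UN_eqI: "\<lbrakk>A \<noteq> {}; \<And>a. a \<in> A \<Longrightarrow> B a = S\<rbrakk> \<Longrightarrow> (\<Union>a \<in> A. B a) = S"
  by auto

context additive_category
begin

abbreviation cplx :: "('o, 'a) complex set" where
  "cplx \<equiv> bounded_complexes C"

lemma cob_in: "X \<in> cplx \<Longrightarrow> cob X n \<in> Ob C"
  by (simp add: bounded_complexes_def)

text \<open>The target index is a variable constrained by an equation. Simp rearranges indices, and
  a rule with the literal target \<open>n + 1\<close> would fail to match; the premise is left to
  arithmetic.\<close>

lemma cd_in: "\<lbrakk>X \<in> cplx; m = n + 1\<rbrakk> \<Longrightarrow> cd X n \<in> Mor C (cob X n) (cob X m)"
  by (simp add: bounded_complexes_def)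

lemma cd_cd:
  "\<lbrakk>X \<in> cplx; m = n + 1; k = n + 2\<rbrakk>
   \<Longrightarrow> cmp C (cob X n) (cob X m) (cob X k) (cd X m) (cd X n) = mzero C (cob X n) (cob X k)"
  by (simp add: bounded_complexes_def)

lemma cd_cd_cmp:
  assumes "X \<in> cplx" "m = n + 1" "k = n + 2" "W \<in> Ob C" "f \<in> Mor C W (cob X n)"
  shows "cmp C W (cob X m) (cob X k) (cd X m) (cmp C W (cob X n) (cob X m) (cd X n) f)
    = mzero C W (cob X k)"
  using assms by (simp add: cob_in cd_in cd_cd cmp_0_left cmp_assoc)

lemmas cx_in = cob_in cd_in mor_in
lemmas cx_simps = cd_cd cd_cd_cmp mor_simps

lemma cm_in: "f \<in> chain_maps C X Y \<Longrightarrow> f n \<in> Mor C (cob X n) (cob Y n)"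
  by (simp add: chain_maps_def)

lemma cm_cd:
  "\<lbrakk>f \<in> chain_maps C X Y; m = n + 1\<rbrakk>
   \<Longrightarrow> cmp C (cob X n) (cob X m) (cob Y m) (f m) (cd X n) =
       cmp C (cob X n) (cob Y n) (cob Y m) (cd Y n) (f n)"
  by (simp add: chain_maps_def)

lemma cm_cd_cmp:
  assumes "f \<in> chain_maps C X Y" "m = n + 1" "X \<in> cplx" "Y \<in> cplx" "W \<in> Ob C"
    "g \<in> Mor C W (cob X n)"
  shows "cmp C W (cob X m) (cob Y m) (f m) (cmp C W (cob X n) (cob X m) (cd X n) g) =
    cmp C W (cob Y n) (cob Y m) (cd Y n) (cmp C W (cob X n) (cob Y n) (f n) g)"
  using assms by (simp add: cob_in cd_in cm_in cm_cd cmp_assoc)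

lemma chain_mapsI:
  assumes "\<And>n. f n \<in> Mor C (cob X n) (cob Y n)"
    "\<And>n. cmp C (cob X n) (cob X (n + 1)) (cob Y (n + 1)) (f (n + 1)) (cd X n) =
       cmp C (cob X n) (cob Y n) (cob Y (n + 1)) (cd Y n) (f n)"
  shows "f \<in> chain_maps C X Y"
  using assms by (simp add: chain_maps_def)

lemma chain_id: "X \<in> cplx \<Longrightarrow> (\<lambda>n. idm C (cob X n)) \<in> chain_maps C X X"
  by (rule chain_mapsI) (simp_all add: cx_in cx_simps)

lemma chain_cmp:
  "\<lbrakk>X \<in> cplx; Y \<in> cplx; Z \<in> cplx; f \<in> chain_maps C X Y; g \<in> chain_maps C Y Z\<rbrakk>
   \<Longrightarrow> (\<lambda>n. cmp C (cob X n) (cob Y n) (cob Z n) (g n) (f n)) \<in> chain_maps C X Z"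
  by (rule chain_mapsI) (simp_all add: cx_in cx_simps cm_in cm_cd cm_cd_cmp)

lemma chain_madd:
  "\<lbrakk>X \<in> cplx; Y \<in> cplx; f \<in> chain_maps C X Y; g \<in> chain_maps C X Y\<rbrakk>
   \<Longrightarrow> (\<lambda>n. madd C (cob X n) (cob Y n) (f n) (g n)) \<in> chain_maps C X Y"
  by (rule chain_mapsI) (simp_all add: cx_in cx_simps cm_in cm_cd)

lemma chain_zero:
  "\<lbrakk>X \<in> cplx; Y \<in> cplx\<rbrakk> \<Longrightarrow> (\<lambda>n. mzero C (cob X n) (cob Y n)) \<in> chain_maps C X Y"
  by (rule chain_mapsI) (simp_all add: cx_in cx_simps)


definition homotopies :: "('o, 'a) complex \<Rightarrow> ('o, 'a) complex \<Rightarrow> (int \<Rightarrow> 'a) set" where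
  "homotopies X Y = {s. \<forall>n. s n \<in> Mor C (cob X n) (cob Y (n - 1))}"

text \<open>The boundary \<open>d s + s d\<close> of a family \<open>s\<close> of degree -1; two
  chain maps are homotopic when they differ by such a boundary.\<close>

definition hbd :: "('o, 'a) complex \<Rightarrow> ('o, 'a) complex \<Rightarrow> (int \<Rightarrow> 'a) \<Rightarrow> int \<Rightarrow> 'a" where
  "hbd X Y s n = madd C (cob X n) (cob Y n)
     (cmp C (cob X n) (cob Y (n - 1)) (cob Y n) (cd Y (n - 1)) (s n))
     (cmp C (cob X n) (cob X (n + 1)) (cob Y n) (s (n + 1)) (cd X n))"

lemma homotopic_iff:
  "homotopic C X Y f g \<longleftrightarrow>
     (\<exists>s \<in> homotopies X Y. \<forall>n. f n = madd C (cob X n) (cob Y n) (g n) (hbd X Y s n))"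
  by (auto simp: homotopic_def homotopies_def hbd_def)

lemma hom_in: "\<lbrakk>s \<in> homotopies X Y; m = n - 1\<rbrakk> \<Longrightarrow> s n \<in> Mor C (cob X n) (cob Y m)"
  by (simp add: homotopies_def)

lemma homotopiesI: "(\<And>n. s n \<in> Mor C (cob X n) (cob Y (n - 1))) \<Longrightarrow> s \<in> homotopies X Y"
  by (simp add: homotopies_def)

lemma hbd_in: "\<lbrakk>X \<in> cplx; Y \<in> cplx; s \<in> homotopies X Y\<rbrakk> \<Longrightarrow> hbd X Y s n \<in> Mor C (cob X n) (cob Y n)"
  by (simp add: hbd_def hom_in cx_in)

lemma homotopic_refl:
  assumes "X \<in> cplx" "Y \<in> cplx" "f \<in> chain_maps C X Y"
  shows "homotopic C X Y f f"
  unfolding homotopic_iff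
  by (rule bexI[of _ "\<lambda>n. mzero C (cob X n) (cob Y (n - 1))"])
    (use assms in \<open>simp_all add: homotopiesI hom_in hbd_def cx_in cx_simps cm_in\<close>)

lemma homotopic_sym:
  assumes "X \<in> cplx" "Y \<in> cplx" "f \<in> chain_maps C X Y" "g \<in> chain_maps C X Y"
    and "homotopic C X Y f g"
  shows "homotopic C X Y g f"
proof -
  obtain s where s: "s \<in> homotopies X Y"
    and f: "\<And>n. f n = madd C (cob X n) (cob Y n) (g n) (hbd X Y s n)"
    using assms(5) unfolding homotopic_iff by blast
  show ?thesis
    unfolding homotopic_iff f
    by (rule bexI[of _ "\<lambda>n. mneg C (cob X n) (cob Y (n - 1)) (s n)"])
     (use assms s in \<open>simp_all add: homotopiesI hom_in hbd_def cx_in cx_simps cm_in madd_ac\<close>)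
qed

lemma homotopic_trans:
  assumes "X \<in> cplx" "Y \<in> cplx" "f \<in> chain_maps C X Y" "g \<in> chain_maps C X Y" "h \<in> chain_maps C X Y"
    and "homotopic C X Y f g" "homotopic C X Y g h"
  shows "homotopic C X Y f h"
proof -
  obtain s where s: "s \<in> homotopies X Y"
    and f: "\<And>n. f n = madd C (cob X n) (cob Y n) (g n) (hbd X Y s n)"
    using assms(6) unfolding homotopic_iff by blast
  obtain t where t: "t \<in> homotopies X Y"
    and g: "\<And>n. g n = madd C (cob X n) (cob Y n) (h n) (hbd X Y t n)"
    using assms(7) unfolding homotopic_iff by blast
  show ?thesis
    unfolding homotopic_iff f g
    by (rule bexI[of _ "\<lambda>n. madd C (cob X n) (cob Y (n - 1)) (s n) (t n)"])
     (use assms s t in \<open>simp_all add: homotopiesI hom_in hbd_def cx_in cx_simps cm_in madd_ac\<close>)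
qed

abbreviation hc :: "('o, 'a) complex \<Rightarrow> ('o, 'a) complex \<Rightarrow> (int \<Rightarrow> 'a) \<Rightarrow> (int \<Rightarrow> 'a) set" where
  "hc \<equiv> homotopy_class C"

lemma hc_self: "\<lbrakk>X \<in> cplx; Y \<in> cplx; f \<in> chain_maps C X Y\<rbrakk> \<Longrightarrow> f \<in> hc X Y f"
  by (simp add: homotopy_class_def homotopic_refl)

lemma hc_eq_iff:
  assumes "X \<in> cplx" "Y \<in> cplx" "f \<in> chain_maps C X Y" "g \<in> chain_maps C X Y"
  shows "hc X Y f = hc X Y g \<longleftrightarrow> homotopic C X Y f g"
proof
  assume "hc X Y f = hc X Y g"
  then show "homotopic C X Y f g" using hc_self[OF assms(1-3)] by (auto simp: homotopy_class_def)
next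
  assume "homotopic C X Y f g"
  then show "hc X Y f = hc X Y g"
    using assms homotopic_sym homotopic_trans unfolding homotopy_class_def by blast
qed

lemma hc_eqI:
  assumes "X \<in> cplx" "Y \<in> cplx" "f \<in> chain_maps C X Y" "g \<in> chain_maps C X Y"
    and "s \<in> homotopies X Y" "\<And>n. f n = madd C (cob X n) (cob Y n) (g n) (hbd X Y s n)"
  shows "hc X Y f = hc X Y g"
  using assms hc_eq_iff homotopic_iff by blast

lemma hc_eqE:
  assumes "hc X Y f = hc X Y g" "X \<in> cplx" "Y \<in> cplx" "f \<in> chain_maps C X Y" "g \<in> chain_maps C X Y"
  obtains s where "s \<in> homotopies X Y" "\<And>n. f n = madd C (cob X n) (cob Y n) (g n) (hbd X Y s n)"
  using assms hc_eq_iff homotopic_iff by metis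

lemma hc_mem:
  assumes "X \<in> cplx" "Y \<in> cplx" "f \<in> chain_maps C X Y" "f' \<in> hc X Y f"
  shows "f' \<in> chain_maps C X Y" "hc X Y f' = hc X Y f"
  using assms hc_eq_iff by (auto simp: homotopy_class_def)

text \<open>The two factors are changed one after the other: a homotopy \<open>t\<close> for
  \<open>g\<close> contributes \<open>t f'\<close>, and a homotopy \<open>s\<close> for
  \<open>f\<close> contributes \<open>g s\<close>. That these are homotopies uses that
  \<open>f'\<close> and \<open>g\<close> commute with the differentials.\<close>

lemma hc_cmp_cong:
  assumes "X \<in> cplx" "Y \<in> cplx" "Z \<in> cplx"
    and f: "f \<in> chain_maps C X Y" "f' \<in> chain_maps C X Y" "hc X Y f' = hc X Y f"
    and g: "g \<in> chain_maps C Y Z" "g' \<in> chain_maps C Y Z" "hc Y Z g' = hc Y Z g"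
  shows "hc X Z (\<lambda>n. cmp C (cob X n) (cob Y n) (cob Z n) (g' n) (f' n)) =
    hc X Z (\<lambda>n. cmp C (cob X n) (cob Y n) (cob Z n) (g n) (f n))"
proof -
  obtain s where s: "s \<in> homotopies X Y"
    and fs: "\<And>n. f' n = madd C (cob X n) (cob Y n) (f n) (hbd X Y s n)"
    using hc_eqE[OF f(3) assms(1,2) f(2,1)] by blast
  obtain t where t: "t \<in> homotopies Y Z"
    and gt: "\<And>n. g' n = madd C (cob Y n) (cob Z n) (g n) (hbd Y Z t n)"
    using hc_eqE[OF g(3) assms(2,3) g(2,1)] by blast
  have chm: "(\<lambda>n. cmp C (cob X n) (cob Y n) (cob Z n) (g' n) (f' n)) \<in> chain_maps C X Z"
    "(\<lambda>n. cmp C (cob X n) (cob Y n) (cob Z n) (g n) (f' n)) \<in> chain_maps C X Z"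
    "(\<lambda>n. cmp C (cob X n) (cob Y n) (cob Z n) (g n) (f n)) \<in> chain_maps C X Z"
    using assms chain_cmp by blast+
  have "hc X Z (\<lambda>n. cmp C (cob X n) (cob Y n) (cob Z n) (g' n) (f' n)) =
    hc X Z (\<lambda>n. cmp C (cob X n) (cob Y n) (cob Z n) (g n) (f' n))"
  proof (rule hc_eqI[OF assms(1,3) chm(1,2)])
    show "(\<lambda>n. cmp C (cob X n) (cob Y n) (cob Z (n - 1)) (t n) (f' n)) \<in> homotopies X Z"
      using assms(1-3) f(2) t by (simp add: homotopiesI hom_in cx_in cm_in)
    then show "cmp C (cob X n) (cob Y n) (cob Z n) (g' n) (f' n) = madd C (cob X n) (cob Z n)
        (cmp C (cob X n) (cob Y n) (cob Z n) (g n) (f' n))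
        (hbd X Z (\<lambda>n. cmp C (cob X n) (cob Y n) (cob Z (n - 1)) (t n) (f' n)) n)" for n
      using assms(1-3) f(2) g(1) t unfolding gt hbd_def
      by (simp add: hom_in cx_in cx_simps cm_in cm_cd)
  qed
  also have "\<dots> = hc X Z (\<lambda>n. cmp C (cob X n) (cob Y n) (cob Z n) (g n) (f n))"
  proof (rule hc_eqI[OF assms(1,3) chm(2,3)])
    show "(\<lambda>n. cmp C (cob X n) (cob Y (n - 1)) (cob Z (n - 1)) (g (n - 1)) (s n)) \<in> homotopies X Z"
      using assms(1-3) g(1) s by (simp add: homotopiesI hom_in cx_in cm_in)
    then show "cmp C (cob X n) (cob Y n) (cob Z n) (g n) (f' n) = madd C (cob X n) (cob Z n)
        (cmp C (cob X n) (cob Y n) (cob Z n) (g n) (f n))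
        (hbd X Z (\<lambda>n. cmp C (cob X n) (cob Y (n - 1)) (cob Z (n - 1)) (g (n - 1)) (s n)) n)" for n
      using assms(1-3) f(1) g(1) s unfolding fs hbd_def
      by (simp add: hom_in cx_in cx_simps cm_in cm_cd_cmp)
  qed
  finally show ?thesis .
qed

lemma hc_madd_cong:
  assumes "X \<in> cplx" "Y \<in> cplx"
    and f: "f \<in> chain_maps C X Y" "f' \<in> chain_maps C X Y" "hc X Y f' = hc X Y f"
    and g: "g \<in> chain_maps C X Y" "g' \<in> chain_maps C X Y" "hc X Y g' = hc X Y g"
  shows "hc X Y (\<lambda>n. madd C (cob X n) (cob Y n) (f' n) (g' n)) =
    hc X Y (\<lambda>n. madd C (cob X n) (cob Y n) (f n) (g n))"
proof -
  obtain s where s: "s \<in> homotopies X Y"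
    and fs: "\<And>n. f' n = madd C (cob X n) (cob Y n) (f n) (hbd X Y s n)"
    using hc_eqE[OF f(3) assms(1,2) f(2,1)] by blast
  obtain t where t: "t \<in> homotopies X Y"
    and gt: "\<And>n. g' n = madd C (cob X n) (cob Y n) (g n) (hbd X Y t n)"
    using hc_eqE[OF g(3) assms(1,2) g(2,1)] by blast
  have chm: "(\<lambda>n. madd C (cob X n) (cob Y n) (f' n) (g' n)) \<in> chain_maps C X Y"
    using assms chain_madd by blast
  show ?thesis
  proof (rule hc_eqI[OF assms(1,2) chm chain_madd[OF assms(1,2) f(1) g(1)]])
    show "(\<lambda>n. madd C (cob X n) (cob Y (n - 1)) (s n) (t n)) \<in> homotopies X Y"
      using assms(1,2) s t by (simp add: homotopiesI hom_in cx_in)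
    show "madd C (cob X n) (cob Y n) (f' n) (g' n) = madd C (cob X n) (cob Y n)
        (madd C (cob X n) (cob Y n) (f n) (g n))
        (hbd X Y (\<lambda>n. madd C (cob X n) (cob Y (n - 1)) (s n) (t n)) n)" for n
      using assms(1,2) f(1) g(1) s t unfolding fs gt hbd_def
      by (simp add: hom_in cx_in cx_simps cm_in madd_ac)
  qed
qed

abbreviation K where "K \<equiv> Kb C"

lemma K_sel:
  "Ob K = cplx"
  "Mor K X Y = hc X Y ` chain_maps C X Y"
  "idm K X = hc X X (\<lambda>n. idm C (cob X n))"
  "mzero K X Y = hc X Y (\<lambda>n. mzero C (cob X n) (cob Y n))"
  "cmp K = cmp (Kb_pcat C)" "madd K = madd (Kb_pcat C)"
  "dist K = distinguished_triangles C"
  by (simp_all add: Kb_def Kb_pcat_def pcat.defs tcat.defs)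

text \<open>The composite is defined as a union over all representatives. The congruence lemma makes
  all members of the union equal, and reflexivity of homotopy makes the union nonempty.\<close>

lemma K_cmp:
  assumes "X \<in> cplx" "Y \<in> cplx" "Z \<in> cplx" "f \<in> chain_maps C X Y" "g \<in> chain_maps C Y Z"
  shows "cmp K X Y Z (hc Y Z g) (hc X Y f) = hc X Z (\<lambda>n. cmp C (cob X n) (cob Y n) (cob Z n) (g n) (f n))"
proof -
  have ne: "hc Y Z g \<noteq> {}" "hc X Y f \<noteq> {}"
    using hc_self assms by blast+
  have "hc X Z (\<lambda>n. cmp C (cob X n) (cob Y n) (cob Z n) (g' n) (f' n)) =
    hc X Z (\<lambda>n. cmp C (cob X n) (cob Y n) (cob Z n) (g n) (f n))"
    if "g' \<in> hc Y Z g" "f' \<in> hc X Y f" for f' g'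
    using that hc_mem assms by (intro hc_cmp_cong) blast+
  then have "(\<Union>g' \<in> hc Y Z g. \<Union>f' \<in> hc X Y f.
      hc X Z (\<lambda>n. cmp C (cob X n) (cob Y n) (cob Z n) (g' n) (f' n))) =
    hc X Z (\<lambda>n. cmp C (cob X n) (cob Y n) (cob Z n) (g n) (f n))"
    using ne by (intro UN_eqI)
  then show ?thesis unfolding K_sel(5) Kb_pcat_def by simp
qed

lemma K_madd:
  assumes "X \<in> cplx" "Y \<in> cplx" "f \<in> chain_maps C X Y" "g \<in> chain_maps C X Y"
  shows "madd K X Y (hc X Y f) (hc X Y g) = hc X Y (\<lambda>n. madd C (cob X n) (cob Y n) (f n) (g n))"
proof -
  have ne: "hc X Y g \<noteq> {}" "hc X Y f \<noteq> {}"
    using hc_self assms by blast+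
  have "hc X Y (\<lambda>n. madd C (cob X n) (cob Y n) (f' n) (g' n)) =
    hc X Y (\<lambda>n. madd C (cob X n) (cob Y n) (f n) (g n))"
    if "f' \<in> hc X Y f" "g' \<in> hc X Y g" for f' g'
    using that hc_mem assms by (intro hc_madd_cong) blast+
  then have "(\<Union>f' \<in> hc X Y f. \<Union>g' \<in> hc X Y g.
      hc X Y (\<lambda>n. madd C (cob X n) (cob Y n) (f' n) (g' n))) =
    hc X Y (\<lambda>n. madd C (cob X n) (cob Y n) (f n) (g n))"
    using ne by (intro UN_eqI)
  then show ?thesis unfolding K_sel(6) Kb_pcat_def by simp
qed

lemma hc_in: "f \<in> chain_maps C X Y \<Longrightarrow> hc X Y f \<in> Mor K X Y"
  by (simp add: K_sel)

lemma hc_cong: "(\<And>n. f n = g n) \<Longrightarrow> hc X Y f = hc X Y g"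
  by presburger

lemma K_mzero_in: "\<lbrakk>X \<in> cplx; Y \<in> cplx\<rbrakk> \<Longrightarrow> mzero K X Y \<in> Mor K X Y"
  by (simp add: K_sel chain_zero)

text \<open>Idempotence of zero is what shows that an additive functor out of \<open>K\<close>
  preserves zero.\<close>

lemma K_mzero_add: "\<lbrakk>X \<in> cplx; Y \<in> cplx\<rbrakk> \<Longrightarrow> madd K X Y (mzero K X Y) (mzero K X Y) = mzero K X Y"
  unfolding K_sel(4)
  by (subst K_madd) (simp_all add: chain_zero madd_0_left mzero_in cob_in)

end

lemma bounded_complexes_zero:
  "X \<in> bounded_complexes C \<Longrightarrow> \<exists>N. \<forall>n. N < \<bar>n\<bar> \<longrightarrow> zero_object C (cob X n)"
  by (simp add: bounded_complexes_def)

text \<open>Constants are moved to the front of an index, where arithmetic can merge them; equal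
  degrees then become syntactically equal.\<close>

lemma idx: "(n :: int) + 1 = 1 + n" "n + numeral k = numeral k + n"
  by simp_all

section \<open>Twisted sums, cones and weak kernels\<close>

context additive_category
begin

definition bprod where
  "bprod X Y = (SOME (S, i1, i2, p1, p2). is_biproduct C X Y S i1 i2 p1 p2)"

definition "bS X Y = (case bprod X Y of (S, i1, i2, p1, p2) \<Rightarrow> S)"
definition "bi1 X Y = (case bprod X Y of (S, i1, i2, p1, p2) \<Rightarrow> i1)"
definition "bi2 X Y = (case bprod X Y of (S, i1, i2, p1, p2) \<Rightarrow> i2)"
definition "bp1 X Y = (case bprod X Y of (S, i1, i2, p1, p2) \<Rightarrow> p1)"
definition "bp2 X Y = (case bprod X Y of (S, i1, i2, p1, p2) \<Rightarrow> p2)"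

lemma bprod:
  assumes "X \<in> Ob C" "Y \<in> Ob C"
  shows "is_biproduct C X Y (bS X Y) (bi1 X Y) (bi2 X Y) (bp1 X Y) (bp2 X Y)"
proof -
  have "\<exists>t. case t of (S, i1, i2, p1, p2) \<Rightarrow> is_biproduct C X Y S i1 i2 p1 p2"
    using has_biproduct[OF assms] by auto
  from someI_ex[OF this] show ?thesis
    unfolding bprod_def[symmetric] bS_def bi1_def bi2_def bp1_def bp2_def
    by (auto split: prod.splits)
qed

lemma b_in:
  assumes "X \<in> Ob C" "Y \<in> Ob C"
  shows "bS X Y \<in> Ob C" "bi1 X Y \<in> Mor C X (bS X Y)" "bi2 X Y \<in> Mor C Y (bS X Y)"
    "bp1 X Y \<in> Mor C (bS X Y) X" "bp2 X Y \<in> Mor C (bS X Y) Y"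
  using biproductD[OF assms bprod[OF assms]] by blast+

lemma b_simps0:
  assumes "X \<in> Ob C" "Y \<in> Ob C"
  shows "cmp C X (bS X Y) X (bp1 X Y) (bi1 X Y) = idm C X"
    "cmp C Y (bS X Y) Y (bp2 X Y) (bi2 X Y) = idm C Y"
    "cmp C Y (bS X Y) X (bp1 X Y) (bi2 X Y) = mzero C Y X"
    "cmp C X (bS X Y) Y (bp2 X Y) (bi1 X Y) = mzero C X Y"
  using biproductD[OF assms bprod[OF assms]] by blast+

lemma b_simps1:
  assumes "X \<in> Ob C" "Y \<in> Ob C" "W \<in> Ob C"
  shows "f \<in> Mor C W X \<Longrightarrow> cmp C W (bS X Y) X (bp1 X Y) (cmp C W X (bS X Y) (bi1 X Y) f) = f"
    "g \<in> Mor C W Y \<Longrightarrow> cmp C W (bS X Y) Y (bp2 X Y) (cmp C W Y (bS X Y) (bi2 X Y) g) = g"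
    "g \<in> Mor C W Y \<Longrightarrow> cmp C W (bS X Y) X (bp1 X Y) (cmp C W Y (bS X Y) (bi2 X Y) g) = mzero C W X"
    "f \<in> Mor C W X \<Longrightarrow> cmp C W (bS X Y) Y (bp2 X Y) (cmp C W X (bS X Y) (bi1 X Y) f) = mzero C W Y"
  using assms by (simp_all add: b_in b_simps0 cmp_assoc idm_left cmp_0_left)

lemmas b_simps = b_simps0 b_simps1
lemmas bS_eq_from = biproduct_eq_from[OF _ _ bprod]

lemma bS_zero:
  assumes "zero_object C X" "zero_object C Y"
  shows "zero_object C (bS X Y)"
proof -
  have o: "X \<in> Ob C" "Y \<in> Ob C" and i: "idm C X = mzero C X X" "idm C Y = mzero C Y Y"
    using assms by (simp_all add: zero_object_iff)
  have "bi1 X Y = mzero C X (bS X Y)" "bi2 X Y = mzero C Y (bS X Y)"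
    using assms zero_object_from b_in[OF o] by blast+
  then show ?thesis
    unfolding zero_object_iff using biproductD(10)[OF o bprod[OF o]] o
    by (simp add: b_in cmp_0_left madd_0_left mzero_in)
qed

definition unshift_complex :: "('o, 'a) complex \<Rightarrow> ('o, 'a) complex" where
  "unshift_complex X = \<lparr>cob = (\<lambda>n. cob X (n - 1)),
     cd = (\<lambda>n. mneg C (cob X (n - 1)) (cob X n) (cd X (n - 1)))\<rparr>"

text \<open>A direct sum with twisted differential, the matrix with rows \<open>(d_X, 0)\<close> and
  \<open>(c, d_Y)\<close>. The choice \<open>c = 0\<close> gives the biproduct, replacing
  \<open>X\<close> by its shift gives the mapping cone, and replacing \<open>Y\<close> by its
  inverse shift gives the cocone.\<close>

definition ext_complex :: "('o, 'a) complex \<Rightarrow> ('o, 'a) complex \<Rightarrow> (int \<Rightarrow> 'a) \<Rightarrow> ('o, 'a) complex" where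
  "ext_complex X Y c = \<lparr>cob = (\<lambda>n. bS (cob X n) (cob Y n)),
     cd = (\<lambda>n. madd C (bS (cob X n) (cob Y n)) (bS (cob X (n + 1)) (cob Y (n + 1)))
       (cmp C (bS (cob X n) (cob Y n)) (cob X (n + 1)) (bS (cob X (n + 1)) (cob Y (n + 1)))
         (bi1 (cob X (n + 1)) (cob Y (n + 1)))
         (cmp C (bS (cob X n) (cob Y n)) (cob X n) (cob X (n + 1)) (cd X n) (bp1 (cob X n) (cob Y n))))
       (cmp C (bS (cob X n) (cob Y n)) (cob Y (n + 1)) (bS (cob X (n + 1)) (cob Y (n + 1)))
         (bi2 (cob X (n + 1)) (cob Y (n + 1)))
         (madd C (bS (cob X n) (cob Y n)) (cob Y (n + 1))
           (cmp C (bS (cob X n) (cob Y n)) (cob X n) (cob Y (n + 1)) (c n) (bp1 (cob X n) (cob Y n)))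
           (cmp C (bS (cob X n) (cob Y n)) (cob Y n) (cob Y (n + 1)) (cd Y n)
             (bp2 (cob X n) (cob Y n))))))\<rparr>"

lemma cob_sel:
  "cob (unshift_complex X) n = cob X (n - 1)"
  "cob (shift_complex C X) n = cob X (n + 1)"
  "cob (ext_complex X Y c) n = bS (cob X n) (cob Y n)"
  by (simp_all add: unshift_complex_def shift_complex_def ext_complex_def)

lemma cd_sel:
  "cd (unshift_complex X) n = mneg C (cob X (n - 1)) (cob X n) (cd X (n - 1))"
  "cd (shift_complex C X) n = mneg C (cob X (n + 1)) (cob X (n + 2)) (cd X (n + 1))"
  by (simp_all add: unshift_complex_def shift_complex_def)

lemma bounded_complexesI:
  assumes "\<And>n. cob X n \<in> Ob C" "\<And>n. cd X n \<in> Mor C (cob X n) (cob X (n + 1))"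
    "\<And>n. cmp C (cob X n) (cob X (n + 1)) (cob X (n + 2)) (cd X (n + 1)) (cd X n) =
       mzero C (cob X n) (cob X (n + 2))"
    "\<And>n. N < \<bar>n\<bar> \<Longrightarrow> zero_object C (cob X n)"
  shows "X \<in> cplx"
  using assms unfolding bounded_complexes_def by blast

lemma shift_in: assumes "X \<in> cplx" shows "shift_complex C X \<in> cplx"
proof -
  obtain N where N: "\<And>n. N < \<bar>n\<bar> \<Longrightarrow> zero_object C (cob X n)"
    using assms bounded_complexes_zero by blast
  show ?thesis
  proof (rule bounded_complexesI)
    show "zero_object C (cob (shift_complex C X) n)" if "N + 1 < \<bar>n\<bar>" for n
      using that N[of "n + 1"] by (simp add: cob_sel)
  qed (use assms in \<open>simp_all add: idx cob_sel cd_sel cx_in cx_simps\<close>)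
qed

lemma unshift_in: assumes "X \<in> cplx" shows "unshift_complex X \<in> cplx"
proof -
  obtain N where N: "\<And>n. N < \<bar>n\<bar> \<Longrightarrow> zero_object C (cob X n)"
    using assms bounded_complexes_zero by blast
  show ?thesis
  proof (rule bounded_complexesI)
    show "zero_object C (cob (unshift_complex X) n)" if "N + 1 < \<bar>n\<bar>" for n
      using that N[of "n - 1"] by (simp add: cob_sel)
  qed (use assms in \<open>simp_all add: idx cob_sel cd_sel cx_in cx_simps\<close>)
qed

text \<open>The last hypothesis is the lower left entry of the square of the twisted differential;
  the other entries vanish because \<open>X\<close> and \<open>Y\<close> are complexes.\<close>

lemma ext_in:
  assumes "X \<in> cplx" "Y \<in> cplx" "\<And>n m. m = n + 1 \<Longrightarrow> c n \<in> Mor C (cob X n) (cob Y m)"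
    and "\<And>n. madd C (cob X n) (cob Y (n + 2))
       (cmp C (cob X n) (cob X (n + 1)) (cob Y (n + 2)) (c (n + 1)) (cd X n))
       (cmp C (cob X n) (cob Y (n + 1)) (cob Y (n + 2)) (cd Y (n + 1)) (c n)) = mzero C (cob X n) (cob Y (n + 2))"
  shows "ext_complex X Y c \<in> cplx"
proof -
  obtain N where N: "\<And>n. N < \<bar>n\<bar> \<Longrightarrow> zero_object C (cob X n)"
    using assms bounded_complexes_zero by blast
  obtain M where M: "\<And>n. M < \<bar>n\<bar> \<Longrightarrow> zero_object C (cob Y n)"
    using assms bounded_complexes_zero by blast
  show ?thesis
  proof (rule bounded_complexesI)
    show "zero_object C (cob (ext_complex X Y c) n)" if "max M N < \<bar>n\<bar>" for n
      using that N[of n] M[of n] by (simp add: cob_sel bS_zero)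
    \<comment> \<open>The hypothesis on \<open>c\<close> after composition with the injection
      \<open>bi2\<close>, already distributed over the sum: this is the shape in which the entry
      appears after simplification.\<close>
    have c: "madd C (cob X n) (bS (cob X (n + 2)) (cob Y (n + 2)))
       (cmp C (cob X n) (cob Y (n + 2)) (bS (cob X (n + 2)) (cob Y (n + 2))) (bi2 (cob X (n + 2)) (cob Y (n + 2)))
         (cmp C (cob X n) (cob X (n + 1)) (cob Y (n + 2)) (c (n + 1)) (cd X n)))
       (cmp C (cob X n) (cob Y (n + 2)) (bS (cob X (n + 2)) (cob Y (n + 2))) (bi2 (cob X (n + 2)) (cob Y (n + 2)))
         (cmp C (cob X n) (cob Y (n + 1)) (cob Y (n + 2)) (cd Y (n + 1)) (c n))) =
       mzero C (cob X n) (bS (cob X (n + 2)) (cob Y (n + 2)))" for n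
      using assms(1,2) by (simp add: cx_in b_in assms(3) cmp_madd_right[symmetric] assms(4) cmp_0_right)
    show "cmp C (cob (ext_complex X Y c) n) (cob (ext_complex X Y c) (n + 1)) (cob (ext_complex X Y c) (n + 2))
      (cd (ext_complex X Y c) (n + 1)) (cd (ext_complex X Y c) n) =
       mzero C (cob (ext_complex X Y c) n) (cob (ext_complex X Y c) (n + 2))" for n
      by (rule bS_eq_from[of "cob X n" "cob Y n", where W = "bS (cob X (n + 2)) (cob Y (n + 2))"])
        (use assms(1,2) c[of n] in
          \<open>simp_all add: idx ext_complex_def assms(3) cx_in cx_simps b_in b_simps\<close>)
  qed (use assms(1,2) in \<open>simp_all add: idx ext_complex_def assms(3) cx_in b_in\<close>)
qed


lemma ext_i2:
  assumes "X \<in> cplx" "Y \<in> cplx" "\<And>n m. m = n + 1 \<Longrightarrow> c n \<in> Mor C (cob X n) (cob Y m)"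
  shows "(\<lambda>n. bi2 (cob X n) (cob Y n)) \<in> chain_maps C Y (ext_complex X Y c)"
  by (rule chain_mapsI)
    (use assms(1,2) in \<open>simp_all add: idx ext_complex_def assms(3) cx_in cx_simps b_in b_simps\<close>)

lemma ext_p1:
  assumes "X \<in> cplx" "Y \<in> cplx" "\<And>n m. m = n + 1 \<Longrightarrow> c n \<in> Mor C (cob X n) (cob Y m)"
  shows "(\<lambda>n. bp1 (cob X n) (cob Y n)) \<in> chain_maps C (ext_complex X Y c) X"
  by (rule chain_mapsI)
    (use assms(1,2) in \<open>simp_all add: idx ext_complex_def assms(3) cx_in cx_simps b_in b_simps\<close>)

lemma K_biproduct:
  assumes "X \<in> cplx" "Y \<in> cplx"
  shows "\<exists>S i1 i2 p1 p2. is_biproduct K X Y S i1 i2 p1 p2"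
proof -
  define S where "S = ext_complex X Y (\<lambda>n. mzero C (cob X n) (cob Y (n + 1)))"
  let ?i1 = "\<lambda>n. bi1 (cob X n) (cob Y n)" and ?i2 = "\<lambda>n. bi2 (cob X n) (cob Y n)"
  let ?p1 = "\<lambda>n. bp1 (cob X n) (cob Y n)" and ?p2 = "\<lambda>n. bp2 (cob X n) (cob Y n)"
  have S: "S \<in> cplx"
    unfolding S_def by (rule ext_in) (use assms in \<open>simp_all add: idx cx_in cx_simps\<close>)
  have cS: "cob S n = bS (cob X n) (cob Y n)" for n by (simp add: S_def cob_sel)
  have i: "?i1 \<in> chain_maps C X S" "?i2 \<in> chain_maps C Y S"
    and p: "?p1 \<in> chain_maps C S X" "?p2 \<in> chain_maps C S Y"
    by (rule chain_mapsI; use assms in \<open>simp add: idx S_def ext_complex_def cx_in cx_simps b_in b_simps\<close>)+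
  have sum: "madd C (bS (cob X n) (cob Y n)) (bS (cob X n) (cob Y n))
      (cmp C (bS (cob X n) (cob Y n)) (cob X n) (bS (cob X n) (cob Y n)) (?i1 n) (?p1 n))
      (cmp C (bS (cob X n) (cob Y n)) (cob Y n) (bS (cob X n) (cob Y n)) (?i2 n) (?p2 n)) =
      idm C (bS (cob X n) (cob Y n))" for n
    using biproductD(10)[OF _ _ bprod] cob_in assms by blast
  have "is_biproduct K X Y S (hc X S ?i1) (hc Y S ?i2) (hc S X ?p1) (hc S Y ?p2)"
    unfolding is_biproduct_def
    using assms S i p chain_cmp[OF assms(1) S assms(1) i(1) p(1)]
      chain_cmp[OF S assms(1) S p(1) i(1)] chain_cmp[OF S assms(2) S p(2) i(2)]
    by (simp add: hc_in K_cmp K_madd) (simp add: K_sel(1,3,4) cS sum b_simps cob_in)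
  then show ?thesis by blast
qed

abbreviation cone where "cone X Y f \<equiv> ext_complex (shift_complex C X) Y (\<lambda>n. f (n + 1))"

lemma cone_in:
  assumes "X \<in> cplx" "Y \<in> cplx" "f \<in> chain_maps C X Y"
  shows "cone X Y f \<in> cplx"
  by (rule ext_in)
    (use assms in \<open>simp_all add: shift_in idx cob_sel cd_sel cx_in cx_simps cm_in cm_cd\<close>)

lemma cone_standard:
  assumes "X \<in> cplx" "Y \<in> cplx" "f \<in> chain_maps C X Y"
  shows "(X, Y, cone X Y f, hc X Y f, hc Y (cone X Y f) (\<lambda>n. bi2 (cob X (n + 1)) (cob Y n)),
    hc (cone X Y f) (shift_complex C X) (\<lambda>n. bp1 (cob X (n + 1)) (cob Y n))) \<in> standard_triangles C"
proof -
  have "is_cone C X Y f (cone X Y f) (\<lambda>n. bi2 (cob X (n + 1)) (cob Y n)) (\<lambda>n. bp1 (cob X (n + 1)) (cob Y n))"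
    unfolding is_cone_def
    by (rule exI[of _ "\<lambda>n. bi1 (cob X (n + 1)) (cob Y n)"], rule exI[of _ "\<lambda>n. bp2 (cob X (n + 1)) (cob Y n)"])
      (use assms in \<open>simp add: cob_sel bprod cob_in ext_complex_def cd_sel idx\<close>)
  then show ?thesis unfolding standard_triangles_def using assms cone_in by blast
qed

lemma cone_i2:
  assumes "X \<in> cplx" "Y \<in> cplx" "f \<in> chain_maps C X Y"
  shows "(\<lambda>n. bi2 (cob X (n + 1)) (cob Y n)) \<in> chain_maps C Y (cone X Y f)"
  using ext_i2[of "shift_complex C X" Y "\<lambda>n. f (n + 1)"] assms by (simp add: shift_in cob_sel cm_in)

lemma cone_p1:
  assumes "X \<in> cplx" "Y \<in> cplx" "f \<in> chain_maps C X Y"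
  shows "(\<lambda>n. bp1 (cob X (n + 1)) (cob Y n)) \<in> chain_maps C (cone X Y f) (shift_complex C X)"
  using ext_p1[of "shift_complex C X" Y "\<lambda>n. f (n + 1)"] assms by (simp add: shift_in cob_sel cm_in)

text \<open>A null homotopy of the composite into the cone has two components. Its component in
  \<open>X\<close> is a chain map \<open>s\<close>, and its component in \<open>Y\<close> is a
  homotopy between the given map and \<open>f s\<close>.\<close>

lemma cone_weak_kernel:
  assumes "X \<in> cplx" "Y \<in> cplx" "f \<in> chain_maps C X Y" "P \<in> cplx" "m \<in> Mor K P Y"
    and "cmp K P Y (cone X Y f) (hc Y (cone X Y f) (\<lambda>n. bi2 (cob X (n + 1)) (cob Y n))) m =
      mzero K P (cone X Y f)"
  shows "\<exists>s \<in> Mor K P X. cmp K P X Y (hc X Y f) s = m"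
proof -
  let ?Z = "cone X Y f" and ?S = "\<lambda>n. bS (cob X (n + 1)) (cob Y n)"
  obtain g where g: "g \<in> chain_maps C P Y" "m = hc P Y g" using assms(5) by (auto simp: K_sel)
  note Z = cone_in[OF assms(1-3)] and i2 = cone_i2[OF assms(1-3)]
  have "hc P ?Z (\<lambda>n. cmp C (cob P n) (cob Y n) (cob ?Z n) (bi2 (cob X (n + 1)) (cob Y n)) (g n)) =
      hc P ?Z (\<lambda>n. mzero C (cob P n) (cob ?Z n))"
    using assms(6) unfolding g(2) by (simp add: K_cmp assms(1,2,4) Z i2 g) (simp add: K_sel)
  then obtain t where t: "t \<in> homotopies P ?Z" and
    eq0: "\<And>n. cmp C (cob P n) (cob Y n) (cob ?Z n) (bi2 (cob X (n + 1)) (cob Y n)) (g n) =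
      madd C (cob P n) (cob ?Z n) (mzero C (cob P n) (cob ?Z n)) (hbd P ?Z t n)"
    by (rule hc_eqE) (use assms(4) Z chain_cmp[OF assms(4,2) Z g(1) i2] chain_zero in blast)+
  have tin: "t n \<in> Mor C (cob P n) (bS (cob X n) (cob Y k))" if "k = n - 1" for n k
    using hom_in[OF t refl, of n] that by (simp add: cob_sel)
  have eq: "cmp C (cob P n) (cob Y n) (cob ?Z n) (bi2 (cob X (n + 1)) (cob Y n)) (g n) = hbd P ?Z t n" for n
    using eq0[of n] assms Z t by (simp add: madd_0_left hbd_in cob_in)
  \<comment> \<open>In degree \<open>n - 1\<close> the cone is the sum of \<open>X\<close> in degree
    n and \<open>Y\<close> in degree \<open>n - 1\<close>. So \<open>s\<close> has degree 0 and
    \<open>q\<close> has degree -1.\<close>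
  define s where "s n = cmp C (cob P n) (bS (cob X n) (cob Y (n - 1))) (cob X n) (bp1 (cob X n) (cob Y (n - 1))) (t n)" for n
  define q where "q n = cmp C (cob P n) (bS (cob X n) (cob Y (n - 1))) (cob Y (n - 1)) (bp2 (cob X n) (cob Y (n - 1))) (t n)" for n
  have sin: "s n \<in> Mor C (cob P n) (cob X n)" for n
    unfolding s_def using assms by (simp add: cx_in b_in tin)
  have qin: "q n \<in> Mor C (cob P n) (cob Y k)" if "k = n - 1" for n k
    unfolding s_def q_def using assms that by (simp add: cx_in b_in tin)
  \<comment> \<open>The \<open>X\<close> row of the homotopy equation. The injection into the cone
    has no entry there, and the shifted differential carries a sign; what remains is that
    \<open>s\<close> commutes with the differentials.\<close>
  have e1: "madd C (cob P n) (cob X (n + 1)) (cmp C (cob P n) (cob P (n + 1)) (cob X (n + 1)) (s (n + 1)) (cd P n))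
     (mneg C (cob P n) (cob X (n + 1)) (cmp C (cob P n) (cob X n) (cob X (n + 1)) (cd X n) (s n))) = mzero C (cob P n) (cob X (n + 1))" for n
    using arg_cong[OF eq[of n], of "\<lambda>h. cmp C (cob P n) (?S n) (cob X (n + 1)) (bp1 (cob X (n + 1)) (cob Y n)) h"]
      assms(1,2,4) g(1)
    unfolding hbd_def s_def
    by (simp add: cob_sel idx ext_complex_def cd_sel cx_in cx_simps b_in b_simps tin cm_in cm_in[OF assms(3)] madd_comm)
  have s: "s \<in> chain_maps C P X"
    by (rule chain_mapsI, rule sin, rule madd_neg_eq_zero[OF _ _ _ _ e1])
      (use assms sin in \<open>simp_all add: cx_in\<close>)
  \<comment> \<open>The \<open>Y\<close> row of the same equation exhibits \<open>q\<close> as the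
    homotopy.\<close>
  have "hc P Y g = hc P Y (\<lambda>n. cmp C (cob P n) (cob X n) (cob Y n) (f n) (s n))"
  proof (rule hc_eqI[OF assms(4,2) g(1) chain_cmp[OF assms(4,1,2) s assms(3)]])
    show "q \<in> homotopies P Y" using qin by (simp add: homotopiesI)
    show "g n = madd C (cob P n) (cob Y n) (cmp C (cob P n) (cob X n) (cob Y n) (f n) (s n)) (hbd P Y q n)" for n
      using arg_cong[OF eq[of n], of "\<lambda>h. cmp C (cob P n) (?S n) (cob Y n) (bp2 (cob X (n + 1)) (cob Y n)) h"]
      assms(1,2,4) g(1)
    unfolding hbd_def s_def q_def
    by (simp add: cob_sel idx ext_complex_def cd_sel cx_in cx_simps b_in b_simps tin cm_in cm_in[OF assms(3)] madd_ac)
  qed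
  then show ?thesis
    using K_cmp[OF assms(4,1,2) s assms(3)] g(2) hc_in[OF s] by metis
qed

end

section \<open>Distinguished triangles from cones and cocones\<close>

context additive_category
begin

lemma K_category: "category K"
proof
  fix W X Y Z f g h
  assume "W \<in> Ob K" "X \<in> Ob K" "Y \<in> Ob K" "Z \<in> Ob K" "f \<in> Mor K W X" "g \<in> Mor K X Y" "h \<in> Mor K Y Z"
  then obtain f' g' h' where *: "W \<in> cplx" "X \<in> cplx" "Y \<in> cplx" "Z \<in> cplx"
    and f: "f' \<in> chain_maps C W X" "f = hc W X f'" and g: "g' \<in> chain_maps C X Y" "g = hc X Y g'"
    and h: "h' \<in> chain_maps C Y Z" "h = hc Y Z h'"
    by (auto simp: K_sel)
  show "cmp K W Y Z h (cmp K W X Y g f) = cmp K W X Z (cmp K X Y Z h g) f"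
    using * f g h by (simp add: K_cmp chain_cmp cm_in cob_in cmp_assoc)
qed (auto simp: K_sel(1-3) K_cmp chain_id chain_cmp idm_left idm_right cob_in cm_in)

text \<open>The sum left over on the last summand when the homotopy in \<open>cocone_dist\<close> is
  verified.\<close>

lemma madd_cancel_middle:
  assumes "X \<in> Ob C" "Y \<in> Ob C" "a \<in> Mor C X Y" "b \<in> Mor C X Y" "i \<in> Mor C X Y"
  shows "madd C X Y a (madd C X Y (madd C X Y (madd C X Y (mneg C X Y b) (mneg C X Y a)) i) b) = i"
proof -
  have "madd C X Y a (madd C X Y (madd C X Y (madd C X Y (mneg C X Y b) (mneg C X Y a)) i) b) =
      madd C X Y (madd C X Y b a) (madd C X Y (mneg C X Y (madd C X Y b a)) i)"
    using assms by (simp add: mor_in mneg_madd madd_ac)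
  then show ?thesis using assms by (simp add: mor_in madd_neg_cancel1)
qed

lemma chain_shift:
  "\<lbrakk>X \<in> cplx; Y \<in> cplx; f \<in> chain_maps C X Y\<rbrakk>
   \<Longrightarrow> (\<lambda>n. f (n + 1)) \<in> chain_maps C (shift_complex C X) (shift_complex C Y)"
  by (rule chain_mapsI) (simp_all add: idx cob_sel cd_sel cx_in cx_simps cm_in cm_cd)

lemma shift_hc:
  assumes "X \<in> cplx" "Y \<in> cplx" "f \<in> chain_maps C X Y"
  shows "FMor (Kb_shift C) X Y (hc X Y f) = hc (shift_complex C X) (shift_complex C Y) (\<lambda>n. f (n + 1))"
proof -
  have "hc (shift_complex C X) (shift_complex C Y) (\<lambda>n. f' (n + 1)) =
    hc (shift_complex C X) (shift_complex C Y) (\<lambda>n. f (n + 1))" if f': "f' \<in> hc X Y f" for f'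
  proof -
    note fm = hc_mem[OF assms f']
    obtain s where s: "s \<in> homotopies X Y"
      and fs: "\<And>n. f' n = madd C (cob X n) (cob Y n) (f n) (hbd X Y s n)"
      using hc_eqE[OF fm(2) assms(1,2) fm(1) assms(3)] by blast
    show ?thesis
    proof (rule hc_eqI[OF shift_in shift_in chain_shift chain_shift])
      \<comment> \<open>The sign of the homotopy compensates the sign of the shifted differential,
        so that the boundary itself is only shifted.\<close>
      show "(\<lambda>n. mneg C (cob X (n + 1)) (cob Y n) (s (n + 1)))
          \<in> homotopies (shift_complex C X) (shift_complex C Y)"
        using assms s by (intro homotopiesI) (simp add: cob_sel cx_in hom_in)
      show "f' (n + 1) = madd C (cob (shift_complex C X) n) (cob (shift_complex C Y) n) (f (n + 1))
        (hbd (shift_complex C X) (shift_complex C Y) (\<lambda>n. mneg C (cob X (n + 1)) (cob Y n) (s (n + 1))) n)" for n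
        unfolding fs hbd_def using assms s
        by (simp add: idx cob_sel cd_sel cx_in cx_simps cm_in hom_in)
    qed (use assms fm in auto)
  qed
  moreover have "hc X Y f \<noteq> {}" using hc_self[OF assms] by blast
  ultimately have "(\<Union>f' \<in> hc X Y f. hc (shift_complex C X) (shift_complex C Y) (\<lambda>n. f' (n + 1))) =
      hc (shift_complex C X) (shift_complex C Y) (\<lambda>n. f (n + 1))"
    by (intro UN_eqI)
  then show ?thesis unfolding Kb_shift_def by simp
qed

lemma dist_K_iff:
  "(X, Y, Z, u, v, w) \<in> dist K \<longleftrightarrow> X \<in> Ob K \<and> Y \<in> Ob K \<and> Z \<in> Ob K \<and>
     u \<in> Mor K X Y \<and> v \<in> Mor K Y Z \<and> w \<in> Mor K Z (shift_complex C X) \<and>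
     (\<exists>X' Y' Z' u' v' w' a b c. (X', Y', Z', u', v', w') \<in> standard_triangles C \<and>
        is_iso K X X' a \<and> is_iso K Y Y' b \<and> is_iso K Z Z' c \<and>
        cmp K X Y Y' b u = cmp K X X' Y' u' a \<and>
        cmp K Y Z Z' c v = cmp K Y Y' Z' v' b \<and>
        cmp K Z (shift_complex C X) (shift_complex C X') (FMor (Kb_shift C) X X' a) w =
        cmp K Z Z' (shift_complex C X') w' c)"
proof -
  have "is_iso (Kb_pcat C) X Y f = is_iso K X Y f" for X Y f
    by (simp add: is_iso_def Kb_def pcat.defs tcat.defs Kb_pcat_def)
  moreover have "Ob (Kb_pcat C) = Ob K" "Mor (Kb_pcat C) = Mor K" "cmp (Kb_pcat C) = cmp K"
    by (simp_all add: Kb_def pcat.defs tcat.defs Kb_pcat_def)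
  ultimately show ?thesis
    unfolding K_sel(7) distinguished_triangles_def Let_def
    by (simp add: Kb_shift_def)
qed

text \<open>The isomorphism of triangles consists of identities at \<open>X\<close> and
  \<open>Y\<close> and of \<open>c\<close> at the third vertex. The third morphism is then forced,
  so it is defined by transport along \<open>c\<close>.\<close>

lemma dist_of_standard:
  assumes st: "(X, Y, Z', u, v', w') \<in> standard_triangles C"
    and "X \<in> cplx" "Y \<in> cplx" "Z \<in> cplx" "Z' \<in> cplx"
    and "u \<in> Mor K X Y" "v \<in> Mor K Y Z" "v' \<in> Mor K Y Z'" "w' \<in> Mor K Z' (shift_complex C X)"
    and c: "is_iso K Z Z' c" "cmp K Y Z Z' c v = v'"
  shows "(X, Y, Z, u, v, cmp K Z Z' (shift_complex C X) w' c) \<in> dist K"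
proof -
  interpret Kc: category K by (rule K_category)
  have cM: "c \<in> Mor K Z Z'" using c(1) by (simp add: is_iso_def)
  have id_iso: "is_iso K A A (idm K A)" if "A \<in> cplx" for A
    by (rule Kc.is_isoI[where g = "idm K A"]) (use that in \<open>simp_all add: Kc.idm_in Kc.idm_left K_sel(1)\<close>)
  have S: "FMor (Kb_shift C) X X (idm K X) = idm K (shift_complex C X)"
    using shift_hc[OF assms(2,2) chain_id[OF assms(2)]] by (simp add: K_sel(3) cob_sel)
  have ob: "A \<in> cplx \<Longrightarrow> A \<in> Ob K" for A by (simp add: K_sel)
  note obs = assms(2-5)[THEN ob] shift_in[OF assms(2), THEN ob]
  define w where "w = cmp K Z Z' (shift_complex C X) w' c"
  have w: "w \<in> Mor K Z (shift_complex C X)"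
    unfolding w_def by (rule Kc.cmp_in[OF obs(3,4,5) cM assms(9)])
  have sq: "cmp K X Y Y (idm K Y) u = cmp K X X Y u (idm K X)"
      "cmp K Y Z Z' c v = cmp K Y Y Z' v' (idm K Y)"
      "cmp K Z (shift_complex C X) (shift_complex C X) (FMor (Kb_shift C) X X (idm K X)) w = cmp K Z Z' (shift_complex C X) w' c"
    using S w obs assms(6-8) c(2) by (simp_all add: Kc.idm_left Kc.idm_right w_def)
  show ?thesis
    unfolding w_def[symmetric] dist_K_iff
    using obs assms(6,7) w st sq id_iso[OF assms(2)] id_iso[OF assms(3)] c(1) by blast
qed

text \<open>This takes the place of rotating triangles. The cocone \<open>L\<close> of
  \<open>h\<close> maps to \<open>X\<close>, and the cone of that map is homotopy equivalent to
  \<open>Y\<close>, compatibly with \<open>h\<close>; so the standard triangle on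
  \<open>L -> X\<close> becomes one ending in \<open>h\<close>.\<close>

lemma cocone_dist:
  assumes "X \<in> cplx" "Y \<in> cplx" "h \<in> Mor K X Y"
  shows "\<exists>L k w. (L, X, Y, k, h, w) \<in> dist K"
proof -
  interpret Kc: category K by (rule K_category)
  obtain g where g: "g \<in> chain_maps C X Y" "h = hc X Y g" using assms(3) by (auto simp: K_sel)
  \<comment> \<open>In degree n this is the sum of \<open>X\<close> in degree n and \<open>Y\<close>
    in degree \<open>n - 1\<close>, twisted by \<open>g\<close>.\<close>
  define L where "L = ext_complex X (unshift_complex Y) g"
  have gs: "g n \<in> Mor C (cob X n) (cob (unshift_complex Y) m)" if "m = n + 1" for n m
    using that g by (simp add: cob_sel cm_in)
  have L: "L \<in> cplx"
    unfolding L_def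
    by (rule ext_in) (use assms g(1) in \<open>simp_all add: unshift_in idx cob_sel cd_sel cx_in cx_simps cm_in cm_cd\<close>)
  define k where "k = (\<lambda>n. bp1 (cob X n) (cob Y (n - 1)))"
  have k: "k \<in> chain_maps C L X"
    unfolding k_def L_def
    using ext_p1[OF assms(1) unshift_in[OF assms(2)] gs] by (simp add: cob_sel)
  define Z where "Z = cone L X k"
  have Z: "Z \<in> cplx" unfolding Z_def by (rule cone_in[OF L assms(1) k])
  have cL: "cob L n = bS (cob X n) (cob Y (n - 1))" for n by (simp add: L_def cob_sel)
  have cZ: "cob Z n = bS (bS (cob X (n + 1)) (cob Y n)) (cob X n)" for n by (simp add: Z_def cob_sel cL)
  \<comment> \<open>In degree n, \<open>Z\<close> consists of triples (x', y, x) with x' in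
    \<open>X\<close> of degree \<open>n + 1\<close>, y in \<open>Y\<close> and x in \<open>X\<close>
    of degree n. In these terms \<open>e\<close> is (x', y, x) to y + g x, \<open>r\<close> is y to
    (0, y, 0), and the homotopy \<open>t\<close> sends (x', y, x) to (x, 0, 0).\<close>
  define e where "e = (\<lambda>n. madd C (cob Z n) (cob Y n)
     (cmp C (cob Z n) (bS (cob X (n + 1)) (cob Y n)) (cob Y n) (bp2 (cob X (n + 1)) (cob Y n))
        (bp1 (bS (cob X (n + 1)) (cob Y n)) (cob X n)))
     (cmp C (cob Z n) (cob X n) (cob Y n) (g n) (bp2 (bS (cob X (n + 1)) (cob Y n)) (cob X n))))"
  define r where "r = (\<lambda>n. cmp C (cob Y n) (bS (cob X (n + 1)) (cob Y n)) (cob Z n)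
     (bi1 (bS (cob X (n + 1)) (cob Y n)) (cob X n)) (bi2 (cob X (n + 1)) (cob Y n)))"
  define t where "t = (\<lambda>n. cmp C (cob Z n) (bS (cob X n) (cob Y (n - 1))) (cob Z (n - 1))
     (bi1 (bS (cob X n) (cob Y (n - 1))) (cob X (n - 1)))
     (cmp C (cob Z n) (cob X n) (bS (cob X n) (cob Y (n - 1))) (bi1 (cob X n) (cob Y (n - 1)))
        (bp2 (bS (cob X (n + 1)) (cob Y n)) (cob X n))))"
  let ?i2 = "\<lambda>n. bi2 (bS (cob X (n + 1)) (cob Y n)) (cob X n)"
  have i2: "?i2 \<in> chain_maps C X Z"
    using cone_i2[OF L assms(1) k] by (simp add: Z_def cL)
  have dZ: "cd Z n = madd C (cob Z n) (cob Z (n + 1))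
       (cmp C (cob Z n) (bS (cob X (n + 2)) (cob Y (n + 1))) (cob Z (n + 1))
         (bi1 (bS (cob X (n + 2)) (cob Y (n + 1))) (cob X (n + 1)))
         (cmp C (cob Z n) (bS (cob X (n + 1)) (cob Y n)) (bS (cob X (n + 2)) (cob Y (n + 1)))
            (mneg C (bS (cob X (n + 1)) (cob Y n)) (bS (cob X (n + 2)) (cob Y (n + 1))) (cd L (n + 1)))
            (bp1 (bS (cob X (n + 1)) (cob Y n)) (cob X n))))
       (cmp C (cob Z n) (cob X (n + 1)) (cob Z (n + 1))
         (bi2 (bS (cob X (n + 2)) (cob Y (n + 1))) (cob X (n + 1)))
         (madd C (cob Z n) (cob X (n + 1))
           (cmp C (cob Z n) (bS (cob X (n + 1)) (cob Y n)) (cob X (n + 1)) (k (n + 1)) (bp1 (bS (cob X (n + 1)) (cob Y n)) (cob X n)))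
           (cmp C (cob Z n) (cob X n) (cob X (n + 1)) (cd X n)
             (bp2 (bS (cob X (n + 1)) (cob Y n)) (cob X n)))))" for n
    unfolding Z_def ext_complex_def by (simp add: cob_sel cd_sel cL idx)
  have dL: "cd L n = madd C (bS (cob X n) (cob Y (n - 1))) (bS (cob X (n + 1)) (cob Y n))
       (cmp C (bS (cob X n) (cob Y (n - 1))) (cob X (n + 1)) (bS (cob X (n + 1)) (cob Y n))
         (bi1 (cob X (n + 1)) (cob Y n))
         (cmp C (bS (cob X n) (cob Y (n - 1))) (cob X n) (cob X (n + 1)) (cd X n) (bp1 (cob X n) (cob Y (n - 1)))))
       (cmp C (bS (cob X n) (cob Y (n - 1))) (cob Y n) (bS (cob X (n + 1)) (cob Y n))
         (bi2 (cob X (n + 1)) (cob Y n))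
         (madd C (bS (cob X n) (cob Y (n - 1))) (cob Y n)
           (cmp C (bS (cob X n) (cob Y (n - 1))) (cob X n) (cob Y n) (g n) (bp1 (cob X n) (cob Y (n - 1))))
           (cmp C (bS (cob X n) (cob Y (n - 1))) (cob Y (n - 1)) (cob Y n)
             (mneg C (cob Y (n - 1)) (cob Y n) (cd Y (n - 1)))
             (bp2 (cob X n) (cob Y (n - 1))))))" for n
    unfolding L_def ext_complex_def by (simp add: cob_sel cd_sel idx)
  note S = idx cZ dZ dL k_def cx_in cx_simps b_in b_simps cm_in cm_cd cm_cd_cmp
  have e: "e \<in> chain_maps C Z Y"
    by (rule chain_mapsI) (use assms g(1) in \<open>simp_all add: e_def S madd_ac\<close>)
  have r: "r \<in> chain_maps C Y Z"
    by (rule chain_mapsI) (use assms g(1) in \<open>simp_all add: r_def S madd_ac\<close>)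
  have er: "cmp K Y Z Y (hc Z Y e) (hc Y Z r) = idm K Y"
    unfolding K_cmp[OF assms(2) Z assms(2) r e] K_sel(3)
    by (rule hc_cong) (use assms g(1) in \<open>simp add: e_def r_def S\<close>)
  have ei: "cmp K X Z Y (hc Z Y e) (hc X Z ?i2) = h"
    unfolding K_cmp[OF assms(1) Z assms(2) i2 e] g(2)
    by (rule hc_cong) (use assms g(1) in \<open>simp add: e_def S\<close>)
  have "hc Z Z (\<lambda>n. idm C (cob Z n)) = hc Z Z (\<lambda>n. cmp C (cob Z n) (cob Y n) (cob Z n) (r n) (e n))"
  proof (rule hc_eqI[OF Z Z chain_id[OF Z] chain_cmp[OF Z assms(2) Z e r]])
    show "t \<in> homotopies Z Z"
      using assms by (intro homotopiesI) (simp add: t_def cZ idx cx_in b_in)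
    fix n
    show "idm C (cob Z n) = madd C (cob Z n) (cob Z n) (cmp C (cob Z n) (cob Y n) (cob Z n) (r n) (e n)) (hbd Z Z t n)"
    \<comment> \<open>Two splittings separate the three summands of \<open>Z\<close>, and the
      homotopy equation is verified on each of them.\<close>
    proof (rule bS_eq_from[of "bS (cob X (n + 1)) (cob Y n)" "cob X n", where W = "cob Z n"])
      show "cmp C (bS (cob X (n + 1)) (cob Y n)) (bS (bS (cob X (n + 1)) (cob Y n)) (cob X n)) (cob Z n) (idm C (cob Z n)) (bi1 (bS (cob X (n + 1)) (cob Y n)) (cob X n)) =
        cmp C (bS (cob X (n + 1)) (cob Y n)) (bS (bS (cob X (n + 1)) (cob Y n)) (cob X n)) (cob Z n)
        (madd C (cob Z n) (cob Z n) (cmp C (cob Z n) (cob Y n) (cob Z n) (r n) (e n)) (hbd Z Z t n)) (bi1 (bS (cob X (n + 1)) (cob Y n)) (cob X n))"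
        by (rule bS_eq_from[of "cob X (n + 1)" "cob Y n", where W = "cob Z n"])
           (use assms g(1) in \<open>simp_all add: e_def r_def t_def hbd_def S\<close>)
    qed (use assms g(1) in \<open>simp_all add: e_def r_def t_def hbd_def S madd_cancel_middle\<close>)
  qed
  then have re: "cmp K Z Y Z (hc Y Z r) (hc Z Y e) = idm K Z"
    by (simp add: K_cmp[OF Z assms(2) Z e r] K_sel(3))
  have M: "hc Z Y e \<in> Mor K Z Y" "hc Y Z r \<in> Mor K Y Z" "hc X Z ?i2 \<in> Mor K X Z" "hc L X k \<in> Mor K L X"
    using hc_in e r i2 k by blast+
  have ob: "X \<in> Ob K" "Y \<in> Ob K" "Z \<in> Ob K" using assms Z by (simp_all add: K_sel)
  have rh: "cmp K X Y Z (hc Y Z r) h = hc X Z ?i2"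
    unfolding ei[symmetric] using Kc.cmp_assoc[OF ob(1,3,2,3) M(3,1,2)] re Kc.idm_left[OF ob(1,3) M(3)]
    by simp
  have iso: "is_iso K Y Z (hc Y Z r)"
    using Kc.is_isoI[OF M(2,1) er re] .
  let ?w' = "hc Z (shift_complex C L) (\<lambda>n. bp1 (cob L (n + 1)) (cob X n))"
  have st: "(L, X, Z, hc L X k, hc X Z ?i2, ?w') \<in> standard_triangles C"
    using cone_standard[OF L assms(1) k] by (simp add: Z_def cL)
  have w': "?w' \<in> Mor K Z (shift_complex C L)"
    using cone_p1[OF L assms(1) k] hc_in unfolding Z_def by blast
  show ?thesis
    using dist_of_standard[OF st L assms(1,2) Z M(4) assms(3) M(3) w' iso rh] by blast
qed

text \<open>The second clause says that \<open>h\<close> is a weak kernel of \<open>c\<close>. This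
  exactness of Hom(P, -) is what makes the objects of \<open>K\<close> projective in the
  abelianisation.\<close>

lemma cone_dist:
  assumes "X \<in> cplx" "Y \<in> cplx" "h \<in> Mor K X Y"
  shows "\<exists>Z c w. (X, Y, Z, h, c, w) \<in> dist K \<and>
    (\<forall>P \<in> Ob K. \<forall>m \<in> Mor K P Y. cmp K P Y Z c m = mzero K P Z \<longrightarrow> (\<exists>s \<in> Mor K P X. cmp K P X Y h s = m))"
proof -
  interpret Kc: category K by (rule K_category)
  obtain g where g: "g \<in> chain_maps C X Y" "h = hc X Y g" using assms(3) by (auto simp: K_sel)
  let ?Z = "cone X Y g" and ?c = "\<lambda>n. bi2 (cob X (n + 1)) (cob Y n)"
  note Z = cone_in[OF assms(1,2) g(1)]
  have c: "hc Y ?Z ?c \<in> Mor K Y ?Z" using cone_i2[OF assms(1,2) g(1)] hc_in by blast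
  have ob: "Y \<in> Ob K" "?Z \<in> Ob K" using assms Z by (simp_all add: K_sel)
  note iZ = Kc.idm_in[OF ob(2)]
  have "is_iso K ?Z ?Z (idm K ?Z)"
    by (rule Kc.is_isoI[OF iZ iZ]) (use ob iZ in \<open>simp_all add: Kc.idm_left\<close>)
  from dist_of_standard[OF cone_standard[OF assms(1,2) g(1)] assms(1,2) Z Z hc_in[OF g(1)] c c
      hc_in[OF cone_p1[OF assms(1,2) g(1)]] this Kc.idm_left[OF ob c]]
  show ?thesis using cone_weak_kernel[OF assms(1,2) g(1)] unfolding g(2) K_sel(1) by blast
qed

end

section \<open>Modules over the free algebra\<close>

lemma fmod_homsI:
  assumes "\<And>x. x \<in> carrier M \<Longrightarrow> f x \<in> carrier N"
    "\<And>x y. \<lbrakk>x \<in> carrier M; y \<in> carrier M\<rbrakk> \<Longrightarrow> f (x \<oplus>\<^bsub>M\<^esub> y) = f x \<oplus>\<^bsub>N\<^esub> f y"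
    "\<And>a x. \<lbrakk>a \<in> carrier R; x \<in> carrier M\<rbrakk> \<Longrightarrow> f (a \<odot>\<^bsub>M\<^esub> x) = a \<odot>\<^bsub>N\<^esub> f x"
    "\<And>j x. \<lbrakk>j \<in> J; x \<in> carrier M\<rbrakk> \<Longrightarrow> f (act M j x) = act N j (f x)"
    "f \<in> extensional (carrier M)"
  shows "f \<in> fmod_homs R J M N"
  using assms unfolding fmod_homs_def linear_maps_def by auto

lemma fmod_homsD:
  assumes "f \<in> fmod_homs R J M N"
  shows "x \<in> carrier M \<Longrightarrow> f x \<in> carrier N"
    "\<lbrakk>x \<in> carrier M; y \<in> carrier M\<rbrakk> \<Longrightarrow> f (x \<oplus>\<^bsub>M\<^esub> y) = f x \<oplus>\<^bsub>N\<^esub> f y"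
    "\<lbrakk>a \<in> carrier R; x \<in> carrier M\<rbrakk> \<Longrightarrow> f (a \<odot>\<^bsub>M\<^esub> x) = a \<odot>\<^bsub>N\<^esub> f x"
    "\<lbrakk>j \<in> J; x \<in> carrier M\<rbrakk> \<Longrightarrow> f (act M j x) = act N j (f x)"
    "f \<in> extensional (carrier M)"
  using assms unfolding fmod_homs_def linear_maps_def by auto

lemma free_alg_moduleD:
  assumes "free_alg_module R J M"
  shows "module R M"
    "\<lbrakk>j \<in> J; x \<in> carrier M\<rbrakk> \<Longrightarrow> act M j x \<in> carrier M"
    "\<lbrakk>j \<in> J; x \<in> carrier M; y \<in> carrier M\<rbrakk> \<Longrightarrow> act M j (x \<oplus>\<^bsub>M\<^esub> y) = act M j x \<oplus>\<^bsub>M\<^esub> act M j y"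
    "\<lbrakk>j \<in> J; a \<in> carrier R; x \<in> carrier M\<rbrakk> \<Longrightarrow> act M j (a \<odot>\<^bsub>M\<^esub> x) = a \<odot>\<^bsub>M\<^esub> act M j x"
  using assms unfolding free_alg_module_def linear_maps_def by auto

lemma free_alg_moduleI:
  assumes "module R M"
    "\<And>j x. \<lbrakk>j \<in> J; x \<in> carrier M\<rbrakk> \<Longrightarrow> act M j x \<in> carrier M"
    "\<And>j x y. \<lbrakk>j \<in> J; x \<in> carrier M; y \<in> carrier M\<rbrakk> \<Longrightarrow> act M j (x \<oplus>\<^bsub>M\<^esub> y) = act M j x \<oplus>\<^bsub>M\<^esub> act M j y"
    "\<And>j a x. \<lbrakk>j \<in> J; a \<in> carrier R; x \<in> carrier M\<rbrakk> \<Longrightarrow> act M j (a \<odot>\<^bsub>M\<^esub> x) = a \<odot>\<^bsub>M\<^esub> act M j x"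
  shows "free_alg_module R J M"
  using assms unfolding free_alg_module_def linear_maps_def by auto

context module
begin

lemma add_closed: "\<lbrakk>x \<in> carrier M; y \<in> carrier M\<rbrakk> \<Longrightarrow> x \<oplus>\<^bsub>M\<^esub> y \<in> carrier M" by simp
lemma zero_in: "\<zero>\<^bsub>M\<^esub> \<in> carrier M" by simp
lemma smult_in: "\<lbrakk>a \<in> carrier R; x \<in> carrier M\<rbrakk> \<Longrightarrow> a \<odot>\<^bsub>M\<^esub> x \<in> carrier M" by simp

text \<open>Negatives are expressed through the scalar -1, because linear maps are known to respect
  addition and scalars.\<close>

lemma neg_add: "x \<in> carrier M \<Longrightarrow> (\<ominus> \<one>) \<odot>\<^bsub>M\<^esub> x \<oplus>\<^bsub>M\<^esub> x = \<zero>\<^bsub>M\<^esub>"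
  using smult_l_distr[of "\<ominus> \<one>" \<one> x] by (simp add: R.l_neg)

lemma smult_comm: "\<lbrakk>a \<in> carrier R; b \<in> carrier R; x \<in> carrier M\<rbrakk> \<Longrightarrow> a \<odot>\<^bsub>M\<^esub> (b \<odot>\<^bsub>M\<^esub> x) = b \<odot>\<^bsub>M\<^esub> (a \<odot>\<^bsub>M\<^esub> x)"
  by (simp add: smult_assoc1[symmetric] R.m_comm)

end

lemma hom_zero:
  assumes "free_alg_module R J M" "free_alg_module R J N" "f \<in> fmod_homs R J M N"
  shows "f \<zero>\<^bsub>M\<^esub> = \<zero>\<^bsub>N\<^esub>"
proof -
  interpret M: module R M by (rule free_alg_moduleD(1)[OF assms(1)])
  interpret N: module R N by (rule free_alg_moduleD(1)[OF assms(2)])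
  have "f (\<zero>\<^bsub>R\<^esub> \<odot>\<^bsub>M\<^esub> \<zero>\<^bsub>M\<^esub>) = \<zero>\<^bsub>R\<^esub> \<odot>\<^bsub>N\<^esub> f \<zero>\<^bsub>M\<^esub>" using fmod_homsD(3)[OF assms(3), of "\<zero>\<^bsub>R\<^esub>" "\<zero>\<^bsub>M\<^esub>"] by simp
  then show ?thesis using fmod_homsD(1)[OF assms(3), of "\<zero>\<^bsub>M\<^esub>"] by simp
qed

lemma act_zero:
  assumes "free_alg_module R J M" "j \<in> J"
  shows "act M j \<zero>\<^bsub>M\<^esub> = \<zero>\<^bsub>M\<^esub>"
proof -
  interpret M: module R M by (rule free_alg_moduleD(1)[OF assms(1)])
  have "act M j (\<zero>\<^bsub>R\<^esub> \<odot>\<^bsub>M\<^esub> \<zero>\<^bsub>M\<^esub>) = \<zero>\<^bsub>R\<^esub> \<odot>\<^bsub>M\<^esub> act M j \<zero>\<^bsub>M\<^esub>"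
    using free_alg_moduleD(4)[OF assms, of "\<zero>\<^bsub>R\<^esub>" "\<zero>\<^bsub>M\<^esub>"] by simp
  then show ?thesis using free_alg_moduleD(2)[OF assms, of "\<zero>\<^bsub>M\<^esub>"] by simp
qed

lemma hom_compose:
  assumes "f \<in> fmod_homs R J M N" "g \<in> fmod_homs R J N P"
    and M: "free_alg_module R J M"
  shows "compose (carrier M) g f \<in> fmod_homs R J M P"
proof -
  interpret M: module R M by (rule free_alg_moduleD(1)[OF M])
  show ?thesis
    by (rule fmod_homsI)
      (simp_all add: compose_def fmod_homsD(1-4)[OF assms(1)] fmod_homsD(1-4)[OF assms(2)] free_alg_moduleD[OF M])
qed

lemma hom_id:
  assumes M: "free_alg_module R J M"
  shows "(\<lambda>x \<in> carrier M. x) \<in> fmod_homs R J M M"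
proof -
  interpret M: module R M by (rule free_alg_moduleD(1)[OF M])
  show ?thesis by (rule fmod_homsI) (simp_all add: free_alg_moduleD[OF M])
qed

lemma hom_add:
  assumes f: "f \<in> fmod_homs R J M N" and g: "g \<in> fmod_homs R J M N"
    and M: "free_alg_module R J M" and N: "free_alg_module R J N"
  shows "(\<lambda>x \<in> carrier M. f x \<oplus>\<^bsub>N\<^esub> g x) \<in> fmod_homs R J M N"
proof -
  interpret M: module R M by (rule free_alg_moduleD(1)[OF M])
  interpret N: module R N by (rule free_alg_moduleD(1)[OF N])
  show ?thesis
    by (rule fmod_homsI)
      (simp_all add: fmod_homsD(1-4)[OF f] fmod_homsD(1-4)[OF g] free_alg_moduleD[OF M] free_alg_moduleD[OF N]
        N.M.a_ac N.smult_r_distr)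
qed

lemma hom_null:
  assumes M: "free_alg_module R J M" and N: "free_alg_module R J N"
  shows "(\<lambda>x \<in> carrier M. \<zero>\<^bsub>N\<^esub>) \<in> fmod_homs R J M N"
proof -
  interpret M: module R M by (rule free_alg_moduleD(1)[OF M])
  interpret N: module R N by (rule free_alg_moduleD(1)[OF N])
  show ?thesis
    by (rule fmod_homsI)
      (simp_all add: free_alg_moduleD[OF M] free_alg_moduleD[OF N] act_zero[OF N])
qed

lemma hom_neg:
  assumes f: "f \<in> fmod_homs R J M N"
    and M: "free_alg_module R J M" and N: "free_alg_module R J N"
  shows "(\<lambda>x \<in> carrier M. (\<ominus>\<^bsub>R\<^esub> \<one>\<^bsub>R\<^esub>) \<odot>\<^bsub>N\<^esub> f x) \<in> fmod_homs R J M N"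
proof -
  interpret M: module R M by (rule free_alg_moduleD(1)[OF M])
  interpret N: module R N by (rule free_alg_moduleD(1)[OF N])
  have 1: "\<ominus>\<^bsub>R\<^esub> \<one>\<^bsub>R\<^esub> \<in> carrier R" by simp
  show ?thesis
    using 1
    by (intro fmod_homsI)
      (simp_all add: fmod_homsD(1-4)[OF f] free_alg_moduleD[OF M] free_alg_moduleD[OF N]
         N.smult_r_distr N.smult_comm[OF 1])
qed

lemma hom_group:
  assumes M: "free_alg_module R J M" and N: "free_alg_module R J N"
  shows "comm_group \<lparr>carrier = fmod_homs R J M N, mult = (\<lambda>f g. \<lambda>x \<in> carrier M. f x \<oplus>\<^bsub>N\<^esub> g x),
    one = (\<lambda>x \<in> carrier M. \<zero>\<^bsub>N\<^esub>)\<rparr>"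
    (is "comm_group ?G")
proof -
  interpret N: module R N by (rule free_alg_moduleD(1)[OF N])
  note h1 = fmod_homsD(1) and h5 = fmod_homsD(5)
  show ?thesis
  proof (rule comm_groupI)
    fix f assume "f \<in> carrier ?G"
    then have f: "f \<in> fmod_homs R J M N" by simp
    show "\<exists>g \<in> carrier ?G.
      g \<otimes>\<^bsub>?G\<^esub> f = \<one>\<^bsub>?G\<^esub>"
      using hom_neg[OF f M N] h1[OF f]
      by (intro bexI[of _ "\<lambda>x \<in> carrier M. (\<ominus>\<^bsub>R\<^esub> \<one>\<^bsub>R\<^esub>) \<odot>\<^bsub>N\<^esub> f x"]) (simp_all add: N.neg_add cong: restrict_cong)
    show "\<one>\<^bsub>?G\<^esub> \<otimes>\<^bsub>?G\<^esub> f = f"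
      using h1[OF f] h5[OF f] by (intro extensionalityI[of _ "carrier M"]) simp_all
  next
    fix f g assume "f \<in> carrier ?G" "g \<in> carrier ?G"
    then have f: "f \<in> fmod_homs R J M N" "g \<in> fmod_homs R J M N" by simp_all
    show "f \<otimes>\<^bsub>?G\<^esub> g = g \<otimes>\<^bsub>?G\<^esub> f"
      by (simp add: h1[OF f(1)] h1[OF f(2)] N.M.a_comm cong: restrict_cong)
  next
    fix f g h assume "f \<in> carrier ?G" "g \<in> carrier ?G" "h \<in> carrier ?G"
    then have f: "f \<in> fmod_homs R J M N" "g \<in> fmod_homs R J M N" "h \<in> fmod_homs R J M N" by simp_all
    show "f \<otimes>\<^bsub>?G\<^esub> g \<otimes>\<^bsub>?G\<^esub> h = f \<otimes>\<^bsub>?G\<^esub> (g \<otimes>\<^bsub>?G\<^esub> h)"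
      by (simp add: h1[OF f(1)] h1[OF f(2)] h1[OF f(3)] N.M.a_assoc cong: restrict_cong)
  qed (use hom_add[OF _ _ M N] hom_null[OF M N] in simp_all)
qed

lemma two_step_sel [simp]:
  "Ob (two_step_cat mem V R J) = two_step_modules mem V R J"
  "Mor (two_step_cat mem V R J) = fmod_homs R J"
  "idm (two_step_cat mem V R J) M = (\<lambda>x \<in> carrier M. x)"
  "cmp (two_step_cat mem V R J) M N P g f = compose (carrier M) g f"
  "madd (two_step_cat mem V R J) M N f g = (\<lambda>x \<in> carrier M. f x \<oplus>\<^bsub>N\<^esub> g x)"
  "mzero (two_step_cat mem V R J) M N = (\<lambda>x \<in> carrier M. \<zero>\<^bsub>N\<^esub>)"
  by (simp_all add: two_step_cat_def)

lemma two_step_free: "M \<in> two_step_modules mem V R J \<Longrightarrow> free_alg_module R J M"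
  by (simp add: two_step_modules_def)

lemma two_step_preadditive: "preadditive (two_step_cat mem V R J)"
proof (intro preadditive.intro category.intro preadditive_axioms.intro)
  fix M N P f g
  assume "M \<in> Ob (two_step_cat mem V R J)" "N \<in> Ob (two_step_cat mem V R J)"
  then have M: "free_alg_module R J M" and N: "free_alg_module R J N" by (simp_all add: two_step_free)
  show "comm_group (mor_group (two_step_cat mem V R J) M N)"
    unfolding mor_group_def using hom_group[OF M N] by (simp add: two_step_cat_def)
  assume "f \<in> Mor (two_step_cat mem V R J) M N"
  then have f: "f \<in> fmod_homs R J M N" by simp
  show "cmp (two_step_cat mem V R J) M M N f (idm (two_step_cat mem V R J) M) = f"
    "cmp (two_step_cat mem V R J) M N N (idm (two_step_cat mem V R J) N) f = f"
    using fmod_homsD(1,5)[OF f] by (auto simp: compose_def extensional_def fun_eq_iff)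
  assume "g \<in> Mor (two_step_cat mem V R J) N P"
  then have g: "g \<in> fmod_homs R J N P" by simp
  show "cmp (two_step_cat mem V R J) M N P g f \<in> Mor (two_step_cat mem V R J) M P"
    using hom_compose[OF f g M] by simp
  fix Q h
  show "cmp (two_step_cat mem V R J) M P Q h (cmp (two_step_cat mem V R J) M N P g f) =
       cmp (two_step_cat mem V R J) M N Q (cmp (two_step_cat mem V R J) N P Q h g) f"
    using fmod_homsD(1)[OF f] by (auto simp: compose_def fun_eq_iff)
next
  fix M N P f g h
  assume "N \<in> Ob (two_step_cat mem V R J)" "f \<in> Mor (two_step_cat mem V R J) M N"
  then show "cmp (two_step_cat mem V R J) M N P (madd (two_step_cat mem V R J) N P g h) f =
       madd (two_step_cat mem V R J) M P (cmp (two_step_cat mem V R J) M N P g f) (cmp (two_step_cat mem V R J) M N P h f)"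
    using fmod_homsD(1)[of f R J M N] by (auto simp: compose_def fun_eq_iff)
next
  fix M N P f g h
  assume "f \<in> Mor (two_step_cat mem V R J) M N" "g \<in> Mor (two_step_cat mem V R J) M N" "h \<in> Mor (two_step_cat mem V R J) N P"
  then have f: "f \<in> fmod_homs R J M N" "g \<in> fmod_homs R J M N" and h: "h \<in> fmod_homs R J N P" by simp_all
  show "cmp (two_step_cat mem V R J) M N P h (madd (two_step_cat mem V R J) M N f g) =
       madd (two_step_cat mem V R J) M P (cmp (two_step_cat mem V R J) M N P h f) (cmp (two_step_cat mem V R J) M N P h g)"
    using fmod_homsD(1)[OF f(1)] fmod_homsD(1)[OF f(2)] fmod_homsD(2)[OF h] by (auto simp: compose_def fun_eq_iff)
qed (auto simp: two_step_free hom_id)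

section \<open>Two-step modules as extensions of powers of the trivial module\<close>

lemma fmod_power_sel [simp]:
  "carrier (fmod_power M n) = {..<n} \<rightarrow>\<^sub>E carrier M"
  "x \<oplus>\<^bsub>fmod_power M n\<^esub> y = (\<lambda>k \<in> {..<n}. x k \<oplus>\<^bsub>M\<^esub> y k)"
  "\<zero>\<^bsub>fmod_power M n\<^esub> = (\<lambda>k \<in> {..<n}. \<zero>\<^bsub>M\<^esub>)"
  "a \<odot>\<^bsub>fmod_power M n\<^esub> x = (\<lambda>k \<in> {..<n}. a \<odot>\<^bsub>M\<^esub> x k)"
  "act (fmod_power M n) j x = (\<lambda>k \<in> {..<n}. act M j (x k))"
  by (simp_all add: fmod_power_def)

lemma trivial_fmod_sel [simp]:
  "carrier (trivial_fmod R) = carrier R" "x \<oplus>\<^bsub>trivial_fmod R\<^esub> y = x \<oplus>\<^bsub>R\<^esub> y"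
  "\<zero>\<^bsub>trivial_fmod R\<^esub> = \<zero>\<^bsub>R\<^esub>" "a \<odot>\<^bsub>trivial_fmod R\<^esub> x = a \<otimes>\<^bsub>R\<^esub> x" "act (trivial_fmod R) j x = \<zero>\<^bsub>R\<^esub>"
  by (simp_all add: trivial_fmod_def)

lemma trivial_module:
  assumes "cring R" shows "free_alg_module R J (trivial_fmod R)"
proof -
  interpret cring R by (rule assms)
  have "abelian_group (trivial_fmod R)"
  proof (rule abelian_groupI)
    fix x assume "x \<in> carrier (trivial_fmod R)"
    then show "\<exists>y \<in> carrier (trivial_fmod R). y \<oplus>\<^bsub>trivial_fmod R\<^esub> x = \<zero>\<^bsub>trivial_fmod R\<^esub>"
      by (intro bexI[of _ "\<ominus>\<^bsub>R\<^esub> x"]) (simp_all add: l_neg)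
  next
    fix x y assume "x \<in> carrier (trivial_fmod R)" "y \<in> carrier (trivial_fmod R)"
    then show "x \<oplus>\<^bsub>trivial_fmod R\<^esub> y = y \<oplus>\<^bsub>trivial_fmod R\<^esub> x" by (simp add: a_comm)
  qed (simp_all add: a_assoc)
  then have "module R (trivial_fmod R)"
    by (intro moduleI) (simp_all add: assms l_distr r_distr m_assoc)
  then show ?thesis by (rule free_alg_moduleI) simp_all
qed

lemma power_module:
  assumes M: "free_alg_module R J M" shows "free_alg_module R J (fmod_power M n)"
proof -
  interpret M: module R M by (rule free_alg_moduleD(1)[OF M])
  have mem: "x i \<in> carrier M" if "x \<in> {..<n} \<rightarrow>\<^sub>E carrier M" "i < n" for x i
    using PiE_mem[OF that(1), of i] that(2) by simp
  have eqI: "(\<lambda>i \<in> {..<n}. f i) = x" if "x \<in> {..<n} \<rightarrow>\<^sub>E carrier M" "\<And>i. i < n \<Longrightarrow> f i = x i" for x f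
  proof
    show "restrict f {..<n} i = x i" for i using that(2)[of i] PiE_arb[OF that(1), of i] by (cases "i < n") simp_all
  qed
  have cl: "(\<lambda>i \<in> {..<n}. f i) \<in> {..<n} \<rightarrow>\<^sub>E carrier M" if "\<And>i. i < n \<Longrightarrow> f i \<in> carrier M" for f
    using that by (simp add: restrict_PiE_iff)
  have neg: "\<exists>y \<in> {..<n} \<rightarrow>\<^sub>E carrier M. (\<lambda>k \<in> {..<n}. y k \<oplus>\<^bsub>M\<^esub> x k) = (\<lambda>k \<in> {..<n}. \<zero>\<^bsub>M\<^esub>)"
    if x: "x \<in> {..<n} \<rightarrow>\<^sub>E carrier M" for x
    by (rule bexI[of _ "\<lambda>k \<in> {..<n}. \<ominus>\<^bsub>M\<^esub> x k"])
      (use x in \<open>simp_all add: M.M.l_neg mem cl cong: restrict_cong\<close>)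
  have "abelian_group (fmod_power M n)"
  proof (rule abelian_groupI)
    fix x y assume "x \<in> carrier (fmod_power M n)" "y \<in> carrier (fmod_power M n)"
    then show "x \<oplus>\<^bsub>fmod_power M n\<^esub> y = y \<oplus>\<^bsub>fmod_power M n\<^esub> x"
      by (simp add: mem M.M.a_comm cong: restrict_cong)
  qed (simp_all add: mem cl eqI neg M.M.a_assoc cong: restrict_cong)
  then have "module R (fmod_power M n)"
    by (intro moduleI)
      (simp_all add: M.R.cring_axioms M.smult_l_distr M.smult_r_distr M.smult_assoc1 mem cl eqI cong: restrict_cong)
  then show ?thesis
    by (rule free_alg_moduleI) (simp_all add: free_alg_moduleD[OF M] mem cl cong: restrict_cong)
qed

text \<open>A short exact sequence from F^n through \<open>M\<close> to F^m, both ends with zero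
  action; no splitting is meant. It replaces submodules and coset modules by maps from and to
  tuples, on which constructions can be computed.\<close>

definition ses_split ::
  "('r, 'y) ring_scheme \<Rightarrow> 'i set \<Rightarrow> ('r, 'b, 'i) fmodule \<Rightarrow> nat \<Rightarrow> nat \<Rightarrow> ((nat \<Rightarrow> 'r) \<Rightarrow> 'b) \<Rightarrow> ('b \<Rightarrow> nat \<Rightarrow> 'r) \<Rightarrow> bool" where
  "ses_split R J M n m k p \<longleftrightarrow>
     k \<in> fmod_homs R J (fmod_power (trivial_fmod R) n) M \<and> p \<in> fmod_homs R J M (fmod_power (trivial_fmod R) m) \<and>
     inj_on k ({..<n} \<rightarrow>\<^sub>E carrier R) \<and> p ` carrier M = {..<m} \<rightarrow>\<^sub>E carrier R \<and>
     k ` ({..<n} \<rightarrow>\<^sub>E carrier R) = {x \<in> carrier M. p x = (\<lambda>k \<in> {..<m}. \<zero>\<^bsub>R\<^esub>)}"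

lemma a_r_coset_mem:
  fixes M (structure)
  shows "H +> x = (\<lambda>h. h \<oplus> x) ` H"
  unfolding a_r_coset_def' by auto

text \<open>Elements with the same image differ by an element of the kernel. The difference is
  written with the scalar -1, so that linearity of \<open>p\<close> applies directly.\<close>

lemma coset_fiber:
  assumes M: "free_alg_module R J M" and N: "free_alg_module R J N" and p: "p \<in> fmod_homs R J M N"
    and x: "x \<in> carrier M"
  shows "{y \<in> carrier M. p y = \<zero>\<^bsub>N\<^esub>} +>\<^bsub>M\<^esub> x = {z \<in> carrier M. p z = p x}"
proof -
  interpret M: module R M by (rule free_alg_moduleD(1)[OF M])
  interpret N: module R N by (rule free_alg_moduleD(1)[OF N])
  note ph = fmod_homsD(1-3)[OF p]
  have e: "\<ominus>\<^bsub>R\<^esub> \<one>\<^bsub>R\<^esub> \<in> carrier R" by simp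
  have "z \<in> (\<lambda>h. h \<oplus>\<^bsub>M\<^esub> x) ` {y \<in> carrier M. p y = \<zero>\<^bsub>N\<^esub>}" if z: "z \<in> carrier M" "p z = p x" for z
  proof (rule image_eqI[of _ _ "z \<oplus>\<^bsub>M\<^esub> (\<ominus>\<^bsub>R\<^esub> \<one>\<^bsub>R\<^esub>) \<odot>\<^bsub>M\<^esub> x"])
    show "z = z \<oplus>\<^bsub>M\<^esub> (\<ominus>\<^bsub>R\<^esub> \<one>\<^bsub>R\<^esub>) \<odot>\<^bsub>M\<^esub> x \<oplus>\<^bsub>M\<^esub> x"
      using z x e by (simp add: M.M.a_assoc M.neg_add)
    have "p (z \<oplus>\<^bsub>M\<^esub> (\<ominus>\<^bsub>R\<^esub> \<one>\<^bsub>R\<^esub>) \<odot>\<^bsub>M\<^esub> x) = p x \<oplus>\<^bsub>N\<^esub> (\<ominus>\<^bsub>R\<^esub> \<one>\<^bsub>R\<^esub>) \<odot>\<^bsub>N\<^esub> p x"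
      using z x e ph by simp
    also have "\<dots> = \<zero>\<^bsub>N\<^esub>" using N.neg_add[OF ph(1)[OF x]] ph(1)[OF x] e N.M.a_comm by simp
    finally show "z \<oplus>\<^bsub>M\<^esub> (\<ominus>\<^bsub>R\<^esub> \<one>\<^bsub>R\<^esub>) \<odot>\<^bsub>M\<^esub> x \<in> {y \<in> carrier M. p y = \<zero>\<^bsub>N\<^esub>}" using z x e by simp
  qed
  moreover have "h \<oplus>\<^bsub>M\<^esub> x \<in> carrier M \<and> p (h \<oplus>\<^bsub>M\<^esub> x) = p x" if "h \<in> carrier M" "p h = \<zero>\<^bsub>N\<^esub>" for h
    using that x ph by simp
  ultimately show ?thesis unfolding a_r_coset_mem by blast
qed

lemma quotient_sel:
  "carrier (quotient_fmod M H) = (\<lambda>x. H +>\<^bsub>M\<^esub> x) ` carrier M"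
  "X \<oplus>\<^bsub>quotient_fmod M H\<^esub> Y = X <+>\<^bsub>M\<^esub> Y"
  "a \<odot>\<^bsub>quotient_fmod M H\<^esub> X = (\<Union>x \<in> X. H +>\<^bsub>M\<^esub> (a \<odot>\<^bsub>M\<^esub> x))"
  "act (quotient_fmod M H) j X = (\<Union>x \<in> X. H +>\<^bsub>M\<^esub> act M j x)"
  by (auto simp: quotient_fmod_def A_RCOSETS_def')

context
  fixes R :: "('r, 'y) ring_scheme" and J :: "'i set" and M :: "('r, 'b, 'i) fmodule" and H :: "'b set"
  assumes M: "free_alg_module R J M" and H: "free_alg_submodule R J H M"
begin

interpretation M: module R M by (rule free_alg_moduleD(1)[OF M])

lemma submodule_facts:
  "H \<subseteq> carrier M" "\<zero>\<^bsub>M\<^esub> \<in> H" "\<lbrakk>x \<in> H; y \<in> H\<rbrakk> \<Longrightarrow> x \<oplus>\<^bsub>M\<^esub> y \<in> H"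
  "\<lbrakk>a \<in> carrier R; x \<in> H\<rbrakk> \<Longrightarrow> a \<odot>\<^bsub>M\<^esub> x \<in> H" "\<lbrakk>j \<in> J; x \<in> H\<rbrakk> \<Longrightarrow> act M j x \<in> H"
proof -
  have s: "submodule H R M" using H by (simp add: free_alg_submodule_def)
  then have g: "subgroup H (add_monoid M)" by (simp add: submodule_def)
  show "H \<subseteq> carrier M" "\<zero>\<^bsub>M\<^esub> \<in> H" "\<lbrakk>x \<in> H; y \<in> H\<rbrakk> \<Longrightarrow> x \<oplus>\<^bsub>M\<^esub> y \<in> H"
    using subgroup.subset[OF g] subgroup.one_closed[OF g] subgroup.m_closed[OF g] by simp_all
  show "\<lbrakk>a \<in> carrier R; x \<in> H\<rbrakk> \<Longrightarrow> a \<odot>\<^bsub>M\<^esub> x \<in> H" using submodule.smult_closed[OF s] by simp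
  show "\<lbrakk>j \<in> J; x \<in> H\<rbrakk> \<Longrightarrow> act M j x \<in> H" using H by (simp add: free_alg_submodule_def)
qed

lemma coset_eq: "\<lbrakk>h \<in> H; x \<in> carrier M\<rbrakk> \<Longrightarrow> H +>\<^bsub>M\<^esub> (h \<oplus>\<^bsub>M\<^esub> x) = H +>\<^bsub>M\<^esub> x"
proof -
  assume h: "h \<in> H" and x: "x \<in> carrier M"
  have g: "subgroup H (add_monoid M)" using H by (simp add: free_alg_submodule_def submodule_def)
  show ?thesis
    by (rule M.M.a_repr_independence[symmetric, OF _ x g]) (use h in \<open>auto simp: a_r_coset_mem\<close>)
qed

lemma coset_self: "x \<in> carrier M \<Longrightarrow> x \<in> H +>\<^bsub>M\<^esub> x"
  unfolding a_r_coset_mem by (rule image_eqI[of _ _ "\<zero>\<^bsub>M\<^esub>"]) (simp_all add: submodule_facts)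

lemma coset_memE:
  assumes "y \<in> H +>\<^bsub>M\<^esub> x" obtains h where "h \<in> H" "y = h \<oplus>\<^bsub>M\<^esub> x"
  using assms unfolding a_r_coset_mem by blast

lemma coset_sum:
  assumes x: "x \<in> carrier M" and y: "y \<in> carrier M"
  shows "(H +>\<^bsub>M\<^esub> x) <+>\<^bsub>M\<^esub> (H +>\<^bsub>M\<^esub> y) = H +>\<^bsub>M\<^esub> (x \<oplus>\<^bsub>M\<^esub> y)"
proof -
  have g: "subgroup H (add_monoid M)" using H by (simp add: free_alg_submodule_def submodule_def)
  interpret abelian_subgroup H M
    by (intro abelian_subgroupI3 additive_subgroup.intro g M.M.abelian_group_axioms)
  show ?thesis by (rule a_rcos_sum[OF x y])
qed

text \<open>Representatives differ by an element of \<open>H\<close>, and \<open>H\<close> is stable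
  under scalars, so all members of the union coincide.\<close>

lemma coset_smult:
  assumes a: "a \<in> carrier R" and x: "x \<in> carrier M"
  shows "(\<Union>y \<in> H +>\<^bsub>M\<^esub> x. H +>\<^bsub>M\<^esub> (a \<odot>\<^bsub>M\<^esub> y)) = H +>\<^bsub>M\<^esub> (a \<odot>\<^bsub>M\<^esub> x)"
proof (rule UN_eqI)
  show "H +>\<^bsub>M\<^esub> x \<noteq> {}" using coset_self[OF x] by blast
  fix y assume "y \<in> H +>\<^bsub>M\<^esub> x"
  then obtain h where h: "h \<in> H" "y = h \<oplus>\<^bsub>M\<^esub> x" by (rule coset_memE)
  then have "h \<in> carrier M" using submodule_facts(1) by blast
  then have "a \<odot>\<^bsub>M\<^esub> y = (a \<odot>\<^bsub>M\<^esub> h) \<oplus>\<^bsub>M\<^esub> (a \<odot>\<^bsub>M\<^esub> x)" unfolding h(2) using a x by (simp add: M.smult_r_distr)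
  then show "H +>\<^bsub>M\<^esub> (a \<odot>\<^bsub>M\<^esub> y) = H +>\<^bsub>M\<^esub> (a \<odot>\<^bsub>M\<^esub> x)"
    using coset_eq[OF submodule_facts(4)[OF a h(1)]] a x by simp
qed

lemma coset_act:
  assumes j: "j \<in> J" and x: "x \<in> carrier M"
  shows "(\<Union>y \<in> H +>\<^bsub>M\<^esub> x. H +>\<^bsub>M\<^esub> act M j y) = H +>\<^bsub>M\<^esub> act M j x"
proof (rule UN_eqI)
  show "H +>\<^bsub>M\<^esub> x \<noteq> {}" using coset_self[OF x] by blast
  fix y assume "y \<in> H +>\<^bsub>M\<^esub> x"
  then obtain h where h: "h \<in> H" "y = h \<oplus>\<^bsub>M\<^esub> x" by (rule coset_memE)
  then have "h \<in> carrier M" using submodule_facts(1) by blast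
  then have "act M j y = act M j h \<oplus>\<^bsub>M\<^esub> act M j x" unfolding h(2) using j x free_alg_moduleD(3)[OF M] by simp
  then show "H +>\<^bsub>M\<^esub> act M j y = H +>\<^bsub>M\<^esub> act M j x"
    using coset_eq[OF submodule_facts(5)[OF j h(1)]] free_alg_moduleD(2)[OF M j x] by simp
qed

end

lemma iso_inverse_hom:
  assumes M: "free_alg_module R J M" and f: "f \<in> fmod_homs R J M N" and b: "bij_betw f (carrier M) (carrier N)"
  shows "(\<lambda>y \<in> carrier N. inv_into (carrier M) f y) \<in> fmod_homs R J N M"
    "bij_betw (\<lambda>y \<in> carrier N. inv_into (carrier M) f y) (carrier N) (carrier M)"
proof -
  interpret M: module R M by (rule free_alg_moduleD(1)[OF M])
  let ?g = "\<lambda>y \<in> carrier N. inv_into (carrier M) f y"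
  note fh = fmod_homsD(1-4)[OF f]
  have gf: "?g (f x) = x" if "x \<in> carrier M" for x
    using that fh(1) bij_betw_inv_into_left[OF b] by simp
  have "\<exists>x \<in> carrier M. y = f x" if "y \<in> carrier N" for y using that b unfolding bij_betw_def by blast
  then obtain s where s: "\<And>y. y \<in> carrier N \<Longrightarrow> s y \<in> carrier M \<and> y = f (s y)" by metis
  have gs: "?g y = s y" if "y \<in> carrier N" for y using gf[of "s y"] s[OF that] by simp
  show "?g \<in> fmod_homs R J N M"
  proof (rule fmod_homsI)
    fix y assume y: "y \<in> carrier N"
    show "?g y \<in> carrier M" using s[OF y] gs[OF y] by simp
    show "?g (y \<oplus>\<^bsub>N\<^esub> z) = ?g y \<oplus>\<^bsub>M\<^esub> ?g z" if z: "z \<in> carrier N" for z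
      using gf[of "s y \<oplus>\<^bsub>M\<^esub> s z"] fh(2)[of "s y" "s z"] s[OF y] s[OF z] gs[OF y] gs[OF z] by simp
    show "?g (a \<odot>\<^bsub>N\<^esub> y) = a \<odot>\<^bsub>M\<^esub> ?g y" if "a \<in> carrier R" for a
      using gf[of "a \<odot>\<^bsub>M\<^esub> s y"] fh(3)[of a "s y"] that s[OF y] gs[OF y] by simp
    show "?g (act N j y) = act M j (?g y)" if "j \<in> J" for j
      using gf[of "act M j (s y)"] fh(4)[of j "s y"] that s[OF y] gs[OF y] free_alg_moduleD(2)[OF M] by simp
  qed simp
  show "bij_betw ?g (carrier N) (carrier M)"
    using bij_betw_inv_into[OF b] by (simp cong: bij_betw_cong)
qed

text \<open>Here \<open>k\<close> inverts the identification of the submodule with F^n, and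
  \<open>p\<close> is the quotient map followed by the identification of the quotient with
  F^m.\<close>

lemma two_stepD:
  fixes M :: "('r, 'v, 'i) fmodule"
  assumes R: "cring R" and M: "M \<in> two_step_modules mem V R J"
  shows "\<exists>n m k p. ses_split R J M n m k p"
proof -
  have fM: "free_alg_module R J M" using M by (rule two_step_free)
  interpret M: module R M by (rule free_alg_moduleD(1)[OF fM])
  obtain H n m f g where H: "free_alg_submodule R J H M"
    and f: "f \<in> fmod_homs R J (M\<lparr>carrier := H\<rparr>) (fmod_power (trivial_fmod R) n)"
      "bij_betw f H (carrier (fmod_power (trivial_fmod R) n))"
    and g: "g \<in> fmod_homs R J (quotient_fmod M H) (fmod_power (trivial_fmod R) m)"
      "bij_betw g (carrier (quotient_fmod M H)) (carrier (fmod_power (trivial_fmod R) m))"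
    using M unfolding two_step_modules_def finite_trivial_sum_def fmod_isomorphic_def by auto
  let ?Pn = "fmod_power (trivial_fmod R) n :: ('r, nat \<Rightarrow> 'r, 'i) fmodule"
  let ?Pm = "fmod_power (trivial_fmod R) m :: ('r, nat \<Rightarrow> 'r, 'i) fmodule"
  note sf = submodule_facts[OF fM H]
  have "module R (M\<lparr>carrier := H\<rparr>)"
    using H submodule.submodule_is_module[OF _ M.module_axioms] unfolding free_alg_submodule_def by blast
  then have fH: "free_alg_module R J (M\<lparr>carrier := H\<rparr>)"
    by (rule free_alg_moduleI) (simp_all add: sf(5) subsetD[OF sf(1)] free_alg_moduleD[OF fM])
  have mod_m: "free_alg_module R J ?Pm"
    using power_module[OF trivial_module[OF R]] .
  have f2: "bij_betw f (carrier (M\<lparr>carrier := H\<rparr>)) (carrier ?Pn)" using f(2) by simp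
  define k where "k = (\<lambda>y \<in> carrier ?Pn. inv_into (carrier (M\<lparr>carrier := H\<rparr>)) f y)"
  note k = iso_inverse_hom[OF fH f(1) f2, folded k_def]
  have kh: "k \<in> fmod_homs R J ?Pn M"
    by (rule fmod_homsI) (use fmod_homsD[OF k(1)] subsetD[OF sf(1)] in simp_all)
  define p where "p = (\<lambda>x \<in> carrier M. g (H +>\<^bsub>M\<^esub> x))"
  have q_in: "H +>\<^bsub>M\<^esub> x \<in> carrier (quotient_fmod M H)" if "x \<in> carrier M" for x
    using that by (simp add: quotient_sel)
  note gh = fmod_homsD(1-4)[OF g(1)]
  have ph: "p \<in> fmod_homs R J M ?Pm"
  proof (rule fmod_homsI)
    fix x assume x: "x \<in> carrier M"
    show "p x \<in> carrier ?Pm" using x gh(1)[OF q_in[OF x]] by (simp only: p_def restrict_apply')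
    show "p (x \<oplus>\<^bsub>M\<^esub> y) = p x \<oplus>\<^bsub>?Pm\<^esub> p y" if y: "y \<in> carrier M" for y
      using x y gh(2)[OF q_in[OF x] q_in[OF y]] unfolding p_def
      by (simp only: quotient_sel coset_sum[OF fM H] restrict_apply' M.M.a_closed)
    show "p (a \<odot>\<^bsub>M\<^esub> x) = a \<odot>\<^bsub>?Pm\<^esub> p x" if a: "a \<in> carrier R" for a
      using x a gh(3)[OF a q_in[OF x]] unfolding p_def
      by (simp only: quotient_sel coset_smult[OF fM H] restrict_apply' M.smult_closed)
    show "p (act M j x) = act ?Pm j (p x)" if j: "j \<in> J" for j
      using x j gh(4)[OF j q_in[OF x]] unfolding p_def
      by (simp only: quotient_sel coset_act[OF fM H] restrict_apply' free_alg_moduleD(2)[OF fM])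
  qed (simp add: p_def)
  have H0: "H +>\<^bsub>M\<^esub> \<zero>\<^bsub>M\<^esub> = H" using sf(1) by (force simp: a_r_coset_mem)
  have g0: "g H = (\<lambda>k \<in> {..<m}. \<zero>\<^bsub>R\<^esub>)"
    using hom_zero[OF fM mod_m ph] by (simp add: p_def H0)
  have ker: "p x = (\<lambda>k \<in> {..<m}. \<zero>\<^bsub>R\<^esub>) \<longleftrightarrow> x \<in> H" if x: "x \<in> carrier M" for x
  proof
    assume "p x = (\<lambda>k \<in> {..<m}. \<zero>\<^bsub>R\<^esub>)"
    then have "g (H +>\<^bsub>M\<^esub> x) = g H" using x g0 by (simp add: p_def)
    then have "H +>\<^bsub>M\<^esub> x = H"
      using g(2) q_in[OF x] q_in[of "\<zero>\<^bsub>M\<^esub>"] H0 unfolding bij_betw_def inj_on_def by simp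
    then show "x \<in> H" using coset_self[OF fM H x] by simp
  next
    assume "x \<in> H"
    then have "H +>\<^bsub>M\<^esub> x = H" using coset_eq[OF fM H, of x "\<zero>\<^bsub>M\<^esub>"] x H0 by simp
    then show "p x = (\<lambda>k \<in> {..<m}. \<zero>\<^bsub>R\<^esub>)" using x g0 by (simp add: p_def)
  qed
  have kH: "k ` ({..<n} \<rightarrow>\<^sub>E carrier R) = H" and ki: "inj_on k ({..<n} \<rightarrow>\<^sub>E carrier R)"
    using k(2) unfolding bij_betw_def by simp_all
  have "p ` carrier M = g ` carrier (quotient_fmod M H)"
    unfolding quotient_sel image_image by (rule image_cong) (simp_all add: p_def)
  then have pi: "p ` carrier M = {..<m} \<rightarrow>\<^sub>E carrier R"
    using g(2) unfolding bij_betw_def by simp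
  have "H = {x \<in> carrier M. p x = (\<lambda>k \<in> {..<m}. \<zero>\<^bsub>R\<^esub>)}" using ker sf(1) by blast
  then have "ses_split R J M n m k p" unfolding ses_split_def using kh ph kH ki pi by simp
  then show ?thesis by blast
qed

text \<open>The submodule is the image of \<open>k\<close>. It is also the kernel of
  \<open>p\<close>, so its cosets are the fibres of \<open>p\<close> and the quotient is identified
  with F^m.\<close>

lemma two_stepI:
  fixes M :: "('r, 'v, 'i) fmodule"
  assumes R: "cring R" and M: "free_alg_module R J M" "carrier M = elts mem m'" "mem m' V"
    and s: "ses_split R J M n m k p"
  shows "M \<in> two_step_modules mem V R J"
proof -
  interpret M: module R M by (rule free_alg_moduleD(1)[OF M(1)])
  let ?Pn = "fmod_power (trivial_fmod R) n :: ('r, nat \<Rightarrow> 'r, 'i) fmodule"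
  let ?Pm = "fmod_power (trivial_fmod R) m :: ('r, nat \<Rightarrow> 'r, 'i) fmodule"
  have Pn: "free_alg_module R J ?Pn" and Pm: "free_alg_module R J ?Pm" using power_module[OF trivial_module[OF R]] by blast+
  interpret Pn: module R ?Pn by (rule free_alg_moduleD(1)[OF Pn])
  have k: "k \<in> fmod_homs R J ?Pn M" and p: "p \<in> fmod_homs R J M ?Pm"
    and inj: "inj_on k (carrier ?Pn)" and surj: "p ` carrier M = carrier ?Pm"
    and im: "k ` carrier ?Pn = {x \<in> carrier M. p x = \<zero>\<^bsub>?Pm\<^esub>}"
    using s unfolding ses_split_def by simp_all
  define H where "H = k ` carrier ?Pn"
  note kh = fmod_homsD(1-4)[OF k] and ph = fmod_homsD(1-4)[OF p]
  have Hsub: "H \<subseteq> carrier M" unfolding H_def using kh(1) by blast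
  have smult: "a \<odot>\<^bsub>M\<^esub> x \<in> H" if "a \<in> carrier R" "x \<in> H" for a x
    using that kh(3)[OF that(1), symmetric] Pn.smult_closed[OF that(1)] unfolding H_def by blast
  have act: "act M j x \<in> H" if "j \<in> J" "x \<in> H" for j x
    using that kh(4)[OF that(1), symmetric] free_alg_moduleD(2)[OF Pn that(1)] unfolding H_def by blast
  have "submodule H R M"
  proof (rule M.submoduleI[OF Hsub])
    show "\<zero>\<^bsub>M\<^esub> \<in> H" unfolding H_def using hom_zero[OF Pn M(1) k] Pn.zero_in by (metis imageI)
    show "a \<oplus>\<^bsub>M\<^esub> b \<in> H" if "a \<in> H" "b \<in> H" for a b
      using that kh(2)[symmetric] Pn.add_closed unfolding H_def by auto
    show "\<ominus>\<^bsub>M\<^esub> a \<in> H" if a: "a \<in> H" for a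
    proof -
      have ac: "a \<in> carrier M" using a Hsub by blast
      have "\<ominus>\<^bsub>M\<^esub> a = (\<ominus>\<^bsub>R\<^esub> \<one>\<^bsub>R\<^esub>) \<odot>\<^bsub>M\<^esub> a"
        by (rule M.M.minus_equality[OF M.neg_add[OF ac] ac]) (use ac in simp)
      then show ?thesis using smult[OF _ a] by simp
    qed
  qed (rule smult)
  then have Hs: "free_alg_submodule R J H M" unfolding free_alg_submodule_def using act by blast
  have kH: "k \<in> fmod_homs R J ?Pn (M\<lparr>carrier := H\<rparr>)"
    by (rule fmod_homsI) (use kh fmod_homsD(5)[OF k] in \<open>simp_all add: H_def\<close>)
  have kb: "bij_betw k (carrier ?Pn) (carrier (M\<lparr>carrier := H\<rparr>))"
    using inj unfolding bij_betw_def H_def by simp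
  have 1: "finite_trivial_sum R J (M\<lparr>carrier := H\<rparr>)"
    unfolding finite_trivial_sum_def fmod_isomorphic_def using iso_inverse_hom[OF Pn kH kb] by blast
  have fib: "H +>\<^bsub>M\<^esub> x = {z \<in> carrier M. p z = p x}" if "x \<in> carrier M" for x
    unfolding H_def im by (rule coset_fiber[OF M(1) Pm p that])
  \<comment> \<open>The map induced by \<open>p\<close>: it is constant on a coset, so any element
    may be picked.\<close>
  define g where "g = (\<lambda>X \<in> carrier (quotient_fmod M H). p (SOME x. x \<in> X))"
  have g: "g (H +>\<^bsub>M\<^esub> x) = p x" if x: "x \<in> carrier M" for x
  proof -
    have "(SOME z. z \<in> H +>\<^bsub>M\<^esub> x) \<in> H +>\<^bsub>M\<^esub> x" using coset_self[OF M(1) Hs x] by (rule someI)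
    then have "p (SOME z. z \<in> H +>\<^bsub>M\<^esub> x) = p x" using fib[OF x] by blast
    then show ?thesis unfolding g_def using x by (simp add: quotient_sel)
  qed
  have qE: "\<exists>x. x \<in> carrier M \<and> X = H +>\<^bsub>M\<^esub> x" if "X \<in> carrier (quotient_fmod M H)" for X
    using that unfolding quotient_sel by blast
  have g1: "g X \<in> carrier ?Pm" if X: "X \<in> carrier (quotient_fmod M H)" for X
  proof -
    obtain x where x: "x \<in> carrier M" "X = H +>\<^bsub>M\<^esub> x" using qE[OF X] by blast
    show ?thesis using ph(1)[OF x(1)] g[OF x(1), folded x(2)] by (simp only:)
  qed
  have g2: "g (X \<oplus>\<^bsub>quotient_fmod M H\<^esub> Y) = g X \<oplus>\<^bsub>?Pm\<^esub> g Y"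
    if X: "X \<in> carrier (quotient_fmod M H)" and Y: "Y \<in> carrier (quotient_fmod M H)" for X Y
  proof -
    obtain x where x: "x \<in> carrier M" "X = H +>\<^bsub>M\<^esub> x" using qE[OF X] by blast
    obtain y where y: "y \<in> carrier M" "Y = H +>\<^bsub>M\<^esub> y" using qE[OF Y] by blast
    have "X \<oplus>\<^bsub>quotient_fmod M H\<^esub> Y = H +>\<^bsub>M\<^esub> (x \<oplus>\<^bsub>M\<^esub> y)"
      unfolding x(2) y(2) quotient_sel by (rule coset_sum[OF M(1) Hs x(1) y(1)])
    then show ?thesis
      using g[OF M.add_closed[OF x(1) y(1)]] g[OF x(1), folded x(2)] g[OF y(1), folded y(2)] ph(2)[OF x(1) y(1)]
      by (simp only:)
  qed
  have g3: "g (a \<odot>\<^bsub>quotient_fmod M H\<^esub> X) = a \<odot>\<^bsub>?Pm\<^esub> g X"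
    if a: "a \<in> carrier R" and X: "X \<in> carrier (quotient_fmod M H)" for a X
  proof -
    obtain x where x: "x \<in> carrier M" "X = H +>\<^bsub>M\<^esub> x" using qE[OF X] by blast
    have "a \<odot>\<^bsub>quotient_fmod M H\<^esub> X = H +>\<^bsub>M\<^esub> (a \<odot>\<^bsub>M\<^esub> x)"
      unfolding x(2) quotient_sel by (rule coset_smult[OF M(1) Hs a x(1)])
    then show ?thesis using g[OF M.smult_in[OF a x(1)]] g[OF x(1), folded x(2)] ph(3)[OF a x(1)] by (simp only:)
  qed
  have g4: "g (act (quotient_fmod M H) j X) = act ?Pm j (g X)"
    if j: "j \<in> J" and X: "X \<in> carrier (quotient_fmod M H)" for j X
  proof -
    obtain x where x: "x \<in> carrier M" "X = H +>\<^bsub>M\<^esub> x" using qE[OF X] by blast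
    have "act (quotient_fmod M H) j X = H +>\<^bsub>M\<^esub> act M j x"
      unfolding x(2) quotient_sel by (rule coset_act[OF M(1) Hs j x(1)])
    then show ?thesis
      using g[OF free_alg_moduleD(2)[OF M(1) j x(1)]] g[OF x(1), folded x(2)] ph(4)[OF j x(1)] by (simp only:)
  qed
  have gh: "g \<in> fmod_homs R J (quotient_fmod M H) ?Pm"
    by (rule fmod_homsI[OF g1 g2 g3 g4]) (simp_all only: g_def restrict_extensional)
  have "bij_betw g (carrier (quotient_fmod M H)) (carrier ?Pm)"
    unfolding bij_betw_def
  proof
    show "inj_on g (carrier (quotient_fmod M H))"
    proof (rule inj_onI)
      fix X Y assume "X \<in> carrier (quotient_fmod M H)" "Y \<in> carrier (quotient_fmod M H)" and e: "g X = g Y"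
      then obtain x y where x: "x \<in> carrier M" "X = H +>\<^bsub>M\<^esub> x" and y: "y \<in> carrier M" "Y = H +>\<^bsub>M\<^esub> y"
        unfolding quotient_sel by blast
      have "p x = p y" using e g[OF x(1), folded x(2)] g[OF y(1), folded y(2)] by (simp only:)
      then show "X = Y" using fib[OF x(1), folded x(2)] fib[OF y(1), folded y(2)] by (simp only:)
    qed
    show "g ` carrier (quotient_fmod M H) = carrier ?Pm"
      unfolding quotient_sel image_image surj[symmetric] by (rule image_cong[OF refl g])
  qed
  then have 2: "finite_trivial_sum R J (quotient_fmod M H)"
    unfolding finite_trivial_sum_def fmod_isomorphic_def using gh by blast
  show ?thesis unfolding two_step_modules_def using M Hs 1 2 by blast
qed

lemma restrict_eqI:
  fixes n :: nat
  assumes "x \<in> {..<n} \<rightarrow>\<^sub>E S" "\<And>i. i < n \<Longrightarrow> f i = x i" shows "(\<lambda>i \<in> {..<n}. f i) = x"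
proof
  show "restrict f {..<n} i = x i" for i using assms(2)[of i] PiE_arb[OF assms(1), of i] by (cases "i < n") simp_all
qed

lemma PiE_nat_mem: "\<lbrakk>x \<in> {..<n :: nat} \<rightarrow>\<^sub>E S; i < n\<rbrakk> \<Longrightarrow> x i \<in> S"
  using PiE_mem[of x "{..<n}" "\<lambda>_. S" i] by simp

section \<open>Direct sums of modules\<close>

context zfc_sets
begin

text \<open>Underlying sets of modules are sets of elements of \<open>'v\<close>, so the direct sum
  is built on set-theoretic ordered pairs instead of the product type.\<close>

definition prodm :: "('r, 'v, 'i) fmodule \<Rightarrow> ('r, 'v, 'i) fmodule \<Rightarrow> ('r, 'v, 'i) fmodule" where
  "prodm M N = \<lparr>carrier = (\<lambda>(x, y). opair x y) ` (carrier M \<times> carrier N), mult = (\<lambda>x y. x),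
     one = zero_set, zero = opair \<zero>\<^bsub>M\<^esub> \<zero>\<^bsub>N\<^esub>,
     add = (\<lambda>x y. opair (ofst x \<oplus>\<^bsub>M\<^esub> ofst y) (osnd x \<oplus>\<^bsub>N\<^esub> osnd y)),
     smult = (\<lambda>a x. opair (a \<odot>\<^bsub>M\<^esub> ofst x) (a \<odot>\<^bsub>N\<^esub> osnd x)),
     act = (\<lambda>j x. opair (act M j (ofst x)) (act N j (osnd x)))\<rparr>"

lemma prodm_sel [simp]:
  "opair x y \<in> carrier (prodm M N) \<longleftrightarrow> x \<in> carrier M \<and> y \<in> carrier N"
  "\<zero>\<^bsub>prodm M N\<^esub> = opair \<zero>\<^bsub>M\<^esub> \<zero>\<^bsub>N\<^esub>"
  "z \<oplus>\<^bsub>prodm M N\<^esub> w = opair (ofst z \<oplus>\<^bsub>M\<^esub> ofst w) (osnd z \<oplus>\<^bsub>N\<^esub> osnd w)"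
  "a \<odot>\<^bsub>prodm M N\<^esub> z = opair (a \<odot>\<^bsub>M\<^esub> ofst z) (a \<odot>\<^bsub>N\<^esub> osnd z)"
  "act (prodm M N) j z = opair (act M j (ofst z)) (act N j (osnd z))"
  by (auto simp: prodm_def)

lemma prodm_mem:
  assumes "z \<in> carrier (prodm M N)"
  shows "ofst z \<in> carrier M" "osnd z \<in> carrier N" "opair (ofst z) (osnd z) = z"
  using assms by (auto simp: prodm_def)

lemma prodm_module:
  assumes M: "free_alg_module R J M" and N: "free_alg_module R J N"
  shows "free_alg_module R J (prodm M N)"
proof -
  interpret M: module R M by (rule free_alg_moduleD(1)[OF M])
  interpret N: module R N by (rule free_alg_moduleD(1)[OF N])
  have "abelian_group (prodm M N)"
  proof (rule abelian_groupI)
    fix x assume x: "x \<in> carrier (prodm M N)"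
    note x' = prodm_mem[OF x]
    show "\<exists>y \<in> carrier (prodm M N). y \<oplus>\<^bsub>prodm M N\<^esub> x = \<zero>\<^bsub>prodm M N\<^esub>"
      by (rule bexI[of _ "opair (\<ominus>\<^bsub>M\<^esub> ofst x) (\<ominus>\<^bsub>N\<^esub> osnd x)"]) (simp_all add: x' M.M.l_neg N.M.l_neg)
    show "\<zero>\<^bsub>prodm M N\<^esub> \<oplus>\<^bsub>prodm M N\<^esub> x = x" by (simp add: x')
    fix y assume y: "y \<in> carrier (prodm M N)"
    show "x \<oplus>\<^bsub>prodm M N\<^esub> y = y \<oplus>\<^bsub>prodm M N\<^esub> x" by (simp add: x' prodm_mem[OF y] M.M.a_comm N.M.a_comm)
  qed (simp_all add: prodm_mem M.M.a_assoc N.M.a_assoc)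
  then have "module R (prodm M N)"
    by (intro moduleI)
      (simp_all add: M.R.cring_axioms prodm_mem M.smult_l_distr N.smult_l_distr M.smult_r_distr N.smult_r_distr
        M.smult_assoc1 N.smult_assoc1)
  then show ?thesis
    by (rule free_alg_moduleI) (simp_all add: prodm_mem free_alg_moduleD[OF M] free_alg_moduleD[OF N])
qed

lemma prodm_ses:
  fixes M N :: "('r, 'v, 'i) fmodule"
  assumes R: "cring R" and M: "free_alg_module R J M" "ses_split R J M n1 m1 k1 p1"
    and N: "free_alg_module R J N" "ses_split R J N n2 m2 k2 p2"
  shows "\<exists>k p. ses_split R J (prodm M N) (n1 + n2) (m1 + m2) k p"
proof -
  interpret R: cring R by (rule R)
  interpret M: module R M by (rule free_alg_moduleD(1)[OF M(1)])
  interpret N: module R N by (rule free_alg_moduleD(1)[OF N(1)])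
  let ?P = "\<lambda>n. fmod_power (trivial_fmod R) n :: ('r, nat \<Rightarrow> 'r, 'i) fmodule"
  let ?C = "\<lambda>n. {..<n :: nat} \<rightarrow>\<^sub>E carrier R"
  have k1: "k1 \<in> fmod_homs R J (?P n1) M" and p1: "p1 \<in> fmod_homs R J M (?P m1)"
    and i1: "inj_on k1 (?C n1)" and s1: "p1 ` carrier M = ?C m1"
    and e1: "k1 ` ?C n1 = {x \<in> carrier M. p1 x = (\<lambda>k \<in> {..<m1}. \<zero>\<^bsub>R\<^esub>)}"
    using M(2) unfolding ses_split_def by blast+
  have k2: "k2 \<in> fmod_homs R J (?P n2) N" and p2: "p2 \<in> fmod_homs R J N (?P m2)"
    and i2: "inj_on k2 (?C n2)" and s2: "p2 ` carrier N = ?C m2"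
    and e2: "k2 ` ?C n2 = {x \<in> carrier N. p2 x = (\<lambda>k \<in> {..<m2}. \<zero>\<^bsub>R\<^esub>)}"
    using N(2) unfolding ses_split_def by blast+
  \<comment> \<open>Tuples of length \<open>n + m\<close> are cut into their first n and last m
    entries by \<open>l\<close> and \<open>r\<close>, and glued by \<open>j\<close>. All maps of the
    sum of the two sequences are written through these three.\<close>
  define l where "l n x = (\<lambda>i \<in> {..<n}. x i)" for n :: nat and x :: "nat \<Rightarrow> 'r"
  define r where "r n m x = (\<lambda>i \<in> {..<m}. x (n + i))" for n m :: nat and x :: "nat \<Rightarrow> 'r"
  define j where "j n m x y = (\<lambda>i \<in> {..<n + m}. if i < n then x i else y (i - n))" for n m :: nat and x y :: "nat \<Rightarrow> 'r"
  have l: "l n x \<in> ?C n" and r: "r n m x \<in> ?C m" if "x \<in> ?C (n + m)" for n m x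
    using PiE_nat_mem[OF that] by (auto simp: l_def r_def restrict_PiE_iff)
  have jj: "j n m x y \<in> ?C (n + m)" if "x \<in> ?C n" "y \<in> ?C m" for n m x y
    using PiE_nat_mem[OF that(1)] PiE_nat_mem[OF that(2)] by (auto simp: j_def restrict_PiE_iff)
  have lj: "l n (j n m x y) = x" and rj: "r n m (j n m x y) = y" if "x \<in> ?C n" "y \<in> ?C m" for n m x y
    unfolding l_def r_def by (rule restrict_eqI[OF that(1)], simp add: j_def, rule restrict_eqI[OF that(2)], simp add: j_def)
  have jlr: "j n m (l n x) (r n m x) = x" if "x \<in> ?C (n + m)" for n m x
    unfolding j_def by (rule restrict_eqI[OF that]) (auto simp: l_def r_def)
  let ?z = "\<lambda>n. (\<lambda>k \<in> {..<n :: nat}. \<zero>\<^bsub>R\<^esub>)"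
  have zC: "?z n \<in> ?C n" for n by (simp add: restrict_PiE_iff)
  have jz: "j n m (?z n) (?z m) = ?z (n + m)" for n m by (rule ext) (auto simp: j_def restrict_def)
  have j_eq: "j n m x y = ?z (n + m) \<longleftrightarrow> x = ?z n \<and> y = ?z m" if "x \<in> ?C n" "y \<in> ?C m" for n m x y
    using lj[OF that] rj[OF that] lj[OF zC zC, of n m] rj[OF zC zC, of n m] jz[of n m] by metis
  have lops: "l n (\<lambda>i \<in> {..<n + m}. x i \<oplus>\<^bsub>R\<^esub> y i) = (\<lambda>i \<in> {..<n}. l n x i \<oplus>\<^bsub>R\<^esub> l n y i)"
    "r n m (\<lambda>i \<in> {..<n + m}. x i \<oplus>\<^bsub>R\<^esub> y i) = (\<lambda>i \<in> {..<m}. r n m x i \<oplus>\<^bsub>R\<^esub> r n m y i)"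
    "l n (\<lambda>i \<in> {..<n + m}. a \<otimes>\<^bsub>R\<^esub> x i) = (\<lambda>i \<in> {..<n}. a \<otimes>\<^bsub>R\<^esub> l n x i)"
    "r n m (\<lambda>i \<in> {..<n + m}. a \<otimes>\<^bsub>R\<^esub> x i) = (\<lambda>i \<in> {..<m}. a \<otimes>\<^bsub>R\<^esub> r n m x i)"
    "l n (?z (n + m)) = ?z n" "r n m (?z (n + m)) = ?z m" for n m x y a
    by (rule ext, auto simp: l_def r_def restrict_def)+
  have jops: "j n m (\<lambda>i \<in> {..<n}. x i \<oplus>\<^bsub>R\<^esub> x' i) (\<lambda>i \<in> {..<m}. y i \<oplus>\<^bsub>R\<^esub> y' i) =
      (\<lambda>i \<in> {..<n + m}. j n m x y i \<oplus>\<^bsub>R\<^esub> j n m x' y' i)"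
    "j n m (\<lambda>i \<in> {..<n}. a \<otimes>\<^bsub>R\<^esub> x i) (\<lambda>i \<in> {..<m}. a \<otimes>\<^bsub>R\<^esub> y i) = (\<lambda>i \<in> {..<n + m}. a \<otimes>\<^bsub>R\<^esub> j n m x y i)"
    for n m x y x' y' a
    by (rule ext, auto simp: j_def restrict_def)+
  define k where "k = (\<lambda>x \<in> ?C (n1 + n2). opair (k1 (l n1 x)) (k2 (r n1 n2 x)))"
  define p where "p = (\<lambda>z \<in> carrier (prodm M N). j m1 m2 (p1 (ofst z)) (p2 (osnd z)))"
  have k1D: "x \<in> ?C n1 \<Longrightarrow> k1 x \<in> carrier M" "\<lbrakk>x \<in> ?C n1; y \<in> ?C n1\<rbrakk> \<Longrightarrow> k1 (\<lambda>i \<in> {..<n1}. x i \<oplus>\<^bsub>R\<^esub> y i) = k1 x \<oplus>\<^bsub>M\<^esub> k1 y"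
    "\<lbrakk>a \<in> carrier R; x \<in> ?C n1\<rbrakk> \<Longrightarrow> k1 (\<lambda>i \<in> {..<n1}. a \<otimes>\<^bsub>R\<^esub> x i) = a \<odot>\<^bsub>M\<^esub> k1 x"
    "\<lbrakk>j \<in> J; x \<in> ?C n1\<rbrakk> \<Longrightarrow> k1 (?z n1) = act M j (k1 x)" for x y a j
    using fmod_homsD(1-4)[OF k1] by (simp_all cong: restrict_cong)
  have k2D: "x \<in> ?C n2 \<Longrightarrow> k2 x \<in> carrier N" "\<lbrakk>x \<in> ?C n2; y \<in> ?C n2\<rbrakk> \<Longrightarrow> k2 (\<lambda>i \<in> {..<n2}. x i \<oplus>\<^bsub>R\<^esub> y i) = k2 x \<oplus>\<^bsub>N\<^esub> k2 y"
    "\<lbrakk>a \<in> carrier R; x \<in> ?C n2\<rbrakk> \<Longrightarrow> k2 (\<lambda>i \<in> {..<n2}. a \<otimes>\<^bsub>R\<^esub> x i) = a \<odot>\<^bsub>N\<^esub> k2 x"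
    "\<lbrakk>j \<in> J; x \<in> ?C n2\<rbrakk> \<Longrightarrow> k2 (?z n2) = act N j (k2 x)" for x y a j
    using fmod_homsD(1-4)[OF k2] by (simp_all cong: restrict_cong)
  have p1D: "x \<in> carrier M \<Longrightarrow> p1 x \<in> ?C m1" "\<lbrakk>x \<in> carrier M; y \<in> carrier M\<rbrakk> \<Longrightarrow> p1 (x \<oplus>\<^bsub>M\<^esub> y) = (\<lambda>i \<in> {..<m1}. p1 x i \<oplus>\<^bsub>R\<^esub> p1 y i)"
    "\<lbrakk>a \<in> carrier R; x \<in> carrier M\<rbrakk> \<Longrightarrow> p1 (a \<odot>\<^bsub>M\<^esub> x) = (\<lambda>i \<in> {..<m1}. a \<otimes>\<^bsub>R\<^esub> p1 x i)"
    "\<lbrakk>j \<in> J; x \<in> carrier M\<rbrakk> \<Longrightarrow> p1 (act M j x) = ?z m1" for x y a j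
    using fmod_homsD(1-4)[OF p1] by (simp_all cong: restrict_cong)
  have p2D: "x \<in> carrier N \<Longrightarrow> p2 x \<in> ?C m2" "\<lbrakk>x \<in> carrier N; y \<in> carrier N\<rbrakk> \<Longrightarrow> p2 (x \<oplus>\<^bsub>N\<^esub> y) = (\<lambda>i \<in> {..<m2}. p2 x i \<oplus>\<^bsub>R\<^esub> p2 y i)"
    "\<lbrakk>a \<in> carrier R; x \<in> carrier N\<rbrakk> \<Longrightarrow> p2 (a \<odot>\<^bsub>N\<^esub> x) = (\<lambda>i \<in> {..<m2}. a \<otimes>\<^bsub>R\<^esub> p2 x i)"
    "\<lbrakk>j \<in> J; x \<in> carrier N\<rbrakk> \<Longrightarrow> p2 (act N j x) = ?z m2" for x y a j
    using fmod_homsD(1-4)[OF p2] by (simp_all cong: restrict_cong)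
  have addC: "(\<lambda>i \<in> {..<n}. x i \<oplus>\<^bsub>R\<^esub> y i) \<in> ?C n" if "x \<in> ?C n" "y \<in> ?C n" for x y n
    using PiE_nat_mem[OF that(1)] PiE_nat_mem[OF that(2)] by (simp add: restrict_PiE_iff)
  have smC: "(\<lambda>i \<in> {..<n}. a \<otimes>\<^bsub>R\<^esub> x i) \<in> ?C n" if "a \<in> carrier R" "x \<in> ?C n" for x a n
    using that(1) PiE_nat_mem[OF that(2)] by (simp add: restrict_PiE_iff)
  have "ses_split R J (prodm M N) (n1 + n2) (m1 + m2) k p"
    unfolding ses_split_def
  proof (intro conjI)
    show "k \<in> fmod_homs R J (?P (n1 + n2)) (prodm M N)"
    proof (rule fmod_homsI)
      fix x assume "x \<in> carrier (?P (n1 + n2))"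
      then have x: "x \<in> ?C (n1 + n2)" by simp
      note lx = l[OF x] and rx = r[OF x]
      have kx: "k x = opair (k1 (l n1 x)) (k2 (r n1 n2 x))" using x by (simp only: k_def restrict_apply')
      show "k x \<in> carrier (prodm M N)" using k1D(1)[OF lx] k2D(1)[OF rx] by (simp add: kx)
      show "k (x \<oplus>\<^bsub>?P (n1 + n2)\<^esub> y) = k x \<oplus>\<^bsub>prodm M N\<^esub> k y" if "y \<in> carrier (?P (n1 + n2))" for y
      proof -
        have y: "y \<in> ?C (n1 + n2)" using that by simp
        have ky: "k y = opair (k1 (l n1 y)) (k2 (r n1 n2 y))" using y by (simp only: k_def restrict_apply')
        have "k (\<lambda>i \<in> {..<n1 + n2}. x i \<oplus>\<^bsub>R\<^esub> y i) = opair (k1 (l n1 x) \<oplus>\<^bsub>M\<^esub> k1 (l n1 y)) (k2 (r n1 n2 x) \<oplus>\<^bsub>N\<^esub> k2 (r n1 n2 y))"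
          using addC[OF x y] k1D(2)[OF lx l[OF y]] k2D(2)[OF rx r[OF y]]
          by (simp only: k_def restrict_apply' lops)
        then show ?thesis by (simp add: kx ky)
      qed
      show "k (a \<odot>\<^bsub>?P (n1 + n2)\<^esub> x) = a \<odot>\<^bsub>prodm M N\<^esub> k x" if a: "a \<in> carrier R" for a
      proof -
        have "k (\<lambda>i \<in> {..<n1 + n2}. a \<otimes>\<^bsub>R\<^esub> x i) = opair (a \<odot>\<^bsub>M\<^esub> k1 (l n1 x)) (a \<odot>\<^bsub>N\<^esub> k2 (r n1 n2 x))"
          using smC[OF a x] k1D(3)[OF a lx] k2D(3)[OF a rx]
          by (simp only: k_def restrict_apply' lops)
        then show ?thesis by (simp add: kx)
      qed
      show "k (act (?P (n1 + n2)) i x) = act (prodm M N) i (k x)" if i: "i \<in> J" for i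
      proof -
        have "k (?z (n1 + n2)) = opair (act M i (k1 (l n1 x))) (act N i (k2 (r n1 n2 x)))"
          using zC[of "n1 + n2"] k1D(4)[OF i lx] k2D(4)[OF i rx] by (simp only: k_def restrict_apply' lops)
        then show ?thesis by (simp add: kx)
      qed
    qed (simp add: k_def)
    show "p \<in> fmod_homs R J (prodm M N) (?P (m1 + m2))"
    proof (rule fmod_homsI)
      fix z assume z: "z \<in> carrier (prodm M N)"
      note zz = prodm_mem(1,2)[OF z]
      have pz: "p z = j m1 m2 (p1 (ofst z)) (p2 (osnd z))" using z by (simp only: p_def restrict_apply')
      show "p z \<in> carrier (?P (m1 + m2))" using jj[OF p1D(1)[OF zz(1)] p2D(1)[OF zz(2)]] by (simp add: pz)
      show "p (z \<oplus>\<^bsub>prodm M N\<^esub> w) = p z \<oplus>\<^bsub>?P (m1 + m2)\<^esub> p w" if w: "w \<in> carrier (prodm M N)" for w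
        using zz z prodm_mem(1,2)[OF w] w by (simp add: pz p_def p1D(2) p2D(2) jops cong: restrict_cong)
      show "p (a \<odot>\<^bsub>prodm M N\<^esub> z) = a \<odot>\<^bsub>?P (m1 + m2)\<^esub> p z" if a: "a \<in> carrier R" for a
        using zz z a by (simp add: pz p_def p1D(3) p2D(3) jops cong: restrict_cong)
      show "p (act (prodm M N) i z) = act (?P (m1 + m2)) i (p z)" if i: "i \<in> J" for i
        using zz z i by (simp add: pz p_def p1D(4) p2D(4) jz free_alg_moduleD(2)[OF M(1)] free_alg_moduleD(2)[OF N(1)] cong: restrict_cong)
    qed (simp add: p_def)
    show "inj_on k (?C (n1 + n2))"
    proof (rule inj_onI)
      fix x y assume x: "x \<in> ?C (n1 + n2)" and y: "y \<in> ?C (n1 + n2)" and "k x = k y"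
      then have e: "k1 (l n1 x) = k1 (l n1 y)" "k2 (r n1 n2 x) = k2 (r n1 n2 y)"
        by (simp_all only: k_def restrict_apply' opair_eq)
      have "l n1 x = l n1 y" "r n1 n2 x = r n1 n2 y"
        by (rule inj_onD[OF i1 e(1) l[OF x] l[OF y]], rule inj_onD[OF i2 e(2) r[OF x] r[OF y]])
      then have "j n1 n2 (l n1 x) (r n1 n2 x) = j n1 n2 (l n1 y) (r n1 n2 y)" by (simp only:)
      then show "x = y" by (simp only: jlr[OF x] jlr[OF y])
    qed
    show "p ` carrier (prodm M N) = ?C (m1 + m2)"
    proof
      show "p ` carrier (prodm M N) \<subseteq> ?C (m1 + m2)"
      proof (rule image_subsetI)
        fix z assume z: "z \<in> carrier (prodm M N)"
        show "p z \<in> ?C (m1 + m2)"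
          using jj[OF p1D(1)[OF prodm_mem(1)[OF z]] p2D(1)[OF prodm_mem(2)[OF z]]] z by (simp only: p_def restrict_apply')
      qed
      show "?C (m1 + m2) \<subseteq> p ` carrier (prodm M N)"
      proof
        fix y assume y: "y \<in> ?C (m1 + m2)"
        obtain u where u: "u \<in> carrier M" "l m1 y = p1 u" using l[OF y] unfolding s1[symmetric] by (rule imageE)
        obtain v where v: "v \<in> carrier N" "r m1 m2 y = p2 v" using r[OF y] unfolding s2[symmetric] by (rule imageE)
        have "p (opair u v) = y" using u v jlr[OF y] by (simp add: p_def)
        then show "y \<in> p ` carrier (prodm M N)" using u v by (intro image_eqI[of _ _ "opair u v"]) simp_all
      qed
    qed
    show "k ` (?C (n1 + n2)) = {z \<in> carrier (prodm M N). p z = ?z (m1 + m2)}"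
    proof (intro equalityI subsetI)
      fix z assume "z \<in> k ` (?C (n1 + n2))"
      then obtain x where x: "x \<in> ?C (n1 + n2)" "z = k x" by (rule imageE)
      have z: "z = opair (k1 (l n1 x)) (k2 (r n1 n2 x))" using x by (simp only: k_def restrict_apply')
      have "k1 (l n1 x) \<in> carrier M \<and> p1 (k1 (l n1 x)) = ?z m1" using e1 l[OF x(1)] by blast
      moreover have "k2 (r n1 n2 x) \<in> carrier N \<and> p2 (k2 (r n1 n2 x)) = ?z m2" using e2 r[OF x(1)] by blast
      ultimately show "z \<in> {z \<in> carrier (prodm M N). p z = ?z (m1 + m2)}" unfolding z by (simp add: p_def jz)
    next
      fix z assume "z \<in> {z \<in> carrier (prodm M N). p z = ?z (m1 + m2)}"
      then have z: "z \<in> carrier (prodm M N)" "j m1 m2 (p1 (ofst z)) (p2 (osnd z)) = ?z (m1 + m2)"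
        unfolding p_def by (auto cong: conj_cong)
      note zz = prodm_mem[OF z(1)]
      have "p1 (ofst z) = ?z m1" "p2 (osnd z) = ?z m2"
        using z(2) j_eq[OF p1D(1)[OF zz(1)] p2D(1)[OF zz(2)]] by blast+
      then have "ofst z \<in> k1 ` ?C n1" "osnd z \<in> k2 ` ?C n2" using e1 e2 zz by blast+
      then obtain u v where u: "u \<in> ?C n1" "ofst z = k1 u" and v: "v \<in> ?C n2" "osnd z = k2 v" by (elim imageE)
      have "k (j n1 n2 u v) = opair (k1 u) (k2 v)"
        using jj[OF u(1) v(1)] by (simp only: k_def restrict_apply' lj[OF u(1) v(1)] rj[OF u(1) v(1)])
      then have "z = k (j n1 n2 u v)" using zz(3) u(2) v(2) by simp
      then show "z \<in> k ` (?C (n1 + n2))" using jj[OF u(1) v(1)] by (rule image_eqI)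
    qed
  qed
  then show ?thesis by blast
qed

end

lemma restrict_empty: "restrict f {} = (\<lambda>x. undefined)"
  by (rule ext) simp

section \<open>The additive category of two-step modules\<close>

locale two_step = universe mem V for mem :: "'v \<Rightarrow> 'v \<Rightarrow> bool" and V :: 'v +
  fixes F :: "'v ring" and J :: "'v set"
  assumes field_F: "field F" and carrier_F: "\<exists>k. mem k V \<and> carrier F = elts mem k"
begin

interpretation F: field F by (rule field_F)

lemma cring_F: "cring F" by (rule F.cring_axioms)

abbreviation A :: "(('v, 'v, 'v) fmodule, 'v \<Rightarrow> 'v) pcat" where
  "A \<equiv> two_step_cat mem V F J"

abbreviation "Obj \<equiv> two_step_modules mem V F J"
abbreviation "Hom \<equiv> fmod_homs F J :: ('v, 'v, 'v) fmodule \<Rightarrow> ('v, 'v, 'v) fmodule \<Rightarrow> ('v \<Rightarrow> 'v) set"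

lemma Obj_carrier: "M \<in> Obj \<Longrightarrow> \<exists>m. mem m V \<and> carrier M = elts mem m"
  by (simp add: two_step_modules_def)

lemma prodm_Obj:
  assumes M: "M \<in> Obj" and N: "N \<in> Obj" shows "prodm M N \<in> Obj"
proof -
  obtain m n where m: "mem m V" "carrier M = elts mem m" and n: "mem n V" "carrier N = elts mem n"
    using Obj_carrier[OF M] Obj_carrier[OF N] by blast
  obtain p where p: "mem p V" "elts mem p = (\<lambda>(x, y). opair x y) ` (elts mem m \<times> elts mem n)"
    using U_product[OF m(1) n(1)] by blast
  have "carrier (prodm M N) = elts mem p" unfolding p(2) by (simp add: prodm_def m n)
  moreover obtain n1 m1 k1 p1 where "ses_split F J M n1 m1 k1 p1" using two_stepD[OF cring_F M] by blast
  moreover obtain n2 m2 k2 p2 where "ses_split F J N n2 m2 k2 p2" using two_stepD[OF cring_F N] by blast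
  ultimately obtain k q where "ses_split F J (prodm M N) (n1 + n2) (m1 + m2) k q"
    using prodm_ses[OF cring_F two_step_free[OF M] _ two_step_free[OF N]] by blast
  from two_stepI[OF cring_F prodm_module[OF two_step_free[OF M] two_step_free[OF N]] \<open>carrier (prodm M N) = elts mem p\<close> p(1) this]
  show ?thesis .
qed

lemma prodm_biproduct:
  assumes M: "M \<in> Obj" and N: "N \<in> Obj"
  shows "is_biproduct A M N (prodm M N) (\<lambda>x \<in> carrier M. opair x \<zero>\<^bsub>N\<^esub>) (\<lambda>y \<in> carrier N. opair \<zero>\<^bsub>M\<^esub> y)
    (\<lambda>z \<in> carrier (prodm M N). ofst z) (\<lambda>z \<in> carrier (prodm M N). osnd z)"
proof -
  note fM = two_step_free[OF M] and fN = two_step_free[OF N]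
  interpret M: module F M by (rule free_alg_moduleD(1)[OF fM])
  interpret N: module F N by (rule free_alg_moduleD(1)[OF fN])
  have i1: "(\<lambda>x \<in> carrier M. opair x \<zero>\<^bsub>N\<^esub>) \<in> Hom M (prodm M N)"
    by (rule fmod_homsI) (simp_all add: free_alg_moduleD(2)[OF fM] act_zero[OF fN])
  have i2: "(\<lambda>y \<in> carrier N. opair \<zero>\<^bsub>M\<^esub> y) \<in> Hom N (prodm M N)"
    by (rule fmod_homsI) (simp_all add: free_alg_moduleD(2)[OF fN] act_zero[OF fM])
  have p1: "(\<lambda>z \<in> carrier (prodm M N). ofst z) \<in> Hom (prodm M N) M"
    by (rule fmod_homsI) (simp_all add: prodm_mem free_alg_moduleD(2)[OF fM] free_alg_moduleD(2)[OF fN])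
  have p2: "(\<lambda>z \<in> carrier (prodm M N). osnd z) \<in> Hom (prodm M N) N"
    by (rule fmod_homsI) (simp_all add: prodm_mem free_alg_moduleD(2)[OF fM] free_alg_moduleD(2)[OF fN])
  show ?thesis
    unfolding is_biproduct_def
    using i1 i2 p1 p2 prodm_Obj[OF M N]
    by (simp add: compose_def prodm_mem cong: restrict_cong)
qed

definition zero_mod :: "('v, 'v, 'v) fmodule" where
  "zero_mod = (trivial_fmod F)\<lparr>carrier := {\<zero>\<^bsub>F\<^esub>}\<rparr>"

definition one_mod :: "('v, 'v, 'v) fmodule" where
  "one_mod = trivial_fmod F"

text \<open>The ring F[x]/(x^2) as a module over itself, with the variable i acting as x and the
  others as zero: the pair (a, b) stands for a + b x.\<close>

definition ext_mod :: "'v \<Rightarrow> ('v, 'v, 'v) fmodule" where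
  "ext_mod i = (prodm one_mod one_mod)\<lparr>act := \<lambda>j z. if j = i then opair \<zero>\<^bsub>F\<^esub> (ofst z) else opair \<zero>\<^bsub>F\<^esub> \<zero>\<^bsub>F\<^esub>\<rparr>"

lemma one_sel [simp]:
  "carrier one_mod = carrier F" "x \<oplus>\<^bsub>one_mod\<^esub> y = x \<oplus>\<^bsub>F\<^esub> y"
  "\<zero>\<^bsub>one_mod\<^esub> = \<zero>\<^bsub>F\<^esub>" "a \<odot>\<^bsub>one_mod\<^esub> x = a \<otimes>\<^bsub>F\<^esub> x" "act one_mod j x = \<zero>\<^bsub>F\<^esub>"
  by (simp_all add: one_mod_def)

lemma zero_sel [simp]:
  "carrier zero_mod = {\<zero>\<^bsub>F\<^esub>}" "x \<oplus>\<^bsub>zero_mod\<^esub> y = x \<oplus>\<^bsub>F\<^esub> y"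
  "\<zero>\<^bsub>zero_mod\<^esub> = \<zero>\<^bsub>F\<^esub>" "a \<odot>\<^bsub>zero_mod\<^esub> x = a \<otimes>\<^bsub>F\<^esub> x" "act zero_mod j x = \<zero>\<^bsub>F\<^esub>"
  by (simp_all add: zero_mod_def)

lemma ext_sel [simp]:
  "carrier (ext_mod i) = carrier (prodm one_mod one_mod)"
  "z \<oplus>\<^bsub>ext_mod i\<^esub> w = opair (ofst z \<oplus>\<^bsub>F\<^esub> ofst w) (osnd z \<oplus>\<^bsub>F\<^esub> osnd w)"
  "\<zero>\<^bsub>ext_mod i\<^esub> = opair \<zero>\<^bsub>F\<^esub> \<zero>\<^bsub>F\<^esub>"
  "a \<odot>\<^bsub>ext_mod i\<^esub> z = opair (a \<otimes>\<^bsub>F\<^esub> ofst z) (a \<otimes>\<^bsub>F\<^esub> osnd z)"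
  "act (ext_mod i) j z = (if j = i then opair \<zero>\<^bsub>F\<^esub> (ofst z) else opair \<zero>\<^bsub>F\<^esub> \<zero>\<^bsub>F\<^esub>)"
  by (simp_all add: ext_mod_def prodm_def)

lemma one2_mem:
  assumes "z \<in> carrier (prodm one_mod one_mod)"
  shows "ofst z \<in> carrier F" "osnd z \<in> carrier F" "opair (ofst z) (osnd z) = z"
  using prodm_mem[OF assms] by simp_all

lemma one_free: "free_alg_module F J one_mod"
  unfolding one_mod_def by (rule trivial_module[OF cring_F])

lemma one_Obj: "one_mod \<in> Obj"
proof -
  obtain k where k: "mem k V" "carrier F = elts mem k" using carrier_F by blast
  have "ses_split F J one_mod 0 1 (\<lambda>x \<in> {..<0 :: nat} \<rightarrow>\<^sub>E carrier F. \<zero>\<^bsub>F\<^esub>) (\<lambda>x \<in> carrier F. \<lambda>k \<in> {..<1 :: nat}. x)"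
    unfolding ses_split_def
  proof (intro conjI)
    show "(\<lambda>x \<in> {..<0 :: nat} \<rightarrow>\<^sub>E carrier F. \<zero>\<^bsub>F\<^esub>) \<in> fmod_homs F J (fmod_power (trivial_fmod F) (0 :: nat)) one_mod"
      by (rule fmod_homsI) (simp_all add: restrict_empty)
    show "(\<lambda>x \<in> carrier F. \<lambda>k \<in> {..<1 :: nat}. x) \<in> fmod_homs F J one_mod (fmod_power (trivial_fmod F) 1)"
      by (rule fmod_homsI) (simp_all add: restrict_PiE_iff cong: restrict_cong)
    show "(\<lambda>x \<in> carrier F. \<lambda>k \<in> {..<1 :: nat}. x) ` carrier one_mod = {..<1 :: nat} \<rightarrow>\<^sub>E carrier F"
    proof (intro equalityI subsetI)
      fix y assume y: "y \<in> {..<1 :: nat} \<rightarrow>\<^sub>E carrier F"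
      have "(\<lambda>k \<in> {..<1 :: nat}. y 0) = y" by (rule restrict_eqI[OF y]) simp
      moreover have "y 0 \<in> carrier F" by (rule PiE_nat_mem[OF y]) simp
      ultimately show "y \<in> (\<lambda>x \<in> carrier F. \<lambda>k \<in> {..<1 :: nat}. x) ` carrier one_mod"
        by (intro image_eqI[of _ _ "y 0"]) simp_all
    next
      fix y assume "y \<in> (\<lambda>x \<in> carrier F. \<lambda>k \<in> {..<1 :: nat}. x) ` carrier one_mod"
      then obtain x where x: "x \<in> carrier F" "y = (\<lambda>k \<in> {..<1 :: nat}. x)" by auto
      show "y \<in> {..<1 :: nat} \<rightarrow>\<^sub>E carrier F" using x by (simp add: restrict_PiE_iff)
    qed
    show "(\<lambda>x \<in> {..<0 :: nat} \<rightarrow>\<^sub>E carrier F. \<zero>\<^bsub>F\<^esub>) ` ({..<0 :: nat} \<rightarrow>\<^sub>E carrier F) =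
      {x \<in> carrier one_mod. (\<lambda>x \<in> carrier F. \<lambda>k \<in> {..<1 :: nat}. x) x = (\<lambda>k \<in> {..<1 :: nat}. \<zero>\<^bsub>F\<^esub>)}"
      by (auto dest: fun_cong[of _ _ 0])
  qed simp
  note s = this
  have c: "carrier one_mod = elts mem k" using k(2) by simp
  show ?thesis by (rule two_stepI[OF cring_F one_free c k(1) s])
qed

lemma zero_Obj: "zero_mod \<in> Obj"
proof -
  obtain k where k: "mem k V" "carrier F = elts mem k" using carrier_F by blast
  have "mem \<zero>\<^bsub>F\<^esub> k" using k(2) F.zero_closed unfolding elts_def by blast
  then have m: "mem (upair \<zero>\<^bsub>F\<^esub> \<zero>\<^bsub>F\<^esub>) V" using U_trans[OF _ k(1)] U_upair by blast
  have c: "carrier zero_mod = elts mem (upair \<zero>\<^bsub>F\<^esub> \<zero>\<^bsub>F\<^esub>)" by simp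
  have f: "free_alg_module F J zero_mod"
  proof -
    have "abelian_group zero_mod" by (rule abelian_groupI) simp_all
    then have "module F zero_mod" by (intro moduleI) (simp_all add: cring_F)
    then show ?thesis by (rule free_alg_moduleI) simp_all
  qed
  have s: "ses_split F J zero_mod 0 0 (\<lambda>x \<in> {..<0 :: nat} \<rightarrow>\<^sub>E carrier F. \<zero>\<^bsub>F\<^esub>) (\<lambda>x \<in> {\<zero>\<^bsub>F\<^esub>}. \<lambda>k \<in> {..<0 :: nat}. x)"
    unfolding ses_split_def
  proof (intro conjI)
    show "(\<lambda>x \<in> {..<0 :: nat} \<rightarrow>\<^sub>E carrier F. \<zero>\<^bsub>F\<^esub>) \<in> fmod_homs F J (fmod_power (trivial_fmod F) 0) zero_mod"
      by (rule fmod_homsI) (simp_all add: restrict_empty)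
    show "(\<lambda>x \<in> {\<zero>\<^bsub>F\<^esub>}. \<lambda>k \<in> {..<0 :: nat}. x) \<in> fmod_homs F J zero_mod (fmod_power (trivial_fmod F) 0)"
      by (rule fmod_homsI) (simp_all add: restrict_empty)
    show "(\<lambda>x \<in> {\<zero>\<^bsub>F\<^esub>}. \<lambda>k \<in> {..<0 :: nat}. x) ` carrier zero_mod = {..<0 :: nat} \<rightarrow>\<^sub>E carrier F"
      by (simp add: restrict_empty)
    show "(\<lambda>x \<in> {..<0 :: nat} \<rightarrow>\<^sub>E carrier F. \<zero>\<^bsub>F\<^esub>) ` ({..<0 :: nat} \<rightarrow>\<^sub>E carrier F) =
      {x \<in> carrier zero_mod. (\<lambda>x \<in> {\<zero>\<^bsub>F\<^esub>}. \<lambda>k \<in> {..<0 :: nat}. x) x = (\<lambda>k \<in> {..<0 :: nat}. \<zero>\<^bsub>F\<^esub>)}"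
      by (auto simp: restrict_empty)
  qed simp
  show ?thesis by (rule two_stepI[OF cring_F f c m s])
qed

lemma zero_mod_zero: "zero_object A zero_mod"
proof -
  interpret A: preadditive A by (rule two_step_preadditive)
  show ?thesis unfolding A.zero_object_iff using zero_Obj by (simp cong: restrict_cong)
qed

lemma additive_A: "additive_category A"
proof (intro additive_category.intro additive_category_axioms.intro two_step_preadditive)
  show "\<exists>Z. zero_object A Z" using zero_mod_zero by blast
  fix X Y assume "X \<in> Ob A" "Y \<in> Ob A"
  then have "X \<in> Obj" "Y \<in> Obj" by simp_all
  from prodm_biproduct[OF this] show "\<exists>S i1 i2 p1 p2. is_biproduct A X Y S i1 i2 p1 p2" by blast
qed

lemma ext_free: "free_alg_module F J (ext_mod i)"
proof -
  have "abelian_group (ext_mod i)"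
  proof (rule abelian_groupI)
    fix x assume x: "x \<in> carrier (ext_mod i)"
    then have x': "x \<in> carrier (prodm one_mod one_mod)" by simp
    show "\<exists>y \<in> carrier (ext_mod i). y \<oplus>\<^bsub>ext_mod i\<^esub> x = \<zero>\<^bsub>ext_mod i\<^esub>"
      by (rule bexI[of _ "opair (\<ominus>\<^bsub>F\<^esub> ofst x) (\<ominus>\<^bsub>F\<^esub> osnd x)"]) (simp_all add: one2_mem[OF x'] F.l_neg)
    fix y assume "y \<in> carrier (ext_mod i)"
    then have y': "y \<in> carrier (prodm one_mod one_mod)" by simp
    show "x \<oplus>\<^bsub>ext_mod i\<^esub> y = y \<oplus>\<^bsub>ext_mod i\<^esub> x" by (simp add: one2_mem[OF x'] one2_mem[OF y'] F.a_comm)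
  qed (simp_all add: one2_mem F.a_assoc)
  then have "module F (ext_mod i)"
    by (intro moduleI) (simp_all add: cring_F one2_mem F.l_distr F.r_distr F.m_assoc)
  then show ?thesis by (rule free_alg_moduleI) (simp_all add: one2_mem)
qed

lemma ext_Obj: "ext_mod i \<in> Obj"
proof -
  obtain p where p: "mem p V" "carrier (prodm one_mod one_mod) = elts mem p"
    using Obj_carrier[OF prodm_Obj[OF one_Obj one_Obj]] by blast
  \<comment> \<open>The submodule consists of the pairs (0, b). Multiplication by x vanishes on it
    and on the quotient, which the first coordinate identifies with F.\<close>
  let ?k = "\<lambda>u \<in> {..<1} \<rightarrow>\<^sub>E carrier F. opair \<zero>\<^bsub>F\<^esub> (u (0 :: nat))"
  let ?p = "\<lambda>z \<in> carrier (prodm one_mod one_mod). \<lambda>k \<in> {..<1 :: nat}. ofst z"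
  have u0: "u 0 \<in> carrier F" if "u \<in> {..<1 :: nat} \<rightarrow>\<^sub>E carrier F" for u using PiE_nat_mem[OF that] by simp
  have ue: "(\<lambda>k \<in> {..<1}. u 0) = u" if "u \<in> {..<1 :: nat} \<rightarrow>\<^sub>E carrier F" for u
    by (rule restrict_eqI[OF that]) simp
  have "ses_split F J (ext_mod i) 1 1 ?k ?p"
    unfolding ses_split_def
  proof (intro conjI)
    show "?k \<in> fmod_homs F J (fmod_power (trivial_fmod F) 1) (ext_mod i)"
      by (rule fmod_homsI) (simp_all add: u0 restrict_PiE_iff)
    show "?p \<in> fmod_homs F J (ext_mod i) (fmod_power (trivial_fmod F) 1)"
      by (rule fmod_homsI) (simp_all add: one2_mem restrict_PiE_iff cong: restrict_cong)
    show "inj_on ?k ({..<1} \<rightarrow>\<^sub>E carrier F)"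
    proof (rule inj_onI)
      fix u v assume u: "u \<in> {..<1 :: nat} \<rightarrow>\<^sub>E carrier F" and v: "v \<in> {..<1 :: nat} \<rightarrow>\<^sub>E carrier F" and "?k u = ?k v"
      then have "u 0 = v 0" by (simp only: restrict_apply' opair_eq)
      then have "(\<lambda>k \<in> {..<1 :: nat}. u 0) = (\<lambda>k \<in> {..<1}. v 0)" by (simp only:)
      then show "u = v" by (simp only: ue[OF u] ue[OF v])
    qed
    show "?p ` carrier (ext_mod i) = {..<1} \<rightarrow>\<^sub>E carrier F"
    proof (intro equalityI subsetI)
      fix y assume y: "y \<in> {..<1 :: nat} \<rightarrow>\<^sub>E carrier F"
      have "?p (opair (y 0) \<zero>\<^bsub>F\<^esub>) = y" using u0[OF y] ue[OF y] by simp
      then show "y \<in> ?p ` carrier (ext_mod i)"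
        using u0[OF y] by (intro image_eqI[of _ _ "opair (y 0) \<zero>\<^bsub>F\<^esub>"]) simp_all
    next
      fix y assume "y \<in> ?p ` carrier (ext_mod i)"
      then obtain z where z: "z \<in> carrier (prodm one_mod one_mod)" "y = ?p z" by auto
      show "y \<in> {..<1} \<rightarrow>\<^sub>E carrier F" using z one2_mem[OF z(1)] by (simp add: restrict_PiE_iff)
    qed
    show "?k ` ({..<1} \<rightarrow>\<^sub>E carrier F) = {z \<in> carrier (ext_mod i). ?p z = (\<lambda>k \<in> {..<1}. \<zero>\<^bsub>F\<^esub>)}"
    proof (intro equalityI subsetI)
      fix z assume "z \<in> ?k ` ({..<1} \<rightarrow>\<^sub>E carrier F)"
      then obtain u where u: "u \<in> {..<1} \<rightarrow>\<^sub>E carrier F" "z = ?k u" by (rule imageE)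
      have z: "z = opair \<zero>\<^bsub>F\<^esub> (u 0)" using u by (simp only: restrict_apply')
      show "z \<in> {z \<in> carrier (ext_mod i). ?p z = (\<lambda>k \<in> {..<1}. \<zero>\<^bsub>F\<^esub>)}"
        unfolding z using u0[OF u(1)] by simp
    next
      fix z assume "z \<in> {z \<in> carrier (ext_mod i). ?p z = (\<lambda>k \<in> {..<1}. \<zero>\<^bsub>F\<^esub>)}"
      then have z: "z \<in> carrier (prodm one_mod one_mod)" and e: "?p z = (\<lambda>k \<in> {..<1}. \<zero>\<^bsub>F\<^esub>)"
        by (auto cong: conj_cong)
      have e0: "ofst z = \<zero>\<^bsub>F\<^esub>" using fun_cong[OF e, of 0] z by simp
      have "osnd z \<in> carrier F" using prodm_mem(2)[OF z] by simp
      then have "(\<lambda>k \<in> {..<1 :: nat}. osnd z) \<in> {..<1} \<rightarrow>\<^sub>E carrier F" by (simp add: restrict_PiE_iff)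
      then show "z \<in> ?k ` ({..<1} \<rightarrow>\<^sub>E carrier F)"
        by (intro image_eqI[of _ _ "\<lambda>k \<in> {..<1}. osnd z"]) (use prodm_mem(3)[OF z] e0 in simp_all)
    qed
  qed
  note s = this
  have c: "carrier (ext_mod i) = elts mem p" using p(2) by simp
  show ?thesis by (rule two_stepI[OF cring_F ext_free c p(1) s])
qed

text \<open>Restriction of scalars along the endomorphism of the free algebra that fixes the
  variable i and sends the others to zero. It does not touch the underlying vector space.\<close>

definition rho :: "'v \<Rightarrow> ('v, 'v, 'v) fmodule \<Rightarrow> ('v, 'v, 'v) fmodule" where
  "rho i M = M\<lparr>act := \<lambda>j x. if j = i then act M j x else \<zero>\<^bsub>M\<^esub>\<rparr>"

lemma rho_sel [simp]:
  "carrier (rho i M) = carrier M" "x \<oplus>\<^bsub>rho i M\<^esub> y = x \<oplus>\<^bsub>M\<^esub> y" "\<zero>\<^bsub>rho i M\<^esub> = \<zero>\<^bsub>M\<^esub>"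
  "a \<odot>\<^bsub>rho i M\<^esub> x = a \<odot>\<^bsub>M\<^esub> x" "act (rho i M) j x = (if j = i then act M j x else \<zero>\<^bsub>M\<^esub>)"
  by (simp_all add: rho_def)

lemma rho_free:
  assumes M: "free_alg_module F J M" shows "free_alg_module F J (rho i M)"
proof -
  interpret M: module F M by (rule free_alg_moduleD(1)[OF M])
  have "abelian_group (rho i M)"
  proof (rule abelian_groupI)
    fix x assume "x \<in> carrier (rho i M)"
    then show "\<exists>y \<in> carrier (rho i M). y \<oplus>\<^bsub>rho i M\<^esub> x = \<zero>\<^bsub>rho i M\<^esub>"
      by (intro bexI[of _ "\<ominus>\<^bsub>M\<^esub> x"]) (simp_all add: M.M.l_neg)
    fix y assume "y \<in> carrier (rho i M)"
    then show "x \<oplus>\<^bsub>rho i M\<^esub> y = y \<oplus>\<^bsub>rho i M\<^esub> x" using \<open>x \<in> carrier (rho i M)\<close> by (simp add: M.M.a_comm)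
  qed (simp_all add: M.M.a_assoc)
  then have "module F (rho i M)"
    by (intro moduleI) (simp_all add: cring_F M.smult_l_distr M.smult_r_distr M.smult_assoc1)
  then show ?thesis by (rule free_alg_moduleI) (auto simp: free_alg_moduleD[OF M])
qed

text \<open>Both ends of the sequence have zero action, so switching off variables leaves
  \<open>k\<close> and \<open>p\<close> equivariant, and the same sequence serves.\<close>

lemma rho_Obj:
  assumes M: "M \<in> Obj" shows "rho i M \<in> Obj"
proof -
  note fM = two_step_free[OF M]
  interpret M: module F M by (rule free_alg_moduleD(1)[OF fM])
  obtain m where m: "mem m V" "carrier M = elts mem m" using Obj_carrier[OF M] by blast
  obtain n n' k p where s: "ses_split F J M n n' k p" using two_stepD[OF cring_F M] by blast
  let ?P = "\<lambda>n. fmod_power (trivial_fmod F) n :: ('v, nat \<Rightarrow> 'v, 'v) fmodule"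
  have P: "free_alg_module F J (?P n)" for n by (rule power_module[OF trivial_module[OF cring_F]])
  have k: "k \<in> fmod_homs F J (?P n) M" and p: "p \<in> fmod_homs F J M (?P n')" using s unfolding ses_split_def by blast+
  have act0: "act (?P n) j x = \<zero>\<^bsub>?P n\<^esub>" for n j x by simp
  have "k \<in> fmod_homs F J (?P n) (rho i M)"
  proof (rule fmod_homsI)
    fix j x assume j: "j \<in> J" "x \<in> carrier (?P n)"
    have "act M j (k x) = \<zero>\<^bsub>M\<^esub>" using fmod_homsD(4)[OF k j] hom_zero[OF P fM k] unfolding act0 by simp
    then show "k (act (?P n) j x) = act (rho i M) j (k x)" unfolding act0 hom_zero[OF P fM k] by auto
  qed (use fmod_homsD[OF k] in simp_all)
  moreover have "p \<in> fmod_homs F J (rho i M) (?P n')"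
    by (rule fmod_homsI) (use fmod_homsD[OF p] hom_zero[OF fM P p] in \<open>auto cong: restrict_cong\<close>)
  ultimately have "ses_split F J (rho i M) n n' k p" using s unfolding ses_split_def by simp
  note s = this
  have c: "carrier (rho i M) = elts mem m" using m(2) by simp
  show ?thesis by (rule two_stepI[OF cring_F rho_free[OF fM] c m(1) s])
qed

lemma rho_Hom:
  assumes M: "M \<in> Obj" and N: "N \<in> Obj" and f: "f \<in> Hom M N"
  shows "f \<in> Hom (rho i M) (rho i N)"
  by (rule fmod_homsI)
    (use fmod_homsD[OF f] hom_zero[OF two_step_free[OF M] two_step_free[OF N] f] in auto)

end

section \<open>Relabelling objects\<close>

text \<open>An additive endofunctor that is the identity on morphisms. Since it commutes with all
  operations on the nose, complexes, homotopies and cones are carried over by changing the objects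
  alone.\<close>

locale relabelling = additive_category C for C :: "('o, 'a, 'x) pcat_scheme" +
  fixes \<rho> :: "'o \<Rightarrow> 'o"
  assumes rho_Ob: "X \<in> Ob C \<Longrightarrow> \<rho> X \<in> Ob C"
    and rho_Mor: "\<lbrakk>X \<in> Ob C; Y \<in> Ob C; f \<in> Mor C X Y\<rbrakk> \<Longrightarrow> f \<in> Mor C (\<rho> X) (\<rho> Y)"
    and rho_idm: "X \<in> Ob C \<Longrightarrow> idm C (\<rho> X) = idm C X"
    and rho_cmp: "\<lbrakk>X \<in> Ob C; Y \<in> Ob C; Z \<in> Ob C\<rbrakk> \<Longrightarrow> cmp C (\<rho> X) (\<rho> Y) (\<rho> Z) g f = cmp C X Y Z g f"
    and rho_madd: "\<lbrakk>X \<in> Ob C; Y \<in> Ob C\<rbrakk> \<Longrightarrow> madd C (\<rho> X) (\<rho> Y) f g = madd C X Y f g"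
    and rho_mzero: "\<lbrakk>X \<in> Ob C; Y \<in> Ob C\<rbrakk> \<Longrightarrow> mzero C (\<rho> X) (\<rho> Y) = mzero C X Y"
begin

lemma rho_mneg: "\<lbrakk>X \<in> Ob C; Y \<in> Ob C; f \<in> Mor C X Y\<rbrakk> \<Longrightarrow> mneg C (\<rho> X) (\<rho> Y) f = mneg C X Y f"
  by (rule neg_unique) (simp_all add: rho_Ob rho_Mor mneg_in rho_madd rho_mzero madd_neg_right)

lemma rho_zero: "zero_object C X \<Longrightarrow> zero_object C (\<rho> X)"
  by (simp add: zero_object_iff rho_Ob rho_idm rho_mzero)

lemma rho_biproduct:
  assumes "X \<in> Ob C" "Y \<in> Ob C" "is_biproduct C X Y S i1 i2 p1 p2"
  shows "is_biproduct C (\<rho> X) (\<rho> Y) (\<rho> S) i1 i2 p1 p2"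
  using biproductD[OF assms] assms(1,2) unfolding is_biproduct_def
  by (simp add: rho_Ob rho_Mor rho_idm rho_cmp rho_madd rho_mzero)

definition Rc :: "('o, 'a) complex \<Rightarrow> ('o, 'a) complex" where
  "Rc X = \<lparr>cob = (\<lambda>n. \<rho> (cob X n)), cd = cd X\<rparr>"

lemma Rc_sel [simp]: "cob (Rc X) n = \<rho> (cob X n)" "cd (Rc X) n = cd X n"
  by (simp_all add: Rc_def)

lemma Rc_in: assumes "X \<in> cplx" shows "Rc X \<in> cplx"
proof -
  obtain N where N: "\<And>n. N < \<bar>n\<bar> \<Longrightarrow> zero_object C (cob X n)"
    using assms bounded_complexes_zero by blast
  show ?thesis
    by (rule bounded_complexesI[where N = N])
      (use assms N in \<open>simp_all add: cob_in cd_in cd_cd rho_Ob rho_Mor rho_cmp rho_mzero rho_zero\<close>)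
qed

lemma Rc_chain: "\<lbrakk>X \<in> cplx; Y \<in> cplx; f \<in> chain_maps C X Y\<rbrakk> \<Longrightarrow> f \<in> chain_maps C (Rc X) (Rc Y)"
  by (rule chain_mapsI) (simp_all add: cob_in cm_in cm_cd rho_Mor rho_cmp)

lemma Rc_hc:
  assumes "X \<in> cplx" "Y \<in> cplx" "f \<in> chain_maps C X Y" "g \<in> chain_maps C X Y" "hc X Y f = hc X Y g"
  shows "hc (Rc X) (Rc Y) f = hc (Rc X) (Rc Y) g"
proof -
  obtain s where s: "s \<in> homotopies X Y" "\<And>n. f n = madd C (cob X n) (cob Y n) (g n) (hbd X Y s n)"
    using hc_eqE[OF assms(5,1,2,3,4)] by blast
  have "s \<in> homotopies (Rc X) (Rc Y)"
    using s(1) assms by (intro homotopiesI) (simp add: rho_Mor cob_in hom_in)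
  moreover have "f n = madd C (cob (Rc X) n) (cob (Rc Y) n) (g n) (hbd (Rc X) (Rc Y) s n)" for n
    using s(2)[of n] assms by (simp add: hbd_def rho_cmp rho_madd cob_in)
  ultimately show ?thesis using hc_eqI[OF Rc_in Rc_in Rc_chain Rc_chain] assms by blast
qed

text \<open>Any representative of the homotopy class will do, because a homotopy remains one after
  relabelling.\<close>

definition R :: "(('o, 'a) complex, (int \<Rightarrow> 'a) set, ('o, 'a) complex, (int \<Rightarrow> 'a) set) func" where
  "R = \<lparr>FOb = Rc, FMor = (\<lambda>X Y f. hc (Rc X) (Rc Y) (SOME g. g \<in> f))\<rparr>"

lemma R_Ob [simp]: "FOb R X = Rc X"
  by (simp add: R_def)

lemma R_hc:
  assumes "X \<in> cplx" "Y \<in> cplx" "f \<in> chain_maps C X Y"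
  shows "FMor R X Y (hc X Y f) = hc (Rc X) (Rc Y) f"
proof -
  have "(SOME g. g \<in> hc X Y f) \<in> hc X Y f" using hc_self[OF assms] by (rule someI[of "\<lambda>g. g \<in> hc X Y f"])
  note m = hc_mem[OF assms this]
  show ?thesis unfolding R_def using Rc_hc[OF assms(1,2) m(1) assms(3) m(2)] by simp
qed

lemma R_functor: "is_functor K K R"
  unfolding is_functor_def
proof (intro conjI K_category ballI)
  fix X assume "X \<in> Ob K"
  then have X: "X \<in> cplx" by (simp add: K_sel(1))
  then show "FOb R X \<in> Ob K" by (simp add: K_sel(1) Rc_in)
  show "FMor R X X (idm K X) = idm K (FOb R X)"
    unfolding K_sel(3) R_hc[OF X X chain_id[OF X]] using X by (simp add: rho_idm cob_in)
  fix Y f assume "Y \<in> Ob K" "f \<in> Mor K X Y"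
  then obtain f' where Y: "Y \<in> cplx" and f: "f' \<in> chain_maps C X Y" "f = hc X Y f'" by (auto simp: K_sel)
  show "FMor R X Y f \<in> Mor K (FOb R X) (FOb R Y)"
    unfolding f(2) R_hc[OF X Y f(1)] using X Y f(1) by (simp add: hc_in Rc_chain)
  fix Z g assume "Z \<in> Ob K" "g \<in> Mor K Y Z"
  then obtain g' where Z: "Z \<in> cplx" and g: "g' \<in> chain_maps C Y Z" "g = hc Y Z g'" by (auto simp: K_sel)
  show "FMor R X Z (cmp K X Y Z g f) = cmp K (FOb R X) (FOb R Y) (FOb R Z) (FMor R Y Z g) (FMor R X Y f)"
    unfolding f(2) g(2) using X Y Z f(1) g(1)
    by (simp add: K_cmp R_hc Rc_in Rc_chain chain_cmp rho_cmp cob_in)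
qed

lemma R_madd:
  assumes "X \<in> cplx" "Y \<in> cplx" "f \<in> Mor K X Y" "g \<in> Mor K X Y"
  shows "FMor R X Y (madd K X Y f g) = madd K (Rc X) (Rc Y) (FMor R X Y f) (FMor R X Y g)"
proof -
  obtain f' g' where "f' \<in> chain_maps C X Y" "f = hc X Y f'" "g' \<in> chain_maps C X Y" "g = hc X Y g'"
    using assms(3,4) by (auto simp: K_sel)
  then show ?thesis using assms(1,2)
    by (simp add: K_madd R_hc Rc_in Rc_chain chain_madd rho_madd cob_in)
qed

lemma Rc_shift: "X \<in> cplx \<Longrightarrow> shift_complex C (Rc X) = Rc (shift_complex C X)"
  by (simp add: shift_complex_def Rc_def rho_mneg cob_in cd_in)

text \<open>That \<open>i2\<close> and \<open>p1\<close> are chain maps is read off from the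
  differential of the cone. The biproduct data and this differential keep their form under
  relabelling, so the cone is mapped to a cone.\<close>

lemma R_standard:
  assumes "(X, Y, Z, u, v, w) \<in> standard_triangles C"
  shows "X \<in> cplx" "Y \<in> cplx" "Z \<in> cplx" "u \<in> Mor K X Y" "v \<in> Mor K Y Z" "w \<in> Mor K Z (shift_complex C X)"
    "(Rc X, Rc Y, Rc Z, FMor R X Y u, FMor R Y Z v, FMor R Z (shift_complex C X) w) \<in> standard_triangles C"
proof -
  obtain f i2 p1 where *: "X \<in> cplx" "Y \<in> cplx" "Z \<in> cplx" and f: "f \<in> chain_maps C X Y" "is_cone C X Y f Z i2 p1"
    and uvw: "u = hc X Y f" "v = hc Y Z i2" "w = hc Z (shift_complex C X) p1"
    using assms unfolding standard_triangles_def by blast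
  show "X \<in> cplx" "Y \<in> cplx" "Z \<in> cplx" by (rule *)+
  note o = *[THEN cob_in]
  obtain i1 p2 where b: "\<And>n. is_biproduct C (cob X (n + 1)) (cob Y n) (cob Z n) (i1 n) (i2 n) (p1 n) (p2 n)"
    and dZ: "\<And>n. cd Z n =
         madd C (cob Z n) (cob Z (n + 1))
           (cmp C (cob Z n) (cob X (n + 2)) (cob Z (n + 1)) (i1 (n + 1))
             (cmp C (cob Z n) (cob X (n + 1)) (cob X (n + 2))
               (mneg C (cob X (n + 1)) (cob X (n + 2)) (cd X (n + 1))) (p1 n)))
           (cmp C (cob Z n) (cob Y (n + 1)) (cob Z (n + 1)) (i2 (n + 1))
             (madd C (cob Z n) (cob Y (n + 1))
               (cmp C (cob Z n) (cob X (n + 1)) (cob Y (n + 1)) (f (n + 1)) (p1 n))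
               (cmp C (cob Z n) (cob Y n) (cob Y (n + 1)) (cd Y n) (p2 n))))"
    using f(2) unfolding is_cone_def by blast
  note bD = biproductD[OF o(1) o(2) b]
  have b2: "is_biproduct C (cob X (n + 2)) (cob Y (n + 1)) (cob Z (n + 1)) (i1 (n + 1)) (i2 (n + 1)) (p1 (n + 1)) (p2 (n + 1))" for n
    using b[of "n + 1"] by (simp add: idx)
  note bD2 = biproductD[OF o(1) o(2) b2]
  have i2: "i2 \<in> chain_maps C Y Z"
  proof (rule chain_mapsI)
    show "i2 n \<in> Mor C (cob Y n) (cob Z n)" for n by (rule bD(3))
    show "cmp C (cob Y n) (cob Y (n + 1)) (cob Z (n + 1)) (i2 (n + 1)) (cd Y n) =
      cmp C (cob Y n) (cob Z n) (cob Z (n + 1)) (cd Z n) (i2 n)" for n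
      unfolding dZ using * f(1) bD(2-9)[of n] bD2(2-5)[of n] by (simp add: idx cx_in cx_simps cm_in)
  qed
  have p1: "p1 \<in> chain_maps C Z (shift_complex C X)"
  proof (rule chain_mapsI)
    show "p1 n \<in> Mor C (cob Z n) (cob (shift_complex C X) n)" for n using bD(4) by (simp add: cob_sel)
    have t: "cmp C W (cob Z (n + 1)) (cob X (n + 2)) (p1 (n + 1)) (cmp C W (cob X (n + 2)) (cob Z (n + 1)) (i1 (n + 1)) g) = g"
      "cmp C W (cob Z (n + 1)) (cob X (n + 2)) (p1 (n + 1)) (cmp C W (cob Y (n + 1)) (cob Z (n + 1)) (i2 (n + 1)) h) = mzero C W (cob X (n + 2))"
      if "W \<in> Ob C" "g \<in> Mor C W (cob X (n + 2))" "h \<in> Mor C W (cob Y (n + 1))" for W g h n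
      using that o bD2(2-9)[of n] by (simp_all add: cmp_assoc idm_left cmp_0_left)
    show "cmp C (cob Z n) (cob Z (n + 1)) (cob (shift_complex C X) (n + 1)) (p1 (n + 1)) (cd Z n) =
      cmp C (cob Z n) (cob (shift_complex C X) n) (cob (shift_complex C X) (n + 1)) (cd (shift_complex C X) n) (p1 n)" for n
    proof -
      let ?g = "cmp C (cob Z n) (cob X (n + 1)) (cob X (n + 2)) (mneg C (cob X (n + 1)) (cob X (n + 2)) (cd X (n + 1))) (p1 n)"
      let ?h = "madd C (cob Z n) (cob Y (n + 1))
               (cmp C (cob Z n) (cob X (n + 1)) (cob Y (n + 1)) (f (n + 1)) (p1 n))
               (cmp C (cob Z n) (cob Y n) (cob Y (n + 1)) (cd Y n) (p2 n))"
      have g: "?g \<in> Mor C (cob Z n) (cob X (n + 2))" and h: "?h \<in> Mor C (cob Z n) (cob Y (n + 1))"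
        using * f(1) bD(4,5)[of n] by (simp_all add: cx_in cm_in)
      have "cmp C (cob Z n) (cob Z (n + 1)) (cob X (n + 2)) (p1 (n + 1)) (cd Z n) =
        madd C (cob Z n) (cob X (n + 2))
          (cmp C (cob Z n) (cob Z (n + 1)) (cob X (n + 2)) (p1 (n + 1)) (cmp C (cob Z n) (cob X (n + 2)) (cob Z (n + 1)) (i1 (n + 1)) ?g))
          (cmp C (cob Z n) (cob Z (n + 1)) (cob X (n + 2)) (p1 (n + 1)) (cmp C (cob Z n) (cob Y (n + 1)) (cob Z (n + 1)) (i2 (n + 1)) ?h))"
        unfolding dZ by (rule cmp_madd_right) (use o g h bD2(2-4)[of n] in \<open>simp_all add: cmp_in\<close>)
      also have "\<dots> = ?g" unfolding t(1)[OF o(3) g h] t(2)[OF o(3) g h] by (rule madd_0_right[OF o(3) o(1) g])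
      finally show ?thesis by (simp add: cob_sel cd_sel add.assoc)
    qed
  qed
  have cone: "is_cone C (Rc X) (Rc Y) f (Rc Z) i2 p1"
    unfolding is_cone_def
    by (rule exI[of _ i1], rule exI[of _ p2])
      (use * o dZ in \<open>simp add: rho_biproduct[OF _ _ b] rho_cmp rho_madd rho_mneg cd_in\<close>)
  show "u \<in> Mor K X Y" "v \<in> Mor K Y Z" "w \<in> Mor K Z (shift_complex C X)"
    unfolding uvw using hc_in f(1) i2 p1 by blast+
  show "(Rc X, Rc Y, Rc Z, FMor R X Y u, FMor R Y Z v, FMor R Z (shift_complex C X) w) \<in> standard_triangles C"
    unfolding uvw R_hc[OF *(1,2) f(1)] R_hc[OF *(2,3) i2] R_hc[OF *(3) shift_in[OF *(1)] p1]
      Rc_shift[OF *(1), symmetric] standard_triangles_def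
    using * Rc_in Rc_chain f(1) cone by blast
qed

lemma R_shift:
  assumes "X \<in> cplx" "Y \<in> cplx" "f \<in> Mor K X Y"
  shows "FMor R (shift_complex C X) (shift_complex C Y) (FMor (Kb_shift C) X Y f) =
    FMor (Kb_shift C) (Rc X) (Rc Y) (FMor R X Y f)"
proof -
  obtain g where g: "g \<in> chain_maps C X Y" "f = hc X Y g" using assms(3) by (auto simp: K_sel)
  then show ?thesis using assms(1,2)
    by (simp add: R_hc shift_hc Rc_in Rc_chain shift_in chain_shift Rc_shift)
qed

lemma R_dist:
  assumes "(X, Y, Z, u, v, w) \<in> dist K"
  shows "(Rc X, Rc Y, Rc Z, FMor R X Y u, FMor R Y Z v, FMor R Z (shift_complex C X) w) \<in> dist K"
proof -
  from assms obtain X' Y' Z' u' v' w' a b c where o: "X \<in> Ob K" "Y \<in> Ob K" "Z \<in> Ob K"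
    and m: "u \<in> Mor K X Y" "v \<in> Mor K Y Z" "w \<in> Mor K Z (shift_complex C X)"
    and st: "(X', Y', Z', u', v', w') \<in> standard_triangles C"
    and i: "is_iso K X X' a" "is_iso K Y Y' b" "is_iso K Z Z' c"
    and sq: "cmp K X Y Y' b u = cmp K X X' Y' u' a" "cmp K Y Z Z' c v = cmp K Y Y' Z' v' b"
      "cmp K Z (shift_complex C X) (shift_complex C X') (FMor (Kb_shift C) X X' a) w =
        cmp K Z Z' (shift_complex C X') w' c"
    unfolding dist_K_iff by blast
  note s = R_standard[OF st]
  have o': "X' \<in> Ob K" "Y' \<in> Ob K" "Z' \<in> Ob K" using s(1-3) by (simp_all add: K_sel(1))
  have oc: "X \<in> cplx" "Y \<in> cplx" "Z \<in> cplx" using o by (simp_all add: K_sel(1))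
  have os: "shift_complex C X \<in> Ob K" "shift_complex C X' \<in> Ob K"
    using shift_in oc s(1) by (simp_all add: K_sel(1))
  note m' = s(4) and m'2 = s(5,6)
  note F = functorD(3-6)[OF R_functor] and iM = i[THEN iso_in]
  have SM: "FMor (Kb_shift C) X X' a \<in> Mor K (shift_complex C X) (shift_complex C X')"
  proof -
    obtain g where "g \<in> chain_maps C X X'" "a = hc X X' g" using iM(1) by (auto simp: K_sel)
    then show ?thesis using shift_hc[OF oc(1) s(1)] chain_shift[OF oc(1) s(1)] hc_in by simp
  qed
  have 1: "cmp K (Rc X) (Rc Y) (Rc Y') (FMor R Y Y' b) (FMor R X Y u) = cmp K (Rc X) (Rc X') (Rc Y') (FMor R X' Y' u') (FMor R X X' a)"
    using arg_cong[OF sq(1), of "FMor R X Y'"] F(4)[OF o(1,2) o'(2) m(1) iM(2)] F(4)[OF o(1) o'(1,2) iM(1) m'] by simp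
  have 2: "cmp K (Rc Y) (Rc Z) (Rc Z') (FMor R Z Z' c) (FMor R Y Z v) = cmp K (Rc Y) (Rc Y') (Rc Z') (FMor R Y' Z' v') (FMor R Y Y' b)"
    using arg_cong[OF sq(2), of "FMor R Y Z'"] F(4)[OF o(2,3) o'(3) m(2) iM(3)] F(4)[OF o(2) o'(2,3) iM(2) m'2(1)] by simp
  have 3: "cmp K (Rc Z) (shift_complex C (Rc X)) (shift_complex C (Rc X')) (FMor (Kb_shift C) (Rc X) (Rc X') (FMor R X X' a)) (FMor R Z (shift_complex C X) w) =
     cmp K (Rc Z) (Rc Z') (shift_complex C (Rc X')) (FMor R Z' (shift_complex C X') w') (FMor R Z Z' c)"
    using arg_cong[OF sq(3), of "FMor R Z (shift_complex C X')"] F(4)[OF o(3) os m(3) SM] F(4)[OF o(3) o'(3) os(2) iM(3) m'2(2)]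
      R_shift[OF oc(1) s(1) iM(1)] Rc_shift[OF oc(1)] Rc_shift[OF s(1)] by simp
  have iso: "is_iso K (Rc X) (Rc X') (FMor R X X' a)" "is_iso K (Rc Y) (Rc Y') (FMor R Y Y' b)" "is_iso K (Rc Z) (Rc Z') (FMor R Z Z' c)"
    using functor_iso[OF R_functor o(1) o'(1) i(1)] functor_iso[OF R_functor o(2) o'(2) i(2)] functor_iso[OF R_functor o(3) o'(3) i(3)] by simp_all
  have M: "Rc X \<in> Ob K" "Rc Y \<in> Ob K" "Rc Z \<in> Ob K" "FMor R X Y u \<in> Mor K (Rc X) (Rc Y)" "FMor R Y Z v \<in> Mor K (Rc Y) (Rc Z)"
    "FMor R Z (shift_complex C X) w \<in> Mor K (Rc Z) (shift_complex C (Rc X))"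
    using F(1) o F(2)[OF o(1,2) m(1)] F(2)[OF o(2,3) m(2)] F(2)[OF o(3) os(1) m(3)] Rc_shift[OF oc(1)] by simp_all
  show ?thesis unfolding dist_K_iff using M iso 1 2 3 s(7) by blast
qed

end

section \<open>Two-term complexes and their null homotopies\<close>

context additive_category
begin

text \<open>The zero object filling the other degrees is a parameter, so that relabelling sends a
  two-term complex to a two-term complex.\<close>

definition cplx2 :: "'o \<Rightarrow> 'o \<Rightarrow> 'o \<Rightarrow> 'a \<Rightarrow> ('o, 'a) complex" where
  "cplx2 Z A B d = \<lparr>cob = (\<lambda>n. if n = 0 then A else if n = 1 then B else Z),
     cd = (\<lambda>n. if n = 0 then d else if n = 1 then mzero C B Z else if n = -1 then mzero C Z A else mzero C Z Z)\<rparr>"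

definition map2 :: "'o \<Rightarrow> 'o \<Rightarrow> 'a \<Rightarrow> 'a \<Rightarrow> int \<Rightarrow> 'a" where
  "map2 Z Z' f g = (\<lambda>n. if n = 0 then f else if n = 1 then g else mzero C Z Z')"

lemma cplx2_sel:
  "cob (cplx2 Z A B d) n = (if n = 0 then A else if n = 1 then B else Z)"
  "cd (cplx2 Z A B d) n = (if n = 0 then d else if n = 1 then mzero C B Z else if n = -1 then mzero C Z A else mzero C Z Z)"
  by (simp_all add: cplx2_def)

lemma cplx2_in:
  assumes "zero_object C Z" "A \<in> Ob C" "B \<in> Ob C" "d \<in> Mor C A B"
  shows "cplx2 Z A B d \<in> cplx"
proof -
  have Z: "Z \<in> Ob C" using assms(1) by (simp add: zero_object_def)
  show ?thesis
    by (rule bounded_complexesI[where N = 1])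
      (use assms Z in \<open>auto simp: cplx2_sel mzero_in cmp_0_left cmp_0_right\<close>)
qed

context
  fixes Z A B d Z' A' B' d'
  assumes o: "zero_object C Z" "A \<in> Ob C" "B \<in> Ob C" "d \<in> Mor C A B"
    and o': "zero_object C Z'" "A' \<in> Ob C" "B' \<in> Ob C" "d' \<in> Mor C A' B'"
begin

abbreviation (input) "X2 \<equiv> cplx2 Z A B d"
abbreviation (input) "Y2 \<equiv> cplx2 Z' A' B' d'"

lemma Zob: "Z \<in> Ob C" "Z' \<in> Ob C" using o(1) o'(1) by (simp_all add: zero_object_def)

lemma map2_chain:
  assumes "f \<in> Mor C A A'" "g \<in> Mor C B B'" "cmp C A B B' g d = cmp C A A' B' d' f"
  shows "map2 Z Z' f g \<in> chain_maps C X2 Y2"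
  by (rule chain_mapsI)
    (use assms o o' Zob in \<open>auto simp: cplx2_sel map2_def mzero_in cmp_0_left cmp_0_right\<close>)

lemma chain_map2:
  assumes "f \<in> chain_maps C X2 Y2"
  shows "f 0 \<in> Mor C A A'" "f 1 \<in> Mor C B B'" "cmp C A B B' (f 1) d = cmp C A A' B' d' (f 0)"
    "f = map2 Z Z' (f 0) (f 1)"
proof -
  show "f 0 \<in> Mor C A A'" "f 1 \<in> Mor C B B'" "cmp C A B B' (f 1) d = cmp C A A' B' d' (f 0)"
    using cm_in[OF assms, of 0] cm_in[OF assms, of 1] cm_cd[OF assms, of 1 0] by (simp_all add: cplx2_sel)
  show "f = map2 Z Z' (f 0) (f 1)"
  proof
    fix n
    show "f n = map2 Z Z' (f 0) (f 1) n"
      using cm_in[OF assms, of n] zero_object_to[OF o'(1) Zob(1), of "f n"]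
      by (auto simp: cplx2_sel map2_def split: if_splits)
  qed
qed

text \<open>A homotopy between two-term complexes has a single component that matters, from degree 1
  of the source to degree 0 of the target. Vanishing in \<open>K\<close> thereby becomes a pair of
  equations between module maps.\<close>

lemma map2_eq_zeroI:
  assumes h: "h \<in> Mor C B A'" and f: "f \<in> chain_maps C X2 Y2" "f 0 = cmp C A B A' h d" "f 1 = cmp C B A' B' d' h"
  shows "hc X2 Y2 f = mzero K X2 Y2"
  unfolding K_sel(4)
proof (rule hc_eqI[OF cplx2_in[OF o] cplx2_in[OF o'] f(1) chain_zero[OF cplx2_in[OF o] cplx2_in[OF o']]])
  let ?s = "\<lambda>n :: int. if n = 1 then h else mzero C (cob X2 n) (cob Y2 (n - 1))"
  show "?s \<in> homotopies X2 Y2"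
    using h o o' Zob by (intro homotopiesI) (auto simp: cplx2_sel mzero_in)
  fix n
  show "f n = madd C (cob X2 n) (cob Y2 n) (mzero C (cob X2 n) (cob Y2 n)) (hbd X2 Y2 ?s n)"
    unfolding fun_cong[OF chain_map2(4)[OF f(1)], of n] hbd_def using h o o' Zob f(2,3)
    by (auto simp: map2_def cplx2_sel cmp_in mzero_in cmp_0_left cmp_0_right madd_0_left madd_0_right)
qed

lemma map2_eq_zeroD:
  assumes f: "f \<in> chain_maps C X2 Y2" "hc X2 Y2 f = mzero K X2 Y2"
  shows "\<exists>h \<in> Mor C B A'. f 0 = cmp C A B A' h d \<and> f 1 = cmp C B A' B' d' h"
proof -
  obtain s where s: "s \<in> homotopies X2 Y2"
    and fs: "\<And>n. f n = madd C (cob X2 n) (cob Y2 n) (mzero C (cob X2 n) (cob Y2 n)) (hbd X2 Y2 s n)"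
    using hc_eqE[OF f(2)[unfolded K_sel(4)] cplx2_in[OF o] cplx2_in[OF o'] f(1) chain_zero[OF cplx2_in[OF o] cplx2_in[OF o']]]
    by blast
  have s1: "s 1 \<in> Mor C B A'" "s 0 \<in> Mor C A Z'" "s 2 \<in> Mor C Z B'"
    using hom_in[OF s refl, of 1] hom_in[OF s refl, of 0] hom_in[OF s refl, of 2] by (simp_all add: cplx2_sel)
  have "f 0 = cmp C A B A' (s 1) d" "f 1 = cmp C B A' B' d' (s 1)"
    using fs[of 0] fs[of 1] s1 o o' Zob
    by (simp_all add: hbd_def cplx2_sel cmp_in cmp_0_left cmp_0_right madd_0_left madd_0_right)
  then show ?thesis using s1(1) by blast
qed

end

end

section \<open>The abelianisation\<close>

context category
begin

lemma iso_mono: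
  assumes o: "X \<in> Ob C" "Y \<in> Ob C" and f: "is_iso C X Y f"
  shows "is_mono C X Y f" "is_epi C X Y f"
proof -
  obtain g where g: "is_iso C Y X g" "cmp C X Y X g f = idm C X" "cmp C Y X Y f g = idm C Y"
    using iso_inverse[OF f] .
  note m = iso_in[OF f] iso_in[OF g(1)]
  have "u = cmp C W Y X g (cmp C W X Y f u)" if "W \<in> Ob C" "u \<in> Mor C W X" for W u
    unfolding cmp_assoc[OF that(1) o o(1) that(2) m] g(2) using idm_left[OF that(1) o(1) that(2)] by simp
  then show "is_mono C X Y f" unfolding is_mono_def using m(1) by metis
  have "u = cmp C Y X W (cmp C X Y W u f) g" if "W \<in> Ob C" "u \<in> Mor C Y W" for W u
    unfolding cmp_assoc[symmetric, OF o(2,1,2) that(1) m(2,1) that(2)] g(3) using idm_right[OF o(2) that] by simp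
  then show "is_epi C X Y f" unfolding is_epi_def using m(1) by metis
qed

end

locale abelianised = additive_category C for C :: "('o, 'a, 'x) pcat_scheme" +
  fixes D :: "('p, 'b) pcat" and H
  assumes ab: "is_abelianisation (Kb C) D H"
begin

lemma D_abelian: "abelian_category D" using ab unfolding is_abelianisation_def by blast

sublocale D: abelian_category D by (rule D_abelian)

interpretation Kc: category K by (rule K_category)

lemma H_coh: "cohomological K D H" using ab unfolding is_abelianisation_def by blast

lemma H_add: "additive_functor K D H" using H_coh unfolding cohomological_def by blast

lemmas H_functor = additive_functorD(1)[OF H_add]
lemmas H_Ob = functorD(3)[OF H_functor]
lemmas H_Mor = functorD(4)[OF H_functor]
lemmas H_idm = functorD(5)[OF H_functor]
lemmas H_cmp = functorD(6)[OF H_functor]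

lemma H_ff: "\<lbrakk>X \<in> Ob K; Y \<in> Ob K\<rbrakk> \<Longrightarrow> bij_betw (FMor H X Y) (Mor K X Y) (Mor D (FOb H X) (FOb H Y))"
  using ab unfolding is_abelianisation_def fully_faithful_def by blast

lemma H_full:
  assumes "X \<in> Ob K" "Y \<in> Ob K" "g \<in> Mor D (FOb H X) (FOb H Y)"
  obtains f where "f \<in> Mor K X Y" "g = FMor H X Y f"
  using H_ff[OF assms(1,2)] assms(3) unfolding bij_betw_def by blast

lemma H_inj: "\<lbrakk>X \<in> Ob K; Y \<in> Ob K; f \<in> Mor K X Y; g \<in> Mor K X Y; FMor H X Y f = FMor H X Y g\<rbrakk> \<Longrightarrow> f = g"
  using H_ff unfolding bij_betw_def inj_on_def by blast

lemma H_mzero: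
  assumes "X \<in> Ob K" "Y \<in> Ob K" shows "FMor H X Y (mzero K X Y) = mzero D (FOb H X) (FOb H Y)"
proof -
  have c: "X \<in> cplx" "Y \<in> cplx" using assms by (simp_all add: K_sel(1))
  note z = K_mzero_in[OF c]
  show ?thesis
    by (rule D.idem_zero[OF H_Ob[OF assms(1)] H_Ob[OF assms(2)] H_Mor[OF assms z]])
      (simp add: additive_functorD(2)[OF H_add assms z z, symmetric] K_mzero_add[OF c])
qed

lemma H_eq_zero: "\<lbrakk>X \<in> Ob K; Y \<in> Ob K; f \<in> Mor K X Y; FMor H X Y f = mzero D (FOb H X) (FOb H Y)\<rbrakk> \<Longrightarrow> f = mzero K X Y"
  using H_inj H_mzero K_mzero_in K_sel(1) by metis

lemma dist_Ob: "(X, Y, Z, u, v, w) \<in> dist K \<Longrightarrow> X \<in> Ob K \<and> Y \<in> Ob K \<and> Z \<in> Ob K"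
  unfolding dist_K_iff by blast

lemma dist_Mor: "(X, Y, Z, u, v, w) \<in> dist K \<Longrightarrow> u \<in> Mor K X Y \<and> v \<in> Mor K Y Z"
  unfolding dist_K_iff by blast

lemma H_dist:
  assumes "(X, Y, Z, u, v, w) \<in> dist K"
  shows "exact_pair D (FOb H X) (FOb H Y) (FOb H Z) (FMor H X Y u) (FMor H Y Z v)"
proof -
  have "exact_at D (FOb H X) (FOb H Y) (FOb H Z) (FMor H X Y u) (FMor H Y Z v)"
    using H_coh assms unfolding cohomological_def by blast
  then show ?thesis using D.exact_at_iff H_Ob dist_Ob[OF assms] by blast
qed

definition S where "S = FOb H ` Ob K"

lemma S_sub: "S \<subseteq> Ob D" unfolding S_def using H_Ob by blast

text \<open>By fullness \<open>h\<close> comes from a morphism of \<open>K\<close>. Its cocone gives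
  a distinguished triangle, which the cohomological functor makes exact at \<open>X\<close>.\<close>

lemma S_kernel: "\<lbrakk>X \<in> S; Y \<in> S; h \<in> Mor D X Y\<rbrakk> \<Longrightarrow> \<exists>L \<in> S. \<exists>k. exact_pair D L X Y k h"
proof -
  assume "X \<in> S" "Y \<in> S" and h: "h \<in> Mor D X Y"
  then obtain X' Y' where X: "X' \<in> Ob K" "X = FOb H X'" and Y: "Y' \<in> Ob K" "Y = FOb H Y'" unfolding S_def by blast
  obtain f where f: "f \<in> Mor K X' Y'" "h = FMor H X' Y' f" using H_full[OF X(1) Y(1)] h unfolding X(2) Y(2) .
  obtain L k w where d: "(L, X', Y', k, f, w) \<in> dist K" using cocone_dist X(1) Y(1) f(1) unfolding K_sel(1) by blast
  show ?thesis using H_dist[OF d] dist_Ob[OF d] unfolding S_def X(2) Y(2) f(2) by blast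
qed

lemma S_cokernel: "\<lbrakk>X \<in> S; Y \<in> S; h \<in> Mor D X Y\<rbrakk> \<Longrightarrow> \<exists>L \<in> S. \<exists>k. exact_pair D X Y L h k"
proof -
  assume "X \<in> S" "Y \<in> S" and h: "h \<in> Mor D X Y"
  then obtain X' Y' where X: "X' \<in> Ob K" "X = FOb H X'" and Y: "Y' \<in> Ob K" "Y = FOb H Y'" unfolding S_def by blast
  obtain f where f: "f \<in> Mor K X' Y'" "h = FMor H X' Y' f" using H_full[OF X(1) Y(1)] h unfolding X(2) Y(2) .
  obtain L k w where d: "(X', Y', L, f, k, w) \<in> dist K" using cone_dist X(1) Y(1) f(1) unfolding K_sel(1) by blast
  show ?thesis using H_dist[OF d] dist_Ob[OF d] unfolding S_def X(2) Y(2) f(2) by blast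
qed

lemma H_biproduct:
  assumes "X \<in> Ob K" "Y \<in> Ob K" "is_biproduct K X Y P i1 i2 p1 p2"
  shows "is_biproduct D (FOb H X) (FOb H Y) (FOb H P) (FMor H X P i1) (FMor H Y P i2) (FMor H P X p1) (FMor H P Y p2)"
proof -
  have P: "P \<in> Ob K" "i1 \<in> Mor K X P" "i2 \<in> Mor K Y P" "p1 \<in> Mor K P X" "p2 \<in> Mor K P Y"
    and e: "cmp K X P X p1 i1 = idm K X" "cmp K Y P Y p2 i2 = idm K Y"
     "cmp K Y P X p1 i2 = mzero K Y X" "cmp K X P Y p2 i1 = mzero K X Y"
     "madd K P P (cmp K P X P i1 p1) (cmp K P Y P i2 p2) = idm K P"
    using assms(3) unfolding is_biproduct_def by blast+
  note c1 = Kc.cmp_in[OF P(1) assms(1) P(1) P(4,2)] and c2 = Kc.cmp_in[OF P(1) assms(2) P(1) P(5,3)]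
  show ?thesis
    unfolding is_biproduct_def using assms(1,2) P
    by (simp add: H_Ob H_Mor H_cmp[symmetric] e H_idm H_mzero additive_functorD(2)[OF H_add P(1) P(1) c1 c2, symmetric])
qed

lemma S_biproduct: "\<lbrakk>X \<in> S; Y \<in> S\<rbrakk> \<Longrightarrow> \<exists>P \<in> S. \<exists>i1 i2 p1 p2. is_biproduct D X Y P i1 i2 p1 p2"
proof -
  assume "X \<in> S" "Y \<in> S"
  then obtain X' Y' where X: "X' \<in> Ob K" "X = FOb H X'" and Y: "Y' \<in> Ob K" "Y = FOb H Y'" unfolding S_def by blast
  obtain P i1 i2 p1 p2 where P: "is_biproduct K X' Y' P i1 i2 p1 p2"
    using K_biproduct X(1) Y(1) unfolding K_sel(1) by blast
  have "FOb H P \<in> S" using P unfolding S_def is_biproduct_def by blast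
  then show ?thesis using H_biproduct[OF X(1) Y(1) P] unfolding X(2) Y(2) by blast
qed

lemma S_img: "X \<in> S \<Longrightarrow> X \<in> img_objects D S"
  using S_sub D.iso_mono[OF _ _ D.iso_idm] unfolding img_objects_def by blast

lemma closed_img:
  assumes "S \<noteq> {}"
  shows "closed_subcategory D (img_objects D S)"
proof (intro closed_subcategory.intro closed_subcategory_axioms.intro D_abelian)
  show "img_objects D S \<subseteq> Ob D" by (auto simp: img_objects_def)
  show "img_objects D S \<noteq> {}" using S_img assms by blast
  show "M \<in> img_objects D S" if "X \<in> img_objects D S" "Y \<in> img_objects D S" "f \<in> Mor D X Y" "is_kernel D X Y f M k" for X Y f M k
    by (rule D.img_kernel[OF S_sub S_kernel that])
  show "M \<in> img_objects D S" if "X \<in> img_objects D S" "Y \<in> img_objects D S" "f \<in> Mor D X Y" "is_cokernel D X Y f M k" for X Y f M k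
    by (rule D.img_cokernel[OF S_sub S_cokernel that])
  show "P \<in> img_objects D S" if "X \<in> img_objects D S" "Y \<in> img_objects D S" "is_biproduct D X Y P i1 i2 p1 p2" for X Y P i1 i2 p1 p2
    by (rule D.img_biproduct[OF S_sub S_biproduct that])
qed

lemma zero_complex: "\<exists>X. X \<in> Ob K"
proof -
  obtain Z where "zero_object C Z" using has_zero by blast
  then have "cplx2 Z Z Z (mzero C Z Z) \<in> cplx" by (intro cplx2_in) (simp_all add: zero_object_def mzero_in)
  then show ?thesis by (auto simp: K_sel(1))
qed

text \<open>The image objects are closed under kernels, cokernels and biproducts, so the retraction
  argument makes every object isomorphic to one of them. The epimorphism and the monomorphism are
  then composed with that isomorphism and its inverse.\<close>

lemma D_img: "Z \<in> Ob D \<Longrightarrow> Z \<in> img_objects D S"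
proof -
  assume Z: "Z \<in> Ob D"
  have ne: "S \<noteq> {}" using zero_complex unfolding S_def by blast
  have HI: "FOb H X \<in> img_objects D S" if "X \<in> Ob K" for X using that S_img unfolding S_def by blast
  have "\<exists>Z' \<in> img_objects D S. \<exists>f. is_iso D Z' Z f"
    by (rule abelianisation_retract[OF ab closed_img[OF ne] HI Z dist_Ob])
  then obtain Z' f where Z': "Z' \<in> img_objects D S" "is_iso D Z' Z f" by blast
  obtain X \<pi> Y \<iota> where XY: "X \<in> S" "is_epi D X Z' \<pi>" "Y \<in> S" "is_mono D Z' Y \<iota>" and o': "Z' \<in> Ob D"
    using Z'(1) unfolding img_objects_def by blast
  obtain g where g: "is_iso D Z Z' g" using iso_inverse[OF Z'(2)] .
  have o: "X \<in> Ob D" "Y \<in> Ob D" using XY S_sub by blast+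
  have "is_epi D X Z (cmp D X Z' Z f \<pi>)"
    by (rule D.epi_cmp[OF o(1) o' Z XY(2) D.iso_mono(2)[OF o' Z Z'(2)]])
  moreover have "is_mono D Z Y (cmp D Z Z' Y \<iota> g)"
    by (rule D.mono_cmp[OF Z o' o(2) D.iso_mono(1)[OF Z o' g] XY(4)])
  ultimately show ?thesis unfolding img_objects_def using Z XY(1,3) by blast
qed

lemma D_epi: "Z \<in> Ob D \<Longrightarrow> \<exists>X. X \<in> Ob K \<and> (\<exists>\<pi>. is_epi D (FOb H X) Z \<pi>)"
  using D_img[of Z] unfolding img_objects_def S_def by blast

lemma D_mono: "Z \<in> Ob D \<Longrightarrow> \<exists>Y. Y \<in> Ob K \<and> (\<exists>\<iota>. is_mono D Z (FOb H Y) \<iota>)"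
  using D_img[of Z] unfolding img_objects_def S_def by blast

text \<open>Embed \<open>B\<close> into some \<open>H Y\<close> and cover \<open>A\<close> by some
  \<open>H X\<close>. The composite \<open>H X -> A -> B -> H Y\<close> comes from a morphism
  \<open>h\<close> of \<open>K\<close>, and \<open>f\<close> gives a morphism \<open>m\<close> from
  \<open>P\<close> to \<open>Y\<close>. The cone of \<open>h\<close> kills \<open>m\<close>, so
  \<open>m\<close> factors through \<open>h\<close> by the weak kernel property; cancelling the
  embedding of \<open>B\<close> gives the lift.\<close>

lemma H_projective:
  assumes P: "P \<in> Ob K" and o: "A \<in> Ob D" "B \<in> Ob D" and e: "is_epi D A B e" and f: "f \<in> Mor D (FOb H P) B"
  shows "\<exists>g \<in> Mor D (FOb H P) A. cmp D (FOb H P) A B e g = f"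
proof -
  obtain X \<pi> where X: "X \<in> Ob K" "is_epi D (FOb H X) A \<pi>" using D_epi[OF o(1)] by blast
  obtain Y \<iota> where Y: "Y \<in> Ob K" "is_mono D B (FOb H Y) \<iota>" using D_mono[OF o(2)] by blast
  note oX = H_Ob[OF X(1)] and oY = H_Ob[OF Y(1)] and oP = H_Ob[OF P]
  note pi = D.epi_in[OF X(2)] and io = D.mono_in[OF Y(2)] and em = D.epi_in[OF e]
  define q where "q = cmp D (FOb H X) A B e \<pi>"
  have q: "q \<in> Mor D (FOb H X) B" "is_epi D (FOb H X) B q"
    unfolding q_def by (rule D.cmp_in[OF oX o pi em], rule D.epi_cmp[OF oX o X(2) e])
  obtain h where h: "h \<in> Mor K X Y" "cmp D (FOb H X) B (FOb H Y) \<iota> q = FMor H X Y h"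
    using H_full[OF X(1) Y(1) D.cmp_in[OF oX o(2) oY q(1) io]] .
  obtain m where m: "m \<in> Mor K P Y" "cmp D (FOb H P) B (FOb H Y) \<iota> f = FMor H P Y m"
    using H_full[OF P Y(1) D.cmp_in[OF oP o(2) oY f io]] .
  obtain L c w where d: "(X, Y, L, h, c, w) \<in> dist K"
    and wk: "\<forall>P \<in> Ob K. \<forall>m \<in> Mor K P Y. cmp K P Y L c m = mzero K P L \<longrightarrow> (\<exists>s \<in> Mor K P X. cmp K P X Y h s = m)"
    using cone_dist[folded K_sel(1), OF X(1) Y(1) h(1)] by (elim exE conjE)
  have L: "L \<in> Ob K" and c: "c \<in> Mor K Y L" using dist_Ob[OF d] dist_Mor[OF d] by blast+
  note oL = H_Ob[OF L] and Hc = H_Mor[OF Y(1) L c]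
  have "cmp D (FOb H X) (FOb H Y) (FOb H L) (FMor H Y L c) (FMor H X Y h) = mzero D (FOb H X) (FOb H L)"
    using H_dist[OF d] unfolding exact_pair_def by blast
  then have "cmp D (FOb H X) B (FOb H L) (cmp D B (FOb H Y) (FOb H L) (FMor H Y L c) \<iota>) q = mzero D (FOb H X) (FOb H L)"
    unfolding h(2)[symmetric] D.cmp_assoc[OF oX o(2) oY oL q(1) io Hc] .
  \<comment> \<open>The image of \<open>c\<close> kills that of \<open>h\<close>, which is
    \<open>\<iota> q\<close>, and the epimorphism \<open>q\<close> cancels.\<close>
  then have ci: "cmp D B (FOb H Y) (FOb H L) (FMor H Y L c) \<iota> = mzero D B (FOb H L)"
    by (rule D.epiD[OF q(2) oX o(2) oL D.cmp_in[OF o(2) oY oL io Hc]])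
  have "FMor H P L (cmp K P Y L c m) = cmp D (FOb H P) B (FOb H L) (cmp D B (FOb H Y) (FOb H L) (FMor H Y L c) \<iota>) f"
    unfolding H_cmp[OF P Y(1) L m(1) c] m(2)[symmetric] by (rule D.cmp_assoc[OF oP o(2) oY oL f io Hc])
  also have "\<dots> = mzero D (FOb H P) (FOb H L)" unfolding ci by (rule D.cmp_0_left[OF oP o(2) oL f])
  finally have cm: "cmp K P Y L c m = mzero K P L" by (rule H_eq_zero[OF P L Kc.cmp_in[OF P Y(1) L m(1) c]])
  obtain s where s: "s \<in> Mor K P X" "cmp K P X Y h s = m"
    using wk[rule_format, OF P m(1) cm] by (elim bexE)
  note Hs = H_Mor[OF P X(1) s(1)]
  have "cmp D (FOb H P) B (FOb H Y) \<iota> (cmp D (FOb H P) (FOb H X) B q (FMor H P X s)) = cmp D (FOb H P) B (FOb H Y) \<iota> f"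
    unfolding D.cmp_assoc[OF oP oX o(2) oY Hs q(1) io] h(2) H_cmp[OF P X(1) Y(1) s(1) h(1), symmetric] s(2) m(2) ..
  then have "cmp D (FOb H P) (FOb H X) B q (FMor H P X s) = f"
    by (rule D.mono_eq[OF Y(2) oP D.cmp_in[OF oP oX o(2) Hs q(1)] f])
  then have "cmp D (FOb H P) A B e (cmp D (FOb H P) (FOb H X) A \<pi> (FMor H P X s)) = f"
    unfolding q_def D.cmp_assoc[OF oP oX o Hs pi em] .
  then show ?thesis using D.cmp_in[OF oP oX o(1) Hs pi] by blast
qed

text \<open>Composition with an epimorphism from \<open>H X\<close> and a monomorphism into
  \<open>H Y\<close> loses nothing, and \<open>H\<close> is full and faithful.\<close>

lemma D_hom_inj:
  assumes "Z \<in> Ob D" "Z' \<in> Ob D"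
  shows "\<exists>X \<in> Ob K. \<exists>Y \<in> Ob K. \<exists>f. inj_on f (Mor D Z Z') \<and> f ` Mor D Z Z' \<subseteq> Mor K X Y"
proof -
  obtain X \<pi> where X: "X \<in> Ob K" "is_epi D (FOb H X) Z \<pi>" using D_epi[OF assms(1)] by blast
  obtain Y \<iota> where Y: "Y \<in> Ob K" "is_mono D Z' (FOb H Y) \<iota>" using D_mono[OF assms(2)] by blast
  note oX = H_Ob[OF X(1)] and oY = H_Ob[OF Y(1)] and pi = D.epi_in[OF X(2)] and io = D.mono_in[OF Y(2)]
  define g where "g \<phi> = cmp D (FOb H X) Z' (FOb H Y) \<iota> (cmp D (FOb H X) Z Z' \<phi> \<pi>)" for \<phi>
  have g: "g \<phi> \<in> Mor D (FOb H X) (FOb H Y)" if "\<phi> \<in> Mor D Z Z'" for \<phi>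
    unfolding g_def by (rule D.cmp_in[OF oX assms(2) oY D.cmp_in[OF oX assms pi that] io])
  have gi: "inj_on g (Mor D Z Z')"
  proof (rule inj_onI)
    fix \<phi> \<psi> assume p: "\<phi> \<in> Mor D Z Z'" "\<psi> \<in> Mor D Z Z'" and "g \<phi> = g \<psi>"
    then have "cmp D (FOb H X) Z Z' \<phi> \<pi> = cmp D (FOb H X) Z Z' \<psi> \<pi>"
      unfolding g_def using D.mono_eq[OF Y(2) oX D.cmp_in[OF oX assms pi p(1)] D.cmp_in[OF oX assms pi p(2)]] by blast
    then show "\<phi> = \<psi>" by (rule D.epi_eq[OF X(2) assms(2) p])
  qed
  have b: "bij_betw (inv_into (Mor K X Y) (FMor H X Y)) (Mor D (FOb H X) (FOb H Y)) (Mor K X Y)"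
    by (rule bij_betw_inv_into[OF H_ff[OF X(1) Y(1)]])
  let ?f = "inv_into (Mor K X Y) (FMor H X Y) \<circ> g"
  have gs: "g ` Mor D Z Z' \<subseteq> Mor D (FOb H X) (FOb H Y)" using g by blast
  have "inj_on ?f (Mor D Z Z')"
    by (rule comp_inj_on[OF gi inj_on_subset[OF bij_betw_imp_inj_on[OF b] gs]])
  moreover have "?f ` Mor D Z Z' \<subseteq> Mor K X Y"
    using gs bij_betw_imp_surj_on[OF b] by (auto simp: image_comp[symmetric])
  ultimately show ?thesis using X(1) Y(1) by blast
qed

end

text \<open>Relabelling preserves distinguished triangles, so \<open>H R\<close> is cohomological
  and the existence half of the universal property yields an exact endofunctor.\<close>

lemma (in relabelling) R_extension:
  fixes D :: "('p, 'b) pcat"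
  assumes "is_abelianisation K D H"
  obtains G where "exact_functor D D G" "nat_isomorphic K D (comp_func G H) (comp_func H R)"
proof -
  interpret abelianised C D H by unfold_locales (rule assms)
  have F: "is_functor K D (comp_func H R)" by (rule functor_comp[OF R_functor H_functor])
  have "cohomological K D (comp_func H R)"
    unfolding cohomological_def additive_functor_def
  proof (intro conjI ballI F)
    fix X Y f g assume o: "X \<in> Ob K" "Y \<in> Ob K" and m: "f \<in> Mor K X Y" "g \<in> Mor K X Y"
    have c: "X \<in> cplx" "Y \<in> cplx" using o by (simp_all add: K_sel(1))
    show "FMor (comp_func H R) X Y (madd K X Y f g) =
      madd D (FOb (comp_func H R) X) (FOb (comp_func H R) Y) (FMor (comp_func H R) X Y f) (FMor (comp_func H R) X Y g)"
      using additive_functorD(2)[OF H_add functorD(3)[OF R_functor o(1)] functorD(3)[OF R_functor o(2)]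
          functorD(4)[OF R_functor o m(1)] functorD(4)[OF R_functor o m(2)]] R_madd[OF c m] by simp
  next
    fix t assume "t \<in> dist K"
    moreover obtain X Y Z u v w where t: "t = (X, Y, Z, u, v, w)" by (cases t)
    ultimately have "(Rc X, Rc Y, Rc Z, FMor R X Y u, FMor R Y Z v, FMor R Z (shift_complex C X) w) \<in> dist K"
      using R_dist by blast
    then have "exact_at D (FOb H (Rc X)) (FOb H (Rc Y)) (FOb H (Rc Z)) (FMor H (Rc X) (Rc Y) (FMor R X Y u)) (FMor H (Rc Y) (Rc Z) (FMor R Y Z v))"
      using H_coh unfolding cohomological_def by blast
    then show "case t of (X, Y, Z, u, v, w) \<Rightarrow> exact_at D (FOb (comp_func H R) X) (FOb (comp_func H R) Y) (FOb (comp_func H R) Z)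
         (FMor (comp_func H R) X Y u) (FMor (comp_func H R) Y Z v)"
      unfolding t by simp
  qed
  moreover have "is_equivalence (functor_cat D D (exact_functor D D)) (functor_cat K D (cohomological K D)) (precomp K H)"
    using assms D_abelian unfolding is_abelianisation_def by blast
  ultimately show thesis using precomp_equivalence_lift[OF _ F] that by metis
qed

section \<open>A Serre subcategory defined by exact functors\<close>

context abelian_category
begin

lemma short_exactD:
  assumes "X \<in> Ob C" "Y \<in> Ob C" "Z \<in> Ob C" "short_exact C X Y Z f g"
  shows "is_mono C X Y f" "is_epi C Y Z g" "cmp C X Y Z g f = mzero C X Z"
    "\<lbrakk>W \<in> Ob C; b \<in> Mor C W Y; cmp C W Y Z g b = mzero C W Z\<rbrakk> \<Longrightarrow> \<exists>u \<in> Mor C W X. cmp C W X Y f u = b"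
proof -
  have e: "exact_pair C X Y Z f g" and m: "is_mono C X Y f" and ep: "is_epi C Y Z g"
    using assms(4) exact_at_iff[OF assms(1-3)] unfolding short_exact_def by blast+
  show "is_mono C X Y f" "is_epi C Y Z g" by (rule m, rule ep)
  show "cmp C X Y Z g f = mzero C X Z" using e unfolding exact_pair_def by blast
  assume b: "W \<in> Ob C" "b \<in> Mor C W Y" "cmp C W Y Z g b = mzero C W Z"
  obtain Q q where Q: "is_cokernel C X Y f Q q" using has_cokernel[OF assms(1,2) mono_in[OF m]] by blast
  note q = cokernelD[OF Q]
  have "cmp C W Y Q q b = mzero C W Q" using e b q unfolding exact_pair_def by blast
  then show "\<exists>u \<in> Mor C W X. cmp C W X Y f u = b"
    using kernel_factor[OF mono_kernel_cokernel[OF assms(1,2) m Q] b(1,2)] by blast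
qed

lemma mono_short_exact:
  assumes "X \<in> Ob C" "Y \<in> Ob C" "is_mono C X Y f" "is_cokernel C X Y f Q q"
  shows "short_exact C X Y Q f q"
proof -
  note q = cokernelD[OF assms(4)] and f = mono_in[OF assms(3)]
  note k = mono_kernel_cokernel[OF assms]
  have "exact_pair C X Y Q f q"
    unfolding exact_pair_def
  proof (intro conjI ballI impI f q)
    fix A B a b assume A: "A \<in> Ob C" "B \<in> Ob C" "a \<in> Mor C Y A" "b \<in> Mor C B Y"
      and *: "cmp C X Y A a f = mzero C X A \<and> cmp C B Y Q q b = mzero C B Q"
    obtain u where u: "u \<in> Mor C B X" "cmp C B X Y f u = b" using kernel_factor[OF k A(2,4)] * by blast
    have "cmp C B Y A a b = cmp C B X A (cmp C X Y A a f) u"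
      unfolding u(2)[symmetric] by (rule cmp_assoc[OF A(2) assms(1,2) A(1) u(1) f A(3)])
    then show "cmp C B Y A a b = mzero C B A" using * cmp_0_left[OF A(2) assms(1) A(1) u(1)] by simp
  qed
  then show ?thesis
    unfolding short_exact_def exact_at_iff[OF assms(1,2) q(1)]
    using assms(3) cokernel_epi[OF assms(1,2) f assms(4)] by blast
qed

lemma epi_short_exact:
  assumes "X \<in> Ob C" "Y \<in> Ob C" "is_epi C X Y e" "is_kernel C X Y e L k"
  shows "short_exact C L X Y k e"
proof -
  note k = kernelD(1-3)[OF assms(4)]
  show ?thesis
    by (rule mono_short_exact[OF k(1) assms(1) kernel_mono[OF assms(1,2) epi_in[OF assms(3)] assms(4)] epi_cokernel_kernel[OF assms]])
qed

lemma functor_mzero: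
  assumes B: "preadditive B" and F: "additive_functor C B F" and o: "X \<in> Ob C" "Y \<in> Ob C"
  shows "FMor F X Y (mzero C X Y) = mzero B (FOb F X) (FOb F Y)"
proof -
  note z = mzero_in[OF o]
  note f = additive_functorD(1)[OF F]
  show ?thesis
    by (rule preadditive.idem_zero[OF B functorD(3)[OF f o(1)] functorD(3)[OF f o(2)] functorD(4)[OF f o z]])
      (simp add: additive_functorD(2)[OF F o z z, symmetric] madd_0_left[OF o z])
qed

end

lemma cat_epi_eq: "\<lbrakk>is_epi C X Y f; W \<in> Ob C; u \<in> Mor C Y W; v \<in> Mor C Y W; cmp C X Y W u f = cmp C X Y W v f\<rbrakk>
    \<Longrightarrow> u = v"
  unfolding is_epi_def by blast

text \<open>The candidate is \<open>\<tau>\<close> at \<open>Z\<close> after \<open>e\<close> after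
  the inverse of \<open>\<tau>\<close> at \<open>Y\<close>; the equation is verified after
  cancelling \<open>\<tau>\<close> at \<open>X\<close>. One and the same \<open>\<epsilon>\<close>
  serves all \<open>X\<close>, \<open>s\<close> and \<open>t\<close>, which makes it possible to
  compare two roofs.\<close>

lemma nat_iso_transfer:
  assumes F: "is_functor D B F" and G: "is_functor D B G" and n: "nat_isomorphic D B F G"
    and Y: "Y \<in> Ob D" and Z: "Z \<in> Ob D" and e: "e \<in> Mor B (FOb F Y) (FOb F Z)"
  shows "\<exists>\<epsilon> \<in> Mor B (FOb G Y) (FOb G Z). \<forall>X \<in> Ob D. \<forall>s \<in> Mor D X Y. \<forall>t \<in> Mor D X Z.
    cmp B (FOb F X) (FOb F Y) (FOb F Z) e (FMor F X Y s) = FMor F X Z t \<longrightarrow>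
    cmp B (FOb G X) (FOb G Y) (FOb G Z) \<epsilon> (FMor G X Y s) = FMor G X Z t"
proof -
  interpret B: category B by (rule functorD(2)[OF F])
  obtain \<tau> where t: "nat_trans D B F G \<tau>" and ti: "\<And>X. X \<in> Ob D \<Longrightarrow> is_iso B (FOb F X) (FOb G X) (\<tau> X)"
    using n unfolding nat_isomorphic_def by blast
  note Fo = functorD(3)[OF F] and Go = functorD(3)[OF G] and ta = nat_transD(2)[OF t]
  obtain y where y: "is_iso B (FOb G Y) (FOb F Y) y" "cmp B (FOb F Y) (FOb G Y) (FOb F Y) y (\<tau> Y) = idm B (FOb F Y)"
    using iso_inverse[OF ti[OF Y]] by blast
  note ym = iso_in[OF y(1)]
  let ?\<epsilon> = "cmp B (FOb G Y) (FOb F Z) (FOb G Z) (\<tau> Z) (cmp B (FOb G Y) (FOb F Y) (FOb F Z) e y)"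
  have ey: "cmp B (FOb G Y) (FOb F Y) (FOb F Z) e y \<in> Mor B (FOb G Y) (FOb F Z)"
    by (rule B.cmp_in[OF Go[OF Y] Fo[OF Y] Fo[OF Z] ym e])
  have eps: "?\<epsilon> \<in> Mor B (FOb G Y) (FOb G Z)" by (rule B.cmp_in[OF Go[OF Y] Fo[OF Z] Go[OF Z] ey ta[OF Z]])
  have "cmp B (FOb G X) (FOb G Y) (FOb G Z) ?\<epsilon> (FMor G X Y s) = FMor G X Z u"
    if X: "X \<in> Ob D" and s: "s \<in> Mor D X Y" and u: "u \<in> Mor D X Z"
      and c: "cmp B (FOb F X) (FOb F Y) (FOb F Z) e (FMor F X Y s) = FMor F X Z u" for X s u
  proof -
    note Fs = functorD(4)[OF F X Y s] and Gs = functorD(4)[OF G X Y s] and Gu = functorD(4)[OF G X Z u] and Fu = functorD(4)[OF F X Z u]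
    have ee: "is_epi B (FOb F X) (FOb G X) (\<tau> X)" by (rule B.iso_mono(2)[OF Fo[OF X] Go[OF X] ti[OF X]])
    have yG: "cmp B (FOb F X) (FOb G Y) (FOb F Y) y (cmp B (FOb F X) (FOb G X) (FOb G Y) (FMor G X Y s) (\<tau> X)) = FMor F X Y s"
      unfolding nat_transD(3)[OF t X Y s, symmetric] B.cmp_assoc[OF Fo[OF X] Fo[OF Y] Go[OF Y] Fo[OF Y] Fs ta[OF Y] ym] y(2)
      by (rule B.idm_left[OF Fo[OF X] Fo[OF Y] Fs])
    note GsX = B.cmp_in[OF Fo[OF X] Go[OF X] Go[OF Y] ta[OF X] Gs]
    have "cmp B (FOb F X) (FOb G X) (FOb G Z) (cmp B (FOb G X) (FOb G Y) (FOb G Z) ?\<epsilon> (FMor G X Y s)) (\<tau> X)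
      = cmp B (FOb F X) (FOb G Y) (FOb G Z) ?\<epsilon> (cmp B (FOb F X) (FOb G X) (FOb G Y) (FMor G X Y s) (\<tau> X))"
      by (rule B.cmp_assoc[symmetric, OF Fo[OF X] Go[OF X] Go[OF Y] Go[OF Z] ta[OF X] Gs eps])
    also have "\<dots> = cmp B (FOb F X) (FOb F Z) (FOb G Z) (\<tau> Z) (cmp B (FOb F X) (FOb G Y) (FOb F Z)
        (cmp B (FOb G Y) (FOb F Y) (FOb F Z) e y) (cmp B (FOb F X) (FOb G X) (FOb G Y) (FMor G X Y s) (\<tau> X)))"
      by (rule B.cmp_assoc[symmetric, OF Fo[OF X] Go[OF Y] Fo[OF Z] Go[OF Z] GsX ey ta[OF Z]])
    also have "\<dots> = cmp B (FOb F X) (FOb F Z) (FOb G Z) (\<tau> Z) (FMor F X Z u)"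
      unfolding B.cmp_assoc[symmetric, OF Fo[OF X] Go[OF Y] Fo[OF Y] Fo[OF Z] GsX ym e] yG c ..
    also have "\<dots> = cmp B (FOb F X) (FOb G X) (FOb G Z) (FMor G X Z u) (\<tau> X)"
      by (rule nat_transD(3)[OF t X Z u])
    finally show ?thesis
      by (rule cat_epi_eq[OF ee Go[OF Z] B.cmp_in[OF Go[OF X] Go[OF Y] Go[OF Z] Gs eps] Gu])
  qed
  then show ?thesis using eps by blast
qed

text \<open>The interface between module computations and the argument in the abelianisation. The
  roofs have legs \<open>s j\<close> and \<open>t j\<close>. The functor Hom(P i, R i -) makes every
  \<open>s j\<close> bijective, kills \<open>t j\<close> for j other than i, and does not kill
  \<open>t i\<close>.\<close>

locale separating = abelianised C D H for C :: "('o, 'a, 'x) pcat_scheme" and D :: "('p, 'b) pcat" and H +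
  fixes I :: "'i set" and G :: "'i \<Rightarrow> ('p, 'b, 'p, 'b) func"
    and R :: "'i \<Rightarrow> (('o, 'a) complex, (int \<Rightarrow> 'a) set, ('o, 'a) complex, (int \<Rightarrow> 'a) set) func"
    and P X :: "'i \<Rightarrow> ('o, 'a) complex" and Y Z :: "('o, 'a) complex" and s t :: "'i \<Rightarrow> (int \<Rightarrow> 'a) set"
  assumes G_exact: "i \<in> I \<Longrightarrow> exact_functor D D (G i)"
    and R_functor: "i \<in> I \<Longrightarrow> is_functor K K (R i)"
    and G_R: "i \<in> I \<Longrightarrow> nat_isomorphic K D (comp_func (G i) H) (comp_func H (R i))"
    and P_Ob: "i \<in> I \<Longrightarrow> P i \<in> Ob K" and X_Ob: "i \<in> I \<Longrightarrow> X i \<in> Ob K" and Y_Ob: "Y \<in> Ob K" and Z_Ob: "Z \<in> Ob K"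
    and s_Mor: "i \<in> I \<Longrightarrow> s i \<in> Mor K (X i) Y" and t_Mor: "i \<in> I \<Longrightarrow> t i \<in> Mor K (X i) Z"
    and s_inj: "\<lbrakk>i \<in> I; j \<in> I; b \<in> Mor K (P i) (FOb (R i) (X j));
      cmp K (P i) (FOb (R i) (X j)) (FOb (R i) Y) (FMor (R i) (X j) Y (s j)) b = mzero K (P i) (FOb (R i) Y)\<rbrakk>
      \<Longrightarrow> b = mzero K (P i) (FOb (R i) (X j))"
    and s_surj: "\<lbrakk>i \<in> I; j \<in> I; c \<in> Mor K (P i) (FOb (R i) Y)\<rbrakk> \<Longrightarrow> \<exists>b \<in> Mor K (P i) (FOb (R i) (X j)).
      cmp K (P i) (FOb (R i) (X j)) (FOb (R i) Y) (FMor (R i) (X j) Y (s j)) b = c"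
    and t_zero: "\<lbrakk>i \<in> I; j \<in> I; i \<noteq> j; b \<in> Mor K (P i) (FOb (R i) (X j))\<rbrakk> \<Longrightarrow>
      cmp K (P i) (FOb (R i) (X j)) (FOb (R i) Z) (FMor (R i) (X j) Z (t j)) b = mzero K (P i) (FOb (R i) Z)"
    and t_nonzero: "i \<in> I \<Longrightarrow> \<exists>b \<in> Mor K (P i) (FOb (R i) (X i)).
      cmp K (P i) (FOb (R i) (X i)) (FOb (R i) Z) (FMor (R i) (X i) Z (t i)) b \<noteq> mzero K (P i) (FOb (R i) Z)"
begin

interpretation Kc: category K by (rule K_category)

abbreviation "hP i \<equiv> FOb H (P i)"
abbreviation "gO i \<equiv> FOb (G i)"
abbreviation "gM i \<equiv> FMor (G i)"
abbreviation "hMor i A \<equiv> Mor D (hP i) (gO i A)"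
abbreviation "hzero i A \<equiv> mzero D (hP i) (gO i A)"
abbreviation "hcmp i A B \<equiv> cmp D (hP i) (gO i A) (gO i B)"
abbreviation "kMor i A \<equiv> Mor K (P i) (FOb (R i) A)"
abbreviation "kzero i A \<equiv> mzero K (P i) (FOb (R i) A)"
abbreviation "kcmp i A B \<equiv> cmp K (P i) (FOb (R i) A) (FOb (R i) B)"

lemmas G_add = exact_functorD(1)[OF G_exact]
lemmas G_functor = additive_functorD(1)[OF G_add]
lemmas G_Ob = functorD(3)[OF G_functor]
lemmas G_Mor = functorD(4)[OF G_functor]

lemma hP_Ob: "i \<in> I \<Longrightarrow> hP i \<in> Ob D" using H_Ob P_Ob by blast

lemma G_mono:
  assumes i: "i \<in> I" and o: "A \<in> Ob D" "B \<in> Ob D" and m: "is_mono D A B f"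
  shows "is_mono D (gO i A) (gO i B) (gM i A B f)"
proof -
  obtain Q q where Q: "is_cokernel D A B f Q q" using D.has_cokernel[OF o D.mono_in[OF m]] by blast
  note q = D.cokernelD[OF Q]
  have "short_exact D (gO i A) (gO i B) (gO i Q) (gM i A B f) (gM i B Q q)"
    by (rule exact_functorD(2)[OF G_exact[OF i] o q(1) D.mono_short_exact[OF o m Q]])
  then show ?thesis by (simp add: short_exact_def)
qed

lemma G_epi:
  assumes i: "i \<in> I" and o: "A \<in> Ob D" "B \<in> Ob D" and m: "is_epi D A B f"
  shows "is_epi D (gO i A) (gO i B) (gM i A B f)"
proof -
  obtain Q q where Q: "is_kernel D A B f Q q" using D.has_kernel[OF o D.epi_in[OF m]] by blast
  note q = D.kernelD(1-3)[OF Q]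
  have "short_exact D (gO i Q) (gO i A) (gO i B) (gM i Q A q) (gM i A B f)"
    by (rule exact_functorD(2)[OF G_exact[OF i] q(1) o D.epi_short_exact[OF o m Q]])
  then show ?thesis by (simp add: short_exact_def)
qed

definition null_at :: "'i \<Rightarrow> 'p \<Rightarrow> bool" where
  "null_at i W \<longleftrightarrow> (\<forall>a \<in> hMor i W. a = hzero i W)"

definition null_objects :: "'p set" where
  "null_objects = {W \<in> Ob D. \<forall>i \<in> I. null_at i W}"

text \<open>Kernels of exact functors are Serre subcategories. For subobjects the proof uses that
  \<open>G i\<close> preserves monomorphisms, for quotients that \<open>H (P i)\<close> is
  projective, and for extensions that \<open>G i\<close> keeps the sequence exact in the
  middle.\<close>

lemma null_objects_serre: "serre_subcategory D null_objects"
  unfolding serre_subcategory_def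
proof (intro conjI ballI allI impI)
  show "null_objects \<subseteq> Ob D" by (auto simp: null_objects_def)
  obtain W where W: "zero_object D W" using D.has_zero by blast
  then have oW: "W \<in> Ob D" and iW: "idm D W = mzero D W W" by (simp_all add: D.zero_object_iff)
  have "null_at i W" if i: "i \<in> I" for i
  proof -
    have "idm D (gO i W) = mzero D (gO i W) (gO i W)"
      using D.functor_mzero[OF D.preadditive_axioms G_add[OF i] oW oW] functorD(5)[OF G_functor[OF i] oW] iW by simp
    then have "zero_object D (gO i W)" using G_Ob[OF i oW] by (simp add: D.zero_object_iff)
    then show ?thesis unfolding null_at_def using D.zero_object_to hP_Ob[OF i] by blast
  qed
  then show "null_objects \<noteq> {}" using oW unfolding null_objects_def by blast
next
  fix A B f assume A: "A \<in> Ob D" and B: "B \<in> null_objects" and m: "is_mono D A B f"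
  have oB: "B \<in> Ob D" using B by (simp add: null_objects_def)
  have "null_at i A" if i: "i \<in> I" for i
    unfolding null_at_def
  proof
    fix a assume a: "a \<in> hMor i A"
    note Gm = G_mono[OF i A oB m]
    have "hcmp i A B (gM i A B f) a \<in> hMor i B"
      by (rule D.cmp_in[OF hP_Ob[OF i] G_Ob[OF i A] G_Ob[OF i oB] a D.mono_in[OF Gm]])
    then have "hcmp i A B (gM i A B f) a = hzero i B"
      using B i unfolding null_objects_def null_at_def by blast
    then show "a = hzero i A"
      by (rule D.monoD[OF Gm G_Ob[OF i A] G_Ob[OF i oB] hP_Ob[OF i] a])
  qed
  then show "A \<in> null_objects" using A by (simp add: null_objects_def)
next
  fix A B f assume A: "A \<in> null_objects" and B: "B \<in> Ob D" and m: "is_epi D A B f"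
  have oA: "A \<in> Ob D" using A by (simp add: null_objects_def)
  have "null_at i B" if i: "i \<in> I" for i
    unfolding null_at_def
  proof
    fix a assume a: "a \<in> hMor i B"
    note Ge = G_epi[OF i oA B m]
    obtain b where b: "b \<in> hMor i A" "hcmp i A B (gM i A B f) b = a"
      using H_projective[OF P_Ob[OF i] G_Ob[OF i oA] G_Ob[OF i B] Ge a] by blast
    then have "b = hzero i A" using A i unfolding null_objects_def null_at_def by blast
    then show "a = hzero i B"
      using b(2) D.cmp_0_right[OF hP_Ob[OF i] G_Ob[OF i oA] G_Ob[OF i B] D.epi_in[OF Ge]] by simp
  qed
  then show "B \<in> null_objects" using B by (simp add: null_objects_def)
next
  fix A B E f g assume A: "A \<in> null_objects" and B: "B \<in> Ob D" and E: "E \<in> null_objects" and se: "short_exact D A B E f g"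
  have oA: "A \<in> Ob D" "E \<in> Ob D" using A E by (simp_all add: null_objects_def)
  have "null_at i B" if i: "i \<in> I" for i
    unfolding null_at_def
  proof
    fix a assume a: "a \<in> hMor i B"
    note o = G_Ob[OF i oA(1)] G_Ob[OF i B] G_Ob[OF i oA(2)]
    note S = D.short_exactD[OF o exact_functorD(2)[OF G_exact[OF i] oA(1) B oA(2) se]]
    have "hcmp i B E (gM i B E g) a \<in> hMor i E"
      by (rule D.cmp_in[OF hP_Ob[OF i] o(2,3) a D.epi_in[OF S(2)]])
    then have "hcmp i B E (gM i B E g) a = hzero i E"
      using E i unfolding null_objects_def null_at_def by blast
    then obtain u where u: "u \<in> hMor i A" "hcmp i A B (gM i A B f) u = a"
      using S(4)[OF hP_Ob[OF i] a] by blast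
    then have "u = hzero i A" using A i unfolding null_objects_def null_at_def by blast
    then show "a = hzero i B"
      using u(2) D.cmp_0_right[OF hP_Ob[OF i] o(1,2) D.mono_in[OF S(1)]] by simp
  qed
  then show "B \<in> null_objects" using B by (simp add: null_objects_def)
qed

text \<open>Factor \<open>f\<close> as \<open>m e\<close>. The kernel of \<open>e\<close> is that of
  \<open>f\<close>, hence null, which gives injectivity. The cokernel of \<open>m\<close> is a
  quotient of that of \<open>f\<close>, hence null, so elements over \<open>B\<close> come from
  \<open>J\<close>; projectivity lifts them along \<open>e\<close> to \<open>A\<close>.\<close>

lemma sigma_bij:
  assumes i: "i \<in> I" and f: "(A, B, f) \<in> serre_morphisms D null_objects"
  shows "bij_betw (hcmp i A B (gM i A B f)) (hMor i A) (hMor i B)"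
proof -
  obtain L k Q q where o: "A \<in> Ob D" "B \<in> Ob D" and fm: "f \<in> Mor D A B" and L: "L \<in> null_objects" "is_kernel D A B f L k"
    and Q: "Q \<in> null_objects" "is_cokernel D A B f Q q" using f unfolding serre_morphisms_def by blast
  obtain J e m where J: "J \<in> Ob D" "is_epi D A J e" "is_mono D J B m" "cmp D A J B m e = f"
    using D.epi_mono_factor[OF o fm] .
  note em = D.epi_in[OF J(2)] and mm = D.mono_in[OF J(3)]
  note k = D.kernelD(1-3)[OF L(2)] and q = D.cokernelD[OF Q(2)]
  \<comment> \<open>Since \<open>m\<close> is a monomorphism, \<open>e\<close> and \<open>f\<close>
    kill the same morphisms.\<close>
  have "is_kernel D A J e L k"
  proof (rule D.kernelI[OF o(1) J(1) k(1) em D.kernel_mono[OF o fm L(2)]])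
    have "cmp D L J B m (cmp D L A J e k) = mzero D L B"
      unfolding D.cmp_assoc[OF k(1) o(1) J(1) o(2) k(2) em mm] J(4) by (rule k(3))
    then show "cmp D L A J e k = mzero D L J"
      by (rule D.monoD[OF J(3,1) o(2) k(1) D.cmp_in[OF k(1) o(1) J(1) k(2) em]])
    fix W w assume w: "W \<in> Ob D" "w \<in> Mor D W A" "cmp D W A J e w = mzero D W J"
    have "cmp D W A B f w = cmp D W J B m (cmp D W A J e w)"
      unfolding J(4)[symmetric] by (rule D.cmp_assoc[symmetric, OF w(1) o(1) J(1) o(2) w(2) em mm])
    then have "cmp D W A B f w = mzero D W B" unfolding w(3) D.cmp_0_right[OF w(1) J(1) o(2) mm] .
    then show "\<exists>u \<in> Mor D W L. cmp D W L A k u = w" using D.kernel_factor[OF L(2) w(1,2)] by blast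
  qed
  note se1 = exact_functorD(2)[OF G_exact[OF i] k(1) o(1) J(1) D.epi_short_exact[OF o(1) J(1,2) this]]
  obtain Q' q' where Q': "is_cokernel D J B m Q' q'" using D.has_cokernel[OF J(1) o(2) mm] by blast
  note q' = D.cokernelD[OF Q']
  note se2 = exact_functorD(2)[OF G_exact[OF i] J(1) o(2) q'(1) D.mono_short_exact[OF J(1) o(2) J(3) Q']]
  have q'f: "cmp D A B Q' q' f = mzero D A Q'"
    unfolding J(4)[symmetric] D.cmp_assoc[OF o(1) J(1) o(2) q'(1) em mm q'(2)] q'(3) by (rule D.cmp_0_left[OF o(1) J(1) q'(1) em])
  obtain r where r: "r \<in> Mor D Q Q'" "cmp D B Q Q' r q = q'" using D.cokernel_factor[OF Q(2) q'(1,2) q'f] by blast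
  \<comment> \<open>The map \<open>q' = r q\<close> is an epimorphism, hence so is \<open>r\<close>;
    this makes \<open>Q'\<close> a quotient of the null object \<open>Q\<close>.\<close>
  have "is_epi D Q Q' r"
    unfolding D.epi_iff[OF q(1) q'(1)]
  proof (intro conjI ballI impI r(1))
    fix W u assume u: "W \<in> Ob D" "u \<in> Mor D Q' W" "cmp D Q Q' W u r = mzero D Q W"
    have "cmp D B Q' W u q' = cmp D B Q W (cmp D Q Q' W u r) q"
      unfolding r(2)[symmetric] by (rule D.cmp_assoc[OF o(2) q(1) q'(1) u(1) q(2) r(1) u(2)])
    then have "cmp D B Q' W u q' = mzero D B W" unfolding u(3) D.cmp_0_left[OF o(2) q(1) u(1) q(2)] .
    then show "u = mzero D Q' W" by (rule D.epiD[OF D.cokernel_epi[OF J(1) o(2) mm Q'] o(2) q'(1) u(1,2)])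
  qed
  then have Q'C: "Q' \<in> null_objects" using null_objects_serre Q(1) q'(1) unfolding serre_subcategory_def by blast
  note h = hP_Ob[OF i] and gA = G_Ob[OF i o(1)] and gB = G_Ob[OF i o(2)] and gJ = G_Ob[OF i J(1)]
    and gL = G_Ob[OF i k(1)] and gQ = G_Ob[OF i q'(1)]
  note ge = G_Mor[OF i o(1) J(1) em] and gm = G_Mor[OF i J(1) o(2) mm]
  note S1 = D.short_exactD[OF gL gA gJ se1] and S2 = D.short_exactD[OF gJ gB gQ se2]
  have gf: "gM i A B f = cmp D (gO i A) (gO i J) (gO i B) (gM i J B m) (gM i A J e)"
    unfolding J(4)[symmetric] by (rule functorD(6)[OF G_functor[OF i] o(1) J(1) o(2) em mm])
  have comp: "hcmp i A B (gM i A B f) a =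
     hcmp i J B (gM i J B m) (hcmp i A J (gM i A J e) a)" if "a \<in> hMor i A" for a
    unfolding gf by (rule D.cmp_assoc[symmetric, OF h gA gJ gB that ge gm])
  have in1: "hcmp i A J (gM i A J e) a \<in> hMor i J" if "a \<in> hMor i A" for a
    by (rule D.cmp_in[OF h gA gJ that ge])
  have e_inj: "a = b" if a: "a \<in> hMor i A" and b: "b \<in> hMor i A"
    and eq: "hcmp i A J (gM i A J e) a = hcmp i A J (gM i A J e) b" for a b
  proof (rule D.madd_neg_eq_zero[OF h gA a b])
    let ?c = "madd D (hP i) (gO i A) a (mneg D (hP i) (gO i A) b)"
    have c: "?c \<in> hMor i A" using h gA a b by (simp add: D.mor_in)
    have "hcmp i A J (gM i A J e) ?c = hzero i J"
      using h gA gJ ge a b eq by (simp add: D.mor_in D.mor_simps)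
    then obtain u where u: "u \<in> hMor i L" "hcmp i L A (gM i L A k) u = ?c"
      using S1(4)[OF h c] by blast
    have "u = hzero i L" using u(1) L(1) i unfolding null_objects_def null_at_def by blast
    then show "?c = hzero i A"
      using u(2) D.cmp_0_right[OF h gL gA D.mono_in[OF S1(1)]] by simp
  qed
  show ?thesis
    unfolding bij_betw_def
  proof
    show "inj_on (hcmp i A B (gM i A B f)) (hMor i A)"
    proof (rule inj_onI)
      fix a b assume a: "a \<in> hMor i A" and b: "b \<in> hMor i A"
        and eq: "hcmp i A B (gM i A B f) a = hcmp i A B (gM i A B f) b"
      have "hcmp i A J (gM i A J e) a = hcmp i A J (gM i A J e) b"
        by (rule D.mono_eq[OF S2(1) h in1[OF a] in1[OF b] eq[unfolded comp[OF a] comp[OF b]]])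
      then show "a = b" by (rule e_inj[OF a b])
    qed
    show "hcmp i A B (gM i A B f) ` hMor i A = hMor i B"
    proof (intro equalityI subsetI)
      fix b assume "b \<in> hcmp i A B (gM i A B f) ` hMor i A"
      then obtain a where a: "a \<in> hMor i A" "b = hcmp i A B (gM i A B f) a" by (rule imageE)
      show "b \<in> hMor i B" unfolding a(2) by (rule D.cmp_in[OF h gA gB a(1) G_Mor[OF i o fm]])
    next
      fix b assume b: "b \<in> hMor i B"
      have "hcmp i B Q' (gM i B Q' q') b \<in> hMor i Q'"
        by (rule D.cmp_in[OF h gB gQ b D.epi_in[OF S2(2)]])
      then have "hcmp i B Q' (gM i B Q' q') b = hzero i Q'"
        using Q'C i unfolding null_objects_def null_at_def by blast
      then obtain v where v: "v \<in> hMor i J" "hcmp i J B (gM i J B m) v = b"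
        using S2(4)[OF h b] by blast
      obtain a where a: "a \<in> hMor i A" "hcmp i A J (gM i A J e) a = v"
        using H_projective[OF P_Ob[OF i] gA gJ S1(2) v(1)] by blast
      show "b \<in> hcmp i A B (gM i A B f) ` hMor i A"
        by (rule image_eqI[OF _ a(1)]) (simp only: comp[OF a(1)] a(2) v(2))
    qed
  qed
qed

section \<open>Passage from Hom sets of the homotopy category to the abelianisation\<close>

definition transport :: "'i \<Rightarrow> (('o, 'a) complex \<Rightarrow> 'b) \<Rightarrow> bool" where
  "transport i \<alpha> \<longleftrightarrow> (\<forall>A \<in> Ob K. is_iso D (gO i (FOb H A)) (FOb H (FOb (R i) A)) (\<alpha> A)) \<and>
    (\<forall>A \<in> Ob K. \<forall>B \<in> Ob K. \<forall>f \<in> Mor K A B.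
      cmp D (gO i (FOb H A)) (gO i (FOb H B)) (FOb H (FOb (R i) B)) (\<alpha> B) (gM i (FOb H A) (FOb H B) (FMor H A B f)) =
      cmp D (gO i (FOb H A)) (FOb H (FOb (R i) A)) (FOb H (FOb (R i) B)) (FMor H (FOb (R i) A) (FOb (R i) B) (FMor (R i) A B f)) (\<alpha> A))"

lemmas transportD = transport_def[THEN iffD1, THEN conjunct1, rule_format] transport_def[THEN iffD1, THEN conjunct2, rule_format]

lemma transport_exists: assumes i: "i \<in> I" shows "\<exists>\<alpha>. transport i \<alpha>"
proof -
  obtain \<alpha> where "nat_trans K D (comp_func (G i) H) (comp_func H (R i)) \<alpha>"
    "\<forall>A \<in> Ob K. is_iso D (FOb (comp_func (G i) H) A) (FOb (comp_func H (R i)) A) (\<alpha> A)"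
    using G_R[OF i] unfolding nat_isomorphic_def by blast
  then have "transport i \<alpha>" using nat_transD(3)[of K D "comp_func (G i) H" "comp_func H (R i)" \<alpha>] unfolding transport_def by simp
  then show ?thesis by blast
qed

text \<open>Elements of \<open>Hom (H P\<^sub>i, G\<^sub>i (H A))\<close> and of \<open>Hom (P\<^sub>i, R\<^sub>i A)\<close> correspond, compatibly
  with morphisms in \<open>A\<close>.\<close>

definition transport_elements :: "'i \<Rightarrow> (('o, 'a) complex \<Rightarrow> 'b \<Rightarrow> (int \<Rightarrow> 'a) set) \<Rightarrow> bool" where
  "transport_elements i \<theta> \<longleftrightarrow> (\<forall>A \<in> Ob K. bij_betw (\<theta> A) (hMor i (FOb H A)) (kMor i A) \<and>
      \<theta> A (hzero i (FOb H A)) = kzero i A) \<and>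
    (\<forall>A \<in> Ob K. \<forall>B \<in> Ob K. \<forall>f \<in> Mor K A B. \<forall>a \<in> hMor i (FOb H A).
      \<theta> B (hcmp i (FOb H A) (FOb H B) (gM i (FOb H A) (FOb H B) (FMor H A B f)) a) =
      kcmp i A B (FMor (R i) A B f) (\<theta> A a))"

lemmas transport_elementsD = transport_elements_def[THEN iffD1, THEN conjunct1, rule_format, THEN conjunct1]
  transport_elements_def[THEN iffD1, THEN conjunct1, rule_format, THEN conjunct2]
  transport_elements_def[THEN iffD1, THEN conjunct2, rule_format]

text \<open>Composition with the isomorphism from \<open>G i H\<close> to \<open>H (R i)\<close> is
  a bijection onto the morphisms from \<open>H (P i)\<close> to \<open>H (R i A)\<close>; as
  \<open>H\<close> is full and faithful, these correspond to the morphisms in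
  \<open>K\<close>.\<close>

lemma transport_elements_exists:
  assumes i: "i \<in> I" shows "\<exists>\<theta>. transport_elements i \<theta>"
proof -
  obtain \<alpha> where al: "transport i \<alpha>" using transport_exists[OF i] by blast
  note ai = transportD(1)[OF al] and an = transportD(2)[OF al]
  note Pi = P_Ob[OF i] and h = hP_Ob[OF i] and RO = functorD(3)[OF R_functor[OF i]] and RM = functorD(4)[OF R_functor[OF i]]
  define al where "al A a = cmp D (hP i) (gO i (FOb H A)) (FOb H (FOb (R i) A)) (\<alpha> A) a" for A a
  define \<theta> where "\<theta> A a = inv_into (kMor i A) (FMor H (P i) (FOb (R i) A)) (al A a)" for A a
  have gH: "gO i (FOb H A) \<in> Ob D" and hR: "FOb H (FOb (R i) A) \<in> Ob D" if "A \<in> Ob K" for A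
    using that G_Ob[OF i] H_Ob RO by blast+
  have alb: "bij_betw (al A) (hMor i (FOb H A)) (Mor D (hP i) (FOb H (FOb (R i) A)))" if A: "A \<in> Ob K" for A
    unfolding bij_betw_def
  proof
    note m = D.iso_mono(1)[OF gH[OF A] hR[OF A] ai[OF A]]
    show "inj_on (al A) (hMor i (FOb H A))"
      unfolding al_def by (rule inj_onI, rule D.mono_eq[OF m h])
    obtain g where g: "is_iso D (FOb H (FOb (R i) A)) (gO i (FOb H A)) g"
      "cmp D (FOb H (FOb (R i) A)) (gO i (FOb H A)) (FOb H (FOb (R i) A)) (\<alpha> A) g = idm D (FOb H (FOb (R i) A))"
      using iso_inverse[OF ai[OF A]] by blast
    show "al A ` hMor i (FOb H A) = Mor D (hP i) (FOb H (FOb (R i) A))"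
    proof (intro equalityI subsetI)
      fix b assume "b \<in> al A ` hMor i (FOb H A)"
      then show "b \<in> Mor D (hP i) (FOb H (FOb (R i) A))"
        unfolding al_def using D.cmp_in[OF h gH[OF A] hR[OF A] _ iso_in[OF ai[OF A]]] by blast
    next
      fix b assume b: "b \<in> Mor D (hP i) (FOb H (FOb (R i) A))"
      have "al A (cmp D (hP i) (FOb H (FOb (R i) A)) (gO i (FOb H A)) g b) = b"
        unfolding al_def D.cmp_assoc[OF h hR[OF A] gH[OF A] hR[OF A] b iso_in[OF g(1)] iso_in[OF ai[OF A]]] g(2)
        by (rule D.idm_left[OF h hR[OF A] b])
      then show "b \<in> al A ` hMor i (FOb H A)"
        using D.cmp_in[OF h hR[OF A] gH[OF A] b iso_in[OF g(1)]] by (rule image_eqI[OF sym])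
    qed
  qed
  have al_in: "al A a \<in> Mor D (hP i) (FOb H (FOb (R i) A))" if "A \<in> Ob K" "a \<in> hMor i (FOb H A)" for A a
    using bij_betwE[OF alb[OF that(1)]] that(2) by blast
  have Ht: "FMor H (P i) (FOb (R i) A) (\<theta> A a) = al A a" and t_in: "\<theta> A a \<in> kMor i A"
    if A: "A \<in> Ob K" "a \<in> hMor i (FOb H A)" for A a
  proof -
    have "al A a \<in> FMor H (P i) (FOb (R i) A) ` kMor i A"
      using al_in[OF A] H_ff[OF Pi RO[OF A(1)]] unfolding bij_betw_def by simp
    then show "FMor H (P i) (FOb (R i) A) (\<theta> A a) = al A a" "\<theta> A a \<in> kMor i A"
      unfolding \<theta>_def by (rule f_inv_into_f, rule inv_into_into)
  qed
  have "transport_elements i \<theta>"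
    unfolding transport_elements_def
  proof (intro conjI ballI)
    fix A assume A: "A \<in> Ob K"
    have "bij_betw (inv_into (kMor i A) (FMor H (P i) (FOb (R i) A)) \<circ> al A)
        (hMor i (FOb H A)) (kMor i A)"
      by (rule bij_betw_trans[OF alb[OF A] bij_betw_inv_into[OF H_ff[OF Pi RO[OF A]]]])
    then show "bij_betw (\<theta> A) (hMor i (FOb H A)) (kMor i A)"
      by (simp add: \<theta>_def comp_def cong: bij_betw_cong)
    note z = D.mzero_in[OF h gH[OF A]]
    have "al A (hzero i (FOb H A)) = mzero D (hP i) (FOb H (FOb (R i) A))"
      unfolding al_def by (rule D.cmp_0_right[OF h gH[OF A] hR[OF A] iso_in[OF ai[OF A]]])
    then show "\<theta> A (hzero i (FOb H A)) = kzero i A"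
      using H_eq_zero[OF Pi RO[OF A] t_in[OF A z]] Ht[OF A z] by simp
    fix B f a assume B: "B \<in> Ob K" and f: "f \<in> Mor K A B" and a: "a \<in> hMor i (FOb H A)"
    let ?gf = "gM i (FOb H A) (FOb H B) (FMor H A B f)"
    have gf: "?gf \<in> Mor D (gO i (FOb H A)) (gO i (FOb H B))"
      by (rule G_Mor[OF i H_Ob[OF A] H_Ob[OF B] H_Mor[OF A B f]])
    note ga = D.cmp_in[OF h gH[OF A] gH[OF B] a gf]
    note Rf = RM[OF A B f] and HRf = H_Mor[OF RO[OF A] RO[OF B] RM[OF A B f]]
    have "al B (hcmp i (FOb H A) (FOb H B) ?gf a) =
       cmp D (hP i) (FOb H (FOb (R i) A)) (FOb H (FOb (R i) B)) (FMor H (FOb (R i) A) (FOb (R i) B) (FMor (R i) A B f)) (al A a)"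
      unfolding al_def D.cmp_assoc[OF h gH[OF A] gH[OF B] hR[OF B] a gf iso_in[OF ai[OF B]]] an[OF A B f]
      by (rule D.cmp_assoc[symmetric, OF h gH[OF A] hR[OF A] hR[OF B] a iso_in[OF ai[OF A]] HRf])
    then have e: "FMor H (P i) (FOb (R i) B) (\<theta> B (hcmp i (FOb H A) (FOb H B) ?gf a)) =
       FMor H (P i) (FOb (R i) B) (kcmp i A B (FMor (R i) A B f) (\<theta> A a))"
      unfolding Ht[OF B ga] H_cmp[OF Pi RO[OF A] RO[OF B] t_in[OF A a] Rf] Ht[OF A a] .
    show "\<theta> B (hcmp i (FOb H A) (FOb H B) ?gf a) =
      kcmp i A B (FMor (R i) A B f) (\<theta> A a)"
      by (rule H_inj[OF Pi RO[OF B] t_in[OF B ga] Kc.cmp_in[OF Pi RO[OF A] RO[OF B] t_in[OF A a] Rf] e])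
  qed
  then show ?thesis by blast
qed

abbreviation "hX j \<equiv> FOb H (X j)"
abbreviation "hY \<equiv> FOb H Y"
abbreviation "hZ \<equiv> FOb H Z"
abbreviation "hs j \<equiv> FMor H (X j) Y (s j)"
abbreviation "ht j \<equiv> FMor H (X j) Z (t j)"

text \<open>The hypothesis on \<open>s\<close> in \<open>K\<close> read through the bijections
  \<open>\<theta>\<close>. The next three lemmas translate the remaining hypotheses on the legs in
  the same way.\<close>

lemma hs_inj:
  assumes i: "i \<in> I" and j: "j \<in> I" and a: "a \<in> hMor i (hX j)"
    and 0: "hcmp i (hX j) hY (gM i (hX j) hY (hs j)) a = hzero i hY"
  shows "a = hzero i (hX j)"
proof -
  obtain \<theta> where te: "transport_elements i \<theta>" using transport_elements_exists[OF i] by blast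
  note b = transport_elementsD(1)[OF te] and z = transport_elementsD(2)[OF te] and c = transport_elementsD(3)[OF te]
  have ta: "\<theta> (X j) a \<in> kMor i (X j)" using bij_betwE[OF b[OF X_Ob[OF j]]] a by blast
  have "kcmp i (X j) Y (FMor (R i) (X j) Y (s j)) (\<theta> (X j) a) = kzero i Y"
    unfolding c[OF X_Ob[OF j] Y_Ob s_Mor[OF j] a, symmetric] 0 by (rule z[OF Y_Ob])
  then have "\<theta> (X j) a = \<theta> (X j) (hzero i (hX j))"
    unfolding z[OF X_Ob[OF j]] by (rule s_inj[OF i j ta])
  then show ?thesis
    by (rule inj_onD[OF bij_betw_imp_inj_on[OF b[OF X_Ob[OF j]]] _ a D.mzero_in[OF hP_Ob[OF i] G_Ob[OF i H_Ob[OF X_Ob[OF j]]]]])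
qed

lemma hs_surj:
  assumes i: "i \<in> I" and j: "j \<in> I" and d: "d \<in> hMor i hY"
  shows "\<exists>a \<in> hMor i (hX j). hcmp i (hX j) hY (gM i (hX j) hY (hs j)) a = d"
proof -
  obtain \<theta> where te: "transport_elements i \<theta>" using transport_elements_exists[OF i] by blast
  note b = transport_elementsD(1)[OF te] and z = transport_elementsD(2)[OF te] and c = transport_elementsD(3)[OF te]
  have "\<theta> Y d \<in> kMor i Y" using bij_betwE[OF b[OF Y_Ob]] d by blast
  then obtain e where e: "e \<in> kMor i (X j)"
    "kcmp i (X j) Y (FMor (R i) (X j) Y (s j)) e = \<theta> Y d" using s_surj[OF i j] by blast
  obtain a where a: "a \<in> hMor i (hX j)" "e = \<theta> (X j) a"
    using e(1) bij_betw_imp_surj_on[OF b[OF X_Ob[OF j]]] by blast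
  have "\<theta> Y (hcmp i (hX j) hY (gM i (hX j) hY (hs j)) a) = \<theta> Y d"
    unfolding c[OF X_Ob[OF j] Y_Ob s_Mor[OF j] a(1)] a(2)[symmetric] by (rule e(2))
  then have "hcmp i (hX j) hY (gM i (hX j) hY (hs j)) a = d"
    by (rule inj_onD[OF bij_betw_imp_inj_on[OF b[OF Y_Ob]] _ D.cmp_in[OF hP_Ob[OF i] G_Ob[OF i H_Ob[OF X_Ob[OF j]]]
       G_Ob[OF i H_Ob[OF Y_Ob]] a(1) G_Mor[OF i H_Ob[OF X_Ob[OF j]] H_Ob[OF Y_Ob] H_Mor[OF X_Ob[OF j] Y_Ob s_Mor[OF j]]]] d])
  then show ?thesis using a(1) by blast
qed

lemma ht_zero:
  assumes i: "i \<in> I" and j: "j \<in> I" and ne: "i \<noteq> j" and a: "a \<in> hMor i (hX j)"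
  shows "hcmp i (hX j) hZ (gM i (hX j) hZ (ht j)) a = hzero i hZ"
proof -
  obtain \<theta> where te: "transport_elements i \<theta>" using transport_elements_exists[OF i] by blast
  note b = transport_elementsD(1)[OF te] and z = transport_elementsD(2)[OF te] and c = transport_elementsD(3)[OF te]
  have ta: "\<theta> (X j) a \<in> kMor i (X j)" using bij_betwE[OF b[OF X_Ob[OF j]]] a by blast
  have "\<theta> Z (hcmp i (hX j) hZ (gM i (hX j) hZ (ht j)) a) = \<theta> Z (hzero i hZ)"
    unfolding c[OF X_Ob[OF j] Z_Ob t_Mor[OF j] a] z[OF Z_Ob] by (rule t_zero[OF i j ne ta])
  then show ?thesis
    by (rule inj_onD[OF bij_betw_imp_inj_on[OF b[OF Z_Ob]] _ D.cmp_in[OF hP_Ob[OF i] G_Ob[OF i H_Ob[OF X_Ob[OF j]]]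
       G_Ob[OF i H_Ob[OF Z_Ob]] a G_Mor[OF i H_Ob[OF X_Ob[OF j]] H_Ob[OF Z_Ob] H_Mor[OF X_Ob[OF j] Z_Ob t_Mor[OF j]]]]
       D.mzero_in[OF hP_Ob[OF i] G_Ob[OF i H_Ob[OF Z_Ob]]]])
qed

lemma ht_nonzero:
  assumes i: "i \<in> I"
  shows "\<exists>a \<in> hMor i (hX i).
    hcmp i (hX i) hZ (gM i (hX i) hZ (ht i)) a \<noteq> hzero i hZ"
proof -
  obtain \<theta> where te: "transport_elements i \<theta>" using transport_elements_exists[OF i] by blast
  note b = transport_elementsD(1)[OF te] and z = transport_elementsD(2)[OF te] and c = transport_elementsD(3)[OF te]
  obtain e where e: "e \<in> kMor i (X i)"
    "kcmp i (X i) Z (FMor (R i) (X i) Z (t i)) e \<noteq> kzero i Z"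
    using t_nonzero[OF i] by blast
  obtain a where a: "a \<in> hMor i (hX i)" "e = \<theta> (X i) a"
    using e(1) bij_betw_imp_surj_on[OF b[OF X_Ob[OF i]]] by blast
  show ?thesis
  proof (rule bexI[OF notI a(1)])
    assume "hcmp i (hX i) hZ (gM i (hX i) hZ (ht i)) a = hzero i hZ"
    then have "\<theta> Z (hcmp i (hX i) hZ (gM i (hX i) hZ (ht i)) a) = kzero i Z"
      using z[OF Z_Ob] by (simp only:)
    then show False using e(2) unfolding c[OF X_Ob[OF i] Z_Ob t_Mor[OF i] a(1)] a(2) by blast
  qed
qed

text \<open>Injectivity on elements makes the kernel null, since it embeds into the source. An
  element over the cokernel lifts to the target by projectivity and then to the source by
  surjectivity, so it is zero.\<close>

lemma hs_sigma:
  assumes j: "j \<in> I" shows "(hX j, hY, hs j) \<in> serre_morphisms D null_objects"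
proof -
  note o = H_Ob[OF X_Ob[OF j]] H_Ob[OF Y_Ob] and m = H_Mor[OF X_Ob[OF j] Y_Ob s_Mor[OF j]]
  obtain L k where L: "is_kernel D (hX j) hY (hs j) L k" using D.has_kernel[OF o m] by blast
  obtain Q q where Q: "is_cokernel D (hX j) hY (hs j) Q q" using D.has_cokernel[OF o m] by blast
  note k = D.kernelD(1-3)[OF L] and q = D.cokernelD[OF Q]
  have "null_at i L" if i: "i \<in> I" for i
    unfolding null_at_def
  proof
    fix a assume a: "a \<in> hMor i L"
    note h = hP_Ob[OF i] and g = G_Ob[OF i k(1)] G_Ob[OF i o(1)] G_Ob[OF i o(2)]
    note gk = G_Mor[OF i k(1) o(1) k(2)] and gs = G_Mor[OF i o m]
    let ?b = "hcmp i L (hX j) (gM i L (hX j) k) a"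
    have b: "?b \<in> hMor i (hX j)" by (rule D.cmp_in[OF h g(1,2) a gk])
    have sk: "cmp D (gO i L) (gO i (hX j)) (gO i hY) (gM i (hX j) hY (hs j)) (gM i L (hX j) k) = mzero D (gO i L) (gO i hY)"
      unfolding functorD(6)[OF G_functor[OF i] k(1) o k(2) m, symmetric] k(3)
      by (rule D.functor_mzero[OF D.preadditive_axioms G_add[OF i] k(1) o(2)])
    have "hcmp i (hX j) hY (gM i (hX j) hY (hs j)) ?b = hzero i hY"
      unfolding D.cmp_assoc[OF h g a gk gs] sk by (rule D.cmp_0_left[OF h g(1,3) a])
    then have "?b = hzero i (hX j)" by (rule hs_inj[OF i j b])
    then show "a = hzero i L"
      by (rule D.monoD[OF G_mono[OF i k(1) o(1) D.kernel_mono[OF o m L]] g(1,2) h a])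
  qed
  then have LC: "L \<in> null_objects" using k(1) by (simp add: null_objects_def)
  have "null_at i Q" if i: "i \<in> I" for i
    unfolding null_at_def
  proof
    fix a assume a: "a \<in> hMor i Q"
    note h = hP_Ob[OF i] and g = G_Ob[OF i o(1)] G_Ob[OF i o(2)] G_Ob[OF i q(1)]
    note gq = G_Mor[OF i o(2) q(1) q(2)] and gs = G_Mor[OF i o m]
    obtain b where b: "b \<in> hMor i hY" "hcmp i hY Q (gM i hY Q q) b = a"
      using H_projective[OF P_Ob[OF i] g(2,3) G_epi[OF i o(2) q(1) D.cokernel_epi[OF o m Q]] a] by blast
    obtain c where c: "c \<in> hMor i (hX j)" "hcmp i (hX j) hY (gM i (hX j) hY (hs j)) c = b"
      using hs_surj[OF i j b(1)] by blast
    have qs: "cmp D (gO i (hX j)) (gO i hY) (gO i Q) (gM i hY Q q) (gM i (hX j) hY (hs j)) = mzero D (gO i (hX j)) (gO i Q)"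
      unfolding functorD(6)[OF G_functor[OF i] o q(1) m q(2), symmetric] q(3)
      by (rule D.functor_mzero[OF D.preadditive_axioms G_add[OF i] o(1) q(1)])
    show "a = hzero i Q"
      unfolding b(2)[symmetric] c(2)[symmetric] D.cmp_assoc[OF h g c(1) gs gq] qs by (rule D.cmp_0_left[OF h g(1,3) c(1)])
  qed
  then have "Q \<in> null_objects" using q(1) by (simp add: null_objects_def)
  then show ?thesis using LC L Q o m unfolding serre_morphisms_def by blast
qed

end

section \<open>Largeness of the quotient\<close>

context zfc_sets
begin

lemma Set_iso:
  assumes "bij_betw f (elts mem m) (elts mem n)"
  shows "is_iso Set_cat m n (cfun m f)"
proof -
  let ?g = "inv_into (elts mem m) f"
  have f: "f x \<in> elts mem n" "?g (f x) = x" if "x \<in> elts mem m" for x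
    using assms that by (auto simp: bij_betw_def)
  have g: "?g y \<in> elts mem m" "f (?g y) = y" if "y \<in> elts mem n" for y
    using assms that by (auto simp: bij_betw_def inv_into_into f_inv_into_f)
  have 1: "cmp Set_cat m n m (cfun n ?g) (cfun m f) = idm Set_cat m"
    using f by (auto intro!: cfun_cong)
  have 2: "cmp Set_cat n m n (cfun m f) (cfun n ?g) = idm Set_cat n"
    using g by (auto intro!: cfun_cong)
  have 3: "cfun n ?g \<in> Mor Set_cat n m" "cfun m f \<in> Mor Set_cat m n" using f g by auto
  show ?thesis unfolding is_iso_def using 1 2 3 by blast
qed

lemma cfun_eqD: "\<lbrakk>cfun m f = cfun m g; x \<in> elts mem m\<rbrakk> \<Longrightarrow> f x = g x"
  using app_cfun[of x m f] app_cfun[of x m g] by simp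

end

text \<open>Morphism classes of \<open>D\<close> must be sets before Hom(H P, G -) can be a functor
  to the category of sets.\<close>

locale separating_sets = separating C D H I G R P X Y Z s t + zfc_sets mem
  for mem :: "'v \<Rightarrow> 'v \<Rightarrow> bool" and C :: "('o, 'a, 'x) pcat_scheme" and D :: "('v, 'v) pcat" and H and I :: "'i set"
    and G R P X Y Z s t +
  assumes Mor_set: "\<lbrakk>A \<in> Ob D; B \<in> Ob D\<rbrakk> \<Longrightarrow> \<exists>m. elts mem m = Mor D A B"
begin

definition hset :: "'i \<Rightarrow> 'v \<Rightarrow> 'v" where
  "hset i W = the_set (hMor i W)"

definition hom_functor :: "'i \<Rightarrow> ('v, 'v, 'v, 'v) func" where
  "hom_functor i = \<lparr>FOb = hset i, FMor = (\<lambda>A B f. cfun (hset i A) (hcmp i A B (gM i A B f)))\<rparr>"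

lemma hom_functor_sel [simp]: "FOb (hom_functor i) = hset i"
  "FMor (hom_functor i) A B f = cfun (hset i A) (hcmp i A B (gM i A B f))"
  by (simp_all add: hom_functor_def)

lemma elts_hset: "\<lbrakk>i \<in> I; W \<in> Ob D\<rbrakk> \<Longrightarrow> elts mem (hset i W) = hMor i W"
  unfolding hset_def by (rule elts_the_set[OF Mor_set[OF hP_Ob G_Ob]])

lemma hom_functor_in:
  assumes i: "i \<in> I" and o: "A \<in> Ob D" "B \<in> Ob D" and f: "f \<in> Mor D A B" and a: "a \<in> elts mem (hset i A)"
  shows "hcmp i A B (gM i A B f) a \<in> elts mem (hset i B)"
  using a unfolding elts_hset[OF i o(1)] elts_hset[OF i o(2)]
  by (rule D.cmp_in[OF hP_Ob[OF i] G_Ob[OF i o(1)] G_Ob[OF i o(2)] _ G_Mor[OF i o f]])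

lemma hom_functor_functor:
  assumes i: "i \<in> I" shows "is_functor D Set_cat (hom_functor i)"
  unfolding is_functor_def
proof (intro conjI ballI D.category_axioms Set_category)
  note h = hP_Ob[OF i]
  fix A assume A: "A \<in> Ob D"
  show "FOb (hom_functor i) A \<in> Ob Set_cat" by simp
  show "FMor (hom_functor i) A A (idm D A) = idm Set_cat (FOb (hom_functor i) A)"
    unfolding hom_functor_sel Set_sel functorD(5)[OF G_functor[OF i] A]
    by (rule cfun_cong) (simp add: elts_hset[OF i A] D.idm_left[OF h G_Ob[OF i A]])
  fix B f assume B: "B \<in> Ob D" and f: "f \<in> Mor D A B"
  show "FMor (hom_functor i) A B f \<in> Mor Set_cat (FOb (hom_functor i) A) (FOb (hom_functor i) B)"
    using hom_functor_in[OF i A B f] by auto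
  fix E g assume E: "E \<in> Ob D" and g: "g \<in> Mor D B E"
  show "FMor (hom_functor i) A E (cmp D A B E g f) =
    cmp Set_cat (FOb (hom_functor i) A) (FOb (hom_functor i) B) (FOb (hom_functor i) E) (FMor (hom_functor i) B E g) (FMor (hom_functor i) A B f)"
    unfolding hom_functor_sel Set_sel
  proof (rule cfun_cong)
    fix a assume a: "a \<in> elts mem (hset i A)"
    then have a': "a \<in> hMor i A" by (simp only: elts_hset[OF i A])
    show "hcmp i A E (gM i A E (cmp D A B E g f)) a =
      app (cfun (hset i B) (hcmp i B E (gM i B E g)))
        (app (cfun (hset i A) (hcmp i A B (gM i A B f))) a)"
      unfolding app_cfun[OF a] app_cfun[OF hom_functor_in[OF i A B f a]] functorD(6)[OF G_functor[OF i] A B E f g]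
      by (rule D.cmp_assoc[symmetric, OF h G_Ob[OF i A] G_Ob[OF i B] G_Ob[OF i E] a' G_Mor[OF i A B f] G_Mor[OF i B E g]])
  qed
qed

lemma hom_functor_inverts:
  assumes i: "i \<in> I" shows "inverts (serre_morphisms D null_objects) Set_cat (hom_functor i)"
proof -
  have "is_iso Set_cat (FOb (hom_functor i) A) (FOb (hom_functor i) B) (FMor (hom_functor i) A B f)"
    if f: "(A, B, f) \<in> serre_morphisms D null_objects" for A B f
  proof -
    have o: "A \<in> Ob D" "B \<in> Ob D" using f by (simp_all add: serre_morphisms_def)
    show ?thesis unfolding hom_functor_sel
      by (rule Set_iso) (simp only: elts_hset[OF i o(1)] elts_hset[OF i o(2)] sigma_bij[OF i f])
  qed
  then show ?thesis unfolding inverts_def by blast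
qed

text \<open>The roofs become morphisms \<open>e j\<close> of the quotient. If
  \<open>e i = e j\<close>, the extension of the Hom functor of index i gives one map
  \<open>\<epsilon>\<close> with \<open>\<epsilon> s = t\<close> on the elements over both sources.
  An element on which \<open>t i\<close> is nonzero has the same image under \<open>s i\<close> as
  some element over the source of index j has under \<open>s j\<close>; applying
  \<open>\<epsilon>\<close> equates a nonzero value of \<open>t i\<close> with a value of
  \<open>t j\<close>, which is zero.\<close>

theorem quotient_large:
  fixes E :: "('v, 'v) cat"
  assumes "is_abelian_quotient D null_objects E Q"
  shows "\<exists>e. inj_on e I \<and> e ` I \<subseteq> Mor E (FOb Q hY) (FOb Q hZ)"
proof -
  have Q: "is_functor D E Q" and inv: "inverts (serre_morphisms D null_objects) E Q"
    and eq: "\<And>B :: ('v, 'v) cat. category B \<Longrightarrow> is_equivalence (functor_cat E B (\<lambda>F. True))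
      (functor_cat D B (inverts (serre_morphisms D null_objects) B)) (precomp D Q)"
    using assms unfolding is_abelian_quotient_def is_localisation_def by blast+
  interpret E: category E by (rule functorD(2)[OF Q])
  note hYZ = H_Ob[OF Y_Ob] H_Ob[OF Z_Ob] and hX = H_Ob[OF X_Ob]
  note hs = H_Mor[OF X_Ob Y_Ob s_Mor] and ht = H_Mor[OF X_Ob Z_Ob t_Mor]
  note QY = functorD(3)[OF Q hYZ(1)] and QZ = functorD(3)[OF Q hYZ(2)]
  have "\<exists>e \<in> Mor E (FOb Q hY) (FOb Q hZ). cmp E (FOb Q (hX j)) (FOb Q hY) (FOb Q hZ) e (FMor Q (hX j) hY (hs j)) = FMor Q (hX j) hZ (ht j)"
    if j: "j \<in> I" for j
  proof -
    note QX = functorD(3)[OF Q hX[OF j]]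
    note Qs = functorD(4)[OF Q hX[OF j] hYZ(1) hs[OF j j]] and Qt = functorD(4)[OF Q hX[OF j] hYZ(2) ht[OF j j]]
    have iso: "is_iso E (FOb Q (hX j)) (FOb Q hY) (FMor Q (hX j) hY (hs j))"
      using inv hs_sigma[OF j] unfolding inverts_def by blast
    obtain y where y: "is_iso E (FOb Q hY) (FOb Q (hX j)) y"
      "cmp E (FOb Q (hX j)) (FOb Q hY) (FOb Q (hX j)) y (FMor Q (hX j) hY (hs j)) = idm E (FOb Q (hX j))"
      using iso_inverse[OF iso] by blast
    \<comment> \<open>The morphism represented by the roof: the left leg is inverted in the
      quotient.\<close>
    let ?e = "cmp E (FOb Q hY) (FOb Q (hX j)) (FOb Q hZ) (FMor Q (hX j) hZ (ht j)) y"
    have "cmp E (FOb Q (hX j)) (FOb Q hY) (FOb Q hZ) ?e (FMor Q (hX j) hY (hs j)) = FMor Q (hX j) hZ (ht j)"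
      unfolding E.cmp_assoc[symmetric, OF QX QY QX QZ Qs iso_in[OF y(1)] Qt] y(2) by (rule E.idm_right[OF QX QZ Qt])
    then show ?thesis using E.cmp_in[OF QY QX QZ iso_in[OF y(1)] Qt] by blast
  qed
  then obtain e where e: "\<And>j. j \<in> I \<Longrightarrow> e j \<in> Mor E (FOb Q hY) (FOb Q hZ)"
    and es: "\<And>j. j \<in> I \<Longrightarrow> cmp E (FOb Q (hX j)) (FOb Q hY) (FOb Q hZ) (e j) (FMor Q (hX j) hY (hs j)) = FMor Q (hX j) hZ (ht j)"
    by metis
  have "inj_on e I"
  proof (rule inj_onI, rule ccontr)
    fix i j assume i: "i \<in> I" and j: "j \<in> I" and ij: "e i = e j" "i \<noteq> j"
    \<comment> \<open>The Hom functor of index i inverts the morphisms in question, so it factors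
      through the quotient up to isomorphism.\<close>
    obtain F where F: "is_functor E Set_cat F" "nat_isomorphic D Set_cat (comp_func F Q) (hom_functor i)"
      using precomp_equivalence_lift[OF eq[OF Set_category] hom_functor_functor[OF i] hom_functor_inverts[OF i]] .
    have Fe: "FMor F (FOb Q hY) (FOb Q hZ) (e i) \<in> Mor Set_cat (FOb (comp_func F Q) hY) (FOb (comp_func F Q) hZ)"
      using functorD(4)[OF F(1) QY QZ e[OF i]] by (simp only: comp_func_sel)
    obtain \<epsilon> where eps: "\<forall>A \<in> Ob D. \<forall>u \<in> Mor D A hY. \<forall>v \<in> Mor D A hZ.
      cmp Set_cat (FOb (comp_func F Q) A) (FOb (comp_func F Q) hY) (FOb (comp_func F Q) hZ)
        (FMor F (FOb Q hY) (FOb Q hZ) (e i)) (FMor (comp_func F Q) A hY u) = FMor (comp_func F Q) A hZ v \<longrightarrow>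
      cmp Set_cat (FOb (hom_functor i) A) (FOb (hom_functor i) hY) (FOb (hom_functor i) hZ) \<epsilon> (FMor (hom_functor i) A hY u) = FMor (hom_functor i) A hZ v"
      using nat_iso_transfer[OF functor_comp[OF Q F(1)] hom_functor_functor[OF i] F(2) hYZ Fe] by blast
    \<comment> \<open>Stated for every \<open>k\<close> with \<open>e k = e i\<close>, since it is
      needed for both roofs with the same \<open>\<epsilon>\<close>.\<close>
    have app_eps: "app \<epsilon> (hcmp i (hX k) hY (gM i (hX k) hY (hs k)) a) =
        hcmp i (hX k) hZ (gM i (hX k) hZ (ht k)) a"
      if k: "k \<in> I" "e k = e i" and a: "a \<in> hMor i (hX k)" for k a
    proof -
      note QX = functorD(3)[OF Q hX[OF k(1)]] and Qs = functorD(4)[OF Q hX[OF k(1)] hYZ(1) hs[OF k(1) k(1)]]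
      have "cmp Set_cat (FOb (comp_func F Q) (hX k)) (FOb (comp_func F Q) hY) (FOb (comp_func F Q) hZ)
        (FMor F (FOb Q hY) (FOb Q hZ) (e i)) (FMor (comp_func F Q) (hX k) hY (hs k)) = FMor (comp_func F Q) (hX k) hZ (ht k)"
        unfolding comp_func_sel functorD(6)[OF F(1) QX QY QZ Qs e[OF i], symmetric] es[OF k(1), unfolded k(2)] ..
      then have "cmp Set_cat (FOb (hom_functor i) (hX k)) (FOb (hom_functor i) hY) (FOb (hom_functor i) hZ) \<epsilon> (FMor (hom_functor i) (hX k) hY (hs k)) = FMor (hom_functor i) (hX k) hZ (ht k)"
        by (rule eps[rule_format, OF hX[OF k(1)] hs[OF k(1) k(1)] ht[OF k(1) k(1)]])
      note th = this[unfolded hom_functor_sel Set_sel]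
      have ha: "a \<in> elts mem (hset i (hX k))" using a by (simp only: elts_hset[OF i hX[OF k(1)]])
      show ?thesis using cfun_eqD[OF th ha] by (simp only: app_cfun[OF ha])
    qed
    obtain a where a: "a \<in> hMor i (hX i)"
      "hcmp i (hX i) hZ (gM i (hX i) hZ (ht i)) a \<noteq> hzero i hZ"
      using ht_nonzero[OF i] by blast
    have "hcmp i (hX i) hY (gM i (hX i) hY (hs i)) a \<in> hMor i hY"
      by (rule D.cmp_in[OF hP_Ob[OF i] G_Ob[OF i hX[OF i]] G_Ob[OF i hYZ(1)] a(1) G_Mor[OF i hX[OF i] hYZ(1) hs[OF i i]]])
    \<comment> \<open>Surjectivity of the other left leg moves the image of \<open>a\<close> to an
      element over the source with index j.\<close>
    then obtain b where b: "b \<in> hMor i (hX j)"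
      "hcmp i (hX j) hY (gM i (hX j) hY (hs j)) b = hcmp i (hX i) hY (gM i (hX i) hY (hs i)) a"
      using hs_surj[OF i j] by blast
    show False
      using a(2) app_eps[OF i refl a(1)] app_eps[OF j ij(1)[symmetric] b(1)] ht_zero[OF i j ij(2) b(1)] b(2) by simp
  qed
  then show ?thesis using e by blast
qed

end

section \<open>Self-extensions of the trivial module\<close>

context two_step
begin

interpretation F: field F by (rule field_F)

sublocale A: additive_category A by (rule additive_A)

lemma relabelling_rho: "relabelling A (rho i)"
proof (intro relabelling.intro relabelling_axioms.intro additive_A)
  fix X Y f assume "X \<in> Ob A" "Y \<in> Ob A" "f \<in> Mor A X Y"
  then show "f \<in> Mor A (rho i X) (rho i Y)" using rho_Hom[of X Y f i] by simp
qed (simp_all add: rho_Obj)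

text \<open>These are equalities of records and not just isomorphisms; relabelling therefore maps
  the complexes below to complexes of the same shape literally.\<close>

lemma rho_fixed: "rho i zero_mod = zero_mod" "rho i one_mod = one_mod" "rho i (ext_mod i) = ext_mod i"
  by (simp_all add: rho_def zero_mod_def one_mod_def ext_mod_def prodm_def trivial_fmod_def fun_eq_iff)

abbreviation "E2 \<equiv> carrier (prodm one_mod one_mod)"
text \<open>For \<open>i = j\<close> this is \<open>ext_mod i\<close> again; otherwise all variables
  act as zero and it is a sum of two trivial modules.\<close>

abbreviation "ext2 i j \<equiv> rho i (ext_mod j)"

text \<open>In terms of F[x]/(x^2), these three maps are the inclusion of the multiples of x, the
  reduction modulo x and the multiplication by x. As functions they do not refer to the variable
  that acts as x.\<close>

definition inc_map :: "'v \<Rightarrow> 'v" where "inc_map = (\<lambda>x \<in> carrier F. opair \<zero>\<^bsub>F\<^esub> x)"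
definition top_map :: "'v \<Rightarrow> 'v" where "top_map = (\<lambda>z \<in> E2. ofst z)"
definition nil_map :: "'v \<Rightarrow> 'v" where "nil_map = (\<lambda>z \<in> E2. opair \<zero>\<^bsub>F\<^esub> (ofst z))"

lemma ext2_Obj: "ext2 i j \<in> Obj"
  by (rule rho_Obj[OF ext_Obj])

lemma inc_Hom: "inc_map \<in> Hom one_mod (ext2 i j)"
  by (rule fmod_homsI) (simp_all add: inc_map_def)

lemma top_Hom: "top_map \<in> Hom (ext2 i j) one_mod"
  by (rule fmod_homsI) (simp_all add: top_map_def one2_mem)

lemma nil_Hom: "nil_map \<in> Hom (ext_mod i) (ext_mod i)"
  by (rule fmod_homsI) (simp_all add: nil_map_def one2_mem)

lemma P_data: "zero_object A zero_mod" "ext_mod i \<in> Ob A" "ext_mod i \<in> Ob A" "nil_map \<in> Mor A (ext_mod i) (ext_mod i)"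
  using zero_mod_zero ext_Obj nil_Hom by simp_all

lemma X_data: "zero_object A zero_mod" "one_mod \<in> Ob A" "ext2 i j \<in> Ob A" "inc_map \<in> Mor A one_mod (ext2 i j)"
  using zero_mod_zero one_Obj ext2_Obj inc_Hom by simp_all

lemma Y_data: "zero_object A zero_mod" "zero_mod \<in> Ob A" "one_mod \<in> Ob A" "mzero A zero_mod one_mod \<in> Mor A zero_mod one_mod"
  and Z_data: "zero_object A zero_mod" "one_mod \<in> Ob A" "zero_mod \<in> Ob A" "mzero A one_mod zero_mod \<in> Mor A one_mod zero_mod"
  using zero_mod_zero one_Obj zero_Obj A.mzero_in[of zero_mod one_mod] A.mzero_in[of one_mod zero_mod] by (simp_all del: two_step_sel(6))

text \<open>Write \<open>1\<close> for the trivial module and \<open>E\<^sub>j\<close> for its self-extension on which only \<open>j\<close> acts. The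
  kernel of the projection \<open>E\<^sub>j \<rightarrow> 1\<close> is \<open>1\<close>, so that the map from \<open>X\<^sub>j = (1 \<rightarrow> E\<^sub>j)\<close> to \<open>Y = (0 \<rightarrow> 1)\<close>
  is a quasi-isomorphism; together with the map to \<open>Z = (1 \<rightarrow> 0)\<close> it represents the class of
  \<open>E\<^sub>j\<close> in \<open>Ext\<^sup>1(1, 1)\<close>.\<close>

definition P_cplx where "P_cplx i = A.cplx2 zero_mod (ext_mod i) (ext_mod i) nil_map"
text \<open>The module is a parameter because relabelling replaces \<open>ext_mod j\<close> by
  \<open>ext2 i j\<close> and keeps the rest.\<close>

definition X_cplx where "X_cplx M = A.cplx2 zero_mod one_mod M inc_map"
definition Y_cplx where "Y_cplx = A.cplx2 zero_mod zero_mod one_mod (mzero A zero_mod one_mod)"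
definition Z_cplx where "Z_cplx = A.cplx2 zero_mod one_mod zero_mod (mzero A one_mod zero_mod)"
definition s_map where "s_map = A.map2 zero_mod zero_mod (mzero A one_mod zero_mod) top_map"
definition t_map where "t_map = A.map2 zero_mod zero_mod (idm A one_mod) (\<lambda>z \<in> E2. \<zero>\<^bsub>F\<^esub>)"

lemma cplx_in: "P_cplx i \<in> A.cplx" "X_cplx (ext2 i j) \<in> A.cplx" "Y_cplx \<in> A.cplx" "Z_cplx \<in> A.cplx"
  unfolding P_cplx_def X_cplx_def Y_cplx_def Z_cplx_def
  by (rule A.cplx2_in[OF P_data], rule A.cplx2_in[OF X_data], rule A.cplx2_in[OF Y_data], rule A.cplx2_in[OF Z_data])

lemma ss_chain: "s_map \<in> chain_maps A (X_cplx (ext2 i j)) Y_cplx"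
  unfolding s_map_def X_cplx_def Y_cplx_def
  by (rule A.map2_chain[OF X_data Y_data])
    (use top_Hom A.mzero_in[of one_mod zero_mod] one_Obj zero_Obj in \<open>simp_all add: compose_def inc_map_def top_map_def cong: restrict_cong\<close>)

lemma tt_chain: "t_map \<in> chain_maps A (X_cplx (ext2 i j)) Z_cplx"
  unfolding t_map_def X_cplx_def Z_cplx_def
  by (rule A.map2_chain[OF X_data Z_data])
    (use A.idm_in[of one_mod] A.mzero_in[of "ext2 i j" zero_mod] one_Obj zero_Obj ext2_Obj[of i j] in
      \<open>simp_all add: compose_def inc_map_def cong: restrict_cong\<close>)

lemma Rc_cplx2:
  "relabelling.Rc (rho i) (A.cplx2 Z A' B d) = A.cplx2 (rho i Z) (rho i A') (rho i B) d"
  unfolding relabelling.Rc_def[OF relabelling_rho] A.cplx2_def by (simp add: fun_eq_iff)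

lemma Rc_XYZ: "relabelling.Rc (rho i) (X_cplx (ext_mod j)) = X_cplx (ext2 i j)" "relabelling.Rc (rho i) Y_cplx = Y_cplx" "relabelling.Rc (rho i) Z_cplx = Z_cplx"
  unfolding X_cplx_def Y_cplx_def Z_cplx_def Rc_cplx2 rho_fixed by (rule refl)+

lemma X_cplx_ext: "X_cplx (ext_mod i) = X_cplx (ext2 i i)" by (simp only: rho_fixed)

context
  fixes i j f
  assumes i: "i \<in> J" and f: "f \<in> chain_maps A (P_cplx i) (X_cplx (ext2 i j))"
begin

lemma f01:
  "f 0 \<in> Hom (ext_mod i) one_mod" "f 1 \<in> Hom (ext_mod i) (ext2 i j)"
  "z \<in> E2 \<Longrightarrow> f 1 (opair \<zero>\<^bsub>F\<^esub> (ofst z)) = opair \<zero>\<^bsub>F\<^esub> (f 0 z)"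
proof -
  note c = A.chain_map2[OF P_data X_data f[unfolded P_cplx_def X_cplx_def]]
  show f0: "f 0 \<in> Hom (ext_mod i) one_mod" and "f 1 \<in> Hom (ext_mod i) (ext2 i j)" using c(1,2) by simp_all
  assume z: "z \<in> E2"
  have "f 0 z \<in> carrier F" using fmod_homsD(1)[OF f0] z by simp
  then show "f 1 (opair \<zero>\<^bsub>F\<^esub> (ofst z)) = opair \<zero>\<^bsub>F\<^esub> (f 0 z)"
    using fun_cong[OF c(3), of z] z by (simp add: compose_def nil_map_def inc_map_def)
qed

lemma f_mem: "z \<in> E2 \<Longrightarrow> f 0 z \<in> carrier F" "z \<in> E2 \<Longrightarrow> f 1 z \<in> E2"
  using fmod_homsD(1)[OF f01(1)] fmod_homsD(1)[OF f01(2)] by simp_all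

text \<open>A homotopy for the composite passes through the zero module, so the composite vanishes
  in degree 1 and \<open>f 1\<close> takes values in the kernel of \<open>top_map\<close>. It
  factors through \<open>inc_map\<close>, and the factor is a null homotopy of
  \<open>f\<close>.\<close>

lemma ss_zero:
  assumes "cmp A.K (P_cplx i) (X_cplx (ext2 i j)) Y_cplx (A.hc (X_cplx (ext2 i j)) Y_cplx s_map) (A.hc (P_cplx i) (X_cplx (ext2 i j)) f) = mzero A.K (P_cplx i) Y_cplx"
  shows "A.hc (P_cplx i) (X_cplx (ext2 i j)) f = mzero A.K (P_cplx i) (X_cplx (ext2 i j))"
proof -
  note c = A.chain_cmp[OF cplx_in(1,2,3) f ss_chain, unfolded P_cplx_def Y_cplx_def]
  obtain h where h: "h \<in> Mor A (ext_mod i) zero_mod" "cmp A (ext_mod i) (ext2 i j) one_mod top_map (f 1) =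
      cmp A (ext_mod i) zero_mod one_mod (mzero A zero_mod one_mod) h"
    using A.map2_eq_zeroD[OF P_data Y_data c, folded P_cplx_def Y_cplx_def] assms[unfolded A.K_cmp[OF cplx_in(1,2,3) f ss_chain]]
    by (auto simp: A.cplx2_sel P_cplx_def Y_cplx_def X_cplx_def s_map_def A.map2_def)
  have h0: "h z \<in> {\<zero>\<^bsub>F\<^esub>}" if "z \<in> E2" for z using fmod_homsD(1)[of h F J "ext_mod i" zero_mod z] h(1) that by simp
  have of0: "ofst (f 1 z) = \<zero>\<^bsub>F\<^esub>" if z: "z \<in> E2" for z
    using fun_cong[OF h(2), of z] z f_mem(2)[OF z] h0[OF z] by (simp add: compose_def top_map_def)
  have f1: "f 1 z = opair \<zero>\<^bsub>F\<^esub> (osnd (f 1 z))" if z: "z \<in> E2" for z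
    using one2_mem(3)[OF f_mem(2)[OF z]] of0[OF z] by simp
  \<comment> \<open>The second coordinate is the factor of \<open>f 1\<close> through
    \<open>inc_map\<close>. It also satisfies the equation in degree 0, because \<open>f 1\<close>
    after \<open>nil_map\<close> is \<open>inc_map\<close> after \<open>f 0\<close>.\<close>
  let ?h = "\<lambda>z \<in> E2. osnd (f 1 z)"
  have hh: "?h \<in> Hom (ext_mod i) one_mod"
  proof (rule fmod_homsI)
    fix x assume x: "x \<in> carrier (ext_mod i)"
    then have x': "x \<in> E2" by simp
    show "?h x \<in> carrier one_mod" using x' one2_mem(2)[OF f_mem(2)[OF x']] by simp
    show "?h (x \<oplus>\<^bsub>ext_mod i\<^esub> y) = ?h x \<oplus>\<^bsub>one_mod\<^esub> ?h y" if y: "y \<in> carrier (ext_mod i)" for y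
      using fmod_homsD(2)[OF f01(2) x y] x' y by (simp add: one2_mem)
    show "?h (a \<odot>\<^bsub>ext_mod i\<^esub> x) = a \<odot>\<^bsub>one_mod\<^esub> ?h x" if a: "a \<in> carrier F" for a
      using fmod_homsD(3)[OF f01(2) a x] x' a by (simp add: one2_mem)
    show "?h (act (ext_mod i) k x) = act one_mod k (?h x)" if k: "k \<in> J" for k
      using fmod_homsD(4)[OF f01(2) k x] x' of0[OF x'] by (simp add: one2_mem split: if_splits)
  qed simp
  show ?thesis
    unfolding P_cplx_def X_cplx_def
  proof (rule A.map2_eq_zeroI[OF P_data X_data])
    show "?h \<in> Mor A (ext_mod i) one_mod" using hh by simp
    show "f \<in> chain_maps A (A.cplx2 zero_mod (ext_mod i) (ext_mod i) nil_map) (A.cplx2 zero_mod one_mod (ext2 i j) inc_map)"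
      using f by (simp only: P_cplx_def X_cplx_def)
    show "f 0 = cmp A (ext_mod i) (ext_mod i) one_mod ?h nil_map"
      by (rule extensionalityI[of _ "E2"])
        (use fmod_homsD(5)[OF f01(1)] in \<open>simp_all add: compose_def nil_map_def one2_mem f01(3)\<close>)
    show "f 1 = cmp A (ext_mod i) one_mod (ext2 i j) inc_map ?h"
      by (rule extensionalityI[of _ "E2"])
        (use fmod_homsD(5)[OF f01(2)] f1 in \<open>simp_all add: compose_def inc_map_def one2_mem f_mem\<close>)
  qed
qed

text \<open>For j other than i the variable i acts as zero on \<open>ext2 i j\<close>, so
  \<open>f 1\<close> kills the multiples of x. As \<open>inc_map\<close> is injective, the chain
  condition forces \<open>f 0 = 0\<close>, the only component that \<open>t_map\<close>
  retains.\<close>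

lemma tt_zero:
  assumes ij: "i \<noteq> j"
  shows "cmp A.K (P_cplx i) (X_cplx (ext2 i j)) Z_cplx (A.hc (X_cplx (ext2 i j)) Z_cplx t_map) (A.hc (P_cplx i) (X_cplx (ext2 i j)) f) = mzero A.K (P_cplx i) Z_cplx"
proof -
  note c = A.chain_cmp[OF cplx_in(1,2,4) f tt_chain]
  have f0: "f 0 z = \<zero>\<^bsub>F\<^esub>" if z: "z \<in> E2" for z
    using fmod_homsD(4)[OF f01(2) i, of z] z ij f01(3)[OF z] by simp
  show ?thesis
    unfolding A.K_cmp[OF cplx_in(1,2,4) f tt_chain]
    unfolding P_cplx_def Z_cplx_def
  proof (rule A.map2_eq_zeroI[OF P_data Z_data _ c[unfolded P_cplx_def Z_cplx_def]])
    show "mzero A (ext_mod i) one_mod \<in> Mor A (ext_mod i) one_mod" by (rule A.mzero_in) (simp_all add: ext_Obj one_Obj)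
  qed (use f0 fmod_homsD(1)[OF f01(1)] in \<open>simp_all add: A.cplx2_sel X_cplx_def t_map_def A.map2_def compose_def nil_map_def f_mem one2_mem cong: restrict_cong\<close>)
qed

end

text \<open>This is the freeness of \<open>ext_mod i\<close> over F[x]/(x^2): a morphism to the
  trivial module lifts along \<open>top_map\<close>, for the split extension as well as for the
  nonsplit one.\<close>

lemma ss_surj:
  assumes i: "i \<in> J" and g: "g \<in> chain_maps A (P_cplx i) Y_cplx"
  shows "\<exists>f \<in> chain_maps A (P_cplx i) (X_cplx (ext2 i j)).
    cmp A.K (P_cplx i) (X_cplx (ext2 i j)) Y_cplx (A.hc (X_cplx (ext2 i j)) Y_cplx s_map) (A.hc (P_cplx i) (X_cplx (ext2 i j)) f) = A.hc (P_cplx i) Y_cplx g"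
proof -
  note c = A.chain_map2[OF P_data Y_data g[unfolded P_cplx_def Y_cplx_def]]
  have g1: "g 1 \<in> Hom (ext_mod i) one_mod" using c(2) by simp
  have g0: "g 0 \<in> Hom (ext_mod i) zero_mod" using c(1) by simp
  note gD = fmod_homsD[OF g1, unfolded ext_sel one_sel]
  \<comment> \<open>The pair (0, a) is x times (a, 0), and x acts as zero on the target.\<close>
  have gz: "g 1 (opair \<zero>\<^bsub>F\<^esub> a) = \<zero>\<^bsub>F\<^esub>" if a: "a \<in> carrier F" for a
    using gD(4)[OF i, of "opair a \<zero>\<^bsub>F\<^esub>"] a by simp
  have g_fst: "g 1 (opair a \<zero>\<^bsub>F\<^esub>) = g 1 (opair a b)" if "a \<in> carrier F" "b \<in> carrier F" for a b
    using gD(2)[of "opair a \<zero>\<^bsub>F\<^esub>" "opair \<zero>\<^bsub>F\<^esub> b"] gD(1)[of "opair a \<zero>\<^bsub>F\<^esub>"] that gz[OF that(2)] by simp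
  have g_fst': "g 1 (opair (ofst z) \<zero>\<^bsub>F\<^esub>) = g 1 z" if z: "z \<in> E2" for z
    using g_fst[OF one2_mem(1,2)[OF z]] one2_mem(3)[OF z] by simp
  let ?c = "\<lambda>b. g 1 (opair b \<zero>\<^bsub>F\<^esub>)"
  have c1: "?c b \<in> carrier F" if "b \<in> carrier F" for b using gD(1)[of "opair b \<zero>\<^bsub>F\<^esub>"] that by simp
  have c2: "?c (b \<oplus>\<^bsub>F\<^esub> b') = ?c b \<oplus>\<^bsub>F\<^esub> ?c b'" if "b \<in> carrier F" "b' \<in> carrier F" for b b'
    using gD(2)[of "opair b \<zero>\<^bsub>F\<^esub>" "opair b' \<zero>\<^bsub>F\<^esub>"] that by simp
  have c3: "?c (a \<otimes>\<^bsub>F\<^esub> b) = a \<otimes>\<^bsub>F\<^esub> ?c b" if "b \<in> carrier F" "a \<in> carrier F" for b a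
    using gD(3)[of a "opair b \<zero>\<^bsub>F\<^esub>"] that by simp
  \<comment> \<open>With c the value of \<open>g 1\<close> at (1, 0), this is the morphism sending
    the generator (1, 0) to (c, 0). If i acts as x on the target, then (a, b) goes to (a c, b c);
    otherwise the multiples of x go to zero. The map \<open>f0\<close> is then dictated by the chain
    condition.\<close>
  define f1 where "f1 = (\<lambda>z \<in> E2. opair (g 1 z) (if i = j then ?c (osnd z) else \<zero>\<^bsub>F\<^esub>))"
  define f0 where "f0 = (if i = j then g 1 else (\<lambda>z \<in> E2. \<zero>\<^bsub>F\<^esub>))"
  have f0: "f0 \<in> Hom (ext_mod i) one_mod"
  proof -
    have z: "(\<lambda>z \<in> E2. \<zero>\<^bsub>F\<^esub>) \<in> Hom (ext_mod i) one_mod"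
      using A.mzero_in[of "ext_mod i" one_mod] by (simp add: ext_Obj one_Obj)
    have "f0 = g 1 \<or> f0 = (\<lambda>z \<in> E2. \<zero>\<^bsub>F\<^esub>)" by (simp add: f0_def)
    then show ?thesis using g1 z by (elim disjE) (simp_all only:)
  qed
  have f1: "f1 \<in> Hom (ext_mod i) (ext2 i j)"
  proof (rule fmod_homsI)
    fix x assume "x \<in> carrier (ext_mod i)"
    then have x: "x \<in> E2" by simp
    show "f1 x \<in> carrier (ext2 i j)" using x by (simp add: f1_def gD(1) c1 one2_mem)
    show "f1 (x \<oplus>\<^bsub>ext_mod i\<^esub> y) = f1 x \<oplus>\<^bsub>ext2 i j\<^esub> f1 y" if "y \<in> carrier (ext_mod i)" for y
      using x that by (simp add: f1_def gD(2) c2 one2_mem)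
    show "f1 (a \<odot>\<^bsub>ext_mod i\<^esub> x) = a \<odot>\<^bsub>ext2 i j\<^esub> f1 x" if "a \<in> carrier F" for a
      using x that by (simp add: f1_def gD(3) c3 one2_mem)
    show "f1 (act (ext_mod i) k x) = act (ext2 i j) k (f1 x)" if "k \<in> J" for k
      using x gz[of "\<zero>\<^bsub>F\<^esub>"] by (simp add: f1_def gz one2_mem g_fst')
  qed (simp add: f1_def)
  let ?f = "A.map2 zero_mod zero_mod f0 f1"
  have fc: "?f \<in> chain_maps A (P_cplx i) (X_cplx (ext2 i j))"
    unfolding P_cplx_def X_cplx_def
  proof (rule A.map2_chain[OF P_data X_data])
    show "cmp A (ext_mod i) (ext_mod i) (ext2 i j) f1 nil_map = cmp A (ext_mod i) one_mod (ext2 i j) inc_map f0"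
      by (rule extensionalityI[of _ E2])
        (simp_all add: compose_def nil_map_def inc_map_def f0_def f1_def one2_mem gD(1) gz g_fst')
  qed (use f0 f1 in simp_all)
  have gm: "A.map2 zero_mod zero_mod (g 0) (g 1) = g" using c(4) by (rule sym)
  have eq: "(\<lambda>n. cmp A (cob (P_cplx i) n) (cob (X_cplx (ext2 i j)) n) (cob Y_cplx n) (s_map n) (?f n)) = g"
  proof -
    note cc = A.chain_map2(4)[OF P_data Y_data A.chain_cmp[OF cplx_in(1,2,3) fc ss_chain, unfolded P_cplx_def Y_cplx_def]]
    have "g 0 = (\<lambda>z \<in> E2. \<zero>\<^bsub>F\<^esub>)"
      by (rule extensionalityI[of _ E2]) (use fmod_homsD(1,5)[OF g0] in simp_all)
    moreover have "compose E2 top_map f1 = g 1"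
      by (rule extensionalityI[of _ E2])
        (use gD(5) in \<open>simp_all add: compose_def top_map_def f1_def gD(1) c1 one2_mem\<close>)
    moreover have "compose E2 (\<lambda>x \<in> carrier F. \<zero>\<^bsub>F\<^esub>) f0 = (\<lambda>z \<in> E2. \<zero>\<^bsub>F\<^esub>)"
      using fmod_homsD(1)[OF f0] by (simp add: compose_def cong: restrict_cong)
    ultimately show ?thesis
      unfolding P_cplx_def Y_cplx_def cc by (subst gm[symmetric]) (simp add: A.cplx2_sel X_cplx_def s_map_def A.map2_def)
  qed
  show ?thesis
    by (rule bexI[OF _ fc]) (simp only: A.K_cmp[OF cplx_in(1,2,3) fc ss_chain] eq)
qed

text \<open>The identity of \<open>ext_mod i\<close> together with \<open>top_map\<close> is a chain
  map, and its composite with \<open>t_map\<close> is \<open>top_map\<close> in degree 0. A null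
  homotopy would factor this through multiplication by x, although morphisms to the trivial module
  kill the multiples of x.\<close>

lemma tt_nonzero:
  assumes i: "i \<in> J"
  shows "\<exists>f \<in> chain_maps A (P_cplx i) (X_cplx (ext2 i i)).
    cmp A.K (P_cplx i) (X_cplx (ext2 i i)) Z_cplx (A.hc (X_cplx (ext2 i i)) Z_cplx t_map) (A.hc (P_cplx i) (X_cplx (ext2 i i)) f) \<noteq> mzero A.K (P_cplx i) Z_cplx"
proof -
  let ?f = "A.map2 zero_mod zero_mod top_map (idm A (ext_mod i))"
  have fc: "?f \<in> chain_maps A (P_cplx i) (X_cplx (ext2 i i))"
    unfolding P_cplx_def X_cplx_def
  proof (rule A.map2_chain[OF P_data X_data])
    show "top_map \<in> Mor A (ext_mod i) one_mod" using top_Hom[of i i] by (simp add: rho_fixed)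
    show "idm A (ext_mod i) \<in> Mor A (ext_mod i) (ext2 i i)" unfolding rho_fixed by (rule A.idm_in) (simp add: ext_Obj)
  qed (simp add: compose_def nil_map_def inc_map_def top_map_def one2_mem cong: restrict_cong)
  note c = A.chain_cmp[OF cplx_in(1,2,4) fc tt_chain, unfolded P_cplx_def Z_cplx_def]
  show ?thesis
  proof (rule bexI[OF notI fc])
    assume "cmp A.K (P_cplx i) (X_cplx (ext2 i i)) Z_cplx (A.hc (X_cplx (ext2 i i)) Z_cplx t_map) (A.hc (P_cplx i) (X_cplx (ext2 i i)) ?f) = mzero A.K (P_cplx i) Z_cplx"
    then obtain h where h: "h \<in> Hom (ext_mod i) one_mod"
      "compose E2 (\<lambda>x \<in> carrier F. x) top_map = compose E2 h nil_map"
      using A.map2_eq_zeroD[OF P_data Z_data c, folded P_cplx_def Z_cplx_def] unfolding A.K_cmp[OF cplx_in(1,2,4) fc tt_chain]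
      by (auto simp: A.cplx2_sel P_cplx_def Z_cplx_def X_cplx_def t_map_def A.map2_def)
    \<comment> \<open>The generator 1 of F[x]/(x^2); \<open>nil_map\<close> sends it to x, while
      \<open>top_map\<close> has value 1 there.\<close>
    let ?e = "opair \<one>\<^bsub>F\<^esub> \<zero>\<^bsub>F\<^esub>"
    have "h (opair \<zero>\<^bsub>F\<^esub> \<one>\<^bsub>F\<^esub>) = \<zero>\<^bsub>F\<^esub>" using fmod_homsD(4)[OF h(1) i, of ?e] by simp
    then show False using fun_cong[OF h(2), of ?e] F.one_not_zero by (simp add: compose_def top_map_def nil_map_def)
  qed
qed

end

section \<open>Smallness\<close>

context universe
begin

text \<open>Replacement along the inverse of the bijection with an element of
  \<open>U\<close>.\<close>

lemma U_small_set:
  assumes "U_small mem U S" shows "\<exists>m. elts mem m = S"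
proof -
  obtain u f where u: "mem u U" "bij_betw f S (elts mem u)" using U_smallE[OF assms] .
  have "S = inv_into S f ` elts mem u" using bij_betw_imp_surj_on[OF bij_betw_inv_into[OF u(2)]] by simp
  then show ?thesis using replacement[of "inv_into S f" u] by simp
qed

end

locale small_two_step = two_step mem V F J + U: universe mem U
  for mem :: "'v \<Rightarrow> 'v \<Rightarrow> bool" and V U :: 'v and F :: "'v ring" and J :: "'v set" +
  assumes int_small: "U_small mem U (UNIV :: int set)" and F_small: "U_small mem U (carrier F)"
begin

interpretation F: field F by (rule field_F)

text \<open>Carriers are required to lie in \<open>V\<close> only; smallness in \<open>U\<close>
  comes from the extension, since F^n times F^m covers the module.\<close>

lemma Obj_small:
  assumes M: "M \<in> Obj" shows "U_small mem U (carrier M)"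
proof -
  note fM = two_step_free[OF M]
  interpret M: module F M by (rule free_alg_moduleD(1)[OF fM])
  obtain n m k p where s: "ses_split F J M n m k p" using two_stepD[OF cring_F M] by blast
  have p: "p \<in> fmod_homs F J M (fmod_power (trivial_fmod F) m)" and surj: "p ` carrier M = {..<m} \<rightarrow>\<^sub>E carrier F"
    and ker: "k ` ({..<n} \<rightarrow>\<^sub>E carrier F) = {x \<in> carrier M. p x = (\<lambda>k \<in> {..<m}. \<zero>\<^bsub>F\<^esub>)}"
    using s unfolding ses_split_def by blast+
  \<comment> \<open>A section of \<open>p\<close> as a map of sets. Every element of the module is
    \<open>?q y\<close> plus an element of the kernel of \<open>p\<close>, which is some
    \<open>k u\<close>.\<close>
  let ?q = "inv_into (carrier M) p"
  \<comment> \<open>The finite index sets are small because they embed into the integers.\<close>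
  have sm: "U_small mem U ({..<l :: nat} \<rightarrow>\<^sub>E carrier F)" for l
    by (rule U.U_small_PiE[OF U.U_small_inj[OF int_small, of int] F_small]) (simp_all add: inj_on_def)
  have cover: "x \<in> (\<lambda>(u, y). k u \<oplus>\<^bsub>M\<^esub> ?q y) ` (({..<n} \<rightarrow>\<^sub>E carrier F) \<times> ({..<m} \<rightarrow>\<^sub>E carrier F))" if x: "x \<in> carrier M" for x
  proof -
    have px: "p x \<in> {..<m} \<rightarrow>\<^sub>E carrier F" using surj x by blast
    define y where "y = ?q (p x)"
    have y: "y \<in> carrier M" "p y = p x" unfolding y_def using x by (simp_all add: inv_into_into f_inv_into_f)
    define w where "w = x \<oplus>\<^bsub>M\<^esub> (\<ominus>\<^bsub>M\<^esub> y)"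
    have w: "w \<in> carrier M" unfolding w_def using x y by simp
    have xw: "x = w \<oplus>\<^bsub>M\<^esub> y" unfolding w_def using x y by (simp add: M.M.a_assoc M.M.l_neg)
    have "p x = (\<lambda>i \<in> {..<m}. p w i \<oplus>\<^bsub>F\<^esub> p x i)"
      using fmod_homsD(2)[OF p w y(1)] unfolding xw[symmetric] y(2) by (simp cong: restrict_cong)
    then have *: "p x i = p w i \<oplus>\<^bsub>F\<^esub> p x i" if "i < m" for i using that by (simp add: fun_eq_iff split: if_splits)
    have pw: "p w \<in> {..<m} \<rightarrow>\<^sub>E carrier F" using surj w by blast
    have "p w = (\<lambda>i \<in> {..<m}. \<zero>\<^bsub>F\<^esub>)"
    proof (rule PiE_ext[OF pw])
      show "(\<lambda>i \<in> {..<m}. \<zero>\<^bsub>F\<^esub>) \<in> {..<m} \<rightarrow>\<^sub>E carrier F" by simp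
      fix i assume "i \<in> {..<m}"
      then have i: "i < m" by simp
      have "p w i \<in> carrier F" "p x i \<in> carrier F" using PiE_nat_mem[OF pw i] PiE_nat_mem[OF px i] .
      then have "p w i = \<zero>\<^bsub>F\<^esub>" using *[OF i] by (metis F.add.r_cancel_one F.add.l_cancel_one)
      then show "p w i = (\<lambda>i \<in> {..<m}. \<zero>\<^bsub>F\<^esub>) i" using i by simp
    qed
    then obtain u where u: "u \<in> {..<n} \<rightarrow>\<^sub>E carrier F" "w = k u" using ker w by blast
    show ?thesis by (rule image_eqI[of _ _ "(u, p x)"]) (use xw u px in \<open>simp_all add: y_def\<close>)
  qed
  show ?thesis
    by (rule U.U_small_subset[OF U.U_small_image[OF U.U_small_Times[OF sm sm]]], rule subsetI, rule cover)
qed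

lemma Hom_small:
  assumes "M \<in> Obj" "N \<in> Obj" shows "U_small mem U (Hom M N)"
proof (rule U.U_small_subset[OF U.U_small_PiE[OF Obj_small[OF assms(1)] Obj_small[OF assms(2)]]])
  show "Hom M N \<subseteq> carrier M \<rightarrow>\<^sub>E carrier N"
  proof
    fix f assume f: "f \<in> Hom M N"
    show "f \<in> carrier M \<rightarrow>\<^sub>E carrier N" unfolding PiE_def using fmod_homsD(1,5)[OF f] by blast
  qed
qed

text \<open>A chain map is a family indexed by all integers, so its smallness rests on that of the
  integers; homotopy classes are an image of the set of chain maps.\<close>

lemma K_small:
  assumes "X \<in> Ob A.K" "Y \<in> Ob A.K" shows "U_small mem U (Mor A.K X Y)"
proof -
  have o: "X \<in> A.cplx" "Y \<in> A.cplx" using assms by (simp_all add: A.K_sel(1))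
  have "U_small mem U (PiE UNIV (\<lambda>n :: int. Hom (cob X n) (cob Y n)))"
    using U.U_small_PiE[OF int_small, of "\<lambda>n. Hom (cob X n) (cob Y n)"] Hom_small A.cob_in[OF o(1)] A.cob_in[OF o(2)] by simp
  moreover have "chain_maps A X Y \<subseteq> PiE UNIV (\<lambda>n :: int. Hom (cob X n) (cob Y n))"
    using A.cm_in[of _ X Y] by auto
  ultimately show ?thesis unfolding A.K_sel(2) by (intro U.U_small_image) (rule U.U_small_subset)
qed

end

section \<open>Verification of the separation hypotheses and conclusion\<close>

lemma (in two_step) separating_complexes:
  assumes ab: "is_abelianisation A.K D H"
  shows "\<exists>G. separating A D H J G (\<lambda>i. relabelling.R A (rho i)) P_cplx (\<lambda>j. X_cplx (ext_mod j)) Y_cplx Z_cplx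
    (\<lambda>j. A.hc (X_cplx (ext_mod j)) Y_cplx s_map) (\<lambda>j. A.hc (X_cplx (ext_mod j)) Z_cplx t_map)"
proof -
  have "\<exists>G. exact_functor D D G \<and> nat_isomorphic A.K D (comp_func G H) (comp_func H (relabelling.R A (rho i)))" for i
    by (rule relabelling.R_extension[OF relabelling_rho ab]) blast
  then obtain G where G: "\<And>i. exact_functor D D (G i)"
    "\<And>i. nat_isomorphic A.K D (comp_func (G i) H) (comp_func H (relabelling.R A (rho i)))" by metis
  have X: "X_cplx (ext_mod j) \<in> A.cplx" for j using cplx_in(2)[of j j] by (simp only: X_cplx_ext)
  have s: "s_map \<in> chain_maps A (X_cplx (ext_mod j)) Y_cplx" and t: "t_map \<in> chain_maps A (X_cplx (ext_mod j)) Z_cplx" for j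
    using ss_chain[of j j] tt_chain[of j j] by (simp_all only: X_cplx_ext)
  note RO = relabelling.R_Ob[OF relabelling_rho]
  have Rs: "FMor (relabelling.R A (rho i)) (X_cplx (ext_mod j)) Y_cplx (A.hc (X_cplx (ext_mod j)) Y_cplx s_map) = A.hc (X_cplx (ext2 i j)) Y_cplx s_map" for i j
    using relabelling.R_hc[OF relabelling_rho X cplx_in(3) s] by (simp only: Rc_XYZ)
  have Rt: "FMor (relabelling.R A (rho i)) (X_cplx (ext_mod j)) Z_cplx (A.hc (X_cplx (ext_mod j)) Z_cplx t_map) = A.hc (X_cplx (ext2 i j)) Z_cplx t_map" for i j
    using relabelling.R_hc[OF relabelling_rho X cplx_in(4) t] by (simp only: Rc_XYZ)
  have "separating A D H J G (\<lambda>i. relabelling.R A (rho i)) P_cplx (\<lambda>j. X_cplx (ext_mod j)) Y_cplx Z_cplx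
    (\<lambda>j. A.hc (X_cplx (ext_mod j)) Y_cplx s_map) (\<lambda>j. A.hc (X_cplx (ext_mod j)) Z_cplx t_map)"
  proof (intro separating.intro separating_axioms.intro abelianised.intro abelianised_axioms.intro additive_A ab G
      relabelling.R_functor[OF relabelling_rho])
    show "P_cplx i \<in> Ob A.K" "X_cplx (ext_mod i) \<in> Ob A.K" "Y_cplx \<in> Ob A.K" "Z_cplx \<in> Ob A.K" for i
      unfolding A.K_sel(1) by (rule cplx_in X)+
    show "A.hc (X_cplx (ext_mod i)) Y_cplx s_map \<in> Mor A.K (X_cplx (ext_mod i)) Y_cplx" "A.hc (X_cplx (ext_mod i)) Z_cplx t_map \<in> Mor A.K (X_cplx (ext_mod i)) Z_cplx" for i
      by (rule A.hc_in[OF s], rule A.hc_in[OF t])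
  next
    fix i j b assume i: "i \<in> J" "j \<in> J"
      and b: "b \<in> Mor A.K (P_cplx i) (FOb (relabelling.R A (rho i)) (X_cplx (ext_mod j)))"
    obtain f where f: "f \<in> chain_maps A (P_cplx i) (X_cplx (ext2 i j))" "b = A.hc (P_cplx i) (X_cplx (ext2 i j)) f"
      using b unfolding RO Rc_XYZ A.K_sel(2) by blast
    show "b = mzero A.K (P_cplx i) (FOb (relabelling.R A (rho i)) (X_cplx (ext_mod j)))"
      if "cmp A.K (P_cplx i) (FOb (relabelling.R A (rho i)) (X_cplx (ext_mod j))) (FOb (relabelling.R A (rho i)) Y_cplx)
        (FMor (relabelling.R A (rho i)) (X_cplx (ext_mod j)) Y_cplx (A.hc (X_cplx (ext_mod j)) Y_cplx s_map)) b =
        mzero A.K (P_cplx i) (FOb (relabelling.R A (rho i)) Y_cplx)"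
      using that unfolding Rs RO Rc_XYZ f(2) by (rule ss_zero[OF i(1) f(1)])
    show "cmp A.K (P_cplx i) (FOb (relabelling.R A (rho i)) (X_cplx (ext_mod j))) (FOb (relabelling.R A (rho i)) Z_cplx)
        (FMor (relabelling.R A (rho i)) (X_cplx (ext_mod j)) Z_cplx (A.hc (X_cplx (ext_mod j)) Z_cplx t_map)) b =
        mzero A.K (P_cplx i) (FOb (relabelling.R A (rho i)) Z_cplx)" if "i \<noteq> j"
      unfolding Rt RO Rc_XYZ f(2) by (rule tt_zero[OF i(1) f(1) that])
  next
    fix i j c assume i: "i \<in> J" "j \<in> J" and c: "c \<in> Mor A.K (P_cplx i) (FOb (relabelling.R A (rho i)) Y_cplx)"
    obtain g where g: "g \<in> chain_maps A (P_cplx i) Y_cplx" "c = A.hc (P_cplx i) Y_cplx g"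
      using c unfolding RO Rc_XYZ A.K_sel(2) by blast
    obtain f where f: "f \<in> chain_maps A (P_cplx i) (X_cplx (ext2 i j))"
      "cmp A.K (P_cplx i) (X_cplx (ext2 i j)) Y_cplx (A.hc (X_cplx (ext2 i j)) Y_cplx s_map) (A.hc (P_cplx i) (X_cplx (ext2 i j)) f) = A.hc (P_cplx i) Y_cplx g"
      using ss_surj[OF i(1) g(1)] by blast
    show "\<exists>b \<in> Mor A.K (P_cplx i) (FOb (relabelling.R A (rho i)) (X_cplx (ext_mod j))).
      cmp A.K (P_cplx i) (FOb (relabelling.R A (rho i)) (X_cplx (ext_mod j))) (FOb (relabelling.R A (rho i)) Y_cplx)
        (FMor (relabelling.R A (rho i)) (X_cplx (ext_mod j)) Y_cplx (A.hc (X_cplx (ext_mod j)) Y_cplx s_map)) b = c"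
      unfolding Rs RO Rc_XYZ g(2) by (rule bexI[OF _ A.hc_in[OF f(1)]]) (rule f(2))
  next
    fix i assume i: "i \<in> J"
    obtain f where f: "f \<in> chain_maps A (P_cplx i) (X_cplx (ext2 i i))"
      "cmp A.K (P_cplx i) (X_cplx (ext2 i i)) Z_cplx (A.hc (X_cplx (ext2 i i)) Z_cplx t_map) (A.hc (P_cplx i) (X_cplx (ext2 i i)) f) \<noteq> mzero A.K (P_cplx i) Z_cplx"
      using tt_nonzero[OF i] by blast
    show "\<exists>b \<in> Mor A.K (P_cplx i) (FOb (relabelling.R A (rho i)) (X_cplx (ext_mod i))).
      cmp A.K (P_cplx i) (FOb (relabelling.R A (rho i)) (X_cplx (ext_mod i))) (FOb (relabelling.R A (rho i)) Z_cplx)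
        (FMor (relabelling.R A (rho i)) (X_cplx (ext_mod i)) Z_cplx (A.hc (X_cplx (ext_mod i)) Z_cplx t_map)) b \<noteq> mzero A.K (P_cplx i) (FOb (relabelling.R A (rho i)) Z_cplx)"
      unfolding Rt RO Rc_XYZ by (rule bexI[OF _ A.hc_in[OF f(1)]]) (rule f(2))
  qed
  then show ?thesis by blast
qed

theorem proposition4:
  fixes mem :: "'v \<Rightarrow> 'v \<Rightarrow> bool" and U V I :: 'v and F :: "'v ring"
    and D :: "('v, 'v) pcat" and H
  assumes "zfc_sets mem"
    and "grothendieck_universe mem U"
    and "\<exists>z. mem z U \<and> elts mem z \<approx> (UNIV :: int set)"
    and "grothendieck_universe mem V" and "elts mem U \<subset> elts mem V"
    and "mem I V" and "\<not> U_small mem U (elts mem I)"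
    and "field F" and "\<exists>k. mem k U \<and> carrier F = elts mem k"
    and "is_abelianisation (Kb (two_step_cat mem V F (elts mem I))) D H"
  shows "U_category mem U D \<and>
    (\<exists>C. serre_subcategory D C \<and>
      (\<exists>E Q. is_abelian_quotient D C (E :: ('v, 'v) cat) Q) \<and>
      (\<forall>E Q. is_abelian_quotient D C (E :: ('v, 'v) cat) Q \<longrightarrow> \<not> U_category mem U E))"
proof -
  obtain k where k: "mem k U" "carrier F = elts mem k" using assms(9) by blast
  have kV: "mem k V" using k(1) assms(5) unfolding elts_def by blast
  interpret two_step mem V F "elts mem I"
    by (intro two_step.intro universe.intro universe_axioms.intro two_step_axioms.intro assms exI[of _ k] conjI kV k)
  \<comment> \<open>Two universes over the same membership relation are in play: \<open>V\<close>
    contains the modules, while \<open>U\<close> measures the sizes of morphism sets.\<close>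
  interpret UU: universe mem U by (intro universe.intro universe_axioms.intro assms)
  interpret small_two_step mem V U F "elts mem I"
  proof (intro small_two_step.intro small_two_step_axioms.intro two_step_axioms UU.universe_axioms)
    show "U_small mem U (UNIV :: int set)" using assms(3) eqpoll_sym unfolding U_small_def by blast
    show "U_small mem U (carrier F)" unfolding k(2) by (rule UU.U_small_elts[OF k(1)])
  qed
  obtain G where "separating A D H (elts mem I) G (\<lambda>i. relabelling.R A (rho i)) P_cplx (\<lambda>j. X_cplx (ext_mod j)) Y_cplx Z_cplx
    (\<lambda>j. A.hc (X_cplx (ext_mod j)) Y_cplx s_map) (\<lambda>j. A.hc (X_cplx (ext_mod j)) Z_cplx t_map)"
    using separating_complexes[OF assms(10)] by blast
  then interpret S: separating A D H "elts mem I" G "\<lambda>i. relabelling.R A (rho i)" P_cplx "\<lambda>j. X_cplx (ext_mod j)" Y_cplx Z_cplx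
    "\<lambda>j. A.hc (X_cplx (ext_mod j)) Y_cplx s_map" "\<lambda>j. A.hc (X_cplx (ext_mod j)) Z_cplx t_map" .
  have small: "U_small mem U (Mor D X Y)" if XY: "X \<in> Ob D" "Y \<in> Ob D" for X Y
  proof -
    obtain X' Y' f where *: "X' \<in> Ob A.K" "Y' \<in> Ob A.K" "inj_on f (Mor D X Y)" "f ` Mor D X Y \<subseteq> Mor A.K X' Y'"
      using S.D_hom_inj[OF XY] by blast
    show ?thesis by (rule UU.U_small_inj[OF K_small[OF *(1,2)] *(3,4)])
  qed
  \<comment> \<open>Smallness of the morphism sets of \<open>D\<close>, just proved, also provides
    them as sets for the functors to the category of sets.\<close>
  interpret S: separating_sets mem A D H "elts mem I" G "\<lambda>i. relabelling.R A (rho i)" P_cplx "\<lambda>j. X_cplx (ext_mod j)" Y_cplx Z_cplx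
    "\<lambda>j. A.hc (X_cplx (ext_mod j)) Y_cplx s_map" "\<lambda>j. A.hc (X_cplx (ext_mod j)) Z_cplx t_map"
    by (intro separating_sets.intro separating_sets_axioms.intro S.separating_axioms zfc_sets_axioms UU.U_small_set[OF small])
  \<comment> \<open>A quotient with objects and morphisms in the type of sets exists, by the path
    construction with paths coded as sets; so the claim about all quotients is not vacuous.\<close>
  interpret L: localisation_construction D "serre_morphisms D S.null_objects" path_code
    by (intro localisation_construction.intro localisation_construction_axioms.intro S.D.category_axioms inj_path_code)
      (simp add: serre_morphisms_def)
  have "\<not> U_category mem U E" if E: "is_abelian_quotient D S.null_objects (E :: ('v, 'v) cat) Q" for E Q
  proof
    assume UE: "U_category mem U E"
    have Q: "is_functor D E Q" using E unfolding is_abelian_quotient_def is_localisation_def by (rule conjunct1)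
    have m: "U_small mem U (Mor E (FOb Q (FOb H Y_cplx)) (FOb Q (FOb H Z_cplx)))"
      using UE functorD(3)[OF Q S.H_Ob[OF S.Y_Ob]] functorD(3)[OF Q S.H_Ob[OF S.Z_Ob]] unfolding U_category_def by blast
    \<comment> \<open>The distinct roofs embed the index set into one set of morphisms of the
      quotient; if that set were small, the index set would be small as well.\<close>
    obtain e where "inj_on e (elts mem I)" "e ` elts mem I \<subseteq> Mor E (FOb Q (FOb H Y_cplx)) (FOb Q (FOb H Z_cplx))"
      using S.quotient_large[OF E] by blast
    from UU.U_small_inj[OF m this] show False using assms(7) by (rule notE[rotated])
  qed
  moreover have "is_abelian_quotient D S.null_objects L.loc L.Q" unfolding is_abelian_quotient_def by (rule L.localisation)
  moreover have "U_category mem U D" unfolding U_category_def using small by blast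
  ultimately show ?thesis using S.null_objects_serre by blast
qed

end
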